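(* Let $X$ be a scheme over a field $F$, let $\mathcal{I}\subseteq \Omega^1_X$ be any sub $\mathcal{O}_X$-module, let $\mathcal{F}=\Omega^1_X/\mathcal{I}$, and let $\mathcal{L}\in \operatorname{Pic}(X)$ be a line bundle on $X$. Let $\operatorname{AT}(\mathcal{L})\in \operatorname{Ext}^1_{\mathcal{O}_X}(\mathcal{L},\mathcal{F}\otimes\mathcal{L})$ be the Atiyah class of $\mathcal{L}$, let $\overline{c}_1(\mathcal{L})\in \operatorname{H}^1(X,\mathcal{F})$ be the generalized first Chern class of $\mathcal{L}$, and let $\phi:\operatorname{Ext}^1_{\mathcal{O}_X}(\mathcal{L},\mathcal{L}\otimes\mathcal{F})\to \operatorname{H}^1(X,\mathcal{F})$ be the canonical map. Then $$\phi(\operatorname{AT}(\mathcal{L}))=\overline{c}_1(\mathcal{L}).$$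
   Context: $\Omega^1_X$ is the sheaf of Kähler differentials of $X$ over $F$; $d:\mathcal{O}_X\to\mathcal{F}$ is the composite of the universal derivation $\mathcal{O}_X\to\Omega^1_X$ with the quotient map. Tensor products are over $\mathcal{O}_X$. Chern classes: $\mathcal{O}^*\subseteq\mathcal{O}_X$ is the sheaf of units, and $\operatorname{dlog}:\mathcal{O}^*\to\Omega^1_X$ is the map of sheaves of abelian groups $x\mapsto d(x)/x$ (here $d$ is the universal derivation). It induces $\operatorname{dlog}:\operatorname{Pic}(X)=\operatorname{H}^1(X,\mathcal{O}^* )\to \operatorname{H}^1(X,\Omega^1_X)$; put $c_1(\mathcal{L})=\operatorname{dlog}(\mathcal{L})$. The generalized first Chern class $\overline{c}_1(\mathcal{L})$ is the image of $c_1(\mathcal{L})$ under the canonical map $\operatorname{H}^1(X,\Omega^1_X)\to \operatorname{H}^1(X,\mathcal{F})$. Atiyah class: for an $\mathcal{O}_X$-module $\mathcal{E}$, let $\mathcal{J}^1_{\mathcal{F}}(\mathcal{E})=\mathcal{F}\otimes\mathcal{E}\oplus\mathcal{E}$ as sheaf of abelian groups, with left $\mathcal{O}_X$-module structure $s(x\otimes e,f)=(sx\otimes e+ds\otimes f,\,sf)$ on local sections. There is an exact sequence of left $\mathcal{O}_X$-modules $0\to\mathcal{F}\otimes\mathcal{E}\to\mathcal{J}^1_{\mathcal{F}}(\mathcal{E})\to\mathcal{E}\to 0$ (canonical inclusion and projection), and $\operatorname{AT}(\mathcal{E})\in\operatorname{Ext}^1_{\mathcal{O}_X}(\mathcal{E},\mathcal{F}\otimes\mathcal{E})$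 is its extension class. The map $\phi$ is the composite $\operatorname{Ext}^1_{\mathcal{O}_X}(\mathcal{L},\mathcal{L}\otimes\mathcal{F})\cong\operatorname{Ext}^1_{\mathcal{O}_X}(\mathcal{O}_X,\mathcal{L}^*\otimes\mathcal{L}\otimes\mathcal{F})\cong\operatorname{Ext}^1_{\mathcal{O}_X}(\mathcal{O}_X,\mathcal{F})\to\operatorname{H}^1(X,\mathcal{F})$ of the canonical maps. *)

theory Defs
  imports
    "HOL-Analysis.Abstract_Topology"
    "HOL-Analysis.Function_Topology"
    "HOL-Algebra.Ideal"
    "HOL-Algebra.RingHom"
    "HOL-Algebra.Module"
begin

section \<open>Sheaves of algebraic structures\<close>

text \<open>
  A presheaf assigns to each open set a structure whose elements all live in one type \<^typ>\<open>'a\<close>.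
  This is no restriction, since a family of sets can be replaced by its disjoint union. The type
  \<^typ>\<open>'s\<close> is the record type of the values (\<^typ>\<open>'a monoid\<close>, \<^typ>\<open>'a ring\<close>,
  \<^typ>\<open>('r, 'a) module\<close>). Values at sets that are not open are irrelevant throughout.
\<close>

record ('x, 's, 'a) presheaf =
  Sec :: "'x set \<Rightarrow> 's"
  Res :: "'x set \<Rightarrow> 'x set \<Rightarrow> 'a \<Rightarrow> 'a"  \<comment> \<open>\<^term>\<open>Res P U V\<close> restricts from \<^term>\<open>U\<close> to \<^term>\<open>V\<close>\<close>

type_synonym ('x, 'a) group_presheaf = "('x, 'a monoid, 'a) presheaf"
type_synonym ('x, 'r) ring_presheaf = "('x, 'r ring, 'r) presheaf"
type_synonym ('x, 'r, 'm) mod_presheaf = "('x, ('r, 'm) module, 'm) presheaf"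
type_synonym ('x, 'm, 'n) sheaf_map = "'x set \<Rightarrow> 'm \<Rightarrow> 'n"

definition presheaf ::
  "'x topology \<Rightarrow> ('x, ('a, 'z) partial_object_scheme, 'a) presheaf \<Rightarrow> bool" where
  "presheaf T P \<longleftrightarrow>
     (\<forall>U V. openin T U \<and> openin T V \<and> V \<subseteq> U \<longrightarrow>
        Res P U V \<in> carrier (Sec P U) \<rightarrow> carrier (Sec P V)) \<and>
     (\<forall>U s. openin T U \<and> s \<in> carrier (Sec P U) \<longrightarrow> Res P U U s = s) \<and>
     (\<forall>U V W s. openin T U \<and> openin T V \<and> openin T W \<and> W \<subseteq> V \<and> V \<subseteq> U \<and> s \<in> carrier (Sec P U) \<longrightarrow>
        Res P V W (Res P U V s) = Res P U W s)"

definition sheaf ::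
  "'x topology \<Rightarrow> ('x, ('a, 'z) partial_object_scheme, 'a) presheaf \<Rightarrow> bool" where
  "sheaf T P \<longleftrightarrow> presheaf T P \<and>
     (\<forall>\<U> s. (\<forall>U\<in>\<U>. openin T U \<and> s U \<in> carrier (Sec P U)) \<and>
        (\<forall>U\<in>\<U>. \<forall>V\<in>\<U>. Res P U (U \<inter> V) (s U) = Res P V (U \<inter> V) (s V)) \<longrightarrow>
        (\<exists>!t. t \<in> carrier (Sec P (\<Union>\<U>)) \<and> (\<forall>U\<in>\<U>. Res P (\<Union>\<U>) U t = s U)))"

text \<open>Germs are equivalence classes of pairs (open neighbourhood, section over it).\<close>

definition germ ::
  "'x topology \<Rightarrow> ('x, ('a, 'z) partial_object_scheme, 'a) presheaf \<Rightarrow> 'x \<Rightarrow> 'x set \<Rightarrow> 'a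
     \<Rightarrow> ('x set \<times> 'a) set" where
  "germ T P x U s =
     {(V, t). openin T V \<and> x \<in> V \<and> t \<in> carrier (Sec P V) \<and>
        (\<exists>W. openin T W \<and> x \<in> W \<and> W \<subseteq> U \<inter> V \<and> Res P U W s = Res P V W t)}"

definition germ_op ::
  "'x topology \<Rightarrow> ('x, ('a, 'z) partial_object_scheme, 'a) presheaf \<Rightarrow> ('x set \<Rightarrow> 'a \<Rightarrow> 'a \<Rightarrow> 'a)
     \<Rightarrow> 'x \<Rightarrow> ('x set \<times> 'a) set \<Rightarrow> ('x set \<times> 'a) set \<Rightarrow> ('x set \<times> 'a) set" where
  "germ_op T P f x A B =
     (\<Union>(U, a)\<in>A. \<Union>(V, b)\<in>B. germ T P x (U \<inter> V) (f (U \<inter> V) (Res P U (U \<inter> V) a) (Res P V (U \<inter> V) b)))"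

definition stalk_ring :: "'x topology \<Rightarrow> ('x, 'r) ring_presheaf \<Rightarrow> 'x \<Rightarrow> ('x set \<times> 'r) set ring" where
  "stalk_ring T P x =
     \<lparr>carrier = {germ T P x U s | U s. openin T U \<and> x \<in> U \<and> s \<in> carrier (Sec P U)},
      monoid.mult = germ_op T P (\<lambda>U. mult (Sec P U)) x,
      one = germ T P x (topspace T) \<one>\<^bsub>Sec P (topspace T)\<^esub>,
      zero = germ T P x (topspace T) \<zero>\<^bsub>Sec P (topspace T)\<^esub>,
      add = germ_op T P (\<lambda>U. add (Sec P U)) x\<rparr>"


section \<open>Locally ringed spaces and schemes\<close>

record ('x, 'r) ringed =
  Top :: "'x topology"
  Str :: "('x, 'r) ring_presheaf"

abbreviation Rg :: "('x, 'r) ringed \<Rightarrow> 'x set \<Rightarrow> 'r ring" where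
  "Rg X U \<equiv> Sec (Str X) U"

definition ringed_space :: "('x, 'r) ringed \<Rightarrow> bool" where
  "ringed_space X \<longleftrightarrow> sheaf (Top X) (Str X) \<and>
     (\<forall>U. openin (Top X) U \<longrightarrow> cring (Rg X U)) \<and>
     (\<forall>U V. openin (Top X) U \<and> openin (Top X) V \<and> V \<subseteq> U \<longrightarrow>
        Res (Str X) U V \<in> ring_hom (Rg X U) (Rg X V))"

definition local_ring :: "('a, 'z) ring_scheme \<Rightarrow> bool" where
  "local_ring R \<longleftrightarrow> cring R \<and> (\<exists>!I. maximalideal I R)"

definition locally_ringed_space :: "('x, 'r) ringed \<Rightarrow> bool" where
  "locally_ringed_space X \<longleftrightarrow> ringed_space X \<and>
     (\<forall>x\<in>topspace (Top X). local_ring (stalk_ring (Top X) (Str X) x))"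

text \<open>
  The open subspace on \<^term>\<open>U\<close>: only the topology changes, since the values of a presheaf on the
  open subsets of \<^term>\<open>U\<close> are unaffected. Sheaves on \<^term>\<open>X\<close> are likewise used unchanged as
  sheaves on the open subspace.
\<close>

definition open_sub :: "('x, 'r) ringed \<Rightarrow> 'x set \<Rightarrow> ('x, 'r) ringed" where
  "open_sub X U = X\<lparr>Top := subtopology (Top X) U\<rparr>"

record ('x, 'y, 's, 'r) lrs_map =
  pts :: "'x \<Rightarrow> 'y"
  pull :: "'y set \<Rightarrow> 's \<Rightarrow> 'r"

definition preimg :: "('x, 'r) ringed \<Rightarrow> ('x, 'y, 's, 'r) lrs_map \<Rightarrow> 'y set \<Rightarrow> 'x set" where
  "preimg X \<phi> V = {x \<in> topspace (Top X). pts \<phi> x \<in> V}"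

definition lrs_morphism ::
  "('x, 'r) ringed \<Rightarrow> ('y, 's) ringed \<Rightarrow> ('x, 'y, 's, 'r) lrs_map \<Rightarrow> bool" where
  "lrs_morphism X Y \<phi> \<longleftrightarrow> continuous_map (Top X) (Top Y) (pts \<phi>) \<and>
     (\<forall>V. openin (Top Y) V \<longrightarrow> pull \<phi> V \<in> ring_hom (Rg Y V) (Rg X (preimg X \<phi> V))) \<and>
     (\<forall>V W s. openin (Top Y) V \<and> openin (Top Y) W \<and> W \<subseteq> V \<and> s \<in> carrier (Rg Y V) \<longrightarrow>
        Res (Str X) (preimg X \<phi> V) (preimg X \<phi> W) (pull \<phi> V s) = pull \<phi> W (Res (Str Y) V W s)) \<and>
     (\<forall>x\<in>topspace (Top X). \<forall>V s. openin (Top Y) V \<and> pts \<phi> x \<in> V \<and> s \<in> carrier (Rg Y V) \<and>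
        germ (Top X) (Str X) x (preimg X \<phi> V) (pull \<phi> V s) \<in> Units (stalk_ring (Top X) (Str X) x) \<longrightarrow>
        germ (Top Y) (Str Y) (pts \<phi> x) V s \<in> Units (stalk_ring (Top Y) (Str Y) (pts \<phi> x)))"

definition lrs_iso :: "('x, 'r) ringed \<Rightarrow> ('y, 's) ringed \<Rightarrow> ('x, 'y, 's, 'r) lrs_map \<Rightarrow> bool" where
  "lrs_iso X Y \<phi> \<longleftrightarrow> lrs_morphism X Y \<phi> \<and> homeomorphic_map (Top X) (Top Y) (pts \<phi>) \<and>
     (\<forall>V. openin (Top Y) V \<longrightarrow>
        bij_betw (pull \<phi> V) (carrier (Rg Y V)) (carrier (Rg X (preimg X \<phi> V))))"

text \<open>
  The fraction \<^term>\<open>a\<close>/\<^term>\<open>f\<close> in the localization of \<^term>\<open>R\<close> at the prime \<^term>\<open>P\<close>, as an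
  equivalence class of pairs (numerator, denominator).
\<close>

definition frac :: "'r ring \<Rightarrow> 'r set \<Rightarrow> 'r \<Rightarrow> 'r \<Rightarrow> ('r \<times> 'r) set" where
  "frac R P a f = {(b, g). b \<in> carrier R \<and> g \<in> carrier R - P \<and>
     (\<exists>h \<in> carrier R - P. h \<otimes>\<^bsub>R\<^esub> (a \<otimes>\<^bsub>R\<^esub> g) = h \<otimes>\<^bsub>R\<^esub> (b \<otimes>\<^bsub>R\<^esub> f))}"

definition frac_add :: "'r ring \<Rightarrow> 'r set \<Rightarrow> ('r \<times> 'r) set \<Rightarrow> ('r \<times> 'r) set \<Rightarrow> ('r \<times> 'r) set" where
  "frac_add R P A B =
     (\<Union>(a, f)\<in>A. \<Union>(b, g)\<in>B. frac R P (a \<otimes>\<^bsub>R\<^esub> g \<oplus>\<^bsub>R\<^esub> b \<otimes>\<^bsub>R\<^esub> f) (f \<otimes>\<^bsub>R\<^esub> g))"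

definition frac_mult :: "'r ring \<Rightarrow> 'r set \<Rightarrow> ('r \<times> 'r) set \<Rightarrow> ('r \<times> 'r) set \<Rightarrow> ('r \<times> 'r) set" where
  "frac_mult R P A B = (\<Union>(a, f)\<in>A. \<Union>(b, g)\<in>B. frac R P (a \<otimes>\<^bsub>R\<^esub> b) (f \<otimes>\<^bsub>R\<^esub> g))"

definition zariski :: "'r ring \<Rightarrow> 'r set topology" where
  "zariski R = topology_generated_by {{P. primeideal P R \<and> f \<notin> P} | f. f \<in> carrier R}"

type_synonym 'r spec_section = "'r set \<Rightarrow> ('r \<times> 'r) set"

definition spec_const :: "'r ring \<Rightarrow> 'r set set \<Rightarrow> 'r \<Rightarrow> 'r spec_section" where
  "spec_const R U a = (\<lambda>P\<in>U. frac R P a \<one>\<^bsub>R\<^esub>)"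

text \<open>Sections of the structure sheaf are functions into the localizations that are locally a
  fraction.\<close>

definition spec_sections :: "'r ring \<Rightarrow> 'r set set \<Rightarrow> 'r spec_section ring" where
  "spec_sections R U =
     \<lparr>carrier = {s \<in> extensional U. \<forall>P\<in>U. \<exists>V a f. openin (zariski R) V \<and> P \<in> V \<and> V \<subseteq> U \<and>
          a \<in> carrier R \<and> f \<in> carrier R \<and> (\<forall>Q\<in>V. f \<notin> Q \<and> s Q = frac R Q a f)},
      monoid.mult = (\<lambda>s t. \<lambda>P\<in>U. frac_mult R P (s P) (t P)),
      one = spec_const R U \<one>\<^bsub>R\<^esub>,
      zero = spec_const R U \<zero>\<^bsub>R\<^esub>,
      add = (\<lambda>s t. \<lambda>P\<in>U. frac_add R P (s P) (t P))\<rparr>"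

definition Spec :: "'r ring \<Rightarrow> ('r set, 'r spec_section) ringed" where
  "Spec R = \<lparr>Top = zariski R, Str = \<lparr>Sec = spec_sections R, Res = (\<lambda>U V s. restrict s V)\<rparr>\<rparr>"

text \<open>
  An affine scheme is isomorphic to the spectrum of its ring of global sections, so it suffices to
  let \<^term>\<open>R\<close> range over rings on the type of sections.
\<close>

definition affine_scheme :: "('x, 'r) ringed \<Rightarrow> bool" where
  "affine_scheme X \<longleftrightarrow> locally_ringed_space X \<and> (\<exists>(R :: 'r ring) \<phi>. cring R \<and> lrs_iso X (Spec R) \<phi>)"

definition scheme :: "('x, 'r) ringed \<Rightarrow> bool" where
  "scheme X \<longleftrightarrow> locally_ringed_space X \<and>
     (\<forall>x\<in>topspace (Top X). \<exists>U. openin (Top X) U \<and> x \<in> U \<and> affine_scheme (open_sub X U))"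

type_synonym ('x, 'r, 'k) structure_map = "('x, 'k set, 'k spec_section, 'r) lrs_map"

definition scheme_over :: "'k ring \<Rightarrow> ('x, 'r) ringed \<Rightarrow> ('x, 'r, 'k) structure_map \<Rightarrow> bool" where
  "scheme_over F X \<phi> \<longleftrightarrow> scheme X \<and> lrs_morphism X (Spec F) \<phi>"

definition scalars :: "'k ring \<Rightarrow> ('x, 'r) ringed \<Rightarrow> ('x, 'r, 'k) structure_map \<Rightarrow> 'x set \<Rightarrow> 'r set" where
  "scalars F X \<phi> U =
     (\<lambda>a. Res (Str X) (topspace (Top X)) U
            (pull \<phi> (topspace (zariski F)) (spec_const F (topspace (zariski F)) a))) ` carrier F"


section \<open>Sheaves of modules\<close>

definition mk_module ::
  "'m set \<Rightarrow> 'm \<Rightarrow> ('m \<Rightarrow> 'm \<Rightarrow> 'm) \<Rightarrow> ('r \<Rightarrow> 'm \<Rightarrow> 'm) \<Rightarrow> ('r, 'm) module" where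
  "mk_module C z a s =
     \<lparr>carrier = C, monoid.mult = undefined, one = undefined, zero = z, add = a, smult = s\<rparr>"

definition mod_sheaf :: "('x, 'r) ringed \<Rightarrow> ('x, 'r, 'm) mod_presheaf \<Rightarrow> bool" where
  "mod_sheaf X M \<longleftrightarrow> sheaf (Top X) M \<and>
     (\<forall>U. openin (Top X) U \<longrightarrow> module (Rg X U) (Sec M U)) \<and>
     (\<forall>U V. openin (Top X) U \<and> openin (Top X) V \<and> V \<subseteq> U \<longrightarrow>
        (\<forall>m\<in>carrier (Sec M U). \<forall>n\<in>carrier (Sec M U).
           Res M U V (m \<oplus>\<^bsub>Sec M U\<^esub> n) = Res M U V m \<oplus>\<^bsub>Sec M V\<^esub> Res M U V n) \<and>
        (\<forall>r\<in>carrier (Rg X U). \<forall>m\<in>carrier (Sec M U).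
           Res M U V (r \<odot>\<^bsub>Sec M U\<^esub> m) = Res (Str X) U V r \<odot>\<^bsub>Sec M V\<^esub> Res M U V m))"

definition mod_hom ::
  "('x, 'r) ringed \<Rightarrow> ('x, 'r, 'm) mod_presheaf \<Rightarrow> ('x, 'r, 'n) mod_presheaf
     \<Rightarrow> ('x, 'm, 'n) sheaf_map \<Rightarrow> bool" where
  "mod_hom X M N h \<longleftrightarrow>
     (\<forall>U. openin (Top X) U \<longrightarrow>
        h U \<in> carrier (Sec M U) \<rightarrow> carrier (Sec N U) \<and>
        (\<forall>m\<in>carrier (Sec M U). \<forall>n\<in>carrier (Sec M U).
           h U (m \<oplus>\<^bsub>Sec M U\<^esub> n) = h U m \<oplus>\<^bsub>Sec N U\<^esub> h U n) \<and>
        (\<forall>r\<in>carrier (Rg X U). \<forall>m\<in>carrier (Sec M U).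
           h U (r \<odot>\<^bsub>Sec M U\<^esub> m) = r \<odot>\<^bsub>Sec N U\<^esub> h U m)) \<and>
     (\<forall>U V. openin (Top X) U \<and> openin (Top X) V \<and> V \<subseteq> U \<longrightarrow>
        (\<forall>m\<in>carrier (Sec M U). Res N U V (h U m) = h V (Res M U V m)))"

definition mod_iso ::
  "('x, 'r) ringed \<Rightarrow> ('x, 'r, 'm) mod_presheaf \<Rightarrow> ('x, 'r, 'n) mod_presheaf
     \<Rightarrow> ('x, 'm, 'n) sheaf_map \<Rightarrow> bool" where
  "mod_iso X M N h \<longleftrightarrow> mod_hom X M N h \<and>
     (\<forall>U. openin (Top X) U \<longrightarrow> bij_betw (h U) (carrier (Sec M U)) (carrier (Sec N U)))"

definition str_mod :: "('x, 'r) ringed \<Rightarrow> ('x, 'r, 'r) mod_presheaf" where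
  "str_mod X =
     \<lparr>Sec = (\<lambda>U. mk_module (carrier (Rg X U)) \<zero>\<^bsub>Rg X U\<^esub> (add (Rg X U)) (mult (Rg X U))),
      Res = Res (Str X)\<rparr>"

definition line_bundle :: "('x, 'r) ringed \<Rightarrow> ('x, 'r, 'l) mod_presheaf \<Rightarrow> bool" where
  "line_bundle X L \<longleftrightarrow> mod_sheaf X L \<and>
     (\<forall>x\<in>topspace (Top X). \<exists>U h. openin (Top X) U \<and> x \<in> U \<and> mod_iso (open_sub X U) (str_mod X) L h)"

text \<open>Sheafification: families of germs that are locally germs of a section.\<close>

type_synonym ('x, 'm) shf = "'x \<Rightarrow> ('x set \<times> 'm) set"

definition sheafify_sections ::
  "('x, 'r) ringed \<Rightarrow> ('x, 'r, 'm) mod_presheaf \<Rightarrow> 'x set \<Rightarrow> ('r, ('x, 'm) shf) module" where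
  "sheafify_sections X M U = mk_module
     {s \<in> extensional U. \<forall>x\<in>U. \<exists>V t. openin (Top X) V \<and> x \<in> V \<and> V \<subseteq> U \<and> t \<in> carrier (Sec M V) \<and>
        (\<forall>y\<in>V. s y = germ (Top X) M y V t)}
     (\<lambda>x\<in>U. germ (Top X) M x U \<zero>\<^bsub>Sec M U\<^esub>)
     (\<lambda>s t. \<lambda>x\<in>U. germ_op (Top X) M (\<lambda>V. add (Sec M V)) x (s x) (t x))
     (\<lambda>r s. \<lambda>x\<in>U. \<Union>(V, m)\<in>s x. germ (Top X) M x (U \<inter> V)
        (Res (Str X) U (U \<inter> V) r \<odot>\<^bsub>Sec M (U \<inter> V)\<^esub> Res M V (U \<inter> V) m))"

definition sheafify ::
  "('x, 'r) ringed \<Rightarrow> ('x, 'r, 'm) mod_presheaf \<Rightarrow> ('x, 'r, ('x, 'm) shf) mod_presheaf" where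
  "sheafify X M = \<lparr>Sec = sheafify_sections X M, Res = (\<lambda>U V s. restrict s V)\<rparr>"

definition to_sheafify ::
  "('x, 'r) ringed \<Rightarrow> ('x, 'r, 'm) mod_presheaf \<Rightarrow> ('x, 'm, ('x, 'm) shf) sheaf_map" where
  "to_sheafify X M U m = (\<lambda>x\<in>U. germ (Top X) M x U m)"

definition mod_subsheaf :: "('x, 'r) ringed \<Rightarrow> ('x, 'r, 'm) mod_presheaf \<Rightarrow> ('x set \<Rightarrow> 'm set) \<Rightarrow> bool" where
  "mod_subsheaf X M I \<longleftrightarrow>
     (\<forall>U. openin (Top X) U \<longrightarrow> submodule (I U) (Rg X U) (Sec M U)) \<and>
     (\<forall>U V. openin (Top X) U \<and> openin (Top X) V \<and> V \<subseteq> U \<longrightarrow> Res M U V \<in> I U \<rightarrow> I V) \<and>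
     (\<forall>U m. openin (Top X) U \<and> m \<in> carrier (Sec M U) \<and>
        (\<forall>x\<in>U. \<exists>V. openin (Top X) V \<and> x \<in> V \<and> V \<subseteq> U \<and> Res M U V m \<in> I V) \<longrightarrow> m \<in> I U)"

definition quot_mod :: "('r, 'm) module \<Rightarrow> 'm set \<Rightarrow> ('r, 'm set) module" where
  "quot_mod M H = mk_module (a_rcosets\<^bsub>M\<^esub> H) H (\<lambda>A B. A <+>\<^bsub>M\<^esub> B)
     (\<lambda>r A. \<Union>m\<in>A. H +>\<^bsub>M\<^esub> (r \<odot>\<^bsub>M\<^esub> m))"

definition quot_presheaf :: "('x, 'r, 'm) mod_presheaf \<Rightarrow> ('x set \<Rightarrow> 'm set) \<Rightarrow> ('x, 'r, 'm set) mod_presheaf" where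
  "quot_presheaf M I =
     \<lparr>Sec = (\<lambda>U. quot_mod (Sec M U) (I U)),
      Res = (\<lambda>U V A. \<Union>m\<in>A. I V +>\<^bsub>Sec M V\<^esub> Res M U V m)\<rparr>"

definition quot_sheaf ::
  "('x, 'r) ringed \<Rightarrow> ('x, 'r, 'm) mod_presheaf \<Rightarrow> ('x set \<Rightarrow> 'm set)
     \<Rightarrow> ('x, 'r, ('x, 'm set) shf) mod_presheaf" where
  "quot_sheaf X M I = sheafify X (quot_presheaf M I)"

definition quot_map ::
  "('x, 'r) ringed \<Rightarrow> ('x, 'r, 'm) mod_presheaf \<Rightarrow> ('x set \<Rightarrow> 'm set)
     \<Rightarrow> ('x, 'm, ('x, 'm set) shf) sheaf_map" where
  "quot_map X M I U m = to_sheafify X (quot_presheaf M I) U (I U +>\<^bsub>Sec M U\<^esub> m)"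

text \<open>
  The dual: sections over \<^term>\<open>U\<close> are the morphisms from \<^term>\<open>L\<close> to the structure sheaf over
  \<^term>\<open>U\<close>, normalised by \<^const>\<open>undefined\<close> outside of their domain.
\<close>

definition hom_trim ::
  "('x, 'r) ringed \<Rightarrow> ('x, 'r, 'l) mod_presheaf \<Rightarrow> 'x set \<Rightarrow> ('x, 'l, 'r) sheaf_map
     \<Rightarrow> ('x, 'l, 'r) sheaf_map" where
  "hom_trim X L U h =
     (\<lambda>V. if openin (Top X) V \<and> V \<subseteq> U then restrict (h V) (carrier (Sec L V)) else undefined)"

definition dual ::
  "('x, 'r) ringed \<Rightarrow> ('x, 'r, 'l) mod_presheaf \<Rightarrow> ('x, 'r, ('x, 'l, 'r) sheaf_map) mod_presheaf" where
  "dual X L =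
     \<lparr>Sec = (\<lambda>U. mk_module
        {h. mod_hom (open_sub X U) L (str_mod X) h \<and> hom_trim X L U h = h}
        (hom_trim X L U (\<lambda>V s. \<zero>\<^bsub>Rg X V\<^esub>))
        (\<lambda>h k. hom_trim X L U (\<lambda>V s. h V s \<oplus>\<^bsub>Rg X V\<^esub> k V s))
        (\<lambda>r h. hom_trim X L U (\<lambda>V s. Res (Str X) U V r \<otimes>\<^bsub>Rg X V\<^esub> h V s))),
      Res = (\<lambda>U V h. hom_trim X L V h)\<rparr>"


section \<open>Modules given by generators and relations\<close>

definition free_module :: "'r ring \<Rightarrow> 'a set \<Rightarrow> ('r, 'a \<Rightarrow> 'r) module" where
  "free_module R S = mk_module
     {f. (\<forall>a\<in>S. f a \<in> carrier R) \<and> (\<forall>a. a \<notin> S \<longrightarrow> f a = \<zero>\<^bsub>R\<^esub>) \<and> finite {a. f a \<noteq> \<zero>\<^bsub>R\<^esub>}}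
     (\<lambda>_. \<zero>\<^bsub>R\<^esub>)
     (\<lambda>f g a. f a \<oplus>\<^bsub>R\<^esub> g a)
     (\<lambda>r f a. r \<otimes>\<^bsub>R\<^esub> f a)"

definition gen :: "'r ring \<Rightarrow> 'a \<Rightarrow> 'a \<Rightarrow> 'r" where
  "gen R a = (\<lambda>b. if b = a then \<one>\<^bsub>R\<^esub> else \<zero>\<^bsub>R\<^esub>)"

definition span_of :: "'r ring \<Rightarrow> ('r, 'm) module \<Rightarrow> 'm set \<Rightarrow> 'm set" where
  "span_of R M G = \<Inter>{H. submodule H R M \<and> G \<subseteq> H}"

definition free_map :: "'r ring \<Rightarrow> 'r ring \<Rightarrow> ('r \<Rightarrow> 'r) \<Rightarrow> ('a \<Rightarrow> 'b) \<Rightarrow> ('a \<Rightarrow> 'r) \<Rightarrow> 'b \<Rightarrow> 'r" where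
  "free_map R R' \<rho> g f = (\<lambda>b. \<Oplus>\<^bsub>R'\<^esub>a\<in>{a. f a \<noteq> \<zero>\<^bsub>R\<^esub> \<and> g a = b}. \<rho> (f a))"


section \<open>Kaehler differentials\<close>

text \<open>
  The module of differentials of a ring \<^term>\<open>A\<close> relative to a set \<^term>\<open>K\<close> of scalars, with one
  generator for each element of \<^term>\<open>A\<close>, and then the sheaf associated to
  the presheaf of differentials of the rings of sections.
\<close>

definition kaehler_rel :: "'r ring \<Rightarrow> 'r set \<Rightarrow> ('r \<Rightarrow> 'r) set" where
  "kaehler_rel A K = span_of A (free_module A (carrier A))
     (let M = free_module A (carrier A) in
       {gen A (a \<oplus>\<^bsub>A\<^esub> b) \<ominus>\<^bsub>M\<^esub> (gen A a \<oplus>\<^bsub>M\<^esub> gen A b) | a b. a \<in> carrier A \<and> b \<in> carrier A} \<union>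
       {gen A (a \<otimes>\<^bsub>A\<^esub> b) \<ominus>\<^bsub>M\<^esub> (a \<odot>\<^bsub>M\<^esub> gen A b \<oplus>\<^bsub>M\<^esub> b \<odot>\<^bsub>M\<^esub> gen A a) | a b. a \<in> carrier A \<and> b \<in> carrier A} \<union>
       {gen A c | c. c \<in> K})"

type_synonym ('x, 'r) omega = "('x, ('r \<Rightarrow> 'r) set) shf"

definition kaehler_presheaf ::
  "'k ring \<Rightarrow> ('x, 'r) ringed \<Rightarrow> ('x, 'r, 'k) structure_map \<Rightarrow> ('x, 'r, ('r \<Rightarrow> 'r) set) mod_presheaf" where
  "kaehler_presheaf F X \<phi> =
     \<lparr>Sec = (\<lambda>U. quot_mod (free_module (Rg X U) (carrier (Rg X U)))
                   (kaehler_rel (Rg X U) (scalars F X \<phi> U))),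
      Res = (\<lambda>U V A. \<Union>f\<in>A. kaehler_rel (Rg X V) (scalars F X \<phi> V)
               +>\<^bsub>free_module (Rg X V) (carrier (Rg X V))\<^esub>
                 free_map (Rg X U) (Rg X V) (Res (Str X) U V) (Res (Str X) U V) f)\<rparr>"

definition kaehler ::
  "'k ring \<Rightarrow> ('x, 'r) ringed \<Rightarrow> ('x, 'r, 'k) structure_map \<Rightarrow> ('x, 'r, ('x, 'r) omega) mod_presheaf" where
  "kaehler F X \<phi> = sheafify X (kaehler_presheaf F X \<phi>)"

definition univ_der ::
  "'k ring \<Rightarrow> ('x, 'r) ringed \<Rightarrow> ('x, 'r, 'k) structure_map \<Rightarrow> ('x, 'r, ('x, 'r) omega) sheaf_map" where
  "univ_der F X \<phi> U a = to_sheafify X (kaehler_presheaf F X \<phi>) U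
     (kaehler_rel (Rg X U) (scalars F X \<phi> U) +>\<^bsub>free_module (Rg X U) (carrier (Rg X U))\<^esub> gen (Rg X U) a)"


section \<open>Tensor products\<close>

definition tensor_rel :: "'r ring \<Rightarrow> ('r, 'm) module \<Rightarrow> ('r, 'n) module \<Rightarrow> ('m \<times> 'n \<Rightarrow> 'r) set" where
  "tensor_rel R M N = span_of R (free_module R (carrier M \<times> carrier N))
     (let T = free_module R (carrier M \<times> carrier N) in
       {gen R (m \<oplus>\<^bsub>M\<^esub> m', n) \<ominus>\<^bsub>T\<^esub> (gen R (m, n) \<oplus>\<^bsub>T\<^esub> gen R (m', n)) | m m' n.
          m \<in> carrier M \<and> m' \<in> carrier M \<and> n \<in> carrier N} \<union>
       {gen R (m, n \<oplus>\<^bsub>N\<^esub> n') \<ominus>\<^bsub>T\<^esub> (gen R (m, n) \<oplus>\<^bsub>T\<^esub> gen R (m, n')) | m n n'.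
          m \<in> carrier M \<and> n \<in> carrier N \<and> n' \<in> carrier N} \<union>
       {gen R (r \<odot>\<^bsub>M\<^esub> m, n) \<ominus>\<^bsub>T\<^esub> (r \<odot>\<^bsub>T\<^esub> gen R (m, n)) | r m n.
          r \<in> carrier R \<and> m \<in> carrier M \<and> n \<in> carrier N} \<union>
       {gen R (m, r \<odot>\<^bsub>N\<^esub> n) \<ominus>\<^bsub>T\<^esub> (r \<odot>\<^bsub>T\<^esub> gen R (m, n)) | r m n.
          r \<in> carrier R \<and> m \<in> carrier M \<and> n \<in> carrier N})"

definition tensor_presheaf ::
  "('x, 'r) ringed \<Rightarrow> ('x, 'r, 'm) mod_presheaf \<Rightarrow> ('x, 'r, 'n) mod_presheaf
     \<Rightarrow> ('x, 'r, ('m \<times> 'n \<Rightarrow> 'r) set) mod_presheaf" where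
  "tensor_presheaf X M N =
     \<lparr>Sec = (\<lambda>U. quot_mod (free_module (Rg X U) (carrier (Sec M U) \<times> carrier (Sec N U)))
                   (tensor_rel (Rg X U) (Sec M U) (Sec N U))),
      Res = (\<lambda>U V A. \<Union>f\<in>A. tensor_rel (Rg X V) (Sec M V) (Sec N V)
               +>\<^bsub>free_module (Rg X V) (carrier (Sec M V) \<times> carrier (Sec N V))\<^esub>
                 free_map (Rg X U) (Rg X V) (Res (Str X) U V) (map_prod (Res M U V) (Res N U V)) f)\<rparr>"

type_synonym ('x, 'r, 'm, 'n) tens = "('x, ('m \<times> 'n \<Rightarrow> 'r) set) shf"

definition tensor ::
  "('x, 'r) ringed \<Rightarrow> ('x, 'r, 'm) mod_presheaf \<Rightarrow> ('x, 'r, 'n) mod_presheaf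
     \<Rightarrow> ('x, 'r, ('x, 'r, 'm, 'n) tens) mod_presheaf" where
  "tensor X M N = sheafify X (tensor_presheaf X M N)"

definition tens ::
  "('x, 'r) ringed \<Rightarrow> ('x, 'r, 'm) mod_presheaf \<Rightarrow> ('x, 'r, 'n) mod_presheaf
     \<Rightarrow> 'x set \<Rightarrow> 'm \<Rightarrow> 'n \<Rightarrow> ('x, 'r, 'm, 'n) tens" where
  "tens X M N U m n = to_sheafify X (tensor_presheaf X M N) U
     (tensor_rel (Rg X U) (Sec M U) (Sec N U)
        +>\<^bsub>free_module (Rg X U) (carrier (Sec M U) \<times> carrier (Sec N U))\<^esub> gen (Rg X U) (m, n))"

text \<open>
  The morphism out of a tensor product of sheaves that is induced by a bilinear map. It is unique on
  sections, since a section of the tensor product is locally a sum of pure tensors.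
\<close>

definition tensor_lift ::
  "('x, 'r) ringed \<Rightarrow> ('x, 'r, 'm) mod_presheaf \<Rightarrow> ('x, 'r, 'n) mod_presheaf \<Rightarrow> ('x, 'r, 'p) mod_presheaf
     \<Rightarrow> ('x set \<Rightarrow> 'm \<Rightarrow> 'n \<Rightarrow> 'p) \<Rightarrow> ('x, ('x, 'r, 'm, 'n) tens, 'p) sheaf_map" where
  "tensor_lift X M N P \<beta> = (SOME h. mod_hom X (tensor X M N) P h \<and>
     (\<forall>U m n. openin (Top X) U \<and> m \<in> carrier (Sec M U) \<and> n \<in> carrier (Sec N U) \<longrightarrow>
        h U (tens X M N U m n) = \<beta> U m n))"

definition tensor_swap ::
  "('x, 'r) ringed \<Rightarrow> ('x, 'r, 'm) mod_presheaf \<Rightarrow> ('x, 'r, 'n) mod_presheaf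
     \<Rightarrow> ('x, ('x, 'r, 'm, 'n) tens, ('x, 'r, 'n, 'm) tens) sheaf_map" where
  "tensor_swap X M N = tensor_lift X M N (tensor X N M) (\<lambda>U m n. tens X N M U n m)"

definition tensor_map_right ::
  "('x, 'r) ringed \<Rightarrow> ('x, 'r, 'm) mod_presheaf \<Rightarrow> ('x, 'r, 'n) mod_presheaf \<Rightarrow> ('x, 'r, 'p) mod_presheaf
     \<Rightarrow> ('x, 'n, 'p) sheaf_map \<Rightarrow> ('x, ('x, 'r, 'm, 'n) tens, ('x, 'r, 'm, 'p) tens) sheaf_map" where
  "tensor_map_right X M N P h = tensor_lift X M N (tensor X M P) (\<lambda>U m n. tens X M P U m (h U n))"

definition evaluation ::
  "('x, 'r) ringed \<Rightarrow> ('x, 'r, 'l) mod_presheaf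
     \<Rightarrow> ('x, ('x, 'r, ('x, 'l, 'r) sheaf_map, 'l) tens, 'r) sheaf_map" where
  "evaluation X L = tensor_lift X (dual X L) L (str_mod X) (\<lambda>U u e. u U e)"

text \<open>
  The morphism sending \<open>u \<otimes> (e \<otimes> g)\<close> to \<open>u(e) g\<close>.
\<close>

definition contraction ::
  "('x, 'r) ringed \<Rightarrow> ('x, 'r, 'l) mod_presheaf \<Rightarrow> ('x, 'r, 'g) mod_presheaf
     \<Rightarrow> ('x, ('x, 'r, ('x, 'l, 'r) sheaf_map, ('x, 'r, 'l, 'g) tens) tens, 'g) sheaf_map" where
  "contraction X L G = (SOME h. mod_hom X (tensor X (dual X L) (tensor X L G)) G h \<and>
     (\<forall>U u e g. openin (Top X) U \<and> u \<in> carrier (Sec (dual X L) U) \<and>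
        e \<in> carrier (Sec L U) \<and> g \<in> carrier (Sec G U) \<longrightarrow>
        h U (tens X (dual X L) (tensor X L G) U u (tens X L G U e g)) = u U e \<odot>\<^bsub>Sec G U\<^esub> g))"


section \<open>Extensions\<close>

type_synonym ('x, 'r, 'g, 'b, 'e) ext =
  "('x, 'r, 'b) mod_presheaf \<times> ('x, 'g, 'b) sheaf_map \<times> ('x, 'b, 'e) sheaf_map"

text \<open>A triple \<open>(B, i, p)\<close> stands for the exact sequence \<open>0 \<rightarrow> G \<rightarrow> B \<rightarrow> E \<rightarrow> 0\<close> with maps \<open>i\<close> and \<open>p\<close>.
  As \<open>i\<close> is injective, exactness at \<open>B\<close> can be tested on sections.\<close>

definition extension ::
  "('x, 'r) ringed \<Rightarrow> ('x, 'r, 'e) mod_presheaf \<Rightarrow> ('x, 'r, 'g) mod_presheaf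
     \<Rightarrow> ('x, 'r, 'g, 'b, 'e) ext \<Rightarrow> bool" where
  "extension X E G = (\<lambda>(B, i, p). mod_sheaf X B \<and> mod_hom X G B i \<and> mod_hom X B E p \<and>
     (\<forall>U. openin (Top X) U \<longrightarrow>
        inj_on (i U) (carrier (Sec G U)) \<and>
        {b \<in> carrier (Sec B U). p U b = \<zero>\<^bsub>Sec E U\<^esub>} = i U ` carrier (Sec G U) \<and>
        (\<forall>e\<in>carrier (Sec E U). \<forall>x\<in>U. \<exists>V b. openin (Top X) V \<and> x \<in> V \<and> V \<subseteq> U \<and>
           b \<in> carrier (Sec B V) \<and> p V b = Res E U V e)))"

definition ext_equiv ::
  "('x, 'r) ringed \<Rightarrow> ('x, 'r, 'e) mod_presheaf \<Rightarrow> ('x, 'r, 'g) mod_presheaf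
     \<Rightarrow> ('x, 'r, 'g, 'b, 'e) ext \<Rightarrow> ('x, 'r, 'g, 'c, 'e) ext \<Rightarrow> bool" where
  "ext_equiv X E G = (\<lambda>(B, i, p) (B', i', p'). \<exists>h. mod_iso X B B' h \<and>
     (\<forall>U. openin (Top X) U \<longrightarrow>
        (\<forall>g\<in>carrier (Sec G U). h U (i U g) = i' U g) \<and>
        (\<forall>b\<in>carrier (Sec B U). p' U (h U b) = p U b)))"

text \<open>
  Elements of \<open>Ext\<^sup>1(E, G)\<close> are classes of extensions of \<open>E\<close> by \<open>G\<close>. The members of a class have
  middle terms on the type \<^typ>\<open>'g \<times> 'e\<close>, which loses nothing: for every extension and every open set,
  the choice of a preimage for each section of \<open>E\<close> that lifts embeds the sections of the middle term
  into the product of the sections of \<open>G\<close> and \<open>E\<close>. The extension whose class is taken may live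
  on any type.
\<close>

type_synonym ('x, 'r, 'g, 'e) ext_class = "('x, 'r, 'g, 'g \<times> 'e, 'e) ext set"

definition ext_class ::
  "('x, 'r) ringed \<Rightarrow> ('x, 'r, 'e) mod_presheaf \<Rightarrow> ('x, 'r, 'g) mod_presheaf
     \<Rightarrow> ('x, 'r, 'g, 'b, 'e) ext \<Rightarrow> ('x, 'r, 'g, 'e) ext_class" where
  "ext_class X E G \<xi> = {\<eta>. extension X E G \<eta> \<and> ext_equiv X E G \<xi> \<eta>}"

text \<open>
  Maps on \<open>Ext\<^sup>1\<close> are defined on representatives; the union runs over classes that all coincide.
  First, the bijection induced by an isomorphism \<open>\<alpha>\<close> from \<open>G\<close> to \<open>G'\<close>.
\<close>

definition ext_push ::
  "('x, 'r) ringed \<Rightarrow> ('x, 'r, 'e) mod_presheaf \<Rightarrow> ('x, 'r, 'g) mod_presheaf \<Rightarrow> ('x, 'r, 'h) mod_presheaf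
     \<Rightarrow> ('x, 'g, 'h) sheaf_map \<Rightarrow> ('x, 'r, 'g, 'e) ext_class \<Rightarrow> ('x, 'r, 'h, 'e) ext_class" where
  "ext_push X E G G' \<alpha> C =
     (\<Union>(B, i, p)\<in>C. ext_class X E G' (B, \<lambda>U. i U \<circ> inv_into (carrier (Sec G U)) (\<alpha> U), p))"

text \<open>
  The canonical map from \<open>Ext\<^sup>1(L, G)\<close> to \<open>Ext\<^sup>1(O, L* \<otimes> G)\<close>: tensor with the dual of \<open>L\<close> and
  identify the quotient with the structure sheaf by evaluation.
\<close>

definition ext_twist ::
  "('x, 'r) ringed \<Rightarrow> ('x, 'r, 'l) mod_presheaf \<Rightarrow> ('x, 'r, 'g) mod_presheaf \<Rightarrow> ('x, 'r, 'g, 'l) ext_class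
     \<Rightarrow> ('x, 'r, ('x, 'r, ('x, 'l, 'r) sheaf_map, 'g) tens, 'r) ext_class" where
  "ext_twist X L G C =
     (\<Union>(B, i, p)\<in>C. ext_class X (str_mod X) (tensor X (dual X L) G)
        (tensor X (dual X L) B,
         tensor_map_right X (dual X L) G B i,
         \<lambda>U. evaluation X L U \<circ> tensor_map_right X (dual X L) B L p U))"


section \<open>First cohomology\<close>

text \<open>
  \<open>H\<^sup>1\<close> is the colimit of Cech cohomology over open covers (for any sheaf of abelian groups on any
  space this is sheaf cohomology in degree one). It suffices to consider covers
  indexed by the points of the space, \<open>x \<in> U x\<close>, since every cover is refined by one of these.
  The groups are written multiplicatively.
\<close>

definition pointed_cover :: "'x topology \<Rightarrow> ('x \<Rightarrow> 'x set) \<Rightarrow> bool" where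
  "pointed_cover T U \<longleftrightarrow> (\<forall>x\<in>topspace T. openin T (U x) \<and> x \<in> U x)"

type_synonym ('x, 'a) cochain = "('x \<Rightarrow> 'x set) \<times> ('x \<Rightarrow> 'x \<Rightarrow> 'a)"

definition cocycle :: "'x topology \<Rightarrow> ('x, 'a) group_presheaf \<Rightarrow> ('x, 'a) cochain \<Rightarrow> bool" where
  "cocycle T G = (\<lambda>(U, c). pointed_cover T U \<and>
     (\<forall>x\<in>topspace T. \<forall>y\<in>topspace T. c x y \<in> carrier (Sec G (U x \<inter> U y))) \<and>
     (\<forall>x\<in>topspace T. \<forall>y\<in>topspace T. \<forall>z\<in>topspace T.
        let W = U x \<inter> U y \<inter> U z in
        Res G (U x \<inter> U y) W (c x y) \<otimes>\<^bsub>Sec G W\<^esub> Res G (U y \<inter> U z) W (c y z) =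
        Res G (U x \<inter> U z) W (c x z)))"

definition cohomologous ::
  "'x topology \<Rightarrow> ('x, 'a) group_presheaf \<Rightarrow> ('x, 'a) cochain \<Rightarrow> ('x, 'a) cochain \<Rightarrow> bool" where
  "cohomologous T G = (\<lambda>(U, c) (V, c').
     \<exists>W b. pointed_cover T W \<and>
       (\<forall>x\<in>topspace T. W x \<subseteq> U x \<inter> V x \<and> b x \<in> carrier (Sec G (W x))) \<and>
       (\<forall>x\<in>topspace T. \<forall>y\<in>topspace T.
          let N = W x \<inter> W y in
          Res G (V x \<inter> V y) N (c' x y) =
          Res G (U x \<inter> U y) N (c x y) \<otimes>\<^bsub>Sec G N\<^esub>
            (Res G (W y) N (b y) \<otimes>\<^bsub>Sec G N\<^esub> inv\<^bsub>Sec G N\<^esub> Res G (W x) N (b x))))"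

type_synonym ('x, 'a) H1_element = "('x, 'a) cochain set"

definition H1_class :: "'x topology \<Rightarrow> ('x, 'a) group_presheaf \<Rightarrow> ('x, 'a) cochain \<Rightarrow> ('x, 'a) H1_element" where
  "H1_class T G c = {c'. cocycle T G c' \<and> cohomologous T G c c'}"

definition H1_map ::
  "'x topology \<Rightarrow> ('x, 'b) group_presheaf \<Rightarrow> ('x, 'a, 'b) sheaf_map \<Rightarrow> ('x, 'a) H1_element
     \<Rightarrow> ('x, 'b) H1_element" where
  "H1_map T G h C = (\<Union>(U, c)\<in>C. H1_class T G (U, \<lambda>x y. h (U x \<inter> U y) (c x y)))"

definition add_presheaf :: "('x, 'r, 'm) mod_presheaf \<Rightarrow> ('x, 'm) group_presheaf" where
  "add_presheaf M = 
     \<lparr>Sec = (\<lambda>U. \<lparr>carrier = carrier (Sec M U), monoid.mult = add (Sec M U), one = zero (Sec M U)\<rparr>),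
      Res = Res M\<rparr>"

definition unit_presheaf :: "('x, 'r) ringed \<Rightarrow> ('x, 'r) group_presheaf" where
  "unit_presheaf X = \<lparr>Sec = (\<lambda>U. units_of (Rg X U)), Res = Res (Str X)\<rparr>"

text \<open>
  The map from \<open>Ext\<^sup>1(O, G)\<close> to \<open>H\<^sup>1(X, G)\<close> takes an extension to the image of the section \<open>1\<close> under
  the connecting homomorphism: choose local lifts \<open>t x\<close> of \<open>1\<close> and take the cocycle of
  differences \<open>t y - t x\<close>.
\<close>

definition ext_to_H1 ::
  "('x, 'r) ringed \<Rightarrow> ('x, 'r, 'g) mod_presheaf \<Rightarrow> ('x, 'r, 'g, 'r) ext_class \<Rightarrow> ('x, 'g) H1_element" where
  "ext_to_H1 X G C = (\<Union>(B, i, p)\<in>C.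
     \<Union>{H1_class (Top X) (add_presheaf G) (U, c) | U c.
        pointed_cover (Top X) U \<and>
        (\<exists>t. (\<forall>x\<in>topspace (Top X). t x \<in> carrier (Sec B (U x)) \<and> p (U x) (t x) = \<one>\<^bsub>Rg X (U x)\<^esub>) \<and>
          (\<forall>x\<in>topspace (Top X). \<forall>y\<in>topspace (Top X).
             c x y \<in> carrier (Sec G (U x \<inter> U y)) \<and>
             i (U x \<inter> U y) (c x y) =
             Res B (U y) (U x \<inter> U y) (t y) \<ominus>\<^bsub>Sec B (U x \<inter> U y)\<^esub> Res B (U x) (U x \<inter> U y) (t x)))})"

text \<open>
  The class of a line bundle in \<open>H\<^sup>1(X, O*)\<close>. For local generators \<open>e x\<close> over \<open>U x\<close>
  the cocycle \<open>g\<close> is normalised by \<open>e x = g x y \<cdot> e y\<close>. The inverse convention changes the sign of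
  Chern classes; with the connecting homomorphism above, and the given module structure on jets,
  this is the one for which the Atiyah class maps to the Chern class without a sign.
\<close>

definition pic_class ::
  "('x, 'r) ringed \<Rightarrow> ('x, 'r, 'l) mod_presheaf \<Rightarrow> ('x, 'r) H1_element" where
  "pic_class X L =
     \<Union>{H1_class (Top X) (unit_presheaf X) (U, g) | U g.
        pointed_cover (Top X) U \<and>
        (\<exists>h. (\<forall>x\<in>topspace (Top X). mod_iso (open_sub X (U x)) (str_mod X) L (h x)) \<and>
          (let e = (\<lambda>x. h x (U x) \<one>\<^bsub>Rg X (U x)\<^esub>) in
           \<forall>x\<in>topspace (Top X). \<forall>y\<in>topspace (Top X).
             g x y \<in> Units (Rg X (U x \<inter> U y)) \<and>
             Res L (U x) (U x \<inter> U y) (e x) =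
             g x y \<odot>\<^bsub>Sec L (U x \<inter> U y)\<^esub> Res L (U y) (U x \<inter> U y) (e y)))}"


section \<open>Chern class and Atiyah class\<close>

definition dlog ::
  "'k ring \<Rightarrow> ('x, 'r) ringed \<Rightarrow> ('x, 'r, 'k) structure_map \<Rightarrow> ('x, 'r, ('x, 'r) omega) sheaf_map" where
  "dlog F X \<phi> U a = inv\<^bsub>Rg X U\<^esub> a \<odot>\<^bsub>Sec (kaehler F X \<phi>) U\<^esub> univ_der F X \<phi> U a"

definition chern_class ::
  "'k ring \<Rightarrow> ('x, 'r) ringed \<Rightarrow> ('x, 'r, 'k) structure_map \<Rightarrow> ('x, 'r, 'l) mod_presheaf
     \<Rightarrow> ('x, ('x, 'r) omega) H1_element" where
  "chern_class F X \<phi> L = H1_map (Top X) (add_presheaf (kaehler F X \<phi>)) (dlog F X \<phi>) (pic_class X L)"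

type_synonym ('x, 'r) qomega = "('x, ('x, 'r) omega set) shf"

definition gen_chern_class ::
  "'k ring \<Rightarrow> ('x, 'r) ringed \<Rightarrow> ('x, 'r, 'k) structure_map \<Rightarrow> ('x set \<Rightarrow> ('x, 'r) omega set)
     \<Rightarrow> ('x, 'r, 'l) mod_presheaf \<Rightarrow> ('x, ('x, 'r) qomega) H1_element" where
  "gen_chern_class F X \<phi> I L =
     H1_map (Top X) (add_presheaf (quot_sheaf X (kaehler F X \<phi>) I)) (quot_map X (kaehler F X \<phi>) I)
       (chern_class F X \<phi> L)"

definition quot_der ::
  "'k ring \<Rightarrow> ('x, 'r) ringed \<Rightarrow> ('x, 'r, 'k) structure_map \<Rightarrow> ('x set \<Rightarrow> ('x, 'r) omega set)
     \<Rightarrow> ('x, 'r, ('x, 'r) qomega) sheaf_map" where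
  "quot_der F X \<phi> I U a = quot_map X (kaehler F X \<phi>) I U (univ_der F X \<phi> U a)"

text \<open>First order jets, and the Atiyah class, with respect to a sheaf \<open>G\<close> and a derivation \<open>d\<close>
  from the structure sheaf to \<open>G\<close>.\<close>

definition jets ::
  "('x, 'r) ringed \<Rightarrow> ('x, 'r, 'g) mod_presheaf \<Rightarrow> ('x, 'r, 'g) sheaf_map \<Rightarrow> ('x, 'r, 'e) mod_presheaf
     \<Rightarrow> ('x, 'r, ('x, 'r, 'g, 'e) tens \<times> 'e) mod_presheaf" where
  "jets X G d E =
     \<lparr>Sec = (\<lambda>U. mk_module
        (carrier (Sec (tensor X G E) U) \<times> carrier (Sec E U))
        (\<zero>\<^bsub>Sec (tensor X G E) U\<^esub>, \<zero>\<^bsub>Sec E U\<^esub>)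
        (\<lambda>(w, e) (w', e'). (w \<oplus>\<^bsub>Sec (tensor X G E) U\<^esub> w', e \<oplus>\<^bsub>Sec E U\<^esub> e'))
        (\<lambda>s (w, e). (s \<odot>\<^bsub>Sec (tensor X G E) U\<^esub> w \<oplus>\<^bsub>Sec (tensor X G E) U\<^esub> tens X G E U (d U s) e,
                     s \<odot>\<^bsub>Sec E U\<^esub> e))),
      Res = (\<lambda>U V (w, e). (Res (tensor X G E) U V w, Res E U V e))\<rparr>"

definition atiyah_class ::
  "('x, 'r) ringed \<Rightarrow> ('x, 'r, 'g) mod_presheaf \<Rightarrow> ('x, 'r, 'g) sheaf_map \<Rightarrow> ('x, 'r, 'e) mod_presheaf
     \<Rightarrow> ('x, 'r, ('x, 'r, 'g, 'e) tens, 'e) ext_class" where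
  "atiyah_class X G d E =
     ext_class X E (tensor X G E) (jets X G d E, \<lambda>U w. (w, \<zero>\<^bsub>Sec E U\<^esub>), \<lambda>U. snd)"

text \<open>The composite \<open>Ext\<^sup>1(L, L \<otimes> G) \<rightarrow> Ext\<^sup>1(O, L* \<otimes> L \<otimes> G) \<rightarrow> Ext\<^sup>1(O, G) \<rightarrow> H\<^sup>1(X, G)\<close>.\<close>

definition ext_line_to_H1 ::
  "('x, 'r) ringed \<Rightarrow> ('x, 'r, 'l) mod_presheaf \<Rightarrow> ('x, 'r, 'g) mod_presheaf
     \<Rightarrow> ('x, 'r, ('x, 'r, 'l, 'g) tens, 'l) ext_class \<Rightarrow> ('x, 'g) H1_element" where
  "ext_line_to_H1 X L G C =
     ext_to_H1 X G
       (ext_push X (str_mod X) (tensor X (dual X L) (tensor X L G)) G (contraction X L G)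
         (ext_twist X L (tensor X L G) C))"

end

theory Submission
  imports Defs
begin

text \<open>
  Choose generators \<open>e x\<close> of \<open>L\<close> on neighbourhoods \<open>U x\<close> with dual generators \<open>u x\<close>, let
  \<open>e x = g x y \<cdot> e y\<close> on overlaps, and put \<open>r x y = inverse (g x y)\<close>. The lifts \<open>(0, e x)\<close> to the
  jets do not satisfy \<open>e y = r x y \<cdot> e x\<close>: the defect is \<open>- d (r x y) \<otimes> e x\<close>. After tensoring with
  the dual, \<open>u x \<otimes> (0, e x)\<close> lifts the section 1, and the difference cocycle of these lifts is the
  product of \<open>u y\<close> with the defect. Contraction turns it into \<open>- g x y \<cdot> d (r x y)\<close>, which is the
  logarithmic derivative of \<open>g x y\<close>.

  The tensor product and the sheaf of differentials are both sheafified quotients of presheaves of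
  free modules, so one universal property serves both. Tensoring an extension with a line bundle
  remains exact because locally it is multiplication by a free generator.
\<close>

section \<open>Modules\<close>

text \<open>An element of Ext^1 or of H^1 is here a set of representatives, and each map on such
  elements is a union over the members of a set. Before a composite can be evaluated, every class on
  the way must be known to be nonempty, since an empty union is not a class, and all members must
  contribute the same set. The members cannot be written down: they are arbitrary extensions
  equivalent to a given one. What can be followed is a property. \<open>lift_data\<close> says that
  an extension admits local lifts of prescribed sections with a prescribed defect. It holds for the
  jets by computation, is invariant under equivalence, is carried along by twisting and by changing
  the kernel, and for lifts of 1 it determines the class in H^1. It has coefficients
  \<open>r x y\<close> because the generators \<open>e x\<close> of \<open>L\<close> differ on
  overlaps; after the twist the lifted sections are 1 and so are the coefficients. Morphisms out of
  tensor products are chosen by \<open>SOME\<close>, so they are accessible only through their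
  values on pure tensors; this is why uniqueness on pure tensors is used throughout.\<close>

lemma mk_module_simps [simp]:
  "carrier (mk_module C z a s) = C"
  "zero (mk_module C z a s) = z"
  "add (mk_module C z a s) = a"
  "smult (mk_module C z a s) = s"
  by (simp_all add: mk_module_def)

text \<open>Additive inverses come from the scalars: \<open>\<ominus> 1 \<odot> x\<close> is an
  inverse of \<open>x\<close>, and \<open>s0\<close> turns
  \<open>(\<ominus> 1 \<oplus> 1) \<odot> x\<close> into zero. Modules whose elements are cosets,
  germs or morphisms can thus be set up from zero, addition and scalar action alone.\<close>

lemma module_intro:
  fixes R :: "'r ring" and M :: "('r, 'm) module"
  assumes R: "cring R" and z: "\<zero>\<^bsub>M\<^esub> \<in> carrier M"
    and ac: "\<And>x y. x \<in> carrier M \<Longrightarrow> y \<in> carrier M \<Longrightarrow> x \<oplus>\<^bsub>M\<^esub> y \<in> carrier M"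
    and aa: "\<And>x y w. x \<in> carrier M \<Longrightarrow> y \<in> carrier M \<Longrightarrow> w \<in> carrier M
      \<Longrightarrow> (x \<oplus>\<^bsub>M\<^esub> y) \<oplus>\<^bsub>M\<^esub> w = x \<oplus>\<^bsub>M\<^esub> (y \<oplus>\<^bsub>M\<^esub> w)"
    and acm: "\<And>x y. x \<in> carrier M \<Longrightarrow> y \<in> carrier M \<Longrightarrow> x \<oplus>\<^bsub>M\<^esub> y = y \<oplus>\<^bsub>M\<^esub> x"
    and az: "\<And>x. x \<in> carrier M \<Longrightarrow> \<zero>\<^bsub>M\<^esub> \<oplus>\<^bsub>M\<^esub> x = x"
    and sc: "\<And>r x. r \<in> carrier R \<Longrightarrow> x \<in> carrier M \<Longrightarrow> r \<odot>\<^bsub>M\<^esub> x \<in> carrier M"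
    and sl: "\<And>r s x. r \<in> carrier R \<Longrightarrow> s \<in> carrier R \<Longrightarrow> x \<in> carrier M
      \<Longrightarrow> (r \<oplus>\<^bsub>R\<^esub> s) \<odot>\<^bsub>M\<^esub> x = r \<odot>\<^bsub>M\<^esub> x \<oplus>\<^bsub>M\<^esub> s \<odot>\<^bsub>M\<^esub> x"
    and sr: "\<And>r x y. r \<in> carrier R \<Longrightarrow> x \<in> carrier M \<Longrightarrow> y \<in> carrier M
      \<Longrightarrow> r \<odot>\<^bsub>M\<^esub> (x \<oplus>\<^bsub>M\<^esub> y) = r \<odot>\<^bsub>M\<^esub> x \<oplus>\<^bsub>M\<^esub> r \<odot>\<^bsub>M\<^esub> y"
    and sa: "\<And>r s x. r \<in> carrier R \<Longrightarrow> s \<in> carrier R \<Longrightarrow> x \<in> carrier M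
      \<Longrightarrow> (r \<otimes>\<^bsub>R\<^esub> s) \<odot>\<^bsub>M\<^esub> x = r \<odot>\<^bsub>M\<^esub> (s \<odot>\<^bsub>M\<^esub> x)"
    and s1: "\<And>x. x \<in> carrier M \<Longrightarrow> \<one>\<^bsub>R\<^esub> \<odot>\<^bsub>M\<^esub> x = x"
    and s0: "\<And>x. x \<in> carrier M \<Longrightarrow> \<zero>\<^bsub>R\<^esub> \<odot>\<^bsub>M\<^esub> x = \<zero>\<^bsub>M\<^esub>"
  shows "module R M"
proof (rule moduleI[OF R])
  interpret R: cring R by (rule R)
  show "abelian_group M"
  proof (rule abelian_groupI)
    fix x assume x: "x \<in> carrier M"
    have "\<ominus>\<^bsub>R\<^esub> \<one>\<^bsub>R\<^esub> \<odot>\<^bsub>M\<^esub> x \<oplus>\<^bsub>M\<^esub> x = (\<ominus>\<^bsub>R\<^esub> \<one>\<^bsub>R\<^esub> \<oplus>\<^bsub>R\<^esub> \<one>\<^bsub>R\<^esub>) \<odot>\<^bsub>M\<^esub> x"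
      using x by (simp add: sl s1)
    then have "\<ominus>\<^bsub>R\<^esub> \<one>\<^bsub>R\<^esub> \<odot>\<^bsub>M\<^esub> x \<oplus>\<^bsub>M\<^esub> x = \<zero>\<^bsub>M\<^esub>"
      using x by (simp add: R.l_neg s0)
    then show "\<exists>y\<in>carrier M. y \<oplus>\<^bsub>M\<^esub> x = \<zero>\<^bsub>M\<^esub>"
      using x sc by (intro bexI[of _ "\<ominus>\<^bsub>R\<^esub> \<one>\<^bsub>R\<^esub> \<odot>\<^bsub>M\<^esub> x"]) auto
  qed (use assms in auto)
qed (use assms in auto)

lemma module_add_closed:
  assumes "module R M" "x \<in> carrier M" "y \<in> carrier M"
  shows "x \<oplus>\<^bsub>M\<^esub> y \<in> carrier M"
proof -
  interpret module R M by fact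
  show ?thesis using assms(2,3) by simp
qed

lemma module_eq_diffI:
  fixes R :: "'r ring" and M :: "('r, 'm) module"
  assumes "module R M" "x \<in> carrier M" "y \<in> carrier M" "x \<oplus>\<^bsub>M\<^esub> y = z"
  shows "x = z \<ominus>\<^bsub>M\<^esub> y"
proof -
  interpret module R M by fact
  show ?thesis using assms(2,3) unfolding assms(4)[symmetric] by (simp add: a_minus_def M.a_assoc M.r_neg)
qed

text \<open>Linearity along a map \<open>\<rho>\<close> of scalars. Restriction of sections is of
  this kind with \<open>\<rho>\<close> the restriction of functions, and morphisms over one open set
  are the case \<open>lin\<close>, so one set of lemmas serves both.\<close>

definition semilin ::
  "'r ring \<Rightarrow> ('r, 'm) module \<Rightarrow> ('s, 'n) module \<Rightarrow> ('r \<Rightarrow> 's)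
     \<Rightarrow> ('m \<Rightarrow> 'n) \<Rightarrow> bool" where
  "semilin R M N \<rho> f \<longleftrightarrow> f \<in> carrier M \<rightarrow> carrier N \<and>
     (\<forall>m\<in>carrier M. \<forall>n\<in>carrier M. f (m \<oplus>\<^bsub>M\<^esub> n) = f m \<oplus>\<^bsub>N\<^esub> f n) \<and>
     (\<forall>r\<in>carrier R. \<forall>m\<in>carrier M. f (r \<odot>\<^bsub>M\<^esub> m) = \<rho> r \<odot>\<^bsub>N\<^esub> f m)"

abbreviation lin where "lin R M N \<equiv> semilin R M N (\<lambda>r. r)"

lemma semilinI:
  assumes "\<And>m. m \<in> carrier M \<Longrightarrow> f m \<in> carrier N"
    and "\<And>m n. m \<in> carrier M \<Longrightarrow> n \<in> carrier M \<Longrightarrow> f (m \<oplus>\<^bsub>M\<^esub> n) = f m \<oplus>\<^bsub>N\<^esub> f n"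
    and "\<And>r m. r \<in> carrier R \<Longrightarrow> m \<in> carrier M \<Longrightarrow> f (r \<odot>\<^bsub>M\<^esub> m) = \<rho> r \<odot>\<^bsub>N\<^esub> f m"
  shows "semilin R M N \<rho> f"
  using assms by (auto simp: semilin_def)

lemma semilin_closed: "semilin R M N \<rho> f \<Longrightarrow> m \<in> carrier M \<Longrightarrow> f m \<in> carrier N"
  and semilin_add: "semilin R M N \<rho> f \<Longrightarrow> m \<in> carrier M \<Longrightarrow> n \<in> carrier M
    \<Longrightarrow> f (m \<oplus>\<^bsub>M\<^esub> n) = f m \<oplus>\<^bsub>N\<^esub> f n"
  and semilin_smult: "semilin R M N \<rho> f \<Longrightarrow> r \<in> carrier R \<Longrightarrow> m \<in> carrier M
    \<Longrightarrow> f (r \<odot>\<^bsub>M\<^esub> m) = \<rho> r \<odot>\<^bsub>N\<^esub> f m"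
  by (auto simp: semilin_def)

lemma semilin_zero:
  assumes f: "semilin R M N \<rho> f" and M: "module R M" and N: "module S N"
  shows "f \<zero>\<^bsub>M\<^esub> = \<zero>\<^bsub>N\<^esub>"
proof -
  interpret M: module R M by (rule M)
  interpret N: module S N by (rule N)
  have "f \<zero>\<^bsub>M\<^esub> \<oplus>\<^bsub>N\<^esub> f \<zero>\<^bsub>M\<^esub> = f \<zero>\<^bsub>M\<^esub>"
    using semilin_add[OF f M.zero_closed M.zero_closed] by simp
  then show ?thesis
    using semilin_closed[OF f M.zero_closed] by (simp add: N.M.add.r_cancel_one)
qed

lemma semilin_minus:
  assumes f: "semilin R M N \<rho> f" and M: "module R M" and N: "module S N" and m: "m \<in> carrier M"
  shows "f (\<ominus>\<^bsub>M\<^esub> m) = \<ominus>\<^bsub>N\<^esub> f m"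
proof -
  interpret M: module R M by (rule M)
  interpret N: module S N by (rule N)
  have "f (\<ominus>\<^bsub>M\<^esub> m) \<oplus>\<^bsub>N\<^esub> f m = \<zero>\<^bsub>N\<^esub>"
    using semilin_add[OF f M.a_inv_closed[OF m] m] semilin_zero[OF f M N] m by (simp add: M.M.l_neg)
  then show ?thesis
    using semilin_closed[OF f] m by (simp add: N.M.minus_equality)
qed

lemma semilin_diff:
  assumes f: "semilin R M N \<rho> f" and M: "module R M" and N: "module S N"
    and m: "m \<in> carrier M" and n: "n \<in> carrier M"
  shows "f (m \<ominus>\<^bsub>M\<^esub> n) = f m \<ominus>\<^bsub>N\<^esub> f n"
proof -
  interpret M: module R M by (rule M)
  interpret N: module S N by (rule N)
  show ?thesis
    using semilin_add[OF f m M.a_inv_closed[OF n]] semilin_minus[OF f M N n] m n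
    by (simp add: a_minus_def)
qed

lemma semilin_comp:
  assumes "semilin R M N \<rho> f" "semilin S N P \<sigma> g" "\<And>r. r \<in> carrier R \<Longrightarrow> \<rho> r \<in> carrier S"
    "\<And>r. r \<in> carrier R \<Longrightarrow> \<tau> r = \<sigma> (\<rho> r)"
  shows "semilin R M P \<tau> (\<lambda>m. g (f m))"
  using assms unfolding semilin_def by (auto simp: Pi_def)

subsection \<open>Quotients\<close>

locale quot_module = module R M for R :: "'r ring" and M :: "('r, 'm) module" (structure) +
  fixes H assumes sub: "submodule H R M"
begin

sublocale abelian_subgroup H M
  using sub abelian_subgroupI3 additive_subgroupI submodule.axioms(1) M.abelian_group_axioms by blast

lemma H_sub: "H \<subseteq> carrier M" and H_zero: "\<zero>\<^bsub>M\<^esub> \<in> H"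
  and H_add: "\<And>x y. x \<in> H \<Longrightarrow> y \<in> H \<Longrightarrow> x \<oplus>\<^bsub>M\<^esub> y \<in> H"
  and H_smult: "\<And>r x. r \<in> carrier R \<Longrightarrow> x \<in> H \<Longrightarrow> r \<odot>\<^bsub>M\<^esub> x \<in> H"
  and H_minus: "\<And>x. x \<in> H \<Longrightarrow> \<ominus>\<^bsub>M\<^esub> x \<in> H"
  using submoduleE[OF sub] a_subset by auto

lemma cls_eq:
  assumes m: "m \<in> carrier M" and n: "n \<in> carrier M"
  shows "H +> m = H +> n \<longleftrightarrow> m \<ominus>\<^bsub>M\<^esub> n \<in> H"
proof -
  have "H +> m = H +> n \<longleftrightarrow> m \<in> H +> n"
    using a_repr_independence'[OF _ n, of m] a_rcos_self[OF m] by blast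
  then show ?thesis
    by (simp add: a_rcos_module[OF n m] a_minus_def)
qed

lemma cls_zero: "m \<in> H \<Longrightarrow> H +> m = H"
  by (rule a_rcos_const)

lemma cls_cases: "A \<in> carrier (quot_mod M H) \<Longrightarrow> (\<And>m. m \<in> carrier M \<Longrightarrow> A = H +> m \<Longrightarrow> thesis) \<Longrightarrow> thesis"
  by (auto simp: quot_mod_def A_RCOSETS_def' )

lemma cls_closed: "m \<in> carrier M \<Longrightarrow> H +> m \<in> carrier (quot_mod M H)"
  by (auto simp: quot_mod_def intro: M.a_rcosetsI[OF H_sub])

lemma cls_mem: "m \<in> carrier M \<Longrightarrow> n \<in> H +> m \<Longrightarrow> n \<in> carrier M \<and> H +> n = H +> m"
  using M.a_r_coset_subset_G[OF H_sub] a_repr_independence'[of n m] by blast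

text \<open>Every operation on cosets is defined by a union over representatives.\<close>

lemma cls_Union:
  assumes m: "m \<in> carrier M" and "\<And>n. n \<in> carrier M \<Longrightarrow> H +> n = H +> m \<Longrightarrow> f n = f m"
  shows "(\<Union>n\<in>H +> m. f n) = f m"
proof -
  have "f n = f m" if "n \<in> H +> m" for n
    using assms(2) cls_mem[OF m that] by blast
  then show ?thesis
    using a_rcos_self[OF m] by blast
qed

lemma quot_zero: "\<zero>\<^bsub>quot_mod M H\<^esub> = H +> \<zero>\<^bsub>M\<^esub>"
  using cls_zero[OF H_zero] by (simp add: quot_mod_def)

lemma quot_add: "m \<in> carrier M \<Longrightarrow> n \<in> carrier M
  \<Longrightarrow> (H +> m) \<oplus>\<^bsub>quot_mod M H\<^esub> (H +> n) = H +> (m \<oplus>\<^bsub>M\<^esub> n)"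
  by (simp add: quot_mod_def a_rcos_sum)

lemma quot_smult:
  assumes r: "r \<in> carrier R" and m: "m \<in> carrier M"
  shows "r \<odot>\<^bsub>quot_mod M H\<^esub> (H +> m) = H +> (r \<odot>\<^bsub>M\<^esub> m)"
proof -
  have "(\<Union>n\<in>H +> m. H +> (r \<odot>\<^bsub>M\<^esub> n)) = H +> (r \<odot>\<^bsub>M\<^esub> m)"
  proof (rule cls_Union[OF m])
    fix n assume n: "n \<in> carrier M" "H +> n = H +> m"
    then have "n \<ominus>\<^bsub>M\<^esub> m \<in> H" using cls_eq m by blast
    then have "r \<odot>\<^bsub>M\<^esub> (n \<ominus>\<^bsub>M\<^esub> m) \<in> H" using r H_smult by blast
    moreover have "r \<odot>\<^bsub>M\<^esub> (n \<ominus>\<^bsub>M\<^esub> m) = r \<odot>\<^bsub>M\<^esub> n \<ominus>\<^bsub>M\<^esub> r \<odot>\<^bsub>M\<^esub> m"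
      using n m r by (simp add: a_minus_def smult_r_distr smult_r_minus)
    ultimately show "H +> (r \<odot>\<^bsub>M\<^esub> n) = H +> (r \<odot>\<^bsub>M\<^esub> m)"
      using cls_eq n m r by simp
  qed
  then show ?thesis by (simp add: quot_mod_def)
qed

lemma quot_is_module: "module R (quot_mod M H)"
proof (rule module_intro)
  show "cring R" by (rule R.cring_axioms)
qed (auto elim!: cls_cases simp: quot_zero quot_add quot_smult cls_closed M.a_ac
    smult_l_distr smult_r_distr smult_assoc1)

lemma cls_lin: "lin R M (quot_mod M H) (\<lambda>m. H +> m)"
  by (rule semilinI) (auto simp: quot_add quot_smult cls_closed)

text \<open>The induced map evaluates \<open>f\<close> at a chosen element of the coset. Two
  elements of a coset differ by an element of \<open>H\<close>, which \<open>f\<close> kills, so the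
  choice is harmless.\<close>

lemma quot_lift:
  assumes f: "semilin R M N \<rho> f" and N: "module S N" and k: "\<And>m. m \<in> H \<Longrightarrow> f m = \<zero>\<^bsub>N\<^esub>"
  shows "\<exists>g. semilin R (quot_mod M H) N \<rho> g \<and> (\<forall>m\<in>carrier M. g (H +> m) = f m)"
proof -
  interpret N: module S N by (rule N)
  define g where "g A = f (SOME m. m \<in> A)" for A
  have g: "g (H +> m) = f m" if m: "m \<in> carrier M" for m
  proof -
    have "(SOME n. n \<in> H +> m) \<in> H +> m" using a_rcos_self[OF m] by (rule someI[of "\<lambda>n. n \<in> H +> m"])
    then obtain n where n: "n = (SOME n. n \<in> H +> m)" "n \<in> carrier M" "H +> n = H +> m"
      using cls_mem[OF m] by blast
    then have "f (n \<ominus>\<^bsub>M\<^esub> m) = \<zero>\<^bsub>N\<^esub>" using k cls_eq m by blast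
    then have "f n \<ominus>\<^bsub>N\<^esub> f m = \<zero>\<^bsub>N\<^esub>" using semilin_diff[OF f module_axioms N n(2) m] by simp
    then have "f n = f m"
      using n(2) m semilin_closed[OF f] N.M.minus_equality[of "f n" "\<ominus>\<^bsub>N\<^esub> f m"] by (simp add: a_minus_def)
    then show ?thesis using n(1) by (simp add: g_def)
  qed
  have "semilin R (quot_mod M H) N \<rho> g"
    by (rule semilinI) (auto elim!: cls_cases simp: g quot_add quot_smult
        semilin_add[OF f] semilin_smult[OF f] semilin_closed[OF f])
  with g show ?thesis by blast
qed

end

subsection \<open>Generated submodules\<close>

lemma span_of_submodule:
  assumes M: "module R M" and G: "G \<subseteq> carrier M"
  shows "submodule (span_of R M G) R M"
proof -
  interpret M: module R M by (rule M)
  note E = M.submoduleE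
  show ?thesis
  proof (rule M.submoduleI)
    show "span_of R M G \<subseteq> carrier M"
      using M.carrier_is_submodule G by (auto simp: span_of_def)
    show "\<zero>\<^bsub>M\<^esub> \<in> span_of R M G"
    proof -
      have "\<zero>\<^bsub>M\<^esub> \<in> H" if "submodule H R M" for H
        using subgroup.one_closed[OF submodule.axioms(1)[OF that]] by simp
      then show ?thesis by (simp add: span_of_def)
    qed
  qed (auto simp: span_of_def dest: E)
qed

lemma span_of_incl: "G \<subseteq> span_of R M G"
  by (auto simp: span_of_def)

lemma semilin_vimage_submodule:
  fixes R :: "'r ring" and S :: "'s ring" and M :: "('r, 'm) module" and N :: "('s, 'n) module"
  assumes M: "module R M" and N: "module S N" and f: "semilin R M N \<rho> f"
    and \<rho>: "\<rho> \<in> carrier R \<rightarrow> carrier S" and H: "submodule H S N"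
  shows "submodule {m \<in> carrier M. f m \<in> H} R M"
proof -
  interpret M: module R M by (rule M)
  interpret N: module S N by (rule N)
  interpret H: quot_module S N H using N H by (simp add: quot_module_def quot_module_axioms_def)
  show ?thesis
    using \<rho> by (intro M.submoduleI)
      (auto simp: semilin_zero[OF f M N] semilin_minus[OF f M N] semilin_add[OF f] semilin_smult[OF f]
        H.H_zero H.H_minus H.H_add H.H_smult Pi_def)
qed

text \<open>The span is the smallest submodule containing \<open>G\<close>, and the preimage of
  \<open>H\<close> is a submodule containing \<open>G\<close>. Statements about all relations are
  thereby reduced to the generating ones.\<close>

lemma span_of_image:
  fixes R :: "'r ring" and S :: "'s ring" and M :: "('r, 'm) module" and N :: "('s, 'n) module"
  assumes "module R M" "module S N" "semilin R M N \<rho> f" "\<rho> \<in> carrier R \<rightarrow> carrier S"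
    and "submodule H S N" "G \<subseteq> carrier M" "\<And>m. m \<in> G \<Longrightarrow> f m \<in> H" "x \<in> span_of R M G"
  shows "f x \<in> H"
  using semilin_vimage_submodule[OF assms(1-5)] assms(6-8) unfolding span_of_def by blast

subsection \<open>Free modules\<close>

lemma free_module_simps [simp]:
  "\<zero>\<^bsub>free_module R S\<^esub> = (\<lambda>_. \<zero>\<^bsub>R\<^esub>)"
  "f \<oplus>\<^bsub>free_module R S\<^esub> g = (\<lambda>a. f a \<oplus>\<^bsub>R\<^esub> g a)"
  "r \<odot>\<^bsub>free_module R S\<^esub> f = (\<lambda>a. r \<otimes>\<^bsub>R\<^esub> f a)"
  by (simp_all add: free_module_def)

lemma free_carrier: "f \<in> carrier (free_module R S) \<longleftrightarrow>
    (\<forall>a\<in>S. f a \<in> carrier R) \<and> (\<forall>a. a \<notin> S \<longrightarrow> f a = \<zero>\<^bsub>R\<^esub>) \<and> finite {a. f a \<noteq> \<zero>\<^bsub>R\<^esub>}"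
  by (simp add: free_module_def)

lemma free_val: "cring R \<Longrightarrow> f \<in> carrier (free_module R S) \<Longrightarrow> f a \<in> carrier R"
  by (cases "a \<in> S") (auto simp: free_carrier cring.cring_simprules)

lemma free_support: "f \<in> carrier (free_module R S) \<Longrightarrow> {a. f a \<noteq> \<zero>\<^bsub>R\<^esub>} \<subseteq> S"
  by (auto simp: free_carrier)

lemma free_module_module:
  fixes R :: "'r ring"
  assumes R: "cring R"
  shows "module R (free_module R S)"
proof -
  interpret R: cring R by (rule R)
  note fv = free_val[OF R]
  show ?thesis
  proof (rule module_intro[OF R])
    fix f g assume fg: "f \<in> carrier (free_module R S)" "g \<in> carrier (free_module R S)"
    have "{a. f a \<oplus>\<^bsub>R\<^esub> g a \<noteq> \<zero>\<^bsub>R\<^esub>} \<subseteq> {a. f a \<noteq> \<zero>\<^bsub>R\<^esub>} \<union> {a. g a \<noteq> \<zero>\<^bsub>R\<^esub>}" by auto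
    then have "finite {a. f a \<oplus>\<^bsub>R\<^esub> g a \<noteq> \<zero>\<^bsub>R\<^esub>}"
      by (rule finite_subset) (use fg in \<open>auto simp: free_carrier\<close>)
    then show "f \<oplus>\<^bsub>free_module R S\<^esub> g \<in> carrier (free_module R S)"
      using fg by (auto simp: free_carrier)
  next
    fix r f assume rf: "r \<in> carrier R" "f \<in> carrier (free_module R S)"
    have "{a. r \<otimes>\<^bsub>R\<^esub> f a \<noteq> \<zero>\<^bsub>R\<^esub>} \<subseteq> {a. f a \<noteq> \<zero>\<^bsub>R\<^esub>}" using rf by auto
    then have "finite {a. r \<otimes>\<^bsub>R\<^esub> f a \<noteq> \<zero>\<^bsub>R\<^esub>}"
      by (rule finite_subset) (use rf in \<open>auto simp: free_carrier\<close>)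
    then show "r \<odot>\<^bsub>free_module R S\<^esub> f \<in> carrier (free_module R S)"
      using rf by (auto simp: free_carrier)
  next
    show "\<zero>\<^bsub>free_module R S\<^esub> \<in> carrier (free_module R S)" by (simp add: free_carrier)
  qed (simp_all add: fun_eq_iff fv R.a_ac R.l_distr R.r_distr R.m_assoc)
qed

lemma gen_carrier:
  assumes R: "cring R" and a: "a \<in> S"
  shows "gen R a \<in> carrier (free_module R S)"
proof -
  interpret R: cring R by (rule R)
  have "{b. gen R a b \<noteq> \<zero>\<^bsub>R\<^esub>} \<subseteq> {a}" by (auto simp: gen_def)
  then have "finite {b. gen R a b \<noteq> \<zero>\<^bsub>R\<^esub>}" by (rule finite_subset) auto
  then show ?thesis using a by (auto simp: free_carrier gen_def)
qed

text \<open>Induction on the size of the support: setting \<open>f\<close> to zero at one point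
  \<open>a\<close> of the support splits off the summand \<open>f a \<odot> gen a\<close>.\<close>

lemma free_induct [consumes 2, case_names zero add]:
  assumes R: "cring R" and f: "f \<in> carrier (free_module R S)"
    and P0: "P (\<lambda>_. \<zero>\<^bsub>R\<^esub>)"
    and Padd: "\<And>f r a. f \<in> carrier (free_module R S) \<Longrightarrow> r \<in> carrier R \<Longrightarrow> a \<in> S \<Longrightarrow> P f
      \<Longrightarrow> P (f \<oplus>\<^bsub>free_module R S\<^esub> r \<odot>\<^bsub>free_module R S\<^esub> gen R a)"
  shows "P f"
proof -
  interpret R: cring R by (rule R)
  have "finite B \<Longrightarrow> f \<in> carrier (free_module R S) \<Longrightarrow> {a. f a \<noteq> \<zero>\<^bsub>R\<^esub>} = B \<Longrightarrow> P f" for B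
  proof (induction B arbitrary: f rule: finite_induct)
    case empty
    then have "f = (\<lambda>_. \<zero>\<^bsub>R\<^esub>)" by auto
    then show ?case using P0 by simp
  next
    case (insert a B f)
    define g where "g = f(a := \<zero>\<^bsub>R\<^esub>)"
    have gB: "{b. g b \<noteq> \<zero>\<^bsub>R\<^esub>} = B" using insert.prems(2) insert.hyps(2) by (auto simp: g_def)
    have g: "g \<in> carrier (free_module R S)"
      using insert.prems(1) insert.hyps(1) by (auto simp: free_carrier gB) (auto simp: g_def)
    have a: "a \<in> S" using insert.prems free_support by blast
    have "f = g \<oplus>\<^bsub>free_module R S\<^esub> f a \<odot>\<^bsub>free_module R S\<^esub> gen R a"
      using free_val[OF R insert.prems(1)] by (auto simp: g_def gen_def fun_eq_iff)
    moreover have "P (g \<oplus>\<^bsub>free_module R S\<^esub> f a \<odot>\<^bsub>free_module R S\<^esub> gen R a)"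
      by (rule Padd[OF g free_val[OF R insert.prems(1)] a insert.IH[OF g gB]])
    ultimately show ?case by simp
  qed
  then show ?thesis using f by (auto simp: free_carrier)
qed

lemma free_eqI:
  assumes R: "cring R" and F: "semilin R (free_module R S) N \<rho> F" and G: "semilin R (free_module R S) N \<rho> G"
    and N: "module R' N" and eq: "\<And>a. a \<in> S \<Longrightarrow> F (gen R a) = G (gen R a)"
    and f: "f \<in> carrier (free_module R S)"
  shows "F f = G f"
  using R f
proof (induction rule: free_induct)
  case zero
  show ?case
    using semilin_zero[OF F free_module_module[OF R] N] semilin_zero[OF G free_module_module[OF R] N] by simp
next
  case (add f r a)
  note g = gen_carrier[OF R add(3)]
  interpret M: module R "free_module R S" by (rule free_module_module[OF R])
  show ?case
    using semilin_add[OF F add(1) M.smult_closed[OF add(2) g]] semilin_add[OF G add(1) M.smult_closed[OF add(2) g]]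
      semilin_smult[OF F add(2) g] semilin_smult[OF G add(2) g] eq[OF add(3)] add(4)
    by (simp del: free_module_simps)
qed

text \<open>The extension is the sum of \<open>f a \<odot> g a\<close> over the support of
  \<open>f\<close>. Supports of \<open>f\<close>, \<open>h\<close> and their sum differ, so the sum
  is first allowed to run over any finite set containing the support, the extra terms being
  zero.\<close>

lemma free_lift:
  assumes N: "module R N" and g: "g \<in> S \<rightarrow> carrier N"
  shows "\<exists>F. lin R (free_module R S) N F \<and> (\<forall>a\<in>S. F (gen R a) = g a)"
proof -
  interpret module R N by (rule N)
  let ?M = "free_module R S"
  define F where "F f = (\<Oplus>\<^bsub>N\<^esub>a\<in>{a. f a \<noteq> \<zero>\<^bsub>R\<^esub>}. f a \<odot>\<^bsub>N\<^esub> g a)" for f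
  have cl: "f a \<odot>\<^bsub>N\<^esub> g a \<in> carrier N" if "f \<in> carrier ?M" "a \<in> S" for f a
    using that g by (auto simp: free_carrier)
  have F: "F f = (\<Oplus>\<^bsub>N\<^esub>a\<in>B. f a \<odot>\<^bsub>N\<^esub> g a)"
    if f: "f \<in> carrier ?M" and B: "finite B" "{a. f a \<noteq> \<zero>\<^bsub>R\<^esub>} \<subseteq> B" "B \<subseteq> S" for f B
    unfolding F_def
  proof (rule M.add.finprod_mono_neutral_cong_left)
    fix i assume i: "i \<in> B - {a. f a \<noteq> \<zero>\<^bsub>R\<^esub>}"
    then have "g i \<in> carrier N" using B g by blast
    with i show "f i \<odot>\<^bsub>N\<^esub> g i = \<zero>\<^bsub>N\<^esub>" by simp
  qed (use B cl[OF f] in auto)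
  have "lin R ?M N F"
  proof (rule semilinI)
    fix f assume f: "f \<in> carrier ?M"
    show "F f \<in> carrier N"
      unfolding F_def using cl[OF f] free_support[OF f] by (intro M.finsum_closed) auto
  next
    fix f h assume f: "f \<in> carrier ?M" and h: "h \<in> carrier ?M"
    have fh: "f \<oplus>\<^bsub>?M\<^esub> h \<in> carrier ?M"
      by (rule module_add_closed[OF free_module_module[OF R.cring_axioms] f h])
    define B where "B = {a. f a \<noteq> \<zero>\<^bsub>R\<^esub>} \<union> {a. h a \<noteq> \<zero>\<^bsub>R\<^esub>}"
    have B: "finite B" "B \<subseteq> S" using f h free_support[OF f] free_support[OF h] by (auto simp: B_def free_carrier)
    have "F (f \<oplus>\<^bsub>?M\<^esub> h) = (\<Oplus>\<^bsub>N\<^esub>a\<in>B. (f \<oplus>\<^bsub>?M\<^esub> h) a \<odot>\<^bsub>N\<^esub> g a)"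
      by (rule F[OF fh B(1) _ B(2)]) (auto simp: B_def)
    also have "\<dots> = (\<Oplus>\<^bsub>N\<^esub>a\<in>B. f a \<odot>\<^bsub>N\<^esub> g a \<oplus>\<^bsub>N\<^esub> h a \<odot>\<^bsub>N\<^esub> g a)"
    proof (rule M.finsum_cong')
      fix a assume "a \<in> B"
      then have "g a \<in> carrier N" using B g by blast
      then show "(f \<oplus>\<^bsub>?M\<^esub> h) a \<odot>\<^bsub>N\<^esub> g a = f a \<odot>\<^bsub>N\<^esub> g a \<oplus>\<^bsub>N\<^esub> h a \<odot>\<^bsub>N\<^esub> g a"
        using free_val[OF R.cring_axioms f] free_val[OF R.cring_axioms h] by (simp add: smult_l_distr)
    qed (use B cl[OF f] cl[OF h] in auto)
    also have "\<dots> = (\<Oplus>\<^bsub>N\<^esub>a\<in>B. f a \<odot>\<^bsub>N\<^esub> g a) \<oplus>\<^bsub>N\<^esub> (\<Oplus>\<^bsub>N\<^esub>a\<in>B. h a \<odot>\<^bsub>N\<^esub> g a)"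
      using B cl[OF f] cl[OF h] by (intro M.finsum_addf) auto
    also have "\<dots> = F f \<oplus>\<^bsub>N\<^esub> F h"
    proof -
      have "F f = (\<Oplus>\<^bsub>N\<^esub>a\<in>B. f a \<odot>\<^bsub>N\<^esub> g a)" "F h = (\<Oplus>\<^bsub>N\<^esub>a\<in>B. h a \<odot>\<^bsub>N\<^esub> g a)"
        by (rule F[OF f B(1) _ B(2)] F[OF h B(1) _ B(2)], simp add: B_def)+
      then show ?thesis by simp
    qed
    finally show "F (f \<oplus>\<^bsub>?M\<^esub> h) = F f \<oplus>\<^bsub>N\<^esub> F h" .
  next
    fix r f assume r: "r \<in> carrier R" and f: "f \<in> carrier ?M"
    have rf: "r \<odot>\<^bsub>?M\<^esub> f \<in> carrier ?M"
      by (rule module.smult_closed[OF free_module_module[OF R.cring_axioms] r f])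
    define B where "B = {a. f a \<noteq> \<zero>\<^bsub>R\<^esub>}"
    have B: "finite B" "B \<subseteq> S" using f free_support[OF f] by (auto simp: B_def free_carrier)
    have "F (r \<odot>\<^bsub>?M\<^esub> f) = (\<Oplus>\<^bsub>N\<^esub>a\<in>B. (r \<odot>\<^bsub>?M\<^esub> f) a \<odot>\<^bsub>N\<^esub> g a)"
      using r by (intro F[OF rf B(1) _ B(2)]) (auto simp: B_def)
    also have "\<dots> = (\<Oplus>\<^bsub>N\<^esub>a\<in>B. r \<odot>\<^bsub>N\<^esub> (f a \<odot>\<^bsub>N\<^esub> g a))"
    proof (rule M.finsum_cong')
      fix a assume "a \<in> B"
      then have "g a \<in> carrier N" using B g by blast
      then show "(r \<odot>\<^bsub>?M\<^esub> f) a \<odot>\<^bsub>N\<^esub> g a = r \<odot>\<^bsub>N\<^esub> (f a \<odot>\<^bsub>N\<^esub> g a)"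
        using free_val[OF R.cring_axioms f] r by (simp add: smult_assoc1)
    qed (use B cl[OF f] r in auto)
    also have "\<dots> = r \<odot>\<^bsub>N\<^esub> F f"
      unfolding F_def using B cl[OF f] r by (subst finsum_smult_ldistr) (auto simp: B_def)
    finally show "F (r \<odot>\<^bsub>?M\<^esub> f) = r \<odot>\<^bsub>N\<^esub> F f" .
  qed
  moreover have "F (gen R a) = g a" if a: "a \<in> S" for a
  proof -
    have "F (gen R a) = (\<Oplus>\<^bsub>N\<^esub>b\<in>{a}. gen R a b \<odot>\<^bsub>N\<^esub> g b)"
      using a by (intro F gen_carrier R.cring_axioms) (auto simp: gen_def)
    also have "\<dots> = g a"
      using a funcset_mem[OF g a] by (subst M.finsum_insert) (auto simp: gen_def)
    finally show ?thesis .
  qed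
  ultimately show ?thesis by blast
qed

text \<open>The map of free modules induced by a ring map on coefficients and a map \<open>g\<close>
  on bases. As \<open>g\<close> may identify generators, for instance when it restricts sections,
  the coefficient at \<open>b\<close> is a sum over a fibre of \<open>g\<close>.\<close>

locale free_maps = R: cring R + R': cring R' for R R' :: "'r ring" +
  fixes \<rho> and g :: "'a \<Rightarrow> 'b" and S S'
  assumes \<rho>: "\<rho> \<in> ring_hom R R'" and g: "g \<in> S \<rightarrow> S'"
begin

sublocale ring_hom_cring R R' \<rho>
  using \<rho> by unfold_locales auto

abbreviation "fm \<equiv> free_map R R' \<rho> g"

lemma fm_eq:
  assumes f: "f \<in> carrier (free_module R S)" and B: "finite B" "{a. f a \<noteq> \<zero>\<^bsub>R\<^esub>} \<subseteq> B"
  shows "fm f b = (\<Oplus>\<^bsub>R'\<^esub>a\<in>{a\<in>B. g a = b}. \<rho> (f a))"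
  unfolding free_map_def using B free_val[OF R.cring_axioms f]
  by (intro R'.add.finprod_mono_neutral_cong_left) auto

text \<open>Finite support is preserved because the image is supported on \<open>g\<close> applied
  to the old support. Additivity and compatibility with scalars hold coefficientwise, once the sums
  over fibres are written over a common finite index set by \<open>fm_eq\<close>.\<close>

lemma fm_semilin: "semilin R (free_module R S) (free_module R' S') \<rho> fm"
proof (rule semilinI)
  fix f assume f: "f \<in> carrier (free_module R S)"
  note v = free_val[OF R.cring_axioms f]
  have z: "fm f b = \<zero>\<^bsub>R'\<^esub>" if "b \<notin> g ` {a. f a \<noteq> \<zero>\<^bsub>R\<^esub>}" for b
  proof -
    have "{a. f a \<noteq> \<zero>\<^bsub>R\<^esub> \<and> g a = b} = {}" using that by auto
    then show ?thesis by (simp only: free_map_def R'.finsum_empty)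
  qed
  then have "{b. fm f b \<noteq> \<zero>\<^bsub>R'\<^esub>} \<subseteq> g ` {a. f a \<noteq> \<zero>\<^bsub>R\<^esub>}" by auto
  then have "finite {b. fm f b \<noteq> \<zero>\<^bsub>R'\<^esub>}"
    by (rule finite_subset) (use f in \<open>auto simp: free_carrier\<close>)
  moreover have "fm f b \<in> carrier R'" for b
    unfolding free_map_def using v by (intro R'.finsum_closed) auto
  moreover have "fm f b = \<zero>\<^bsub>R'\<^esub>" if "b \<notin> S'" for b
  proof (rule z)
    show "b \<notin> g ` {a. f a \<noteq> \<zero>\<^bsub>R\<^esub>}" using that funcset_mem[OF g] free_support[OF f] by auto
  qed
  ultimately show "fm f \<in> carrier (free_module R' S')" by (simp add: free_carrier)
next
  fix f h assume f: "f \<in> carrier (free_module R S)" and h: "h \<in> carrier (free_module R S)"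
  have fh: "f \<oplus>\<^bsub>free_module R S\<^esub> h \<in> carrier (free_module R S)"
    by (rule module_add_closed[OF free_module_module[OF R.cring_axioms] f h])
  define B where "B = {a. f a \<noteq> \<zero>\<^bsub>R\<^esub>} \<union> {a. h a \<noteq> \<zero>\<^bsub>R\<^esub>}"
  have B: "finite B" using f h by (auto simp: B_def free_carrier)
  note v = free_val[OF R.cring_axioms f] free_val[OF R.cring_axioms h]
  show "fm (f \<oplus>\<^bsub>free_module R S\<^esub> h) = fm f \<oplus>\<^bsub>free_module R' S'\<^esub> fm h"
  proof
    fix b
    have "fm (f \<oplus>\<^bsub>free_module R S\<^esub> h) b = (\<Oplus>\<^bsub>R'\<^esub>a\<in>{a\<in>B. g a = b}. \<rho> (f a) \<oplus>\<^bsub>R'\<^esub> \<rho> (h a))"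
    proof -
      have "fm (f \<oplus>\<^bsub>free_module R S\<^esub> h) b = (\<Oplus>\<^bsub>R'\<^esub>a\<in>{a\<in>B. g a = b}. \<rho> ((f \<oplus>\<^bsub>free_module R S\<^esub> h) a))"
        by (rule fm_eq[OF fh B]) (auto simp: B_def)
      also have "\<dots> = (\<Oplus>\<^bsub>R'\<^esub>a\<in>{a\<in>B. g a = b}. \<rho> (f a) \<oplus>\<^bsub>R'\<^esub> \<rho> (h a))"
        by (rule R'.finsum_cong') (use v in \<open>auto simp: Pi_def\<close>)
      finally show ?thesis .
    qed
    also have "\<dots> = fm f b \<oplus>\<^bsub>R'\<^esub> fm h b"
    proof -
      have "fm f b = (\<Oplus>\<^bsub>R'\<^esub>a\<in>{a\<in>B. g a = b}. \<rho> (f a))" "fm h b = (\<Oplus>\<^bsub>R'\<^esub>a\<in>{a\<in>B. g a = b}. \<rho> (h a))"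
        by (rule fm_eq[OF f B] fm_eq[OF h B], simp add: B_def)+
      then show ?thesis using v by (simp add: R'.finsum_addf Pi_def)
    qed
    finally show "fm (f \<oplus>\<^bsub>free_module R S\<^esub> h) b = (fm f \<oplus>\<^bsub>free_module R' S'\<^esub> fm h) b" by simp
  qed
next
  fix r f assume r: "r \<in> carrier R" and f: "f \<in> carrier (free_module R S)"
  have rf: "r \<odot>\<^bsub>free_module R S\<^esub> f \<in> carrier (free_module R S)"
    by (rule module.smult_closed[OF free_module_module[OF R.cring_axioms] r f])
  define B where "B = {a. f a \<noteq> \<zero>\<^bsub>R\<^esub>}"
  have B: "finite B" using f by (auto simp: B_def free_carrier)
  note v = free_val[OF R.cring_axioms f]
  show "fm (r \<odot>\<^bsub>free_module R S\<^esub> f) = \<rho> r \<odot>\<^bsub>free_module R' S'\<^esub> fm f"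
  proof
    fix b
    have "fm (r \<odot>\<^bsub>free_module R S\<^esub> f) b = (\<Oplus>\<^bsub>R'\<^esub>a\<in>{a\<in>B. g a = b}. \<rho> r \<otimes>\<^bsub>R'\<^esub> \<rho> (f a))"
    proof -
      have "fm (r \<odot>\<^bsub>free_module R S\<^esub> f) b = (\<Oplus>\<^bsub>R'\<^esub>a\<in>{a\<in>B. g a = b}. \<rho> ((r \<odot>\<^bsub>free_module R S\<^esub> f) a))"
        by (rule fm_eq[OF rf B]) (use r in \<open>auto simp: B_def\<close>)
      also have "\<dots> = (\<Oplus>\<^bsub>R'\<^esub>a\<in>{a\<in>B. g a = b}. \<rho> r \<otimes>\<^bsub>R'\<^esub> \<rho> (f a))"
        by (rule R'.finsum_cong') (use v r in \<open>auto simp: Pi_def\<close>)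
      finally show ?thesis .
    qed
    also have "\<dots> = \<rho> r \<otimes>\<^bsub>R'\<^esub> fm f b"
    proof -
      have "fm f b = (\<Oplus>\<^bsub>R'\<^esub>a\<in>{a\<in>B. g a = b}. \<rho> (f a))"
        by (rule fm_eq[OF f B]) (simp add: B_def)
      then show ?thesis using v r B by (simp add: R'.finsum_rdistr Pi_def)
    qed
    finally show "fm (r \<odot>\<^bsub>free_module R S\<^esub> f) b = (\<rho> r \<odot>\<^bsub>free_module R' S'\<^esub> fm f) b" by simp
  qed
qed

lemma fm_gen:
  assumes a: "a \<in> S"
  shows "fm (gen R a) = gen R' (g a)"
proof
  fix b
  have "{a'\<in>{a}. g a' = b} = (if g a = b then {a} else {})" by auto
  moreover have "fm (gen R a) b = (\<Oplus>\<^bsub>R'\<^esub>a'\<in>{a'\<in>{a}. g a' = b}. \<rho> (gen R a a'))"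
    using a by (intro fm_eq gen_carrier R.cring_axioms) (auto simp: gen_def)
  ultimately show "fm (gen R a) b = gen R' (g a) b"
    by (auto simp: gen_def R'.finsum_insert)
qed

end

section \<open>Presheaves of modules\<close>

text \<open>Modules of sections with semilinear restrictions, and no gluing condition: free,
  quotient and tensor presheaves have this form before they are sheafified.\<close>

definition pmod :: "('x, 'r) ringed \<Rightarrow> ('x, 'r, 'm) mod_presheaf \<Rightarrow> bool" where
  "pmod X M \<longleftrightarrow> presheaf (Top X) M \<and>
     (\<forall>U. openin (Top X) U \<longrightarrow> module (Rg X U) (Sec M U)) \<and>
     (\<forall>U V. openin (Top X) U \<and> openin (Top X) V \<and> V \<subseteq> U \<longrightarrow>
        semilin (Rg X U) (Sec M U) (Sec M V) (Res (Str X) U V) (Res M U V))"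

text \<open>Morphisms over an open set \<open>U\<close>, expressed by bounding the quantifiers
  rather than by passing to the subspace. Sections of the dual, local trivialisations and coordinate
  functions are of this kind; \<open>U\<close> the whole space gives \<open>mod_hom\<close>.\<close>

definition hom_on ::
  "('x, 'r) ringed \<Rightarrow> 'x set \<Rightarrow> ('x, 'r, 'm) mod_presheaf \<Rightarrow> ('x, 'r, 'n) mod_presheaf
     \<Rightarrow> ('x, 'm, 'n) sheaf_map \<Rightarrow> bool" where
  "hom_on X U M N h \<longleftrightarrow>
     (\<forall>V. openin (Top X) V \<and> V \<subseteq> U \<longrightarrow> lin (Rg X V) (Sec M V) (Sec N V) (h V)) \<and>
     (\<forall>V W. openin (Top X) V \<and> openin (Top X) W \<and> W \<subseteq> V \<and> V \<subseteq> U \<longrightarrow>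
        (\<forall>m\<in>carrier (Sec M V). Res N V W (h V m) = h W (Res M V W m)))"

lemma open_sub_simps [simp]:
  "Str (open_sub X U) = Str X"
  "Top (open_sub X U) = subtopology (Top X) U"
  "str_mod (open_sub X U) = str_mod X"
  by (simp_all add: open_sub_def str_mod_def)

lemma openin_sub [simp]: "openin T U \<Longrightarrow> openin (subtopology T U) V \<longleftrightarrow> openin T V \<and> V \<subseteq> U"
  by (rule openin_open_subtopology)

lemma mod_hom_iff: "mod_hom X M N h \<longleftrightarrow> hom_on X (topspace (Top X)) M N h"
proof -
  have "openin (Top X) V \<and> V \<subseteq> topspace (Top X) \<longleftrightarrow> openin (Top X) V"
    "openin (Top X) V \<and> openin (Top X) W \<and> W \<subseteq> V \<and> V \<subseteq> topspace (Top X) \<longleftrightarrow>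
     openin (Top X) V \<and> openin (Top X) W \<and> W \<subseteq> V" for V W
    using openin_subset[of "Top X" V] by auto
  then show ?thesis
    by (simp only: mod_hom_def hom_on_def semilin_def)
qed

lemma mod_hom_sub_iff:
  assumes U: "openin (Top X) U"
  shows "mod_hom (open_sub X U) M N h \<longleftrightarrow> hom_on X U M N h"
proof -
  have "(openin (Top X) V \<and> V \<subseteq> U) \<and> (openin (Top X) W \<and> W \<subseteq> U) \<and> W \<subseteq> V \<longleftrightarrow>
     openin (Top X) V \<and> openin (Top X) W \<and> W \<subseteq> V \<and> V \<subseteq> U" for V W
    by auto
  then show ?thesis
    by (simp only: mod_hom_def hom_on_def semilin_def open_sub_simps openin_sub[OF U])
qed

lemma mod_sheaf_iff: "mod_sheaf X M \<longleftrightarrow> sheaf (Top X) M \<and> pmod X M"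
proof
  assume A: "mod_sheaf X M"
  then have p: "presheaf (Top X) M" by (simp add: mod_sheaf_def sheaf_def)
  have "semilin (Rg X U) (Sec M U) (Sec M V) (Res (Str X) U V) (Res M U V)"
    if "openin (Top X) U \<and> openin (Top X) V \<and> V \<subseteq> U" for U V
    using A that p unfolding mod_sheaf_def presheaf_def semilin_def by meson
  with A p show "sheaf (Top X) M \<and> pmod X M"
    unfolding pmod_def mod_sheaf_def by meson
next
  assume "sheaf (Top X) M \<and> pmod X M"
  then show "mod_sheaf X M"
    unfolding pmod_def mod_sheaf_def semilin_def by meson
qed

lemma sheaf_presheaf: "sheaf T M \<Longrightarrow> presheaf T M"
  by (simp add: sheaf_def)

lemma presheaf_closed: "presheaf T M \<Longrightarrow> openin T U \<Longrightarrow> openin T V \<Longrightarrow> V \<subseteq> U \<Longrightarrow> s \<in> carrier (Sec M U)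
    \<Longrightarrow> Res M U V s \<in> carrier (Sec M V)"
  and presheaf_id: "presheaf T M \<Longrightarrow> openin T U \<Longrightarrow> s \<in> carrier (Sec M U) \<Longrightarrow> Res M U U s = s"
  and presheaf_comp: "presheaf T M \<Longrightarrow> openin T U \<Longrightarrow> openin T V \<Longrightarrow> openin T W \<Longrightarrow> W \<subseteq> V \<Longrightarrow> V \<subseteq> U
    \<Longrightarrow> s \<in> carrier (Sec M U) \<Longrightarrow> Res M V W (Res M U V s) = Res M U W s"
  unfolding presheaf_def by (auto simp: Pi_def)

subsection \<open>Gluing\<close>

lemma sheafD:
  assumes sh: "sheaf T P"
    and A: "(\<forall>U\<in>\<U>. openin T U \<and> s U \<in> carrier (Sec P U)) \<and>
      (\<forall>U\<in>\<U>. \<forall>V\<in>\<U>. Res P U (U \<inter> V) (s U) = Res P V (U \<inter> V) (s V))"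
  shows "\<exists>!t. t \<in> carrier (Sec P (\<Union>\<U>)) \<and> (\<forall>U\<in>\<U>. Res P (\<Union>\<U>) U t = s U)"
  by (rule conjunct2[OF sh[unfolded sheaf_def], THEN spec, THEN spec, THEN mp, OF A])

text \<open>The open sets on which \<open>s\<close> and \<open>t\<close> agree cover
  \<open>U\<close>, and both sections glue the same family of restrictions, so the uniqueness part
  of the sheaf condition applies.\<close>

lemma sheaf_eqI:
  assumes sh: "sheaf T M" and U: "openin T U" and s: "s \<in> carrier (Sec M U)" and t: "t \<in> carrier (Sec M U)"
    and loc: "\<And>x. x \<in> U \<Longrightarrow> \<exists>V. openin T V \<and> x \<in> V \<and> V \<subseteq> U \<and> Res M U V s = Res M U V t"
  shows "s = t"
proof -
  note p = sheaf_presheaf[OF sh]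
  define \<U> where "\<U> = {V. openin T V \<and> V \<subseteq> U \<and> Res M U V s = Res M U V t}"
  have Un: "\<Union>\<U> = U" using loc by (auto simp: \<U>_def) 
  have "\<exists>!r. r \<in> carrier (Sec M (\<Union>\<U>)) \<and> (\<forall>V\<in>\<U>. Res M (\<Union>\<U>) V r = Res M U V s)"
  proof -
    have "(\<forall>V\<in>\<U>. openin T V \<and> Res M U V s \<in> carrier (Sec M V)) \<and>
      (\<forall>V\<in>\<U>. \<forall>W\<in>\<U>. Res M V (V \<inter> W) (Res M U V s) = Res M W (V \<inter> W) (Res M U W s))"
    proof (intro conjI ballI)
      fix V W assume "V \<in> \<U>" "W \<in> \<U>"
      then have o: "openin T V" "V \<subseteq> U" "openin T W" "W \<subseteq> U" "openin T (V \<inter> W)" by (auto simp: \<U>_def)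
      show "Res M V (V \<inter> W) (Res M U V s) = Res M W (V \<inter> W) (Res M U W s)"
        using presheaf_comp[OF p U o(1,5) _ o(2) s] presheaf_comp[OF p U o(3,5) _ o(4) s] by simp
    next
      fix V assume "V \<in> \<U>"
      then have o: "openin T V" "V \<subseteq> U" by (auto simp: \<U>_def)
      show "openin T V" "Res M U V s \<in> carrier (Sec M V)"
        by (rule o(1), rule presheaf_closed[OF p U o s])
    qed
    then show ?thesis by (rule sheafD[OF sh])
  qed
  moreover have "\<forall>V\<in>\<U>. Res M U V t = Res M U V s" by (auto simp: \<U>_def)
  ultimately show ?thesis using s t unfolding Un by blast
qed

text \<open>Gluing for a predicate \<open>Q\<close> in place of a family. If sections satisfying
  \<open>Q\<close> are unique and stable under restriction, they are compatible on overlaps of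
  themselves, and the cover may consist of all open sets that carry such a section.\<close>

lemma sheaf_glue:
  assumes sh: "sheaf T M" and U: "openin T U"
    and car: "\<And>V s. openin T V \<Longrightarrow> V \<subseteq> U \<Longrightarrow> Q V s \<Longrightarrow> s \<in> carrier (Sec M V)"
    and res: "\<And>V W s. openin T V \<Longrightarrow> V \<subseteq> U \<Longrightarrow> openin T W \<Longrightarrow> W \<subseteq> V \<Longrightarrow> Q V s \<Longrightarrow> Q W (Res M V W s)"
    and un: "\<And>V s t. openin T V \<Longrightarrow> V \<subseteq> U \<Longrightarrow> Q V s \<Longrightarrow> Q V t \<Longrightarrow> s = t"
    and ex: "\<And>x. x \<in> U \<Longrightarrow> \<exists>V s. openin T V \<and> x \<in> V \<and> V \<subseteq> U \<and> Q V s"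
  shows "\<exists>t\<in>carrier (Sec M U). \<forall>V s. openin T V \<and> V \<subseteq> U \<and> Q V s \<longrightarrow> Res M U V t = s"
proof -
  define \<U> where "\<U> = {V. openin T V \<and> V \<subseteq> U \<and> (\<exists>s. Q V s)}"
  define s where "s V = (SOME s. Q V s)" for V
  have Q: "Q V (s V)" if "V \<in> \<U>" for V
    using that unfolding \<U>_def s_def by (auto intro: someI)
  have Un: "\<Union>\<U> = U"
  proof
    show "U \<subseteq> \<Union>\<U>"
    proof
      fix x assume "x \<in> U"
      then obtain V s where "openin T V" "x \<in> V" "V \<subseteq> U" "Q V s" using ex by blast
      then show "x \<in> \<Union>\<U>" unfolding \<U>_def by blast
    qed
  qed (auto simp: \<U>_def)
  have "(\<forall>V\<in>\<U>. openin T V \<and> s V \<in> carrier (Sec M V)) \<and>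
      (\<forall>V\<in>\<U>. \<forall>W\<in>\<U>. Res M V (V \<inter> W) (s V) = Res M W (V \<inter> W) (s W))"
  proof (intro conjI ballI)
    fix V W assume VW: "V \<in> \<U>" "W \<in> \<U>"
    then have o: "openin T V" "V \<subseteq> U" "openin T W" "W \<subseteq> U" "openin T (V \<inter> W)" by (auto simp: \<U>_def)
    have "Q (V \<inter> W) (Res M V (V \<inter> W) (s V))"
      by (rule res[OF o(1,2,5) _ Q[OF VW(1)]]) auto
    moreover have "Q (V \<inter> W) (Res M W (V \<inter> W) (s W))"
      by (rule res[OF o(3,4,5) _ Q[OF VW(2)]]) auto
    ultimately show "Res M V (V \<inter> W) (s V) = Res M W (V \<inter> W) (s W)"
      using un[OF o(5)] o(2) by blast
  qed (use Q car in \<open>auto simp: \<U>_def\<close>)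
  then have "\<exists>!t. t \<in> carrier (Sec M (\<Union>\<U>)) \<and> (\<forall>V\<in>\<U>. Res M (\<Union>\<U>) V t = s V)"
    by (rule sheafD[OF sh])
  then obtain t where t: "t \<in> carrier (Sec M U)" "\<And>V. V \<in> \<U> \<Longrightarrow> Res M U V t = s V"
    unfolding Un by blast
  have "Res M U V t = s'" if "openin T V" "V \<subseteq> U" "Q V s'" for V s'
  proof -
    have "V \<in> \<U>" using that by (auto simp: \<U>_def)
    then show ?thesis using t(2) Q un[OF that(1,2) _ that(3)] by metis
  qed
  then show ?thesis using t(1) by blast
qed

subsection \<open>Germs\<close>

text \<open>Germs are literal sets of pairs, so this is the transitivity of agreement near
  \<open>x\<close>: neighbourhoods of agreement are intersected. One inclusion suffices, the data
  being symmetric.\<close>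

lemma germ_eqI:
  assumes p: "presheaf T M" and o: "openin T U" "openin T V" and x: "x \<in> U" "x \<in> V"
    and s: "s \<in> carrier (Sec M U)" and t: "t \<in> carrier (Sec M V)"
    and W: "openin T W" "x \<in> W" "W \<subseteq> U \<inter> V" "Res M U W s = Res M V W t"
  shows "germ T M x U s = germ T M x V t"
proof -
  have *: "germ T M x U s \<subseteq> germ T M x V t"
    if o: "openin T U" "openin T V" and x: "x \<in> U" "x \<in> V"
    and s: "s \<in> carrier (Sec M U)" and t: "t \<in> carrier (Sec M V)"
    and W: "openin T W" "x \<in> W" "W \<subseteq> U \<inter> V" "Res M U W s = Res M V W t" for U V s t
  proof
    fix z assume z: "z \<in> germ T M x U s"
    obtain N k where zk: "z = (N, k)" by (cases z)
    with z obtain W' where N: "openin T N" "x \<in> N" "k \<in> carrier (Sec M N)"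
      and W': "openin T W'" "x \<in> W'" "W' \<subseteq> U \<inter> N" "Res M U W' s = Res M N W' k"
      by (auto simp: germ_def)
    define A where "A = W \<inter> W'"
    have A: "openin T A" "x \<in> A" "A \<subseteq> W" "A \<subseteq> W'" using W W' by (auto simp: A_def)
    have "Res M V A t = Res M W A (Res M V W t)"
      using presheaf_comp[OF p o(2) W(1) A(1,3) _ t] W(3) by auto
    also have "\<dots> = Res M U A s"
      using presheaf_comp[OF p o(1) W(1) A(1,3) _ s] W(3,4) by auto
    also have "\<dots> = Res M W' A (Res M U W' s)"
      using presheaf_comp[OF p o(1) W'(1) A(1,4) _ s] W'(3) by auto
    also have "\<dots> = Res M N A k"
      using presheaf_comp[OF p N(1) W'(1) A(1,4) _ N(3)] W'(3,4) by auto
    finally show "z \<in> germ T M x V t"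
      using N A W W' zk by (auto simp: germ_def intro!: exI[of _ A])
  qed
  show ?thesis
    using *[OF o x s t W] *[OF o(2,1) x(2,1) t s W(1,2)] W(3,4) by auto
qed

lemma germ_mem:
  assumes "presheaf T M" "openin T U" "x \<in> U" "s \<in> carrier (Sec M U)"
  shows "(U, s) \<in> germ T M x U s"
  using assms by (auto simp: germ_def)

lemma germ_memD:
  assumes p: "presheaf T M" and U: "openin T U" "x \<in> U" "s \<in> carrier (Sec M U)"
    and m: "(V, t) \<in> germ T M x U s"
  shows "openin T V" "x \<in> V" "t \<in> carrier (Sec M V)" "germ T M x V t = germ T M x U s"
    "\<exists>W. openin T W \<and> x \<in> W \<and> W \<subseteq> U \<and> W \<subseteq> V \<and> Res M U W s = Res M V W t"
proof -
  obtain W where W: "openin T W" "x \<in> W" "W \<subseteq> U \<inter> V" "Res M U W s = Res M V W t"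
    and V: "openin T V" "x \<in> V" "t \<in> carrier (Sec M V)"
    using m by (auto simp: germ_def)
  show "openin T V" "x \<in> V" "t \<in> carrier (Sec M V)" by (rule V)+
  show "germ T M x V t = germ T M x U s"
    by (rule germ_eqI[OF p U(1) V(1) U(2) V(2) U(3) V(3) W, symmetric])
  show "\<exists>W. openin T W \<and> x \<in> W \<and> W \<subseteq> U \<and> W \<subseteq> V \<and> Res M U W s = Res M V W t" using W by blast
qed

lemma germ_eqD:
  assumes p: "presheaf T M" and o: "openin T U" "openin T V" and x: "x \<in> U" "x \<in> V"
    and s: "s \<in> carrier (Sec M U)" and t: "t \<in> carrier (Sec M V)"
    and eq: "germ T M x U s = germ T M x V t"
  shows "\<exists>W. openin T W \<and> x \<in> W \<and> W \<subseteq> U \<and> W \<subseteq> V \<and> Res M U W s = Res M V W t"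
  using germ_memD(5)[OF p o(1) x(1) s, of V t] germ_mem[OF p o(2) x(2) t] eq by simp

lemma germ_res:
  assumes p: "presheaf T M" and o: "openin T U" "openin T V" and x: "x \<in> V" "V \<subseteq> U"
    and s: "s \<in> carrier (Sec M U)"
  shows "germ T M x V (Res M U V s) = germ T M x U s"
proof (rule germ_eqI[OF p o(2,1) x(1) _ presheaf_closed[OF p o x(2) s] s o(2) x(1)])
  show "Res M V V (Res M U V s) = Res M U V s"
    by (rule presheaf_id[OF p o(2) presheaf_closed[OF p o x(2) s]])
qed (use x in auto)

section \<open>Ringed spaces and presheaves of modules over them\<close>

locale rspace =
  fixes X :: "('x, 'r) ringed"
  assumes ringed: "ringed_space X"
begin

abbreviation opn :: "'x set \<Rightarrow> bool" where "opn \<equiv> openin (Top X)"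
abbreviation rr where "rr \<equiv> Res (Str X)"
abbreviation TX where "TX \<equiv> topspace (Top X)"

lemma str_sheaf: "sheaf (Top X) (Str X)"
  and str_presheaf: "presheaf (Top X) (Str X)"
  and rg_cring: "opn U \<Longrightarrow> cring (Rg X U)"
  and rr_hom: "opn U \<Longrightarrow> opn V \<Longrightarrow> V \<subseteq> U \<Longrightarrow> rr U V \<in> ring_hom (Rg X U) (Rg X V)"
  using ringed sheaf_presheaf[of "Top X" "Str X"] unfolding ringed_space_def by blast+

lemma rr_closed: "opn U \<Longrightarrow> opn V \<Longrightarrow> V \<subseteq> U \<Longrightarrow> r \<in> carrier (Rg X U) \<Longrightarrow> rr U V r \<in> carrier (Rg X V)"
  and rr_add: "opn U \<Longrightarrow> opn V \<Longrightarrow> V \<subseteq> U \<Longrightarrow> r \<in> carrier (Rg X U) \<Longrightarrow> s \<in> carrier (Rg X U)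
    \<Longrightarrow> rr U V (r \<oplus>\<^bsub>Rg X U\<^esub> s) = rr U V r \<oplus>\<^bsub>Rg X V\<^esub> rr U V s"
  and rr_mult: "opn U \<Longrightarrow> opn V \<Longrightarrow> V \<subseteq> U \<Longrightarrow> r \<in> carrier (Rg X U) \<Longrightarrow> s \<in> carrier (Rg X U)
    \<Longrightarrow> rr U V (r \<otimes>\<^bsub>Rg X U\<^esub> s) = rr U V r \<otimes>\<^bsub>Rg X V\<^esub> rr U V s"
  and rr_one: "opn U \<Longrightarrow> opn V \<Longrightarrow> V \<subseteq> U \<Longrightarrow> rr U V \<one>\<^bsub>Rg X U\<^esub> = \<one>\<^bsub>Rg X V\<^esub>"
  using rr_hom unfolding ring_hom_def by (simp_all add: Pi_iff)

lemma rr_comp: "opn U \<Longrightarrow> opn V \<Longrightarrow> opn W \<Longrightarrow> W \<subseteq> V \<Longrightarrow> V \<subseteq> U \<Longrightarrow> r \<in> carrier (Rg X U)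
    \<Longrightarrow> rr V W (rr U V r) = rr U W r"
  and rr_id: "opn U \<Longrightarrow> r \<in> carrier (Rg X U) \<Longrightarrow> rr U U r = r"
  using presheaf_comp[OF str_presheaf] presheaf_id[OF str_presheaf] by auto

end

locale pmod_space = rspace X for X :: "('x, 'r) ringed" +
  fixes M :: "('x, 'r, 'm) mod_presheaf"
  assumes pmod: "pmod X M"
begin

lemma pre: "presheaf (Top X) M"
  and mods: "opn U \<Longrightarrow> module (Rg X U) (Sec M U)"
  and res_semilin: "opn U \<Longrightarrow> opn V \<Longrightarrow> V \<subseteq> U
    \<Longrightarrow> semilin (Rg X U) (Sec M U) (Sec M V) (rr U V) (Res M U V)"
  using pmod by (auto simp: pmod_def)

lemmas res_closed = presheaf_closed[OF pre]
  and res_id = presheaf_id[OF pre]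
  and res_comp = presheaf_comp[OF pre]

lemma res_add: "opn U \<Longrightarrow> opn V \<Longrightarrow> V \<subseteq> U \<Longrightarrow> m \<in> carrier (Sec M U) \<Longrightarrow> n \<in> carrier (Sec M U)
    \<Longrightarrow> Res M U V (m \<oplus>\<^bsub>Sec M U\<^esub> n) = Res M U V m \<oplus>\<^bsub>Sec M V\<^esub> Res M U V n"
  and res_smult: "opn U \<Longrightarrow> opn V \<Longrightarrow> V \<subseteq> U \<Longrightarrow> r \<in> carrier (Rg X U) \<Longrightarrow> m \<in> carrier (Sec M U)
    \<Longrightarrow> Res M U V (r \<odot>\<^bsub>Sec M U\<^esub> m) = rr U V r \<odot>\<^bsub>Sec M V\<^esub> Res M U V m"
  and res_zero: "opn U \<Longrightarrow> opn V \<Longrightarrow> V \<subseteq> U \<Longrightarrow> Res M U V \<zero>\<^bsub>Sec M U\<^esub> = \<zero>\<^bsub>Sec M V\<^esub>"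
  and res_diff: "opn U \<Longrightarrow> opn V \<Longrightarrow> V \<subseteq> U \<Longrightarrow> m \<in> carrier (Sec M U) \<Longrightarrow> n \<in> carrier (Sec M U)
    \<Longrightarrow> Res M U V (m \<ominus>\<^bsub>Sec M U\<^esub> n) = Res M U V m \<ominus>\<^bsub>Sec M V\<^esub> Res M U V n"
  by (rule semilin_add[OF res_semilin] semilin_smult[OF res_semilin] semilin_zero[OF res_semilin mods mods]
      semilin_diff[OF res_semilin mods mods]; assumption)+

lemma zero_closed: "opn U \<Longrightarrow> \<zero>\<^bsub>Sec M U\<^esub> \<in> carrier (Sec M U)"
  using mods by (simp add: module_def abelian_group_def abelian_monoid.zero_closed)

lemma add_closed: "opn U \<Longrightarrow> m \<in> carrier (Sec M U) \<Longrightarrow> n \<in> carrier (Sec M U)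
    \<Longrightarrow> m \<oplus>\<^bsub>Sec M U\<^esub> n \<in> carrier (Sec M U)"
  by (rule module_add_closed[OF mods])

lemma smult_closed: "opn U \<Longrightarrow> r \<in> carrier (Rg X U) \<Longrightarrow> m \<in> carrier (Sec M U)
    \<Longrightarrow> r \<odot>\<^bsub>Sec M U\<^esub> m \<in> carrier (Sec M U)"
  by (rule module.smult_closed[OF mods])

abbreviation "grm \<equiv> germ (Top X) M"

text \<open>\<open>germ_op\<close> is a union over all pairs of representatives, so what has to be
  seen is that each pair yields the same germ. Everything is compared on the neighbourhood
  \<open>E\<close> where both representatives agree with \<open>a\<close> and
  \<open>b\<close>.\<close>

lemma germ_add:
  assumes U: "opn U" "x \<in> U" and a: "a \<in> carrier (Sec M U)" and b: "b \<in> carrier (Sec M U)"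
  shows "germ_op (Top X) M (\<lambda>V. add (Sec M V)) x (grm x U a) (grm x U b) = grm x U (a \<oplus>\<^bsub>Sec M U\<^esub> b)"
proof -
  have *: "grm x (V \<inter> W) (Res M V (V \<inter> W) c \<oplus>\<^bsub>Sec M (V \<inter> W)\<^esub> Res M W (V \<inter> W) d) = grm x U (a \<oplus>\<^bsub>Sec M U\<^esub> b)"
    if c: "(V, c) \<in> grm x U a" and d: "(W, d) \<in> grm x U b" for V W c d
  proof -
    note C = germ_memD[OF pre U a c] and D = germ_memD[OF pre U b d]
    obtain A where A: "opn A" "x \<in> A" "A \<subseteq> U" "A \<subseteq> V" "Res M U A a = Res M V A c" using C(5) by blast
    obtain B where B: "opn B" "x \<in> B" "B \<subseteq> U" "B \<subseteq> W" "Res M U B b = Res M W B d" using D(5) by blast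
    define E where "E = A \<inter> B"
    have E: "opn E" "x \<in> E" "E \<subseteq> A" "E \<subseteq> B" "E \<subseteq> U" "E \<subseteq> V \<inter> W" "E \<subseteq> V" "E \<subseteq> W" using A B by (auto simp: E_def)
    have o: "opn (V \<inter> W)" using C D by auto
    have "Res M U E a = Res M V E c"
      using res_comp[OF U(1) A(1) E(1,3) A(3) a] res_comp[OF C(1) A(1) E(1,3) A(4) C(3)] A(5) by simp
    moreover have "Res M U E b = Res M W E d"
      using res_comp[OF U(1) B(1) E(1,4) B(3) b] res_comp[OF D(1) B(1) E(1,4) B(4) D(3)] B(5) by simp
    moreover have c': "Res M V (V \<inter> W) c \<in> carrier (Sec M (V \<inter> W))" "Res M W (V \<inter> W) d \<in> carrier (Sec M (V \<inter> W))"
      using C D o by (auto intro!: res_closed)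
    ultimately have "Res M (V \<inter> W) E (Res M V (V \<inter> W) c \<oplus>\<^bsub>Sec M (V \<inter> W)\<^esub> Res M W (V \<inter> W) d) = Res M U E (a \<oplus>\<^bsub>Sec M U\<^esub> b)"
      using res_add[OF U(1) E(1,5) a b] res_add[OF o E(1,6) c'] res_comp[OF C(1) o E(1,6) _ C(3)]
        res_comp[OF D(1) o E(1,6) _ D(3)] by simp
    then show ?thesis
      using C D E U by (intro germ_eqI[OF pre o U(1) _ U(2) add_closed[OF o c'] add_closed[OF U(1) a b] E(1,2)]) auto
  qed
  show ?thesis
    unfolding germ_op_def using * germ_mem[OF pre U a] germ_mem[OF pre U b]
    by (auto simp: split_beta)
qed

text \<open>The expression inside \<open>sheafify_sections\<close>. The scalar is a section over
  \<open>N\<close> and not a germ, so it is restricted to the part of \<open>N\<close> on which the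
  representative lives.\<close>

definition gsmul where
  "gsmul N x r A = (\<Union>(V, m)\<in>A. grm x (N \<inter> V) (rr N (N \<inter> V) r \<odot>\<^bsub>Sec M (N \<inter> V)\<^esub> Res M V (N \<inter> V) m))"

lemma germ_smult:
  assumes U: "opn U" "x \<in> U" and N: "opn N" "U \<subseteq> N" and r: "r \<in> carrier (Rg X N)" and a: "a \<in> carrier (Sec M U)"
  shows "gsmul N x r (grm x U a) = grm x U (rr N U r \<odot>\<^bsub>Sec M U\<^esub> a)"
proof -
  have *: "grm x (N \<inter> V) (rr N (N \<inter> V) r \<odot>\<^bsub>Sec M (N \<inter> V)\<^esub> Res M V (N \<inter> V) c) = grm x U (rr N U r \<odot>\<^bsub>Sec M U\<^esub> a)"
    if c: "(V, c) \<in> grm x U a" for V c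
  proof -
    note C = germ_memD[OF pre U a c]
    obtain A where A: "opn A" "x \<in> A" "A \<subseteq> U" "A \<subseteq> V" "Res M U A a = Res M V A c" using C(5) by blast
    have o: "opn (N \<inter> V)" and AN: "A \<subseteq> N \<inter> V" "A \<subseteq> N" using C A N by auto
    have c': "Res M V (N \<inter> V) c \<in> carrier (Sec M (N \<inter> V))" using C o by (auto intro!: res_closed)
    have r': "rr N (N \<inter> V) r \<in> carrier (Rg X (N \<inter> V))" "rr N U r \<in> carrier (Rg X U)"
      using N U o r by (auto intro!: rr_closed)
    have "Res M (N \<inter> V) A (rr N (N \<inter> V) r \<odot>\<^bsub>Sec M (N \<inter> V)\<^esub> Res M V (N \<inter> V) c) = Res M U A (rr N U r \<odot>\<^bsub>Sec M U\<^esub> a)"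
      using res_smult[OF o A(1) AN(1) r'(1) c'] res_smult[OF U(1) A(1,3) r'(2) a]
        rr_comp[OF N(1) o A(1) AN(1) _ r] rr_comp[OF N(1) U(1) A(1,3) N(2) r] res_comp[OF C(1) o A(1) AN(1) _ C(3)] A(5)
      by simp
    then show ?thesis
      using A AN C N U by (intro germ_eqI[OF pre o U(1) _ U(2) smult_closed[OF o r'(1) c'] smult_closed[OF U(1) r'(2) a] A(1,2)]) auto
  qed
  show ?thesis
    unfolding gsmul_def using * germ_mem[OF pre U a] by (auto simp: split_beta)
qed

section \<open>Sheafification\<close>

abbreviation "Sh \<equiv> sheafify X M"

lemma sh_simps [simp]:
  "Res Sh U V s = restrict s V"
  "\<zero>\<^bsub>Sec Sh U\<^esub> = (\<lambda>x\<in>U. grm x U \<zero>\<^bsub>Sec M U\<^esub>)"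
  "s \<oplus>\<^bsub>Sec Sh U\<^esub> t = (\<lambda>x\<in>U. germ_op (Top X) M (\<lambda>V. add (Sec M V)) x (s x) (t x))"
  "r \<odot>\<^bsub>Sec Sh U\<^esub> s = (\<lambda>x\<in>U. gsmul U x r (s x))"
  by (simp_all add: sheafify_def sheafify_sections_def gsmul_def)

lemma sh_carrier: "s \<in> carrier (Sec Sh U) \<longleftrightarrow> s \<in> extensional U \<and>
    (\<forall>x\<in>U. \<exists>V t. opn V \<and> x \<in> V \<and> V \<subseteq> U \<and> t \<in> carrier (Sec M V) \<and> (\<forall>y\<in>V. s y = grm y V t))"
  by (simp add: sheafify_def sheafify_sections_def)

lemma sh_local:
  assumes s: "s \<in> carrier (Sec Sh U)" and W: "x \<in> W" "opn W" "W \<subseteq> U"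
  obtains V m where "opn V" "x \<in> V" "V \<subseteq> W" "m \<in> carrier (Sec M V)" "\<forall>y\<in>V. s y = grm y V m"
proof -
  have "x \<in> U" using W by auto
  then obtain V m where V: "opn V" "x \<in> V" "V \<subseteq> U" "m \<in> carrier (Sec M V)" "\<forall>y\<in>V. s y = grm y V m"
    using bspec[OF conjunct2[OF s[unfolded sh_carrier]], OF \<open>x \<in> U\<close>] by (elim exE conjE) (rule that; simp)
  have o: "opn (V \<inter> W)" using V W by auto
  show thesis
  proof (rule that[of "V \<inter> W" "Res M V (V \<inter> W) m"])
    show "\<forall>y\<in>V \<inter> W. s y = grm y (V \<inter> W) (Res M V (V \<inter> W) m)"
      using V(5) germ_res[OF pre V(1) o _ _ V(4)] by auto
  qed (use V W o res_closed[OF V(1) o _ V(4)] in auto)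
qed

lemma sh_local2:
  assumes s: "s \<in> carrier (Sec Sh U)" and t: "t \<in> carrier (Sec Sh U)" and W: "x \<in> W" "opn W" "W \<subseteq> U"
  obtains V m n where "opn V" "x \<in> V" "V \<subseteq> W" "m \<in> carrier (Sec M V)" "\<forall>y\<in>V. s y = grm y V m"
    "n \<in> carrier (Sec M V)" "\<forall>y\<in>V. t y = grm y V n"
proof -
  obtain A m where A: "opn A" "x \<in> A" "A \<subseteq> W" "m \<in> carrier (Sec M A)" "\<forall>y\<in>A. s y = grm y A m"
    by (rule sh_local[OF s W])
  have AU: "A \<subseteq> U" using A(3) W(3) by auto
  obtain V n where V: "opn V" "x \<in> V" "V \<subseteq> A" "n \<in> carrier (Sec M V)" "\<forall>y\<in>V. t y = grm y V n"
    by (rule sh_local[OF t A(2,1) AU])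
  have "\<forall>y\<in>V. s y = grm y V (Res M A V m)"
    using germ_res[OF pre A(1) V(1) _ V(3) A(4)] A(5) V(3) by auto
  moreover have "Res M A V m \<in> carrier (Sec M V)" by (rule res_closed[OF A(1) V(1,3) A(4)])
  moreover have "V \<subseteq> W" using V(3) A(3) by auto
  ultimately show thesis
    using that[OF V(1,2) _ _ _ V(4,5)] by blast
qed

lemma sh_at:
  assumes s: "s \<in> carrier (Sec Sh U)" and x: "x \<in> U" "opn U"
  obtains V m where "opn V" "x \<in> V" "V \<subseteq> U" "m \<in> carrier (Sec M V)" "s x = grm x V m"
  by (rule sh_local[OF s x subset_refl]) (rule that; simp)

lemma sh_at2:
  assumes s: "s \<in> carrier (Sec Sh U)" and t: "t \<in> carrier (Sec Sh U)" and x: "x \<in> U" "opn U"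
  obtains V m n where "opn V" "x \<in> V" "V \<subseteq> U" "m \<in> carrier (Sec M V)" "s x = grm x V m"
    "n \<in> carrier (Sec M V)" "t x = grm x V n"
  by (rule sh_local2[OF s t x subset_refl]) (rule that; simp)

lemma sh_at3:
  assumes s: "s \<in> carrier (Sec Sh U)" and t: "t \<in> carrier (Sec Sh U)" and u: "u \<in> carrier (Sec Sh U)"
    and W: "x \<in> U" "opn U"
  obtains V m n k where "opn V" "x \<in> V" "V \<subseteq> U" "m \<in> carrier (Sec M V)" "s x = grm x V m"
    "n \<in> carrier (Sec M V)" "t x = grm x V n" "k \<in> carrier (Sec M V)" "u x = grm x V k"
proof -
  obtain A m where A: "opn A" "x \<in> A" "A \<subseteq> U" "m \<in> carrier (Sec M A)" "\<forall>y\<in>A. s y = grm y A m"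
    by (rule sh_local[OF s W subset_refl])
  obtain V n k where V: "opn V" "x \<in> V" "V \<subseteq> A" "n \<in> carrier (Sec M V)" "\<forall>y\<in>V. t y = grm y V n"
    "k \<in> carrier (Sec M V)" "\<forall>y\<in>V. u y = grm y V k"
    by (rule sh_local2[OF t u A(2,1,3)])
  have "s x = grm x V (Res M A V m)"
    using germ_res[OF pre A(1) V(1) V(2,3) A(4)] A(5) A(2) by auto
  moreover have "Res M A V m \<in> carrier (Sec M V)" by (rule res_closed[OF A(1) V(1,3) A(4)])
  moreover have "V \<subseteq> U" using V(3) A(3) by auto
  ultimately show thesis
    using that[OF V(1,2) _ _ _ V(4) _ V(6)] V(2,5,7) by blast
qed

lemma germ_zero:
  assumes "opn U" "x \<in> V" "opn V" "V \<subseteq> U"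
  shows "grm x U \<zero>\<^bsub>Sec M U\<^esub> = grm x V \<zero>\<^bsub>Sec M V\<^esub>"
  using germ_res[OF pre assms(1,3,2,4) zero_closed[OF assms(1)]] assms by (simp add: res_zero)

lemma sh_ext: "s \<in> carrier (Sec Sh U) \<Longrightarrow> t \<in> carrier (Sec Sh U) \<Longrightarrow> (\<And>x. x \<in> U \<Longrightarrow> s x = t x) \<Longrightarrow> s = t"
  unfolding sh_carrier by (auto intro: extensionalityI)

lemma sh_add_closed:
  assumes U: "opn U" and s: "s \<in> carrier (Sec Sh U)" and t: "t \<in> carrier (Sec Sh U)"
  shows "s \<oplus>\<^bsub>Sec Sh U\<^esub> t \<in> carrier (Sec Sh U)"
  unfolding sh_carrier
proof (intro conjI ballI)
  fix x assume x: "x \<in> U"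
  obtain V m n where V: "opn V" "x \<in> V" "V \<subseteq> U" "m \<in> carrier (Sec M V)" "\<forall>y\<in>V. s y = grm y V m"
    "n \<in> carrier (Sec M V)" "\<forall>y\<in>V. t y = grm y V n"
    by (rule sh_local2[OF s t x U subset_refl])
  have "\<forall>y\<in>V. (s \<oplus>\<^bsub>Sec Sh U\<^esub> t) y = grm y V (m \<oplus>\<^bsub>Sec M V\<^esub> n)"
  proof
    fix y assume y: "y \<in> V"
    show "(s \<oplus>\<^bsub>Sec Sh U\<^esub> t) y = grm y V (m \<oplus>\<^bsub>Sec M V\<^esub> n)"
      using germ_add[OF V(1) y V(4,6)] V y by (auto simp: subset_iff)
  qed
  then show "\<exists>V k. opn V \<and> x \<in> V \<and> V \<subseteq> U \<and> k \<in> carrier (Sec M V) \<and> (\<forall>y\<in>V. (s \<oplus>\<^bsub>Sec Sh U\<^esub> t) y = grm y V k)"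
    using V add_closed[OF V(1,4,6)] by (intro exI[of _ V] exI[of _ "m \<oplus>\<^bsub>Sec M V\<^esub> n"]) simp
qed simp

lemma sh_smult_closed:
  assumes U: "opn U" and r: "r \<in> carrier (Rg X U)" and s: "s \<in> carrier (Sec Sh U)"
  shows "r \<odot>\<^bsub>Sec Sh U\<^esub> s \<in> carrier (Sec Sh U)"
  unfolding sh_carrier
proof (intro conjI ballI)
  fix x assume x: "x \<in> U"
  obtain V m where V: "opn V" "x \<in> V" "V \<subseteq> U" "m \<in> carrier (Sec M V)" "\<forall>y\<in>V. s y = grm y V m"
    by (rule sh_local[OF s x U subset_refl])
  have "\<forall>y\<in>V. (r \<odot>\<^bsub>Sec Sh U\<^esub> s) y = grm y V (rr U V r \<odot>\<^bsub>Sec M V\<^esub> m)"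
  proof
    fix y assume y: "y \<in> V"
    show "(r \<odot>\<^bsub>Sec Sh U\<^esub> s) y = grm y V (rr U V r \<odot>\<^bsub>Sec M V\<^esub> m)"
      using germ_smult[OF V(1) y U V(3) r V(4)] V y by (auto simp: subset_iff)
  qed
  then show "\<exists>V k. opn V \<and> x \<in> V \<and> V \<subseteq> U \<and> k \<in> carrier (Sec M V) \<and> (\<forall>y\<in>V. (r \<odot>\<^bsub>Sec Sh U\<^esub> s) y = grm y V k)"
    using V smult_closed[OF V(1) rr_closed[OF U V(1,3) r] V(4)]
    by (intro exI[of _ V] exI[of _ "rr U V r \<odot>\<^bsub>Sec M V\<^esub> m"]) simp
qed simp

lemma sh_zero_closed:
  assumes U: "opn U"
  shows "\<zero>\<^bsub>Sec Sh U\<^esub> \<in> carrier (Sec Sh U)"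
  unfolding sh_carrier using U zero_closed[OF U] by auto

text \<open>Each axiom is an equation between families of germs and is tested at a point
  \<open>x\<close>. Near \<open>x\<close> all sections involved are germs of sections of
  \<open>M\<close> over one open set \<open>V\<close>, and there the equation is the corresponding
  axiom for \<open>M\<close> over \<open>V\<close>.\<close>

lemma sh_module:
  assumes U: "opn U"
  shows "module (Rg X U) (Sec Sh U)"
proof (rule module_intro)
  note C = sh_add_closed[OF U] sh_smult_closed[OF U] sh_zero_closed[OF U]
  interpret R: cring "Rg X U" by (rule rg_cring[OF U])
  show "cring (Rg X U)" by (rule R.cring_axioms)
  show "\<zero>\<^bsub>Sec Sh U\<^esub> \<in> carrier (Sec Sh U)" by (rule C)
  fix s assume s: "s \<in> carrier (Sec Sh U)"
  {
    show "\<zero>\<^bsub>Sec Sh U\<^esub> \<oplus>\<^bsub>Sec Sh U\<^esub> s = s"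
    proof (rule sh_ext)
      fix x assume x: "x \<in> U"
      obtain V m where V: "opn V" "x \<in> V" "V \<subseteq> U" "m \<in> carrier (Sec M V)" "s x = grm x V m"
        by (rule sh_at[OF s x U])
      interpret V: module "Rg X V" "Sec M V" by (rule mods[OF V(1)])
      note EV = x V germ_zero[OF U V(2,1,3)] germ_add[OF V(1,2)] germ_smult[OF V(1,2) U V(3)] rr_closed[OF U V(1,3)]
        rr_one[OF U V(1,3)] rr_add[OF U V(1,3)] rr_mult[OF U V(1,3)] V.smult_l_distr V.smult_r_distr
        V.smult_assoc1 V.M.a_ac
      show "(\<zero>\<^bsub>Sec Sh U\<^esub> \<oplus>\<^bsub>Sec Sh U\<^esub> s) x = s x"
        by (simp add: EV)
    qed (use C s in \<open>auto simp del: sh_simps\<close>)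
    show "\<one>\<^bsub>Rg X U\<^esub> \<odot>\<^bsub>Sec Sh U\<^esub> s = s"
    proof (rule sh_ext)
      fix x assume x: "x \<in> U"
      obtain V m where V: "opn V" "x \<in> V" "V \<subseteq> U" "m \<in> carrier (Sec M V)" "s x = grm x V m"
        by (rule sh_at[OF s x U])
      interpret V: module "Rg X V" "Sec M V" by (rule mods[OF V(1)])
      note EV = x V germ_zero[OF U V(2,1,3)] germ_add[OF V(1,2)] germ_smult[OF V(1,2) U V(3)] rr_closed[OF U V(1,3)]
        rr_one[OF U V(1,3)] rr_add[OF U V(1,3)] rr_mult[OF U V(1,3)] V.smult_l_distr V.smult_r_distr
        V.smult_assoc1 V.M.a_ac
      show "(\<one>\<^bsub>Rg X U\<^esub> \<odot>\<^bsub>Sec Sh U\<^esub> s) x = s x"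
        by (simp add: EV)
    qed (use C s in \<open>auto simp del: sh_simps\<close>)
    show "\<zero>\<^bsub>Rg X U\<^esub> \<odot>\<^bsub>Sec Sh U\<^esub> s = \<zero>\<^bsub>Sec Sh U\<^esub>"
    proof (rule sh_ext)
      fix x assume x: "x \<in> U"
      obtain V m where V: "opn V" "x \<in> V" "V \<subseteq> U" "m \<in> carrier (Sec M V)" "s x = grm x V m"
        by (rule sh_at[OF s x U])
      interpret V: module "Rg X V" "Sec M V" by (rule mods[OF V(1)])
      note EV = x V germ_zero[OF U V(2,1,3)] germ_add[OF V(1,2)] germ_smult[OF V(1,2) U V(3)] rr_closed[OF U V(1,3)]
        rr_one[OF U V(1,3)] rr_add[OF U V(1,3)] rr_mult[OF U V(1,3)] V.smult_l_distr V.smult_r_distr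
        V.smult_assoc1 V.M.a_ac
      interpret h: ring_hom_cring "Rg X U" "Rg X V" "rr U V"
        using rr_hom[OF U V(1,3)] by unfold_locales
      show "(\<zero>\<^bsub>Rg X U\<^esub> \<odot>\<^bsub>Sec Sh U\<^esub> s) x = \<zero>\<^bsub>Sec Sh U\<^esub> x"
        by (simp add: EV)
    qed (use C s in \<open>auto simp del: sh_simps\<close>)
  }
  fix t assume t: "t \<in> carrier (Sec Sh U)"
  {
    show "s \<oplus>\<^bsub>Sec Sh U\<^esub> t \<in> carrier (Sec Sh U)" by (rule C(1)[OF s t])
    show "s \<oplus>\<^bsub>Sec Sh U\<^esub> t = t \<oplus>\<^bsub>Sec Sh U\<^esub> s"
    proof (rule sh_ext)
      fix x assume x: "x \<in> U"
      obtain V m n where V: "opn V" "x \<in> V" "V \<subseteq> U" "m \<in> carrier (Sec M V)" "s x = grm x V m"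
        "n \<in> carrier (Sec M V)" "t x = grm x V n"
        by (rule sh_at2[OF s t x U])
      interpret V: module "Rg X V" "Sec M V" by (rule mods[OF V(1)])
      note EV = x V germ_zero[OF U V(2,1,3)] germ_add[OF V(1,2)] germ_smult[OF V(1,2) U V(3)] rr_closed[OF U V(1,3)]
        rr_one[OF U V(1,3)] rr_add[OF U V(1,3)] rr_mult[OF U V(1,3)] V.smult_l_distr V.smult_r_distr
        V.smult_assoc1 V.M.a_ac
      show "(s \<oplus>\<^bsub>Sec Sh U\<^esub> t) x = (t \<oplus>\<^bsub>Sec Sh U\<^esub> s) x"
        by (simp add: EV)
    qed (use C s t in \<open>auto simp del: sh_simps\<close>)
    show "(s \<oplus>\<^bsub>Sec Sh U\<^esub> t) \<oplus>\<^bsub>Sec Sh U\<^esub> u = s \<oplus>\<^bsub>Sec Sh U\<^esub> (t \<oplus>\<^bsub>Sec Sh U\<^esub> u)"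
      if u: "u \<in> carrier (Sec Sh U)" for u
    proof (rule sh_ext)
      fix x assume x: "x \<in> U"
      obtain V m n k where V: "opn V" "x \<in> V" "V \<subseteq> U" "m \<in> carrier (Sec M V)" "s x = grm x V m"
        "n \<in> carrier (Sec M V)" "t x = grm x V n" "k \<in> carrier (Sec M V)" "u x = grm x V k"
        by (rule sh_at3[OF s t u x U])
      interpret V: module "Rg X V" "Sec M V" by (rule mods[OF V(1)])
      note EV = x V germ_zero[OF U V(2,1,3)] germ_add[OF V(1,2)] germ_smult[OF V(1,2) U V(3)] rr_closed[OF U V(1,3)]
        rr_one[OF U V(1,3)] rr_add[OF U V(1,3)] rr_mult[OF U V(1,3)] V.smult_l_distr V.smult_r_distr
        V.smult_assoc1 V.M.a_ac
      show "((s \<oplus>\<^bsub>Sec Sh U\<^esub> t) \<oplus>\<^bsub>Sec Sh U\<^esub> u) x = (s \<oplus>\<^bsub>Sec Sh U\<^esub> (t \<oplus>\<^bsub>Sec Sh U\<^esub> u)) x"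
        by (simp add: EV)
    qed (use C s t u in \<open>auto simp del: sh_simps\<close>)
  }
  fix r assume r: "r \<in> carrier (Rg X U)"
  {
    show "r \<odot>\<^bsub>Sec Sh U\<^esub> s \<in> carrier (Sec Sh U)" by (rule C(2)[OF r s])
    show "r \<odot>\<^bsub>Sec Sh U\<^esub> (s \<oplus>\<^bsub>Sec Sh U\<^esub> t) = r \<odot>\<^bsub>Sec Sh U\<^esub> s \<oplus>\<^bsub>Sec Sh U\<^esub> r \<odot>\<^bsub>Sec Sh U\<^esub> t"
    proof (rule sh_ext)
      fix x assume x: "x \<in> U"
      obtain V m n where V: "opn V" "x \<in> V" "V \<subseteq> U" "m \<in> carrier (Sec M V)" "s x = grm x V m"
        "n \<in> carrier (Sec M V)" "t x = grm x V n"
        by (rule sh_at2[OF s t x U])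
      interpret V: module "Rg X V" "Sec M V" by (rule mods[OF V(1)])
      note EV = x V germ_zero[OF U V(2,1,3)] germ_add[OF V(1,2)] germ_smult[OF V(1,2) U V(3)] rr_closed[OF U V(1,3)]
        rr_one[OF U V(1,3)] rr_add[OF U V(1,3)] rr_mult[OF U V(1,3)] V.smult_l_distr V.smult_r_distr
        V.smult_assoc1 V.M.a_ac
      note EV = EV r
      show "(r \<odot>\<^bsub>Sec Sh U\<^esub> (s \<oplus>\<^bsub>Sec Sh U\<^esub> t)) x = (r \<odot>\<^bsub>Sec Sh U\<^esub> s \<oplus>\<^bsub>Sec Sh U\<^esub> r \<odot>\<^bsub>Sec Sh U\<^esub> t) x"
        by (simp add: EV)
    qed (use C s t r in \<open>auto simp del: sh_simps\<close>)
  }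
  fix q assume q: "q \<in> carrier (Rg X U)"
  show "(r \<oplus>\<^bsub>Rg X U\<^esub> q) \<odot>\<^bsub>Sec Sh U\<^esub> s = r \<odot>\<^bsub>Sec Sh U\<^esub> s \<oplus>\<^bsub>Sec Sh U\<^esub> q \<odot>\<^bsub>Sec Sh U\<^esub> s"
  proof (rule sh_ext)
    fix x assume x: "x \<in> U"
    obtain V m where V: "opn V" "x \<in> V" "V \<subseteq> U" "m \<in> carrier (Sec M V)" "s x = grm x V m"
      by (rule sh_at[OF s x U])
    interpret V: module "Rg X V" "Sec M V" by (rule mods[OF V(1)])
    note EV = x V germ_zero[OF U V(2,1,3)] germ_add[OF V(1,2)] germ_smult[OF V(1,2) U V(3)] rr_closed[OF U V(1,3)]
      rr_one[OF U V(1,3)] rr_add[OF U V(1,3)] rr_mult[OF U V(1,3)] V.smult_l_distr V.smult_r_distr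
      V.smult_assoc1 V.M.a_ac r q
    show "((r \<oplus>\<^bsub>Rg X U\<^esub> q) \<odot>\<^bsub>Sec Sh U\<^esub> s) x = (r \<odot>\<^bsub>Sec Sh U\<^esub> s \<oplus>\<^bsub>Sec Sh U\<^esub> q \<odot>\<^bsub>Sec Sh U\<^esub> s) x"
      by (simp add: EV)
  qed (use C s r q in \<open>auto simp del: sh_simps\<close>)
  show "(r \<otimes>\<^bsub>Rg X U\<^esub> q) \<odot>\<^bsub>Sec Sh U\<^esub> s = r \<odot>\<^bsub>Sec Sh U\<^esub> (q \<odot>\<^bsub>Sec Sh U\<^esub> s)"
  proof (rule sh_ext)
    fix x assume x: "x \<in> U"
    obtain V m where V: "opn V" "x \<in> V" "V \<subseteq> U" "m \<in> carrier (Sec M V)" "s x = grm x V m"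
      by (rule sh_at[OF s x U])
    interpret V: module "Rg X V" "Sec M V" by (rule mods[OF V(1)])
    note EV = x V germ_zero[OF U V(2,1,3)] germ_add[OF V(1,2)] germ_smult[OF V(1,2) U V(3)] rr_closed[OF U V(1,3)]
      rr_one[OF U V(1,3)] rr_add[OF U V(1,3)] rr_mult[OF U V(1,3)] V.smult_l_distr V.smult_r_distr
      V.smult_assoc1 V.M.a_ac r q
    show "((r \<otimes>\<^bsub>Rg X U\<^esub> q) \<odot>\<^bsub>Sec Sh U\<^esub> s) x = (r \<odot>\<^bsub>Sec Sh U\<^esub> (q \<odot>\<^bsub>Sec Sh U\<^esub> s)) x"
      by (simp add: EV)
  qed (use C s r q in \<open>auto simp del: sh_simps\<close>)
qed

lemma sh_res_closed:
  assumes U: "opn U" "opn V" "V \<subseteq> U" and s: "s \<in> carrier (Sec Sh U)"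
  shows "restrict s V \<in> carrier (Sec Sh V)"
  unfolding sh_carrier
proof (intro conjI ballI)
  fix x assume x: "x \<in> V"
  obtain W m where W: "opn W" "x \<in> W" "W \<subseteq> V" "m \<in> carrier (Sec M W)" "\<forall>y\<in>W. s y = grm y W m"
    by (rule sh_local[OF s x U(2,3)])
  then have "\<forall>y\<in>W. restrict s V y = grm y W m" by auto
  then show "\<exists>W t. opn W \<and> x \<in> W \<and> W \<subseteq> V \<and> t \<in> carrier (Sec M W) \<and> (\<forall>y\<in>W. restrict s V y = grm y W t)"
    using W by blast
qed simp

lemma sh_pmod: "pmod X Sh"
  unfolding pmod_def
proof (intro conjI allI impI)
  show "presheaf (Top X) Sh"
    unfolding presheaf_def
  proof (intro conjI allI impI)
    fix U V assume "opn U \<and> opn V \<and> V \<subseteq> U"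
    then show "Res Sh U V \<in> carrier (Sec Sh U) \<rightarrow> carrier (Sec Sh V)" using sh_res_closed by auto
  next
    fix U s assume "opn U \<and> s \<in> carrier (Sec Sh U)"
    then show "Res Sh U U s = s" by (auto simp: sh_carrier extensional_restrict)
  next
    fix U V W s assume "opn U \<and> opn V \<and> opn W \<and> W \<subseteq> V \<and> V \<subseteq> U \<and> s \<in> carrier (Sec Sh U)"
    then show "Res Sh V W (Res Sh U V s) = Res Sh U W s" by (auto simp: restrict_def fun_eq_iff)
  qed
  show "module (Rg X U) (Sec Sh U)" if "opn U" for U using sh_module that .
  fix U V assume UV: "opn U \<and> opn V \<and> V \<subseteq> U"
  then have U: "opn U" and V: "opn V" "V \<subseteq> U" by auto
  show "semilin (Rg X U) (Sec Sh U) (Sec Sh V) (rr U V) (Res Sh U V)"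
  proof (rule semilinI)
    fix s assume s: "s \<in> carrier (Sec Sh U)"
    show "Res Sh U V s \<in> carrier (Sec Sh V)" using sh_res_closed[OF U V s] by simp
    show "Res Sh U V (s \<oplus>\<^bsub>Sec Sh U\<^esub> t) = Res Sh U V s \<oplus>\<^bsub>Sec Sh V\<^esub> Res Sh U V t" for t
      using V by (auto simp: restrict_def fun_eq_iff)
    fix r assume r: "r \<in> carrier (Rg X U)"
    show "Res Sh U V (r \<odot>\<^bsub>Sec Sh U\<^esub> s) = rr U V r \<odot>\<^bsub>Sec Sh V\<^esub> Res Sh U V s"
    proof (rule sh_ext)
      note sV = sh_res_closed[OF U V s]
      show "Res Sh U V (r \<odot>\<^bsub>Sec Sh U\<^esub> s) \<in> carrier (Sec Sh V)"
        using sh_res_closed[OF U V sh_smult_closed[OF U r s]] by simp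
      show "rr U V r \<odot>\<^bsub>Sec Sh V\<^esub> Res Sh U V s \<in> carrier (Sec Sh V)"
        using sh_smult_closed[OF V(1) rr_closed[OF U V r] sV] by simp
      fix x assume x: "x \<in> V"
      obtain W m where W: "opn W" "x \<in> W" "W \<subseteq> V" "m \<in> carrier (Sec M W)" "\<forall>y\<in>W. s y = grm y W m"
        by (rule sh_local[OF s x V])
      have sx': "s x = grm x W m" using W by auto
      have WU: "W \<subseteq> U" using W V by auto
      have sx: "restrict s V x = grm x W m" using x W by simp
      show "Res Sh U V (r \<odot>\<^bsub>Sec Sh U\<^esub> s) x = (rr U V r \<odot>\<^bsub>Sec Sh V\<^esub> Res Sh U V s) x"
        using x W r sx' germ_smult[OF W(1,2) U WU r W(4)] germ_smult[OF W(1,2) V(1) W(3) rr_closed[OF U V r] W(4)]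
          rr_comp[OF U V(1) W(1,3) V(2) r] V(2) by auto
    qed
  qed
qed

text \<open>Sections are functions on points: compatible ones agree pointwise and define a function
  on the union. To be locally the germ of a section is a local condition, so this function is again
  a section.\<close>

lemma sh_mod_sheaf: "mod_sheaf X Sh"
  unfolding mod_sheaf_iff
proof
  show "pmod X Sh" by (rule sh_pmod)
  show "sheaf (Top X) Sh"
    unfolding sheaf_def
  proof (intro conjI allI impI)
    show "presheaf (Top X) Sh" using sh_pmod by (simp add: pmod_def)
    fix \<U> s
    assume A: "(\<forall>U\<in>\<U>. opn U \<and> s U \<in> carrier (Sec Sh U)) \<and>
       (\<forall>U\<in>\<U>. \<forall>V\<in>\<U>. Res Sh U (U \<inter> V) (s U) = Res Sh V (U \<inter> V) (s V))"
    then have c: "\<And>U. U \<in> \<U> \<Longrightarrow> opn U \<and> s U \<in> carrier (Sec Sh U)" by blast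
    have e: "s U x = s V x" if "U \<in> \<U>" "V \<in> \<U>" "x \<in> U" "x \<in> V" for U V x
    proof -
      have "Res Sh U (U \<inter> V) (s U) = Res Sh V (U \<inter> V) (s V)" using A that by blast
      from fun_cong[OF this, of x] show ?thesis using that by simp
    qed
    \<comment> \<open>At each point a member of the cover containing it is picked; by
      \<open>e\<close> the value does not depend on the pick.\<close>
    define t where "t = (\<lambda>x\<in>\<Union>\<U>. s (SOME U. U \<in> \<U> \<and> x \<in> U) x)"
    have t: "t x = s U x" if "U \<in> \<U>" "x \<in> U" for U x
    proof -
      have "(SOME U. U \<in> \<U> \<and> x \<in> U) \<in> \<U> \<and> x \<in> (SOME U. U \<in> \<U> \<and> x \<in> U)"
        by (rule someI[of "\<lambda>U. U \<in> \<U> \<and> x \<in> U" U]) (use that in auto)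
      then have "s (SOME U. U \<in> \<U> \<and> x \<in> U) x = s U x" using e that by blast
      then show ?thesis using that by (auto simp: t_def)
    qed
    show "\<exists>!t. t \<in> carrier (Sec Sh (\<Union>\<U>)) \<and> (\<forall>U\<in>\<U>. Res Sh (\<Union>\<U>) U t = s U)"
    proof (rule ex1I[of _ t], intro conjI ballI)
      show "t \<in> carrier (Sec Sh (\<Union>\<U>))"
        unfolding sh_carrier
      proof (intro conjI ballI)
        show "t \<in> extensional (\<Union>\<U>)" by (simp add: t_def)
        fix x assume "x \<in> \<Union>\<U>"
        then obtain U where U: "U \<in> \<U>" "x \<in> U" by auto
        obtain V m where V: "opn V" "x \<in> V" "V \<subseteq> U" "m \<in> carrier (Sec M V)" "\<forall>y\<in>V. s U y = grm y V m"
          by (rule sh_local[of "s U" U x U]) (use c[OF U(1)] U in auto)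
        have "\<forall>y\<in>V. t y = grm y V m" using t[OF U(1)] V by auto
        then show "\<exists>V k. opn V \<and> x \<in> V \<and> V \<subseteq> \<Union>\<U> \<and> k \<in> carrier (Sec M V) \<and> (\<forall>y\<in>V. t y = grm y V k)"
          using V U by blast
      qed
      show "Res Sh (\<Union>\<U>) U t = s U" if "U \<in> \<U>" for U
        using c[OF that] t[OF that] by (auto simp: sh_carrier intro!: extensionalityI[of _ U])
      fix t' assume t': "t' \<in> carrier (Sec Sh (\<Union>\<U>)) \<and> (\<forall>U\<in>\<U>. Res Sh (\<Union>\<U>) U t' = s U)"
      show "t' = t"
      proof (rule extensionalityI)
        show "t' \<in> extensional (\<Union>\<U>)" using t' by (simp add: sh_carrier)
        show "t \<in> extensional (\<Union>\<U>)" by (simp add: t_def)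
        fix x assume "x \<in> \<Union>\<U>"
        then obtain U where U: "U \<in> \<U>" "x \<in> U" by auto
        have "restrict t' U = s U" using t' U by simp
        from fun_cong[OF this, of x] have "t' x = s U x" using U by simp
        then show "t' x = t x" using t[OF U] by simp
      qed
    qed
  qed
qed

section \<open>The map from a presheaf to its sheafification\<close>

abbreviation "to_sh \<equiv> to_sheafify X M"

lemma to_sh_hom: "hom_on X TX M Sh to_sh"
  unfolding hom_on_def
proof (intro conjI allI impI ballI)
  fix U assume "opn U \<and> U \<subseteq> TX"
  then have U: "opn U" by auto
  show "lin (Rg X U) (Sec M U) (Sec Sh U) (to_sh U)"
  proof (rule semilinI)
    fix m assume m: "m \<in> carrier (Sec M U)"
    show "to_sh U m \<in> carrier (Sec Sh U)"
      unfolding sh_carrier to_sheafify_def using U m by auto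
    show "to_sh U (m \<oplus>\<^bsub>Sec M U\<^esub> n) = to_sh U m \<oplus>\<^bsub>Sec Sh U\<^esub> to_sh U n" if n: "n \<in> carrier (Sec M U)" for n
      using germ_add[OF U _ m n] by (auto simp: to_sheafify_def restrict_def fun_eq_iff)
    show "to_sh U (r \<odot>\<^bsub>Sec M U\<^esub> m) = r \<odot>\<^bsub>Sec Sh U\<^esub> to_sh U m" if r: "r \<in> carrier (Rg X U)" for r
      using germ_smult[OF U _ U subset_refl r m] rr_id[OF U r] by (auto simp: to_sheafify_def restrict_def fun_eq_iff)
  qed
next
  fix V W m assume "opn V \<and> opn W \<and> W \<subseteq> V \<and> V \<subseteq> TX" "m \<in> carrier (Sec M V)"
  then show "Res Sh V W (to_sh V m) = to_sh W (Res M V W m)"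
    using germ_res[OF pre] by (auto simp: to_sheafify_def restrict_def fun_eq_iff)
qed

lemma to_sh_surj:
  assumes s: "s \<in> carrier (Sec Sh U)" and U: "opn U" "x \<in> U"
  obtains V m where "opn V" "x \<in> V" "V \<subseteq> U" "m \<in> carrier (Sec M V)" "Res Sh U V s = to_sh V m"
proof -
  obtain V m where V: "opn V" "x \<in> V" "V \<subseteq> U" "m \<in> carrier (Sec M V)" "\<forall>y\<in>V. s y = grm y V m"
    by (rule sh_local[OF s U(2,1) subset_refl])
  have "Res Sh U V s = to_sh V m" using V by (auto simp: to_sheafify_def restrict_def fun_eq_iff)
  then show thesis using that V by blast
qed

text \<open>Equal families of germs only give agreement near each point. This and the local
  surjectivity of \<open>to_sh\<close> are what the universal property of sheafification rests
  on.\<close>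

lemma to_sh_inj:
  assumes U: "opn U" "x \<in> U" and m: "m \<in> carrier (Sec M U)" and n: "n \<in> carrier (Sec M U)"
    and eq: "to_sh U m = to_sh U n"
  shows "\<exists>V. opn V \<and> x \<in> V \<and> V \<subseteq> U \<and> Res M U V m = Res M U V n"
proof -
  have "grm x U m = grm x U n" using fun_cong[OF eq, of x] U(2) by (simp add: to_sheafify_def)
  then show ?thesis using germ_eqD[OF pre U(1,1,2,2) m n] by blast
qed

end

lemma hom_on_lin: "hom_on X U M N h \<Longrightarrow> openin (Top X) V \<Longrightarrow> V \<subseteq> U \<Longrightarrow> lin (Rg X V) (Sec M V) (Sec N V) (h V)"
  and hom_on_nat: "hom_on X U M N h \<Longrightarrow> openin (Top X) V \<Longrightarrow> openin (Top X) W \<Longrightarrow> W \<subseteq> V \<Longrightarrow> V \<subseteq> U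
    \<Longrightarrow> m \<in> carrier (Sec M V) \<Longrightarrow> Res N V W (h V m) = h W (Res M V W m)"
  unfolding hom_on_def by blast+

lemmas hom_on_closed = semilin_closed[OF hom_on_lin]
  and hom_on_add = semilin_add[OF hom_on_lin]
  and hom_on_smult = semilin_smult[OF hom_on_lin]

lemma hom_on_subset: "hom_on X U M N h \<Longrightarrow> U' \<subseteq> U \<Longrightarrow> hom_on X U' M N h"
  unfolding hom_on_def by (meson order_trans)

lemma hom_on_top: "hom_on X (topspace (Top X)) M N h \<Longrightarrow> openin (Top X) U \<Longrightarrow> hom_on X U M N h"
  by (rule hom_on_subset) (auto dest: openin_subset)

lemma hom_on_comp:
  assumes h: "hom_on X U M N h" and k: "hom_on X U N P k"
  shows "hom_on X U M P (\<lambda>V m. k V (h V m))"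
  unfolding hom_on_def
proof (intro conjI allI impI ballI)
  fix V assume "openin (Top X) V \<and> V \<subseteq> U"
  then show "lin (Rg X V) (Sec M V) (Sec P V) (\<lambda>m. k V (h V m))"
    using hom_on_lin[OF h] hom_on_lin[OF k] by (auto intro: semilin_comp)
next
  fix V W m assume A: "openin (Top X) V \<and> openin (Top X) W \<and> W \<subseteq> V \<and> V \<subseteq> U" "m \<in> carrier (Sec M V)"
  then show "Res P V W (k V (h V m)) = k W (h W (Res M V W m))"
    using hom_on_nat[OF h, of V W m] hom_on_nat[OF k, of V W "h V m"] hom_on_closed[OF h, of V m] by simp
qed

lemma hom_on_id:
  shows "hom_on X U M M (\<lambda>V m. m)"
  unfolding hom_on_def semilin_def by simp

locale msheaf_space = rspace X for X :: "('x, 'r) ringed" +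
  fixes M :: "('x, 'r, 'm) mod_presheaf"
  assumes mod_sheaf: "mod_sheaf X M"
begin

sublocale pmod_space X M
  using mod_sheaf by unfold_locales (simp add: mod_sheaf_iff)

lemma shf: "sheaf (Top X) M"
  using mod_sheaf by (simp add: mod_sheaf_iff)

lemmas eqI = sheaf_eqI[OF shf] and glue = sheaf_glue[OF shf]

end

section \<open>Universal property of sheafification\<close>

context pmod_space
begin

lemma to_sh_closed: "opn U \<Longrightarrow> m \<in> carrier (Sec M U) \<Longrightarrow> to_sh U m \<in> carrier (Sec Sh U)"
  and to_sh_add: "opn U \<Longrightarrow> m \<in> carrier (Sec M U) \<Longrightarrow> n \<in> carrier (Sec M U)
    \<Longrightarrow> to_sh U (m \<oplus>\<^bsub>Sec M U\<^esub> n) = to_sh U m \<oplus>\<^bsub>Sec Sh U\<^esub> to_sh U n"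
  and to_sh_smult: "opn U \<Longrightarrow> r \<in> carrier (Rg X U) \<Longrightarrow> m \<in> carrier (Sec M U)
    \<Longrightarrow> to_sh U (r \<odot>\<^bsub>Sec M U\<^esub> m) = r \<odot>\<^bsub>Sec Sh U\<^esub> to_sh U m"
  and to_sh_res: "opn U \<Longrightarrow> opn V \<Longrightarrow> V \<subseteq> U \<Longrightarrow> m \<in> carrier (Sec M U)
    \<Longrightarrow> Res Sh U V (to_sh U m) = to_sh V (Res M U V m)"
  by (rule hom_on_closed[OF to_sh_hom] hom_on_add[OF to_sh_hom] hom_on_smult[OF to_sh_hom] hom_on_nat[OF to_sh_hom];
      (assumption | erule openin_subset))+

lemma to_sh_surj2:
  assumes s: "s \<in> carrier (Sec Sh U)" and t: "t \<in> carrier (Sec Sh U)" and U: "opn U" "x \<in> U"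
  obtains V m n where "opn V" "x \<in> V" "V \<subseteq> U" "m \<in> carrier (Sec M V)" "Res Sh U V s = to_sh V m"
    "n \<in> carrier (Sec M V)" "Res Sh U V t = to_sh V n"
proof -
  interpret S: pmod_space X Sh by unfold_locales (rule sh_pmod)
  obtain A m where A: "opn A" "x \<in> A" "A \<subseteq> U" "m \<in> carrier (Sec M A)" "Res Sh U A s = to_sh A m"
    by (rule to_sh_surj[OF s U])
  obtain V n where V: "opn V" "x \<in> V" "V \<subseteq> A" "n \<in> carrier (Sec M V)" "Res Sh A V (Res Sh U A t) = to_sh V n"
    by (rule to_sh_surj[OF S.res_closed[OF U(1) A(1,3) t] A(1,2)])
  show thesis
  proof (rule that[OF V(1,2)])
    show "V \<subseteq> U" using A V by blast
    show "Res M A V m \<in> carrier (Sec M V)" by (rule res_closed[OF A(1) V(1,3) A(4)])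
    show "Res Sh U V s = to_sh V (Res M A V m)"
      using S.res_comp[OF U(1) A(1) V(1,3) A(3) s] A(5) to_sh_res[OF A(1) V(1,3) A(4)] by (simp del: sh_simps)
    show "n \<in> carrier (Sec M V)" by (rule V(4))
    show "Res Sh U V t = to_sh V n"
      using S.res_comp[OF U(1) A(1) V(1,3) A(3) t] V(5) by (simp del: sh_simps)
  qed
qed

text \<open>A section of the sheafification is locally \<open>to_sh m\<close>; the sections
  \<open>f m\<close> are glued in the sheaf \<open>P\<close>. Linearity and naturality of the result
  are then checked locally, where they are those of \<open>f\<close>.\<close>

lemma sh_lift:
  fixes P :: "('x, 'r, 'p) mod_presheaf"
  assumes U0: "opn U0" and P: "mod_sheaf X P" and f: "hom_on X U0 M P f"
  shows "\<exists>h. hom_on X U0 Sh P h \<and>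
    (\<forall>V m. opn V \<and> V \<subseteq> U0 \<and> m \<in> carrier (Sec M V) \<longrightarrow> h V (to_sh V m) = f V m)"
proof -
  interpret P: msheaf_space X P by unfold_locales (rule P)
  interpret S: pmod_space X Sh by unfold_locales (rule sh_pmod)
  \<comment> \<open>\<open>C V s W p\<close> says that \<open>p\<close> is an admissible value over
    \<open>W\<close> for the image of \<open>s\<close>; it is the predicate to which the gluing
    lemma is applied.\<close>
  define C where "C V s W p \<longleftrightarrow> (\<exists>m\<in>carrier (Sec M W). Res Sh V W s = to_sh W m \<and> p = f W m)" for V s W p
  \<comment> \<open>\<open>to_sh\<close> need not be injective, but sections with the same image
    agree locally, and the target is separated. Hence admissible values are unique.\<close>
  have f_eq: "f W m = f W n" if W: "opn W" "W \<subseteq> U0" and mn: "m \<in> carrier (Sec M W)" "n \<in> carrier (Sec M W)"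
    and eq: "to_sh W m = to_sh W n" for W m n
  proof (rule P.eqI[OF W(1)])
    show "f W m \<in> carrier (Sec P W)" "f W n \<in> carrier (Sec P W)"
      using hom_on_closed[OF f W] mn by auto
    fix x assume x: "x \<in> W"
    obtain V where V: "opn V" "x \<in> V" "V \<subseteq> W" "Res M W V m = Res M W V n"
      using to_sh_inj[OF W(1) x mn eq] by blast
    then have "Res P W V (f W m) = Res P W V (f W n)"
      using hom_on_nat[OF f W(1) V(1,3) W(2) mn(1)] hom_on_nat[OF f W(1) V(1,3) W(2) mn(2)] by simp
    then show "\<exists>V. opn V \<and> x \<in> V \<and> V \<subseteq> W \<and> Res P W V (f W m) = Res P W V (f W n)"
      using V by blast
  qed
  have ex: "\<exists>t\<in>carrier (Sec P V). \<forall>W p. opn W \<and> W \<subseteq> V \<and> C V s W p \<longrightarrow> Res P V W t = p"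
    if V: "opn V" "V \<subseteq> U0" and s: "s \<in> carrier (Sec Sh V)" for V s
  proof (rule P.glue[OF V(1)])
    fix W p assume W: "opn W" "W \<subseteq> V" and c: "C V s W p"
    have WU: "W \<subseteq> U0" using W V by auto
    obtain m where m: "m \<in> carrier (Sec M W)" "Res Sh V W s = to_sh W m" "p = f W m" using c by (auto simp: C_def)
    show "p \<in> carrier (Sec P W)" using hom_on_closed[OF f W(1) WU] m by simp
    show "C V s A (Res P W A p)" if A: "opn A" "A \<subseteq> W" for A
      unfolding C_def
    proof (intro bexI[of _ "Res M W A m"] conjI)
      show "Res Sh V A s = to_sh A (Res M W A m)"
        using S.res_comp[OF V(1) W(1) A W(2) s] m(2) to_sh_res[OF W(1) A m(1)] by (simp del: sh_simps)
      show "Res P W A p = f A (Res M W A m)" using hom_on_nat[OF f W(1) A WU m(1)] m(3) by simp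
    qed (rule res_closed[OF W(1) A m(1)])
    fix q assume "C V s W q"
    then obtain n where n: "n \<in> carrier (Sec M W)" "Res Sh V W s = to_sh W n" "q = f W n" by (auto simp: C_def)
    then have "to_sh W m = to_sh W n" using m(2) by (simp del: sh_simps)
    then show "p = q" using f_eq[OF W(1) WU m(1) n(1)] m(3) n(3) by simp
  next
    fix x assume x: "x \<in> V"
    obtain W m where W: "opn W" "x \<in> W" "W \<subseteq> V" "m \<in> carrier (Sec M W)" "Res Sh V W s = to_sh W m"
      by (rule to_sh_surj[OF s V(1) x])
    then have "C V s W (f W m)" unfolding C_def by (intro bexI[of _ m]) (simp_all del: sh_simps)
    then show "\<exists>W p. opn W \<and> x \<in> W \<and> W \<subseteq> V \<and> C V s W p" using W(1-3) by blast
  qed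
  define h where "h V s = (SOME t. t \<in> carrier (Sec P V) \<and> (\<forall>W p. opn W \<and> W \<subseteq> V \<and> C V s W p \<longrightarrow> Res P V W t = p))" for V s
  have "h V s \<in> carrier (Sec P V) \<and> (\<forall>W p. opn W \<and> W \<subseteq> V \<and> C V s W p \<longrightarrow> Res P V W (h V s) = p)"
    if V: "opn V" "V \<subseteq> U0" and s: "s \<in> carrier (Sec Sh V)" for V s
    unfolding h_def by (rule someI_ex) (use ex[OF V s] in blast)
  then have h_car: "opn V \<Longrightarrow> V \<subseteq> U0 \<Longrightarrow> s \<in> carrier (Sec Sh V) \<Longrightarrow> h V s \<in> carrier (Sec P V)"
    and h_res: "opn V \<Longrightarrow> V \<subseteq> U0 \<Longrightarrow> s \<in> carrier (Sec Sh V) \<Longrightarrow> opn W \<Longrightarrow> W \<subseteq> V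
      \<Longrightarrow> m \<in> carrier (Sec M W) \<Longrightarrow> Res Sh V W s = to_sh W m \<Longrightarrow> Res P V W (h V s) = f W m" for V W s m
    unfolding C_def by blast+
  have "hom_on X U0 Sh P h"
    unfolding hom_on_def
  proof (intro conjI allI impI ballI)
    fix V assume "opn V \<and> V \<subseteq> U0"
    then have V: "opn V" "V \<subseteq> U0" by auto
    show "lin (Rg X V) (Sec Sh V) (Sec P V) (h V)"
    proof (rule semilinI)
      show "h V s \<in> carrier (Sec P V)" if "s \<in> carrier (Sec Sh V)" for s by (rule h_car[OF V that])
    next
      fix s t assume s: "s \<in> carrier (Sec Sh V)" and t: "t \<in> carrier (Sec Sh V)"
      note st = S.add_closed[OF V(1) s t]
      show "h V (s \<oplus>\<^bsub>Sec Sh V\<^esub> t) = h V s \<oplus>\<^bsub>Sec P V\<^esub> h V t"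
      proof (rule P.eqI[OF V(1) h_car[OF V st] P.add_closed[OF V(1) h_car[OF V s] h_car[OF V t]]])
        fix x assume x: "x \<in> V"
        obtain W m n where W: "opn W" "x \<in> W" "W \<subseteq> V" "m \<in> carrier (Sec M W)" "Res Sh V W s = to_sh W m"
          "n \<in> carrier (Sec M W)" "Res Sh V W t = to_sh W n"
          by (rule to_sh_surj2[OF s t V(1) x])
        have WU: "W \<subseteq> U0" using W V by auto
        have "Res Sh V W (s \<oplus>\<^bsub>Sec Sh V\<^esub> t) = to_sh W (m \<oplus>\<^bsub>Sec M W\<^esub> n)"
          using S.res_add[OF V(1) W(1,3) s t] W to_sh_add[OF W(1,4,6)] by (simp del: sh_simps)
        from h_res[OF V st W(1,3) add_closed[OF W(1,4,6)] this] have "Res P V W (h V (s \<oplus>\<^bsub>Sec Sh V\<^esub> t)) = Res P V W (h V s \<oplus>\<^bsub>Sec P V\<^esub> h V t)"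
          using h_res[OF V s W(1,3,4,5)] h_res[OF V t W(1,3,6,7)] hom_on_add[OF f W(1) WU W(4,6)]
            P.res_add[OF V(1) W(1,3) h_car[OF V s] h_car[OF V t]] by simp
        then show "\<exists>W. opn W \<and> x \<in> W \<and> W \<subseteq> V \<and>
            Res P V W (h V (s \<oplus>\<^bsub>Sec Sh V\<^esub> t)) = Res P V W (h V s \<oplus>\<^bsub>Sec P V\<^esub> h V t)"
          using W(1-3) by blast
      qed
    next
      fix r s assume r: "r \<in> carrier (Rg X V)" and s: "s \<in> carrier (Sec Sh V)"
      note rs = S.smult_closed[OF V(1) r s]
      show "h V (r \<odot>\<^bsub>Sec Sh V\<^esub> s) = r \<odot>\<^bsub>Sec P V\<^esub> h V s"
      proof (rule P.eqI[OF V(1) h_car[OF V rs] P.smult_closed[OF V(1) r h_car[OF V s]]])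
        fix x assume x: "x \<in> V"
        obtain W m where W: "opn W" "x \<in> W" "W \<subseteq> V" "m \<in> carrier (Sec M W)" "Res Sh V W s = to_sh W m"
          by (rule to_sh_surj[OF s V(1) x])
        have WU: "W \<subseteq> U0" using W V by auto
        note r' = rr_closed[OF V(1) W(1,3) r]
        have "Res Sh V W (r \<odot>\<^bsub>Sec Sh V\<^esub> s) = to_sh W (rr V W r \<odot>\<^bsub>Sec M W\<^esub> m)"
          using S.res_smult[OF V(1) W(1,3) r s] W to_sh_smult[OF W(1) r' W(4)] by (simp del: sh_simps)
        from h_res[OF V rs W(1,3) smult_closed[OF W(1) r' W(4)] this] have "Res P V W (h V (r \<odot>\<^bsub>Sec Sh V\<^esub> s)) = Res P V W (r \<odot>\<^bsub>Sec P V\<^esub> h V s)"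
          using h_res[OF V s W(1,3,4,5)] hom_on_smult[OF f W(1) WU r' W(4)]
            P.res_smult[OF V(1) W(1,3) r h_car[OF V s]] by simp
        then show "\<exists>W. opn W \<and> x \<in> W \<and> W \<subseteq> V \<and>
            Res P V W (h V (r \<odot>\<^bsub>Sec Sh V\<^esub> s)) = Res P V W (r \<odot>\<^bsub>Sec P V\<^esub> h V s)"
          using W(1-3) by blast
      qed
    qed
  next
    fix V A s assume "opn V \<and> opn A \<and> A \<subseteq> V \<and> V \<subseteq> U0" and s: "s \<in> carrier (Sec Sh V)"
    then have V: "opn V" "V \<subseteq> U0" and A: "opn A" "A \<subseteq> V" "A \<subseteq> U0" by auto
    note sA = S.res_closed[OF V(1) A(1,2) s]
    show "Res P V A (h V s) = h A (Res Sh V A s)"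
    proof (rule P.eqI[OF A(1) P.res_closed[OF V(1) A(1,2) h_car[OF V s]] h_car[OF A(1,3) sA]])
      fix x assume x: "x \<in> A"
      obtain W m where W: "opn W" "x \<in> W" "W \<subseteq> A" "m \<in> carrier (Sec M W)" "Res Sh A W (Res Sh V A s) = to_sh W m"
        by (rule to_sh_surj[OF sA A(1) x])
      have WV: "W \<subseteq> V" using W A by auto
      have sW: "Res Sh V W s = to_sh W m" using S.res_comp[OF V(1) A(1) W(1,3) A(2) s] W(5) by (simp del: sh_simps)
      have "Res P A W (Res P V A (h V s)) = Res P A W (h A (Res Sh V A s))"
        using h_res[OF V s W(1) WV W(4) sW] h_res[OF A(1,3) sA W(1,3,4,5)]
          P.res_comp[OF V(1) A(1) W(1,3) A(2) h_car[OF V s]] by simp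
      then show "\<exists>W. opn W \<and> x \<in> W \<and> W \<subseteq> A \<and> Res P A W (Res P V A (h V s)) = Res P A W (h A (Res Sh V A s))"
        using W(1-3) by blast
    qed
  qed
  moreover have "h V (to_sh V m) = f V m" if V: "opn V" "V \<subseteq> U0" and m: "m \<in> carrier (Sec M V)" for V m
  proof -
    note c = to_sh_closed[OF V(1) m]
    have "Res P V V (h V (to_sh V m)) = f V m"
      by (rule h_res[OF V c V(1) subset_refl m S.res_id[OF V(1) c]])
    then show ?thesis using P.res_id[OF V(1) h_car[OF V c]] by simp
  qed
  ultimately show ?thesis by blast
qed

end

subsection \<open>Quotient sheaves\<close>

text \<open>\<open>I\<close> is a family of submodules stable under restriction, as modules of
  relations are. Besides presheaves of free modules, \<open>M\<close> will also be the sheaf of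
  differentials itself, which gives the coefficient sheaf of the theorem.\<close>

locale quot_space = pmod_space X M for X :: "('x, 'r) ringed" and M :: "('x, 'r, 'm) mod_presheaf" +
  fixes I :: "'x set \<Rightarrow> 'm set"
  assumes I_sub: "opn U \<Longrightarrow> submodule (I U) (Rg X U) (Sec M U)"
    and I_res: "opn U \<Longrightarrow> opn V \<Longrightarrow> V \<subseteq> U \<Longrightarrow> m \<in> I U \<Longrightarrow> Res M U V m \<in> I V"
begin

abbreviation "QP \<equiv> quot_presheaf M I"
abbreviation "QS \<equiv> quot_sheaf X M I"
abbreviation "qmap \<equiv> quot_map X M I"
abbreviation cls where "cls U m \<equiv> I U +>\<^bsub>Sec M U\<^esub> m"

lemma QM: "opn U \<Longrightarrow> quot_module (Rg X U) (Sec M U) (I U)"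
  by (simp add: quot_module_def quot_module_axioms_def mods I_sub)

lemma QP_sec: "Sec QP U = quot_mod (Sec M U) (I U)"
  by (simp add: quot_presheaf_def)

lemma QP_res_cls:
  assumes o: "opn U" "opn V" "V \<subseteq> U" and m: "m \<in> carrier (Sec M U)"
  shows "Res QP U V (cls U m) = cls V (Res M U V m)"
proof -
  interpret U: quot_module "Rg X U" "Sec M U" "I U" by (rule QM[OF o(1)])
  interpret V: quot_module "Rg X V" "Sec M V" "I V" by (rule QM[OF o(2)])
  have "(\<Union>n\<in>cls U m. cls V (Res M U V n)) = cls V (Res M U V m)"
  proof (rule U.cls_Union[OF m])
    fix n assume n: "n \<in> carrier (Sec M U)" "cls U n = cls U m"
    then have "n \<ominus>\<^bsub>Sec M U\<^esub> m \<in> I U" using U.cls_eq m by blast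
    then have "Res M U V (n \<ominus>\<^bsub>Sec M U\<^esub> m) \<in> I V" by (rule I_res[OF o])
    then show "cls V (Res M U V n) = cls V (Res M U V m)"
      using V.cls_eq[OF res_closed[OF o n(1)] res_closed[OF o m]] res_diff[OF o n(1) m] by simp
  qed
  then show ?thesis by (simp add: quot_presheaf_def)
qed

lemma QP_cases:
  assumes U: "opn U" and A: "A \<in> carrier (Sec QP U)"
  obtains m where "m \<in> carrier (Sec M U)" "A = cls U m"
  using quot_module.cls_cases[OF QM[OF U]] A unfolding QP_sec by blast

lemma cls_hom: "hom_on X TX M QP cls"
  unfolding hom_on_def
proof (intro conjI allI impI ballI)
  show "lin (Rg X V) (Sec M V) (Sec QP V) (cls V)" if "opn V \<and> V \<subseteq> TX" for V
    using quot_module.cls_lin[OF QM] that by (simp add: QP_sec)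
qed (use QP_res_cls in auto)

lemma cls_closed: "opn U \<Longrightarrow> m \<in> carrier (Sec M U) \<Longrightarrow> cls U m \<in> carrier (Sec QP U)"
  using quot_module.cls_closed[OF QM] by (simp add: QP_sec)

lemma QP_pmod: "pmod X QP"
  unfolding pmod_def
proof (intro conjI allI impI)
  show "presheaf (Top X) QP"
    unfolding presheaf_def
  proof (intro conjI allI impI)
    fix U V assume "opn U \<and> opn V \<and> V \<subseteq> U"
    then have o: "opn U" "opn V" "V \<subseteq> U" by auto
    show "Res QP U V \<in> carrier (Sec QP U) \<rightarrow> carrier (Sec QP V)"
    proof
      fix A assume "A \<in> carrier (Sec QP U)"
      then obtain m where m: "m \<in> carrier (Sec M U)" "A = cls U m" by (rule QP_cases[OF o(1)])
      show "Res QP U V A \<in> carrier (Sec QP V)"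
        unfolding m(2) QP_res_cls[OF o m(1)] by (rule cls_closed[OF o(2) res_closed[OF o m(1)]])
    qed
  next
    fix U A assume UA: "opn U \<and> A \<in> carrier (Sec QP U)"
    then have U: "opn U" by simp
    obtain m where m: "m \<in> carrier (Sec M U)" "A = cls U m" using QP_cases[OF U] UA by blast
    show "Res QP U U A = A"
      unfolding m(2) QP_res_cls[OF U U subset_refl m(1)] res_id[OF U m(1)] ..
  next
    fix U V W A assume UA: "opn U \<and> opn V \<and> opn W \<and> W \<subseteq> V \<and> V \<subseteq> U \<and> A \<in> carrier (Sec QP U)"
    then have o: "opn U" "opn V" "V \<subseteq> U" "opn W" "W \<subseteq> V" "W \<subseteq> U" by auto
    obtain m where m: "m \<in> carrier (Sec M U)" "A = cls U m" using QP_cases[OF o(1)] UA by blast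
    show "Res QP V W (Res QP U V A) = Res QP U W A"
      unfolding m(2) QP_res_cls[OF o(1-3) m(1)] QP_res_cls[OF o(2,4,5) res_closed[OF o(1-3) m(1)]]
        QP_res_cls[OF o(1,4,6) m(1)] res_comp[OF o(1,2,4,5,3) m(1)] ..
  qed
  show "module (Rg X U) (Sec QP U)" if "opn U" for U
    using quot_module.quot_is_module[OF QM[OF that]] by (simp add: QP_sec)
  fix U V assume "opn U \<and> opn V \<and> V \<subseteq> U"
  then have o: "opn U" "opn V" "V \<subseteq> U" by auto
  interpret U: quot_module "Rg X U" "Sec M U" "I U" by (rule QM[OF o(1)])
  interpret V: quot_module "Rg X V" "Sec M V" "I V" by (rule QM[OF o(2)])
  show "semilin (Rg X U) (Sec QP U) (Sec QP V) (rr U V) (Res QP U V)"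
  proof (rule semilinI)
    fix A assume "A \<in> carrier (Sec QP U)"
    then obtain m where m: "m \<in> carrier (Sec M U)" "A = cls U m" by (rule QP_cases[OF o(1)])
    note m' = res_closed[OF o m(1)]
    show "Res QP U V A \<in> carrier (Sec QP V)"
      unfolding m(2) QP_res_cls[OF o m(1)] by (rule cls_closed[OF o(2) m'])
    show "Res QP U V (r \<odot>\<^bsub>Sec QP U\<^esub> A) = rr U V r \<odot>\<^bsub>Sec QP V\<^esub> Res QP U V A" if r: "r \<in> carrier (Rg X U)" for r
      unfolding m(2) QP_res_cls[OF o m(1)] unfolding QP_sec U.quot_smult[OF r m(1)]
        V.quot_smult[OF rr_closed[OF o r] m'] QP_res_cls[OF o smult_closed[OF o(1) r m(1)]] res_smult[OF o r m(1)] ..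
    fix B assume "B \<in> carrier (Sec QP U)"
    then obtain n where n: "n \<in> carrier (Sec M U)" "B = cls U n" by (rule QP_cases[OF o(1)])
    show "Res QP U V (A \<oplus>\<^bsub>Sec QP U\<^esub> B) = Res QP U V A \<oplus>\<^bsub>Sec QP V\<^esub> Res QP U V B"
      unfolding m(2) n(2) QP_res_cls[OF o m(1)] QP_res_cls[OF o n(1)] unfolding QP_sec U.quot_add[OF m(1) n(1)]
        V.quot_add[OF m' res_closed[OF o n(1)]] QP_res_cls[OF o add_closed[OF o(1) m(1) n(1)]] res_add[OF o m(1) n(1)] ..
  qed
qed

lemma QP_space: "pmod_space X QP"
  by unfold_locales (rule QP_pmod)

lemma qmap_eq: "qmap U m = to_sheafify X QP U (cls U m)"
  by (simp add: quot_map_def)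

lemma qs_mod_sheaf: "mod_sheaf X QS"
  unfolding quot_sheaf_def by (rule pmod_space.sh_mod_sheaf[OF QP_space])

lemma qs_space: "msheaf_space X QS"
  by unfold_locales (rule qs_mod_sheaf)

lemma qmap_hom: "hom_on X TX M QS qmap"
  unfolding qmap_eq[abs_def] quot_sheaf_def
  by (rule hom_on_comp[OF cls_hom pmod_space.to_sh_hom[OF QP_space]])

lemma qmap_closed: "opn U \<Longrightarrow> m \<in> carrier (Sec M U) \<Longrightarrow> qmap U m \<in> carrier (Sec QS U)"
  and qmap_add: "opn U \<Longrightarrow> m \<in> carrier (Sec M U) \<Longrightarrow> n \<in> carrier (Sec M U)
    \<Longrightarrow> qmap U (m \<oplus>\<^bsub>Sec M U\<^esub> n) = qmap U m \<oplus>\<^bsub>Sec QS U\<^esub> qmap U n"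
  and qmap_smult: "opn U \<Longrightarrow> r \<in> carrier (Rg X U) \<Longrightarrow> m \<in> carrier (Sec M U)
    \<Longrightarrow> qmap U (r \<odot>\<^bsub>Sec M U\<^esub> m) = r \<odot>\<^bsub>Sec QS U\<^esub> qmap U m"
  and qmap_res: "opn U \<Longrightarrow> opn V \<Longrightarrow> V \<subseteq> U \<Longrightarrow> m \<in> carrier (Sec M U)
    \<Longrightarrow> Res QS U V (qmap U m) = qmap V (Res M U V m)"
  by (rule hom_on_closed[OF qmap_hom] hom_on_add[OF qmap_hom] hom_on_smult[OF qmap_hom] hom_on_nat[OF qmap_hom];
      (assumption | erule openin_subset))+

lemma qmap_eqI:
  assumes "opn U" "m \<in> carrier (Sec M U)" "n \<in> carrier (Sec M U)" "m \<ominus>\<^bsub>Sec M U\<^esub> n \<in> I U"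
  shows "qmap U m = qmap U n"
  using quot_module.cls_eq[OF QM[OF assms(1)] assms(2,3)] assms(4) by (simp add: qmap_eq)

lemma qmap_surj:
  assumes s: "s \<in> carrier (Sec QS U)" and U: "opn U" "x \<in> U"
  obtains V m where "opn V" "x \<in> V" "V \<subseteq> U" "m \<in> carrier (Sec M V)" "Res QS U V s = qmap V m"
proof -
  obtain V A where V: "opn V" "x \<in> V" "V \<subseteq> U" "A \<in> carrier (Sec QP V)" "Res QS U V s = to_sheafify X QP V A"
    using pmod_space.to_sh_surj[OF QP_space s[unfolded quot_sheaf_def] U] unfolding quot_sheaf_def by blast
  obtain m where "m \<in> carrier (Sec M V)" "A = cls V m" by (rule QP_cases[OF V(1,4)])
  then show thesis using that V by (simp add: qmap_eq)
qed

text \<open>Two universal properties in succession: that of the quotient module over each open set,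
  and that of sheafification. The intermediate maps \<open>g\<close> commute with restriction
  because every element of the quotient presheaf is the class of a section of
  \<open>M\<close>.\<close>

lemma qs_lift:
  fixes P :: "('x, 'r, 'p) mod_presheaf"
  assumes U0: "opn U0" and P: "mod_sheaf X P" and f: "hom_on X U0 M P f"
    and k: "\<And>V m. opn V \<Longrightarrow> V \<subseteq> U0 \<Longrightarrow> m \<in> I V \<Longrightarrow> f V m = \<zero>\<^bsub>Sec P V\<^esub>"
  shows "\<exists>h. hom_on X U0 QS P h \<and>
    (\<forall>V m. opn V \<and> V \<subseteq> U0 \<and> m \<in> carrier (Sec M V) \<longrightarrow> h V (qmap V m) = f V m)"
proof -
  interpret P: msheaf_space X P by unfold_locales (rule P)
  have "\<exists>g. lin (Rg X V) (Sec QP V) (Sec P V) g \<and> (\<forall>m\<in>carrier (Sec M V). g (cls V m) = f V m)"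
    if V: "opn V" "V \<subseteq> U0" for V
    unfolding QP_sec by (rule quot_module.quot_lift[OF QM[OF V(1)] hom_on_lin[OF f V] P.mods[OF V(1)] k[OF V]])
  then obtain g where g: "\<And>V. opn V \<Longrightarrow> V \<subseteq> U0 \<Longrightarrow> lin (Rg X V) (Sec QP V) (Sec P V) (g V)"
    "\<And>V m. opn V \<Longrightarrow> V \<subseteq> U0 \<Longrightarrow> m \<in> carrier (Sec M V) \<Longrightarrow> g V (cls V m) = f V m"
    by metis
  have "hom_on X U0 QP P g"
    unfolding hom_on_def
  proof (intro conjI allI impI ballI)
    fix V W A assume o: "opn V \<and> opn W \<and> W \<subseteq> V \<and> V \<subseteq> U0" and A: "A \<in> carrier (Sec QP V)"
    then have o: "opn V" "opn W" "W \<subseteq> V" "V \<subseteq> U0" "W \<subseteq> U0" by auto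
    obtain m where m: "m \<in> carrier (Sec M V)" "A = cls V m" by (rule QP_cases[OF o(1) A])
    show "Res P V W (g V A) = g W (Res QP V W A)"
      unfolding m(2) QP_res_cls[OF o(1-3) m(1)] g(2)[OF o(1,4) m(1)] g(2)[OF o(2,5) res_closed[OF o(1-3) m(1)]]
      by (rule hom_on_nat[OF f o(1-4) m(1)])
  qed (use g in auto)
  from pmod_space.sh_lift[OF QP_space U0 P this]
  obtain h where h: "hom_on X U0 QS P h"
    "\<And>V A. opn V \<Longrightarrow> V \<subseteq> U0 \<Longrightarrow> A \<in> carrier (Sec QP V) \<Longrightarrow> h V (to_sheafify X QP V A) = g V A"
    unfolding quot_sheaf_def by blast
  have "h V (qmap V m) = f V m" if "opn V" "V \<subseteq> U0" "m \<in> carrier (Sec M V)" for V m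
    unfolding qmap_eq using h(2)[OF that(1,2) cls_closed[OF that(1,3)]] g(2)[OF that] by simp
  then show ?thesis using h(1) by blast
qed

text \<open>\<open>qmap\<close> is surjective only locally, so agreement on classes shows that
  \<open>h s\<close> and \<open>k s\<close> agree on a cover; \<open>P\<close> being a sheaf, they
  are equal.\<close>

lemma qs_unique:
  fixes P :: "('x, 'r, 'p) mod_presheaf"
  assumes U: "opn U" and P: "mod_sheaf X P" and h: "hom_on X U QS P h" and k: "hom_on X U QS P k"
    and eq: "\<And>V m. opn V \<Longrightarrow> V \<subseteq> U \<Longrightarrow> m \<in> carrier (Sec M V) \<Longrightarrow> h V (qmap V m) = k V (qmap V m)"
    and s: "s \<in> carrier (Sec QS U)"
  shows "h U s = k U s"
proof -
  interpret P: msheaf_space X P by unfold_locales (rule P)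
  show ?thesis
  proof (rule P.eqI[OF U hom_on_closed[OF h U subset_refl s] hom_on_closed[OF k U subset_refl s]])
    fix x assume x: "x \<in> U"
    obtain V m where V: "opn V" "x \<in> V" "V \<subseteq> U" "m \<in> carrier (Sec M V)" "Res QS U V s = qmap V m"
      by (rule qmap_surj[OF s U x])
    have "Res P U V (h U s) = Res P U V (k U s)"
      using hom_on_nat[OF h U V(1,3) subset_refl s] hom_on_nat[OF k U V(1,3) subset_refl s] V(5) eq[OF V(1,3,4)] by simp
    then show "\<exists>V. opn V \<and> x \<in> V \<and> V \<subseteq> U \<and> Res P U V (h U s) = Res P U V (k U s)" using V by blast
  qed
qed

end

section \<open>Sheaves given by generators and relations\<close>

lemma zero_submodule:
  fixes R :: "'r ring" and M :: "('r, 'm) module"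
  assumes "module R M"
  shows "submodule {\<zero>\<^bsub>M\<^esub>} R M"
proof -
  interpret module R M by fact
  show ?thesis by (rule submoduleI) auto
qed

lemma module_zero_diff:
  fixes R :: "'r ring" and M :: "('r, 'm) module"
  assumes "module R M" "x \<in> carrier M"
  shows "x \<ominus>\<^bsub>M\<^esub> x = \<zero>\<^bsub>M\<^esub>"
proof -
  interpret module R M by fact
  show ?thesis using assms(2) by (simp add: a_minus_def M.r_neg)
qed

definition free_presheaf ::
  "('x, 'r) ringed \<Rightarrow> ('x set \<Rightarrow> 'a set) \<Rightarrow> ('x set \<Rightarrow> 'x set \<Rightarrow> 'a \<Rightarrow> 'a) \<Rightarrow> ('x, 'r, 'a \<Rightarrow> 'r) mod_presheaf" where
  "free_presheaf X S g = \<lparr>Sec = \<lambda>U. free_module (Rg X U) (S U),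
     Res = \<lambda>U V. free_map (Rg X U) (Rg X V) (Res (Str X) U V) (g U V)\<rparr>"

lemma free_presheaf_simps [simp]:
  "Sec (free_presheaf X S g) U = free_module (Rg X U) (S U)"
  "Res (free_presheaf X S g) U V = free_map (Rg X U) (Rg X V) (Res (Str X) U V) (g U V)"
  by (simp_all add: free_presheaf_def)

locale free_space = rspace X for X :: "('x, 'r) ringed" +
  fixes S :: "'x set \<Rightarrow> 'a set" and g :: "'x set \<Rightarrow> 'x set \<Rightarrow> 'a \<Rightarrow> 'a"
  assumes g_closed: "opn U \<Longrightarrow> opn V \<Longrightarrow> V \<subseteq> U \<Longrightarrow> a \<in> S U \<Longrightarrow> g U V a \<in> S V"
    and g_id: "opn U \<Longrightarrow> a \<in> S U \<Longrightarrow> g U U a = a"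
    and g_comp: "opn U \<Longrightarrow> opn V \<Longrightarrow> opn W \<Longrightarrow> W \<subseteq> V \<Longrightarrow> V \<subseteq> U \<Longrightarrow> a \<in> S U \<Longrightarrow> g V W (g U V a) = g U W a"
begin

abbreviation "FP \<equiv> free_presheaf X S g"

lemma FM: "opn U \<Longrightarrow> opn V \<Longrightarrow> V \<subseteq> U \<Longrightarrow> free_maps (Rg X U) (Rg X V) (rr U V) (g U V) (S U) (S V)"
  by (simp add: free_maps_def free_maps_axioms_def rg_cring rr_hom Pi_def g_closed)

lemma FP_gen: "opn U \<Longrightarrow> a \<in> S U \<Longrightarrow> gen (Rg X U) a \<in> carrier (Sec FP U)"
  by (simp add: gen_carrier rg_cring)

lemma FP_res_gen: "opn U \<Longrightarrow> opn V \<Longrightarrow> V \<subseteq> U \<Longrightarrow> a \<in> S U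
    \<Longrightarrow> Res FP U V (gen (Rg X U) a) = gen (Rg X V) (g U V a)"
  by (simp add: free_maps.fm_gen[OF FM])

lemma FP_module: "opn U \<Longrightarrow> module (Rg X U) (Sec FP U)"
  by (simp add: free_module_module rg_cring)

lemma FP_semilin: "opn U \<Longrightarrow> opn V \<Longrightarrow> V \<subseteq> U \<Longrightarrow> semilin (Rg X U) (Sec FP U) (Sec FP V) (rr U V) (Res FP U V)"
  by (simp add: free_maps.fm_semilin[OF FM])

lemma FP_eqI:
  fixes N :: "('s, 'n) module"
  assumes "opn U" "semilin (Rg X U) (Sec FP U) N \<rho> F" "semilin (Rg X U) (Sec FP U) N \<rho> G" "module R N"
    and "\<And>a. a \<in> S U \<Longrightarrow> F (gen (Rg X U) a) = G (gen (Rg X U) a)" "f \<in> carrier (Sec FP U)"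
  shows "F f = G f"
  by (rule free_eqI[OF rg_cring[OF assms(1)] assms(2,3)[simplified] assms(4,5) assms(6)[simplified]])

text \<open>The identity and composition laws for restriction are equalities of semilinear maps out
  of free modules; on generators they are \<open>g_id\<close> and \<open>g_comp\<close>.\<close>

lemma FP_pmod: "pmod X FP"
  unfolding pmod_def
proof (intro conjI allI impI)
  show "presheaf (Top X) FP"
    unfolding presheaf_def
  proof (intro conjI allI impI)
    fix U V assume "opn U \<and> opn V \<and> V \<subseteq> U"
    then show "Res FP U V \<in> carrier (Sec FP U) \<rightarrow> carrier (Sec FP V)"
      using semilin_closed[OF FP_semilin] by blast
  next
    fix U f assume "opn U \<and> f \<in> carrier (Sec FP U)"
    then have U: "opn U" and f: "f \<in> carrier (Sec FP U)" by auto
    interpret M: module "Rg X U" "Sec FP U" by (rule FP_module[OF U])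
    show "Res FP U U f = f"
    proof (rule FP_eqI[OF U FP_semilin[OF U U subset_refl] _ FP_module[OF U] _ f])
      show "semilin (Rg X U) (Sec FP U) (Sec FP U) (rr U U) (\<lambda>f. f)"
        by (rule semilinI) (simp_all del: free_presheaf_simps add: rr_id[OF U])
      show "Res FP U U (gen (Rg X U) a) = gen (Rg X U) a" if "a \<in> S U" for a
        using FP_res_gen[OF U U subset_refl that] g_id[OF U that] by simp
    qed
  next
    fix U V W f assume "opn U \<and> opn V \<and> opn W \<and> W \<subseteq> V \<and> V \<subseteq> U \<and> f \<in> carrier (Sec FP U)"
    then have o: "opn U" "opn V" "V \<subseteq> U" "opn W" "W \<subseteq> V" "W \<subseteq> U" and f: "f \<in> carrier (Sec FP U)" by auto
    show "Res FP V W (Res FP U V f) = Res FP U W f"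
    proof (rule FP_eqI[OF o(1) _ FP_semilin[OF o(1,4,6)] FP_module[OF o(4)] _ f])
      show "semilin (Rg X U) (Sec FP U) (Sec FP W) (rr U W) (\<lambda>f. Res FP V W (Res FP U V f))"
        by (rule semilin_comp[OF FP_semilin[OF o(1-3)] FP_semilin[OF o(2,4,5)]])
          (simp_all add: rr_closed[OF o(1-3)] rr_comp[OF o(1,2,4,5,3)])
      show "Res FP V W (Res FP U V (gen (Rg X U) a)) = Res FP U W (gen (Rg X U) a)" if a: "a \<in> S U" for a
        using FP_res_gen[OF o(1-3) a] FP_res_gen[OF o(2,4,5) g_closed[OF o(1-3) a]] FP_res_gen[OF o(1,4,6) a]
          g_comp[OF o(1,2,4,5,3) a] by simp
    qed
  qed
qed (simp_all del: free_presheaf_simps add: FP_module FP_semilin)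

sublocale FP: pmod_space X FP
  by unfold_locales (rule FP_pmod)

end

section \<open>Tensor products\<close>

lemma tensor_rel_incl:
  fixes R M N
  defines "T \<equiv> free_module R (carrier M \<times> carrier N)"
  shows "m \<in> carrier M \<Longrightarrow> m' \<in> carrier M \<Longrightarrow> n \<in> carrier N \<Longrightarrow>
      gen R (m \<oplus>\<^bsub>M\<^esub> m', n) \<ominus>\<^bsub>T\<^esub> (gen R (m, n) \<oplus>\<^bsub>T\<^esub> gen R (m', n)) \<in> tensor_rel R M N"
    and "m \<in> carrier M \<Longrightarrow> n \<in> carrier N \<Longrightarrow> n' \<in> carrier N \<Longrightarrow>
      gen R (m, n \<oplus>\<^bsub>N\<^esub> n') \<ominus>\<^bsub>T\<^esub> (gen R (m, n) \<oplus>\<^bsub>T\<^esub> gen R (m, n')) \<in> tensor_rel R M N"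
    and "r \<in> carrier R \<Longrightarrow> m \<in> carrier M \<Longrightarrow> n \<in> carrier N \<Longrightarrow>
      gen R (r \<odot>\<^bsub>M\<^esub> m, n) \<ominus>\<^bsub>T\<^esub> (r \<odot>\<^bsub>T\<^esub> gen R (m, n)) \<in> tensor_rel R M N"
    and "r \<in> carrier R \<Longrightarrow> m \<in> carrier M \<Longrightarrow> n \<in> carrier N \<Longrightarrow>
      gen R (m, r \<odot>\<^bsub>N\<^esub> n) \<ominus>\<^bsub>T\<^esub> (r \<odot>\<^bsub>T\<^esub> gen R (m, n)) \<in> tensor_rel R M N"
  unfolding tensor_rel_def Let_def T_def by (rule subsetD[OF span_of_incl], blast)+

lemma tensor_gens_closed:
  fixes R :: "'r ring" and M :: "('r, 'm) module" and N :: "('r, 'n) module"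
  assumes M: "module R M" and N: "module R N"
  defines "T \<equiv> free_module R (carrier M \<times> carrier N)"
  shows "{gen R (m \<oplus>\<^bsub>M\<^esub> m', n) \<ominus>\<^bsub>T\<^esub> (gen R (m, n) \<oplus>\<^bsub>T\<^esub> gen R (m', n)) | m m' n.
          m \<in> carrier M \<and> m' \<in> carrier M \<and> n \<in> carrier N} \<union>
       {gen R (m, n \<oplus>\<^bsub>N\<^esub> n') \<ominus>\<^bsub>T\<^esub> (gen R (m, n) \<oplus>\<^bsub>T\<^esub> gen R (m, n')) | m n n'.
          m \<in> carrier M \<and> n \<in> carrier N \<and> n' \<in> carrier N} \<union>
       {gen R (r \<odot>\<^bsub>M\<^esub> m, n) \<ominus>\<^bsub>T\<^esub> (r \<odot>\<^bsub>T\<^esub> gen R (m, n)) | r m n.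
          r \<in> carrier R \<and> m \<in> carrier M \<and> n \<in> carrier N} \<union>
       {gen R (m, r \<odot>\<^bsub>N\<^esub> n) \<ominus>\<^bsub>T\<^esub> (r \<odot>\<^bsub>T\<^esub> gen R (m, n)) | r m n.
          r \<in> carrier R \<and> m \<in> carrier M \<and> n \<in> carrier N} \<subseteq> carrier T"
proof -
  interpret M: module R M by (rule M)
  interpret N: module R N by (rule N)
  interpret T: module R T unfolding T_def by (rule free_module_module[OF M.R.cring_axioms])
  have g: "m \<in> carrier M \<Longrightarrow> n \<in> carrier N \<Longrightarrow> gen R (m, n) \<in> carrier T" for m n
    unfolding T_def by (rule gen_carrier[OF M.R.cring_axioms]) simp
  show ?thesis
    by (auto simp: g)
qed

lemma tensor_rel_submodule:
  fixes R :: "'r ring" and M :: "('r, 'm) module" and N :: "('r, 'n) module"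
  assumes M: "module R M" and N: "module R N"
  shows "submodule (tensor_rel R M N) R (free_module R (carrier M \<times> carrier N))"
proof -
  interpret M: module R M by (rule M)
  show ?thesis
    unfolding tensor_rel_def Let_def
    by (rule span_of_submodule[OF free_module_module[OF M.R.cring_axioms] tensor_gens_closed[OF M N]])
qed

text \<open>The four hypotheses are the four kinds of bilinearity relation. The lemma is applied
  with \<open>H\<close> the relations over a smaller open set, to restrict relations, and with
  \<open>H\<close> zero, to see that a linear map coming from a bilinear one factors through the
  tensor product.\<close>

lemma tensor_rel_image:
  fixes R :: "'r ring" and M :: "('r, 'm) module" and N :: "('r, 'n) module"
    and S :: "'s ring" and K :: "('s, 'k) module"
  defines "T \<equiv> free_module R (carrier M \<times> carrier N)"
  assumes M: "module R M" and N: "module R N" and K: "module S K"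
    and F: "semilin R T K \<rho> F" and \<rho>: "\<rho> \<in> carrier R \<rightarrow> carrier S" and H: "submodule H S K"
    and 1: "\<And>m m' n. m \<in> carrier M \<Longrightarrow> m' \<in> carrier M \<Longrightarrow> n \<in> carrier N \<Longrightarrow>
      F (gen R (m \<oplus>\<^bsub>M\<^esub> m', n)) \<ominus>\<^bsub>K\<^esub> (F (gen R (m, n)) \<oplus>\<^bsub>K\<^esub> F (gen R (m', n))) \<in> H"
    and 2: "\<And>m n n'. m \<in> carrier M \<Longrightarrow> n \<in> carrier N \<Longrightarrow> n' \<in> carrier N \<Longrightarrow>
      F (gen R (m, n \<oplus>\<^bsub>N\<^esub> n')) \<ominus>\<^bsub>K\<^esub> (F (gen R (m, n)) \<oplus>\<^bsub>K\<^esub> F (gen R (m, n'))) \<in> H"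
    and 3: "\<And>r m n. r \<in> carrier R \<Longrightarrow> m \<in> carrier M \<Longrightarrow> n \<in> carrier N \<Longrightarrow>
      F (gen R (r \<odot>\<^bsub>M\<^esub> m, n)) \<ominus>\<^bsub>K\<^esub> (\<rho> r \<odot>\<^bsub>K\<^esub> F (gen R (m, n))) \<in> H"
    and 4: "\<And>r m n. r \<in> carrier R \<Longrightarrow> m \<in> carrier M \<Longrightarrow> n \<in> carrier N \<Longrightarrow>
      F (gen R (m, r \<odot>\<^bsub>N\<^esub> n)) \<ominus>\<^bsub>K\<^esub> (\<rho> r \<odot>\<^bsub>K\<^esub> F (gen R (m, n))) \<in> H"
    and x: "x \<in> tensor_rel R M N"
  shows "F x \<in> H"
proof -
  interpret M: module R M by (rule M)
  interpret N: module R N by (rule N)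
  have TM: "module R T" unfolding T_def by (rule free_module_module[OF M.R.cring_axioms])
  interpret T: module R T by (rule TM)
  have g: "m \<in> carrier M \<Longrightarrow> n \<in> carrier N \<Longrightarrow> gen R (m, n) \<in> carrier T" for m n
    unfolding T_def by (rule gen_carrier[OF M.R.cring_axioms]) simp
  note FF = semilin_diff[OF F TM K] semilin_add[OF F] semilin_smult[OF F]
  show ?thesis
  proof (rule span_of_image[OF TM K F \<rho> H])
    show "x \<in> span_of R T ({gen R (m \<oplus>\<^bsub>M\<^esub> m', n) \<ominus>\<^bsub>T\<^esub> (gen R (m, n) \<oplus>\<^bsub>T\<^esub> gen R (m', n)) | m m' n.
          m \<in> carrier M \<and> m' \<in> carrier M \<and> n \<in> carrier N} \<union>
       {gen R (m, n \<oplus>\<^bsub>N\<^esub> n') \<ominus>\<^bsub>T\<^esub> (gen R (m, n) \<oplus>\<^bsub>T\<^esub> gen R (m, n')) | m n n'.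
          m \<in> carrier M \<and> n \<in> carrier N \<and> n' \<in> carrier N} \<union>
       {gen R (r \<odot>\<^bsub>M\<^esub> m, n) \<ominus>\<^bsub>T\<^esub> (r \<odot>\<^bsub>T\<^esub> gen R (m, n)) | r m n.
          r \<in> carrier R \<and> m \<in> carrier M \<and> n \<in> carrier N} \<union>
       {gen R (m, r \<odot>\<^bsub>N\<^esub> n) \<ominus>\<^bsub>T\<^esub> (r \<odot>\<^bsub>T\<^esub> gen R (m, n)) | r m n.
          r \<in> carrier R \<and> m \<in> carrier M \<and> n \<in> carrier N})"
      using x unfolding tensor_rel_def Let_def T_def .
    fix y assume "y \<in> {gen R (m \<oplus>\<^bsub>M\<^esub> m', n) \<ominus>\<^bsub>T\<^esub> (gen R (m, n) \<oplus>\<^bsub>T\<^esub> gen R (m', n)) | m m' n.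
          m \<in> carrier M \<and> m' \<in> carrier M \<and> n \<in> carrier N} \<union>
       {gen R (m, n \<oplus>\<^bsub>N\<^esub> n') \<ominus>\<^bsub>T\<^esub> (gen R (m, n) \<oplus>\<^bsub>T\<^esub> gen R (m, n')) | m n n'.
          m \<in> carrier M \<and> n \<in> carrier N \<and> n' \<in> carrier N} \<union>
       {gen R (r \<odot>\<^bsub>M\<^esub> m, n) \<ominus>\<^bsub>T\<^esub> (r \<odot>\<^bsub>T\<^esub> gen R (m, n)) | r m n.
          r \<in> carrier R \<and> m \<in> carrier M \<and> n \<in> carrier N} \<union>
       {gen R (m, r \<odot>\<^bsub>N\<^esub> n) \<ominus>\<^bsub>T\<^esub> (r \<odot>\<^bsub>T\<^esub> gen R (m, n)) | r m n.
          r \<in> carrier R \<and> m \<in> carrier M \<and> n \<in> carrier N}"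
    then show "F y \<in> H"
      by (elim UnE CollectE exE conjE) (simp_all add: FF g 1 2 3 4)
  qed (rule tensor_gens_closed[OF M N, folded T_def])
qed

text \<open>Taken over an open set \<open>U\<close> because the contraction requires a lift for each
  local section of the dual: such a section pairs only with sections of \<open>L\<close> over open
  subsets of its domain.\<close>

definition bilin ::
  "('x, 'r) ringed \<Rightarrow> 'x set \<Rightarrow> ('x, 'r, 'm) mod_presheaf \<Rightarrow> ('x, 'r, 'n) mod_presheaf \<Rightarrow> ('x, 'r, 'p) mod_presheaf
     \<Rightarrow> ('x set \<Rightarrow> 'm \<Rightarrow> 'n \<Rightarrow> 'p) \<Rightarrow> bool" where
  "bilin X U M N P \<beta> \<longleftrightarrow>
     (\<forall>V n. openin (Top X) V \<and> V \<subseteq> U \<and> n \<in> carrier (Sec N V) \<longrightarrow> lin (Rg X V) (Sec M V) (Sec P V) (\<lambda>m. \<beta> V m n)) \<and>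
     (\<forall>V m. openin (Top X) V \<and> V \<subseteq> U \<and> m \<in> carrier (Sec M V) \<longrightarrow> lin (Rg X V) (Sec N V) (Sec P V) (\<beta> V m)) \<and>
     (\<forall>V W m n. openin (Top X) V \<and> openin (Top X) W \<and> W \<subseteq> V \<and> V \<subseteq> U \<and> m \<in> carrier (Sec M V) \<and> n \<in> carrier (Sec N V)
        \<longrightarrow> Res P V W (\<beta> V m n) = \<beta> W (Res M V W m) (Res N V W n))"

lemma bilin_left: "bilin X U M N P \<beta> \<Longrightarrow> openin (Top X) V \<Longrightarrow> V \<subseteq> U \<Longrightarrow> n \<in> carrier (Sec N V)
    \<Longrightarrow> lin (Rg X V) (Sec M V) (Sec P V) (\<lambda>m. \<beta> V m n)"
  and bilin_right: "bilin X U M N P \<beta> \<Longrightarrow> openin (Top X) V \<Longrightarrow> V \<subseteq> U \<Longrightarrow> m \<in> carrier (Sec M V)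
    \<Longrightarrow> lin (Rg X V) (Sec N V) (Sec P V) (\<beta> V m)"
  and bilin_nat: "bilin X U M N P \<beta> \<Longrightarrow> openin (Top X) V \<Longrightarrow> openin (Top X) W \<Longrightarrow> W \<subseteq> V \<Longrightarrow> V \<subseteq> U
    \<Longrightarrow> m \<in> carrier (Sec M V) \<Longrightarrow> n \<in> carrier (Sec N V)
    \<Longrightarrow> Res P V W (\<beta> V m n) = \<beta> W (Res M V W m) (Res N V W n)"
  by (simp_all add: bilin_def)

locale tensor_space = M: pmod_space X M + N: pmod_space X N
  for X :: "('x, 'r) ringed" and M :: "('x, 'r, 'm) mod_presheaf" and N :: "('x, 'r, 'n) mod_presheaf"
begin

abbreviation "pairs U \<equiv> carrier (Sec M U) \<times> carrier (Sec N U)"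
abbreviation "pres U V \<equiv> map_prod (Res M U V) (Res N U V)"
abbreviation "trel U \<equiv> tensor_rel (Rg X U) (Sec M U) (Sec N U)"

sublocale free_space X pairs pres
  by unfold_locales (auto simp: M.res_closed N.res_closed M.res_id N.res_id M.res_comp N.res_comp)

lemma gen_mem: "M.opn U \<Longrightarrow> m \<in> carrier (Sec M U) \<Longrightarrow> n \<in> carrier (Sec N U) \<Longrightarrow> gen (Rg X U) (m, n) \<in> carrier (Sec FP U)"
  by (rule FP_gen) auto

lemma FP_res_gen': "M.opn U \<Longrightarrow> M.opn V \<Longrightarrow> V \<subseteq> U \<Longrightarrow> m \<in> carrier (Sec M U) \<Longrightarrow> n \<in> carrier (Sec N U)
    \<Longrightarrow> Res FP U V (gen (Rg X U) (m, n)) = gen (Rg X V) (Res M U V m, Res N U V n)"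
  using FP_res_gen[of U V "(m, n)"] by simp

text \<open>Restriction respects the module operations and sends a generator to the generator of the
  restricted pair, so each bilinearity relation restricts to a relation of the same kind.\<close>

sublocale quot_space X FP trel
proof (intro quot_space.intro quot_space_axioms.intro FP.pmod_space_axioms)
  show "submodule (trel U) (Rg X U) (Sec FP U)" if U: "M.opn U" for U
    using tensor_rel_submodule[OF M.mods[OF U] N.mods[OF U]] by simp
  fix U V x assume o: "M.opn U" "M.opn V" "V \<subseteq> U" and x: "x \<in> trel U"
  note MU = M.mods[OF o(1)] N.mods[OF o(1)]
  show "Res FP U V x \<in> trel V"
  proof (rule tensor_rel_image[OF MU FP_module[OF o(2)] _ _ _ _ _ _ _ x])
    show "semilin (Rg X U) (free_module (Rg X U) (pairs U)) (Sec FP V) (M.rr U V) (Res FP U V)"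
      using FP_semilin[OF o] by simp
    show "M.rr U V \<in> carrier (Rg X U) \<rightarrow> carrier (Rg X V)" using M.rr_closed[OF o] by blast
    show "submodule (trel V) (Rg X V) (Sec FP V)"
      using tensor_rel_submodule[OF M.mods[OF o(2)] N.mods[OF o(2)]] by simp
    interpret MU: module "Rg X U" "Sec M U" by (rule MU(1))
    interpret NU: module "Rg X U" "Sec N U" by (rule MU(2))
    note S = FP_res_gen'[OF o] M.res_add[OF o] N.res_add[OF o] M.res_smult[OF o] N.res_smult[OF o]
      M.res_closed[OF o] N.res_closed[OF o] M.rr_closed[OF o]
    show "Res FP U V (gen (Rg X U) (m \<oplus>\<^bsub>Sec M U\<^esub> m', n)) \<ominus>\<^bsub>Sec FP V\<^esub>
        (Res FP U V (gen (Rg X U) (m, n)) \<oplus>\<^bsub>Sec FP V\<^esub> Res FP U V (gen (Rg X U) (m', n))) \<in> trel V"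
      if "m \<in> carrier (Sec M U)" "m' \<in> carrier (Sec M U)" "n \<in> carrier (Sec N U)" for m m' n
      using that by (simp add: S del: free_module_simps free_presheaf_simps(2)) (intro tensor_rel_incl; simp add: S)
    show "Res FP U V (gen (Rg X U) (m, n \<oplus>\<^bsub>Sec N U\<^esub> n')) \<ominus>\<^bsub>Sec FP V\<^esub>
        (Res FP U V (gen (Rg X U) (m, n)) \<oplus>\<^bsub>Sec FP V\<^esub> Res FP U V (gen (Rg X U) (m, n'))) \<in> trel V"
      if "m \<in> carrier (Sec M U)" "n \<in> carrier (Sec N U)" "n' \<in> carrier (Sec N U)" for m n n'
      using that by (simp add: S del: free_module_simps free_presheaf_simps(2)) (intro tensor_rel_incl; simp add: S)
    show "Res FP U V (gen (Rg X U) (r \<odot>\<^bsub>Sec M U\<^esub> m, n)) \<ominus>\<^bsub>Sec FP V\<^esub>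
        (M.rr U V r \<odot>\<^bsub>Sec FP V\<^esub> Res FP U V (gen (Rg X U) (m, n))) \<in> trel V"
      if "r \<in> carrier (Rg X U)" "m \<in> carrier (Sec M U)" "n \<in> carrier (Sec N U)" for r m n
      using that by (simp add: S del: free_module_simps free_presheaf_simps(2)) (intro tensor_rel_incl; simp add: S)
    show "Res FP U V (gen (Rg X U) (m, r \<odot>\<^bsub>Sec N U\<^esub> n)) \<ominus>\<^bsub>Sec FP V\<^esub>
        (M.rr U V r \<odot>\<^bsub>Sec FP V\<^esub> Res FP U V (gen (Rg X U) (m, n))) \<in> trel V"
      if "r \<in> carrier (Rg X U)" "m \<in> carrier (Sec M U)" "n \<in> carrier (Sec N U)" for r m n
      using that by (simp add: S del: free_module_simps free_presheaf_simps(2)) (intro tensor_rel_incl; simp add: S)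
  qed
qed

lemma tensor_eq: "tensor X M N = QS"
  by (simp add: tensor_def quot_sheaf_def quot_presheaf_def tensor_presheaf_def)

lemma tensor_presheaf_eq: "tensor_presheaf X M N = QP"
  by (simp add: quot_presheaf_def tensor_presheaf_def)

lemma tens_eq: "tens X M N U m n = qmap U (gen (Rg X U) (m, n))"
  unfolding tens_def quot_map_def tensor_presheaf_eq by simp

abbreviation "T \<equiv> tensor X M N"
abbreviation tns where "tns \<equiv> tens X M N"

lemma T_mod_sheaf: "mod_sheaf X T"
  unfolding tensor_eq by (rule qs_mod_sheaf)

sublocale T: msheaf_space X T
  by unfold_locales (rule T_mod_sheaf)

lemma tens_closed: "M.opn U \<Longrightarrow> m \<in> carrier (Sec M U) \<Longrightarrow> n \<in> carrier (Sec N U) \<Longrightarrow> tns U m n \<in> carrier (Sec T U)"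
  unfolding tens_eq tensor_eq by (rule qmap_closed[OF _ gen_mem])

lemma tens_res: "M.opn U \<Longrightarrow> M.opn V \<Longrightarrow> V \<subseteq> U \<Longrightarrow> m \<in> carrier (Sec M U) \<Longrightarrow> n \<in> carrier (Sec N U)
    \<Longrightarrow> Res T U V (tns U m n) = tns V (Res M U V m) (Res N U V n)"
  unfolding tens_eq tensor_eq using qmap_res[OF _ _ _ gen_mem, of U V m n] FP_res_gen'[of U V m n] by simp

text \<open>Additivity and homogeneity hold because the differences of both sides are among the
  imposed relations, which \<open>qmap\<close> sends to zero.\<close>

lemma tens_left: "M.opn U \<Longrightarrow> n \<in> carrier (Sec N U) \<Longrightarrow> lin (Rg X U) (Sec M U) (Sec T U) (\<lambda>m. tns U m n)"
proof (rule semilinI)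
  assume U: "M.opn U" and n: "n \<in> carrier (Sec N U)"
  fix m assume m: "m \<in> carrier (Sec M U)"
  show "tns U m n \<in> carrier (Sec T U)" by (rule tens_closed[OF U m n])
  note g = gen_mem[OF U _ n]
  show "tns U (m \<oplus>\<^bsub>Sec M U\<^esub> m') n = tns U m n \<oplus>\<^bsub>Sec T U\<^esub> tns U m' n" if m': "m' \<in> carrier (Sec M U)" for m'
    unfolding tens_eq tensor_eq qmap_add[OF U g[OF m] g[OF m'], symmetric]
  proof (rule qmap_eqI[OF U g[OF M.add_closed[OF U m m']] FP.add_closed[OF U g[OF m] g[OF m']]])
    show "gen (Rg X U) (m \<oplus>\<^bsub>Sec M U\<^esub> m', n) \<ominus>\<^bsub>Sec FP U\<^esub>
      (gen (Rg X U) (m, n) \<oplus>\<^bsub>Sec FP U\<^esub> gen (Rg X U) (m', n)) \<in> trel U"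
      using tensor_rel_incl(1)[OF m m' n, of "Rg X U"] by (simp only: free_presheaf_simps(1))
  qed
  show "tns U (r \<odot>\<^bsub>Sec M U\<^esub> m) n = r \<odot>\<^bsub>Sec T U\<^esub> tns U m n" if r: "r \<in> carrier (Rg X U)" for r
    unfolding tens_eq tensor_eq qmap_smult[OF U r g[OF m], symmetric]
  proof (rule qmap_eqI[OF U g[OF M.smult_closed[OF U r m]] FP.smult_closed[OF U r g[OF m]]])
    show "gen (Rg X U) (r \<odot>\<^bsub>Sec M U\<^esub> m, n) \<ominus>\<^bsub>Sec FP U\<^esub> (r \<odot>\<^bsub>Sec FP U\<^esub> gen (Rg X U) (m, n)) \<in> trel U"
      using tensor_rel_incl(3)[OF r m n] by (simp only: free_presheaf_simps(1))
  qed
qed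

lemma tens_right: "M.opn U \<Longrightarrow> m \<in> carrier (Sec M U) \<Longrightarrow> lin (Rg X U) (Sec N U) (Sec T U) (tns U m)"
proof (rule semilinI)
  assume U: "M.opn U" and m: "m \<in> carrier (Sec M U)"
  fix n assume n: "n \<in> carrier (Sec N U)"
  show "tns U m n \<in> carrier (Sec T U)" by (rule tens_closed[OF U m n])
  note g = gen_mem[OF U m]
  show "tns U m (n \<oplus>\<^bsub>Sec N U\<^esub> n') = tns U m n \<oplus>\<^bsub>Sec T U\<^esub> tns U m n'" if n': "n' \<in> carrier (Sec N U)" for n'
    unfolding tens_eq tensor_eq qmap_add[OF U g[OF n] g[OF n'], symmetric]
  proof (rule qmap_eqI[OF U g[OF N.add_closed[OF U n n']] FP.add_closed[OF U g[OF n] g[OF n']]])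
    show "gen (Rg X U) (m, n \<oplus>\<^bsub>Sec N U\<^esub> n') \<ominus>\<^bsub>Sec FP U\<^esub>
      (gen (Rg X U) (m, n) \<oplus>\<^bsub>Sec FP U\<^esub> gen (Rg X U) (m, n')) \<in> trel U"
      using tensor_rel_incl(2)[OF m n n', of "Rg X U"] by (simp only: free_presheaf_simps(1))
  qed
  show "tns U m (r \<odot>\<^bsub>Sec N U\<^esub> n) = r \<odot>\<^bsub>Sec T U\<^esub> tns U m n" if r: "r \<in> carrier (Rg X U)" for r
    unfolding tens_eq tensor_eq qmap_smult[OF U r g[OF n], symmetric]
  proof (rule qmap_eqI[OF U g[OF N.smult_closed[OF U r n]] FP.smult_closed[OF U r g[OF n]]])
    show "gen (Rg X U) (m, r \<odot>\<^bsub>Sec N U\<^esub> n) \<ominus>\<^bsub>Sec FP U\<^esub> (r \<odot>\<^bsub>Sec FP U\<^esub> gen (Rg X U) (m, n)) \<in> trel U"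
      using tensor_rel_incl(4)[OF r m n] by (simp only: free_presheaf_simps(1))
  qed
qed

text \<open>\<open>\<beta>\<close> extends linearly to maps \<open>F\<close> on the free modules.
  They commute with restriction by a check on generators, and bilinearity says that they kill the
  relations, so they descend to the quotient sheaf.\<close>

lemma tensor_lift_on:
  fixes P :: "('x, 'r, 'p) mod_presheaf"
  assumes U: "M.opn U" and P: "mod_sheaf X P" and b: "bilin X U M N P \<beta>"
  shows "\<exists>h. hom_on X U T P h \<and> (\<forall>V m n. M.opn V \<and> V \<subseteq> U \<and> m \<in> carrier (Sec M V) \<and> n \<in> carrier (Sec N V)
    \<longrightarrow> h V (tns V m n) = \<beta> V m n)"
proof -
  interpret P: msheaf_space X P by unfold_locales (rule P)
  note bl = semilin_add[OF bilin_left[OF b]] semilin_smult[OF bilin_left[OF b]]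
    semilin_add[OF bilin_right[OF b]] semilin_smult[OF bilin_right[OF b]]
  note bc = semilin_closed[OF bilin_right[OF b]]
  have "\<forall>V\<in>{V. M.opn V \<and> V \<subseteq> U}. \<exists>F. lin (Rg X V) (Sec FP V) (Sec P V) F \<and>
    (\<forall>a\<in>pairs V. F (gen (Rg X V) a) = case_prod (\<beta> V) a)"
    unfolding free_presheaf_simps
  proof
    fix V assume "V \<in> {V. M.opn V \<and> V \<subseteq> U}"
    then have V: "M.opn V" "V \<subseteq> U" by auto
    show "\<exists>F. lin (Rg X V) (free_module (Rg X V) (pairs V)) (Sec P V) F \<and>
      (\<forall>a\<in>pairs V. F (gen (Rg X V) a) = case_prod (\<beta> V) a)"
      by (rule free_lift[OF P.mods[OF V(1)]]) (use bc[OF V] in auto)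
  qed
  from bchoice[OF this] obtain F where FF: "\<forall>V\<in>{V. M.opn V \<and> V \<subseteq> U}. lin (Rg X V) (Sec FP V) (Sec P V) (F V) \<and>
    (\<forall>a\<in>pairs V. F V (gen (Rg X V) a) = case_prod (\<beta> V) a)" ..
  have F: "\<And>V. M.opn V \<Longrightarrow> V \<subseteq> U \<Longrightarrow> lin (Rg X V) (Sec FP V) (Sec P V) (F V)"
    and Fg': "\<And>V. M.opn V \<Longrightarrow> V \<subseteq> U \<Longrightarrow> (\<forall>a\<in>pairs V. F V (gen (Rg X V) a) = case_prod (\<beta> V) a)"
    using FF by auto
  have Fg: "F V (gen (Rg X V) (m, n)) = \<beta> V m n"
    if "M.opn V" "V \<subseteq> U" "m \<in> carrier (Sec M V)" "n \<in> carrier (Sec N V)" for V m n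
    using Fg'[OF that(1,2)] that by auto
  have hom: "hom_on X U FP P F"
    unfolding hom_on_def
  proof (intro conjI allI impI ballI)
    show "lin (Rg X V) (Sec FP V) (Sec P V) (F V)" if "M.opn V \<and> V \<subseteq> U" for V using F that by blast
    fix V W f assume "M.opn V \<and> M.opn W \<and> W \<subseteq> V \<and> V \<subseteq> U" and f: "f \<in> carrier (Sec FP V)"
    then have o: "M.opn V" "M.opn W" "W \<subseteq> V" "V \<subseteq> U" "W \<subseteq> U" by auto
    show "Res P V W (F V f) = F W (Res FP V W f)"
    proof (rule FP_eqI[OF o(1) _ _ P.mods[OF o(2)] _ f])
      show "semilin (Rg X V) (Sec FP V) (Sec P W) (M.rr V W) (\<lambda>f. Res P V W (F V f))"
        by (rule semilin_comp[OF F[OF o(1,4)] P.res_semilin[OF o(1-3)]]) auto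
      show "semilin (Rg X V) (Sec FP V) (Sec P W) (M.rr V W) (\<lambda>f. F W (Res FP V W f))"
        by (rule semilin_comp[OF FP_semilin[OF o(1-3)] F[OF o(2,5)]]) (auto simp: M.rr_closed[OF o(1-3)])
      fix a assume "a \<in> pairs V"
      then obtain m n where a: "a = (m, n)" "m \<in> carrier (Sec M V)" "n \<in> carrier (Sec N V)" by auto
      show "Res P V W (F V (gen (Rg X V) a)) = F W (Res FP V W (gen (Rg X V) a))"
        unfolding a(1) FP_res_gen'[OF o(1-3) a(2,3)] Fg[OF o(1,4) a(2,3)]
          Fg[OF o(2,5) M.res_closed[OF o(1-3) a(2)] N.res_closed[OF o(1-3) a(3)]]
        by (rule bilin_nat[OF b o(1-4) a(2,3)])
    qed
  qed
  have kill: "F V x = \<zero>\<^bsub>Sec P V\<^esub>" if V: "M.opn V" "V \<subseteq> U" and x: "x \<in> trel V" for V x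
  proof -
    note MV = M.mods[OF V(1)] N.mods[OF V(1)]
    interpret MV: module "Rg X V" "Sec M V" by (rule MV(1))
    interpret NV: module "Rg X V" "Sec N V" by (rule MV(2))
    note S = Fg[OF V] bl[OF V] bc[OF V] module_zero_diff[OF P.mods[OF V(1)]] P.add_closed[OF V(1)] P.smult_closed[OF V(1)]
    have "F V x \<in> {\<zero>\<^bsub>Sec P V\<^esub>}"
      by (rule tensor_rel_image[OF MV P.mods[OF V(1)] F[OF V, simplified] _ zero_submodule[OF P.mods[OF V(1)]] _ _ _ _ x])
        (simp_all add: S)
    then show ?thesis by simp
  qed
  obtain h where "hom_on X U QS P h" "\<And>V f. M.opn V \<Longrightarrow> V \<subseteq> U \<Longrightarrow> f \<in> carrier (Sec FP V) \<Longrightarrow> h V (qmap V f) = F V f"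
    using qs_lift[OF U P hom kill] by blast
  then have h: "hom_on X U T P h" "\<And>V f. M.opn V \<Longrightarrow> V \<subseteq> U \<Longrightarrow> f \<in> carrier (Sec FP V) \<Longrightarrow> h V (qmap V f) = F V f"
    unfolding tensor_eq .
  have "h V (tns V m n) = \<beta> V m n"
    if V: "M.opn V" "V \<subseteq> U" and mn: "m \<in> carrier (Sec M V)" "n \<in> carrier (Sec N V)" for V m n
    unfolding tens_eq h(2)[OF V gen_mem[OF V(1) mn]] by (rule Fg[OF V mn])
  with h(1) show ?thesis by blast
qed

text \<open>By \<open>qs_unique\<close> the two maps are compared on images of the free modules, and
  there linear maps are determined by the generators, whose images are the pure tensors.\<close>

lemma tensor_unique:
  fixes P :: "('x, 'r, 'p) mod_presheaf"
  assumes U: "M.opn U" and P: "mod_sheaf X P" and h: "hom_on X U T P h" and k: "hom_on X U T P k"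
    and eq: "\<And>V m n. M.opn V \<Longrightarrow> V \<subseteq> U \<Longrightarrow> m \<in> carrier (Sec M V) \<Longrightarrow> n \<in> carrier (Sec N V)
      \<Longrightarrow> h V (tns V m n) = k V (tns V m n)"
    and s: "s \<in> carrier (Sec T U)"
  shows "h U s = k U s"
proof (rule qs_unique[OF U P h[unfolded tensor_eq] k[unfolded tensor_eq] _ s[unfolded tensor_eq]])
  interpret P: msheaf_space X P by unfold_locales (rule P)
  fix V f assume V: "M.opn V" "V \<subseteq> U" and f: "f \<in> carrier (Sec FP V)"
  note q = hom_on_lin[OF hom_on_top[OF qmap_hom V(1)] V(1) subset_refl]
  show "h V (qmap V f) = k V (qmap V f)"
  proof (rule FP_eqI[OF V(1) _ _ P.mods[OF V(1)] _ f])
    show "lin (Rg X V) (Sec FP V) (Sec P V) (\<lambda>f. h V (qmap V f))"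
      by (rule semilin_comp[OF q hom_on_lin[OF h[unfolded tensor_eq] V]]) auto
    show "lin (Rg X V) (Sec FP V) (Sec P V) (\<lambda>f. k V (qmap V f))"
      by (rule semilin_comp[OF q hom_on_lin[OF k[unfolded tensor_eq] V]]) auto
    fix a assume "a \<in> pairs V"
    then show "h V (qmap V (gen (Rg X V) a)) = k V (qmap V (gen (Rg X V) a))"
      using eq[OF V] by (auto simp: tens_eq)
  qed
qed

text \<open>Existence over the whole space discharges the choice in \<open>tensor_lift\<close>;
  afterwards its definition is never consulted.\<close>

lemma tensor_lift_spec:
  fixes P :: "('x, 'r, 'p) mod_presheaf"
  assumes P: "mod_sheaf X P" and b: "bilin X M.TX M N P \<beta>"
  shows "hom_on X M.TX T P (tensor_lift X M N P \<beta>)"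
    and "M.opn U \<Longrightarrow> m \<in> carrier (Sec M U) \<Longrightarrow> n \<in> carrier (Sec N U) \<Longrightarrow> tensor_lift X M N P \<beta> U (tns U m n) = \<beta> U m n"
proof -
  have "\<exists>h. mod_hom X T P h \<and>
     (\<forall>U m n. M.opn U \<and> m \<in> carrier (Sec M U) \<and> n \<in> carrier (Sec N U) \<longrightarrow> h U (tns U m n) = \<beta> U m n)"
    unfolding mod_hom_iff using tensor_lift_on[OF openin_topspace P b] openin_subset by metis
  from someI_ex[OF this, folded tensor_lift_def]
  show "hom_on X M.TX T P (tensor_lift X M N P \<beta>)"
    "M.opn U \<Longrightarrow> m \<in> carrier (Sec M U) \<Longrightarrow> n \<in> carrier (Sec N U) \<Longrightarrow> tensor_lift X M N P \<beta> U (tns U m n) = \<beta> U m n"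
    by (auto simp: mod_hom_iff)
qed

end

section \<open>Local properties of morphisms\<close>

lemma hom_on_zero:
  assumes h: "hom_on X U M N h" and "openin (Top X) V" "V \<subseteq> U" and "pmod X M" "pmod X N"
  shows "h V \<zero>\<^bsub>Sec M V\<^esub> = \<zero>\<^bsub>Sec N V\<^esub>"
  by (rule semilin_zero[OF hom_on_lin[OF h assms(2,3)]]) (use assms in \<open>auto simp: pmod_def\<close>)

lemma hom_on_diff:
  assumes h: "hom_on X U M N h" and "openin (Top X) V" "V \<subseteq> U" and "pmod X M" "pmod X N"
    and "m \<in> carrier (Sec M V)" "n \<in> carrier (Sec M V)"
  shows "h V (m \<ominus>\<^bsub>Sec M V\<^esub> n) = h V m \<ominus>\<^bsub>Sec N V\<^esub> h V n"
  by (rule semilin_diff[OF hom_on_lin[OF h assms(2,3)] _ _ assms(6,7)]) (use assms in \<open>auto simp: pmod_def\<close>)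

locale sheaf_hom = M: msheaf_space X M + N: msheaf_space X N
  for X :: "('x, 'r) ringed" and M :: "('x, 'r, 'm) mod_presheaf" and N :: "('x, 'r, 'n) mod_presheaf" +
  fixes h
  assumes hom: "hom_on X (topspace (Top X)) M N h"
begin

lemma h_closed: "M.opn U \<Longrightarrow> m \<in> carrier (Sec M U) \<Longrightarrow> h U m \<in> carrier (Sec N U)"
  and h_nat: "M.opn U \<Longrightarrow> M.opn V \<Longrightarrow> V \<subseteq> U \<Longrightarrow> m \<in> carrier (Sec M U) \<Longrightarrow> Res N U V (h U m) = h V (Res M U V m)"
  by (rule hom_on_closed[OF hom] hom_on_nat[OF hom]; (assumption | erule openin_subset))+

text \<open>Two sections with the same image have equal restrictions on a cover, hence are equal,
  since \<open>M\<close> is separated.\<close>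

lemma inj_local:
  assumes loc: "\<And>x. x \<in> M.TX \<Longrightarrow> \<exists>U. M.opn U \<and> x \<in> U \<and> (\<forall>V. M.opn V \<and> V \<subseteq> U \<longrightarrow> inj_on (h V) (carrier (Sec M V)))"
    and U: "M.opn U"
  shows "inj_on (h U) (carrier (Sec M U))"
proof (rule inj_onI)
  fix s t assume s: "s \<in> carrier (Sec M U)" and t: "t \<in> carrier (Sec M U)" and eq: "h U s = h U t"
  show "s = t"
  proof (rule M.eqI[OF U s t])
    fix x assume x: "x \<in> U"
    then have "x \<in> M.TX" using openin_subset[OF U] by auto
    from loc[OF this] obtain V where V: "M.opn V" "x \<in> V" "\<And>W. M.opn W \<Longrightarrow> W \<subseteq> V \<Longrightarrow> inj_on (h W) (carrier (Sec M W))"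
      by auto
    define W where "W = U \<inter> V"
    have W: "M.opn W" "x \<in> W" "W \<subseteq> U" "W \<subseteq> V" using U V x by (auto simp: W_def)
    have "h W (Res M U W s) = h W (Res M U W t)"
      using h_nat[OF U W(1,3) s] h_nat[OF U W(1,3) t] eq by simp
    then have "Res M U W s = Res M U W t"
      by (rule inj_onD[OF V(3)[OF W(1,4)] _ M.res_closed[OF U W(1,3) s] M.res_closed[OF U W(1,3) t]])
    then show "\<exists>V. M.opn V \<and> x \<in> V \<and> V \<subseteq> U \<and> Res M U V s = Res M U V t" using W by blast
  qed
qed

text \<open>Injectivity makes local preimages unique, therefore compatible, and they glue in
  \<open>M\<close>. That the glued section maps to \<open>t\<close> is again a local question, now
  in \<open>N\<close>.\<close>

lemma preimage_local:
  assumes inj: "\<And>V. M.opn V \<Longrightarrow> inj_on (h V) (carrier (Sec M V))"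
    and U: "M.opn U" and t: "t \<in> carrier (Sec N U)"
    and loc: "\<And>x. x \<in> U \<Longrightarrow> \<exists>V s. M.opn V \<and> x \<in> V \<and> V \<subseteq> U \<and> s \<in> carrier (Sec M V) \<and> h V s = Res N U V t"
  shows "\<exists>s\<in>carrier (Sec M U). h U s = t"
proof -
  define Q where "Q V s \<longleftrightarrow> s \<in> carrier (Sec M V) \<and> h V s = Res N U V t" for V s
  have "\<exists>s\<in>carrier (Sec M U). \<forall>V r. M.opn V \<and> V \<subseteq> U \<and> Q V r \<longrightarrow> Res M U V s = r"
  proof (rule M.glue[OF U])
    show "r \<in> carrier (Sec M V)" if "Q V r" for V r using that by (simp add: Q_def)
    show "Q W (Res M V W r)" if "M.opn V" "V \<subseteq> U" "M.opn W" "W \<subseteq> V" "Q V r" for V W r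
      using that h_nat[of V W r, symmetric] M.res_closed[of V W r] N.res_comp[OF U that(1,3,4,2) t]
      by (simp add: Q_def)
    show "r = r'" if "M.opn V" "V \<subseteq> U" "Q V r" "Q V r'" for V r r'
      using that inj_onD[OF inj[OF that(1)]] by (simp add: Q_def)
    show "\<exists>V s. M.opn V \<and> x \<in> V \<and> V \<subseteq> U \<and> Q V s" if "x \<in> U" for x
      using loc[OF that] by (simp add: Q_def)
  qed
  then obtain s where s: "s \<in> carrier (Sec M U)" "\<And>V r. M.opn V \<Longrightarrow> V \<subseteq> U \<Longrightarrow> Q V r \<Longrightarrow> Res M U V s = r"
    by blast
  have "h U s = t"
  proof (rule N.eqI[OF U h_closed[OF U s(1)] t])
    fix x assume "x \<in> U"
    from loc[OF this] obtain V r where V: "M.opn V" "x \<in> V" "V \<subseteq> U" "r \<in> carrier (Sec M V)" "h V r = Res N U V t"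
      by blast
    then have "Res M U V s = r" by (intro s(2)) (simp_all add: Q_def)
    then have "Res N U V (h U s) = Res N U V t" using h_nat[OF U V(1,3) s(1)] V(5) by simp
    then show "\<exists>V. M.opn V \<and> x \<in> V \<and> V \<subseteq> U \<and> Res N U V (h U s) = Res N U V t" using V by blast
  qed
  then show ?thesis using s(1) by blast
qed

lemma iso_local:
  assumes loc: "\<And>x. x \<in> M.TX \<Longrightarrow> \<exists>U. M.opn U \<and> x \<in> U \<and>
    (\<forall>V. M.opn V \<and> V \<subseteq> U \<longrightarrow> bij_betw (h V) (carrier (Sec M V)) (carrier (Sec N V)))"
  shows "mod_iso X M N h"
  unfolding mod_iso_def mod_hom_iff
proof (intro conjI allI impI hom)
  have inj: "inj_on (h U) (carrier (Sec M U))" if U: "M.opn U" for U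
  proof (rule inj_local[OF _ U])
    fix x assume "x \<in> M.TX"
    from loc[OF this] show "\<exists>U. M.opn U \<and> x \<in> U \<and> (\<forall>V. M.opn V \<and> V \<subseteq> U \<longrightarrow> inj_on (h V) (carrier (Sec M V)))"
      by (auto dest: bij_betw_imp_inj_on)
  qed
  fix U assume U: "M.opn U"
  have "t \<in> h U ` carrier (Sec M U)" if t: "t \<in> carrier (Sec N U)" for t
  proof -
    have "\<exists>s\<in>carrier (Sec M U). h U s = t"
    proof (rule preimage_local[OF inj U t])
      fix x assume x: "x \<in> U"
      then have "x \<in> M.TX" using openin_subset[OF U] by auto
      from loc[OF this] obtain V where V: "M.opn V" "x \<in> V"
        "\<And>W. M.opn W \<Longrightarrow> W \<subseteq> V \<Longrightarrow> bij_betw (h W) (carrier (Sec M W)) (carrier (Sec N W))"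
        by auto
      define W where "W = U \<inter> V"
      have W: "M.opn W" "x \<in> W" "W \<subseteq> U" "W \<subseteq> V" using U V x by (auto simp: W_def)
      have "Res N U W t \<in> h W ` carrier (Sec M W)"
        using V(3)[OF W(1,4)] N.res_closed[OF U W(1,3) t] by (simp add: bij_betw_def)
      then obtain s where "s \<in> carrier (Sec M W)" "h W s = Res N U W t" by force
      then show "\<exists>V s. M.opn V \<and> x \<in> V \<and> V \<subseteq> U \<and> s \<in> carrier (Sec M V) \<and> h V s = Res N U V t"
        using W(1-3) by blast
    qed
    then show ?thesis by force
  qed
  then show "bij_betw (h U) (carrier (Sec M U)) (carrier (Sec N U))"
    using inj[OF U] h_closed[OF U] unfolding bij_betw_def by blast
qed

end

lemma mod_iso_inverse:
  fixes X :: "('x, 'r) ringed" and M :: "('x, 'r, 'm) mod_presheaf" and N :: "('x, 'r, 'n) mod_presheaf"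
  assumes X: "ringed_space X" and M: "pmod X M" and N: "pmod X N" and iso: "mod_iso X M N h"
  shows "hom_on X (topspace (Top X)) N M (\<lambda>U. inv_into (carrier (Sec M U)) (h U))"
proof -
  interpret M: pmod_space X M by unfold_locales (rule X, rule M)
  interpret N: pmod_space X N by unfold_locales (rule N)
  have hom: "hom_on X (topspace (Top X)) M N h" and bij: "\<And>U. M.opn U \<Longrightarrow> bij_betw (h U) (carrier (Sec M U)) (carrier (Sec N U))"
    using iso by (auto simp: mod_iso_def mod_hom_iff)
  note hom' = hom_on_top[OF hom]
  let ?k = "\<lambda>U. inv_into (carrier (Sec M U)) (h U)"
  have k: "?k U n \<in> carrier (Sec M U)" "h U (?k U n) = n" if "M.opn U" "n \<in> carrier (Sec N U)" for U n
    using bij[OF that(1)] that(2) by (auto simp: bij_betw_def inv_into_into f_inv_into_f)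
  have kI: "?k U n = m" if "M.opn U" "m \<in> carrier (Sec M U)" "h U m = n" for U m n
    using bij[OF that(1)] that(2,3) by (auto simp: bij_betw_def inv_into_f_f)
  show ?thesis
    unfolding hom_on_def
  proof (intro conjI allI impI ballI)
    fix U assume "M.opn U \<and> U \<subseteq> M.TX"
    then have U: "M.opn U" by simp
    note H = hom_on_add[OF hom'[OF U] U subset_refl] hom_on_smult[OF hom'[OF U] U subset_refl]
    show "lin (Rg X U) (Sec N U) (Sec M U) (?k U)"
    proof (rule semilinI)
      fix m assume m: "m \<in> carrier (Sec N U)"
      note km = k[OF U m]
      show "?k U m \<in> carrier (Sec M U)" by (rule km)
      show "?k U (m \<oplus>\<^bsub>Sec N U\<^esub> n) = ?k U m \<oplus>\<^bsub>Sec M U\<^esub> ?k U n" if n: "n \<in> carrier (Sec N U)" for n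
        by (rule kI[OF U M.add_closed[OF U km(1) k(1)[OF U n]]]) (simp add: H(1)[OF km(1) k(1)[OF U n]] km k(2)[OF U n])
      show "?k U (r \<odot>\<^bsub>Sec N U\<^esub> m) = r \<odot>\<^bsub>Sec M U\<^esub> ?k U m" if r: "r \<in> carrier (Rg X U)" for r
        by (rule kI[OF U M.smult_closed[OF U r km(1)]]) (simp add: H(2)[OF r km(1)] km)
    qed
  next
    fix V W n assume A: "M.opn V \<and> M.opn W \<and> W \<subseteq> V \<and> V \<subseteq> M.TX" and n: "n \<in> carrier (Sec N V)"
    then have o: "M.opn V" "M.opn W" "W \<subseteq> V" by auto
    note kn = k[OF o(1) n]
    show "Res M V W (?k V n) = ?k W (Res N V W n)"
      by (rule kI[OF o(2) M.res_closed[OF o kn(1)], symmetric])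
        (simp add: hom_on_nat[OF hom'[OF o(1)] o subset_refl kn(1), symmetric] kn)
  qed
qed

section \<open>Tensoring with a free module of rank one\<close>

text \<open>The condition is imposed over every open \<open>V\<close> inside \<open>U\<close>:
  bijectivity on sections over \<open>U\<close> alone would not make \<open>e\<close> trivialise the
  sheaf there.\<close>

definition free_gen :: "('x, 'r) ringed \<Rightarrow> ('x, 'r, 'm) mod_presheaf \<Rightarrow> 'x set \<Rightarrow> 'm \<Rightarrow> bool" where
  "free_gen X M U e \<longleftrightarrow> openin (Top X) U \<and> e \<in> carrier (Sec M U) \<and>
     (\<forall>V. openin (Top X) V \<and> V \<subseteq> U \<longrightarrow>
       bij_betw (\<lambda>r. r \<odot>\<^bsub>Sec M V\<^esub> Res M U V e) (carrier (Rg X V)) (carrier (Sec M V)))"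

locale free_gen_space = pmod_space X M for X :: "('x, 'r) ringed" and M :: "('x, 'r, 'm) mod_presheaf" +
  fixes U e
  assumes fg: "free_gen X M U e"
begin

lemma U: "opn U" and e: "e \<in> carrier (Sec M U)"
  using fg by (auto simp: free_gen_def)

abbreviation "eV V \<equiv> Res M U V e"

text \<open>The coordinate of a section with respect to the generator \<open>e\<close>.\<close>

definition co where "co V = inv_into (carrier (Rg X V)) (\<lambda>r. r \<odot>\<^bsub>Sec M V\<^esub> eV V)"

lemma eV: "opn V \<Longrightarrow> V \<subseteq> U \<Longrightarrow> eV V \<in> carrier (Sec M V)"
  by (rule res_closed[OF U _ _ e])

lemma e_bij: "opn V \<Longrightarrow> V \<subseteq> U \<Longrightarrow> bij_betw (\<lambda>r. r \<odot>\<^bsub>Sec M V\<^esub> eV V) (carrier (Rg X V)) (carrier (Sec M V))"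
  using fg by (auto simp: free_gen_def)

lemma co: "opn V \<Longrightarrow> V \<subseteq> U \<Longrightarrow> m \<in> carrier (Sec M V) \<Longrightarrow> co V m \<in> carrier (Rg X V)"
  "opn V \<Longrightarrow> V \<subseteq> U \<Longrightarrow> m \<in> carrier (Sec M V) \<Longrightarrow> co V m \<odot>\<^bsub>Sec M V\<^esub> eV V = m"
  using e_bij[of V] f_inv_into_f[of m "\<lambda>r. r \<odot>\<^bsub>Sec M V\<^esub> eV V" "carrier (Rg X V)"]
  by (auto simp: co_def bij_betw_def inv_into_into)

lemma coI: "opn V \<Longrightarrow> V \<subseteq> U \<Longrightarrow> r \<in> carrier (Rg X V) \<Longrightarrow> r \<odot>\<^bsub>Sec M V\<^esub> eV V = m \<Longrightarrow> co V m = r"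
  using e_bij[of V] inv_into_f_f[of "\<lambda>r. r \<odot>\<^bsub>Sec M V\<^esub> eV V" "carrier (Rg X V)" r]
  by (auto simp: co_def bij_betw_def)

lemma co_add:
  assumes V: "opn V" "V \<subseteq> U" and m: "m \<in> carrier (Sec M V)" and n: "n \<in> carrier (Sec M V)"
  shows "co V (m \<oplus>\<^bsub>Sec M V\<^esub> n) = co V m \<oplus>\<^bsub>Rg X V\<^esub> co V n"
proof -
  interpret module "Rg X V" "Sec M V" by (rule mods[OF V(1)])
  show ?thesis
    by (rule coI[OF V]) (simp_all add: co[OF V] m n smult_l_distr eV[OF V])
qed

lemma co_smult:
  assumes V: "opn V" "V \<subseteq> U" and r: "r \<in> carrier (Rg X V)" and m: "m \<in> carrier (Sec M V)"
  shows "co V (r \<odot>\<^bsub>Sec M V\<^esub> m) = r \<otimes>\<^bsub>Rg X V\<^esub> co V m"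
proof -
  interpret module "Rg X V" "Sec M V" by (rule mods[OF V(1)])
  show ?thesis
    by (rule coI[OF V]) (simp_all add: co[OF V] m r smult_assoc1 eV[OF V])
qed

lemma co_res:
  assumes V: "opn V" "V \<subseteq> U" and W: "opn W" "W \<subseteq> V" and m: "m \<in> carrier (Sec M V)"
  shows "co W (Res M V W m) = rr V W (co V m)"
proof (rule coI[OF W(1)])
  show "W \<subseteq> U" using V W by auto
  show "rr V W (co V m) \<in> carrier (Rg X W)" by (rule rr_closed[OF V(1) W co(1)[OF V m]])
  have "rr V W (co V m) \<odot>\<^bsub>Sec M W\<^esub> eV W = Res M V W (co V m \<odot>\<^bsub>Sec M V\<^esub> eV V)"
    using res_smult[OF V(1) W co(1)[OF V m] eV[OF V]] res_comp[OF U V(1) W V(2) e] by simp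
  then show "rr V W (co V m) \<odot>\<^bsub>Sec M W\<^esub> eV W = Res M V W m" using co(2)[OF V m] by simp
qed

lemma co_e:
  assumes V: "opn V" "V \<subseteq> U"
  shows "co V (eV V) = \<one>\<^bsub>Rg X V\<^esub>"
proof -
  interpret module "Rg X V" "Sec M V" by (rule mods[OF V(1)])
  show ?thesis by (rule coI[OF V]) (simp_all add: eV[OF V])
qed

lemma free_gen_restrict:
  assumes V: "opn V" "V \<subseteq> U"
  shows "free_gen X M V (eV V)"
  unfolding free_gen_def
proof (intro conjI allI impI V(1) eV[OF V])
  fix W assume "opn W \<and> W \<subseteq> V"
  then have W: "opn W" "W \<subseteq> V" "W \<subseteq> U" using V by auto
  show "bij_betw (\<lambda>r. r \<odot>\<^bsub>Sec M W\<^esub> Res M V W (eV V)) (carrier (Rg X W)) (carrier (Sec M W))"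
    using e_bij[OF W(1,3)] res_comp[OF U V(1) W(1,2) V(2) e] by simp
qed

text \<open>The inverse of \<open>n \<mapsto> e \<otimes> n\<close> is induced by the bilinear map
  \<open>(m, n) \<mapsto> co m \<odot> n\<close>. One composite is the identity as the coordinate of
  \<open>e\<close> is 1. The other is compared with the identity on pure tensors, where \<open>e
  \<otimes> (co m \<odot> n) = (co m \<odot> e) \<otimes> n = m \<otimes> n\<close>.\<close>

lemma tensor_free_bij:
  fixes N :: "('x, 'r, 'n) mod_presheaf"
  assumes N: "mod_sheaf X N" and V: "opn V" "V \<subseteq> U"
  shows "bij_betw (tens X M N V (eV V)) (carrier (Sec N V)) (carrier (Sec (tensor X M N) V))"
proof -
  interpret N: msheaf_space X N by unfold_locales (rule N)
  interpret MN: tensor_space X M N by unfold_locales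
  have "bilin X U M N N (\<lambda>V m n. co V m \<odot>\<^bsub>Sec N V\<^esub> n)"
    unfolding bilin_def
  proof (intro conjI allI impI)
    fix V n assume "opn V \<and> V \<subseteq> U \<and> n \<in> carrier (Sec N V)"
    then have V: "opn V" "V \<subseteq> U" and n: "n \<in> carrier (Sec N V)" by auto
    interpret NV: module "Rg X V" "Sec N V" by (rule N.mods[OF V(1)])
    show "lin (Rg X V) (Sec M V) (Sec N V) (\<lambda>m. co V m \<odot>\<^bsub>Sec N V\<^esub> n)"
      by (rule semilinI) (simp_all add: co[OF V] n co_add[OF V] co_smult[OF V] NV.smult_l_distr NV.smult_assoc1)
  next
    fix V m assume "opn V \<and> V \<subseteq> U \<and> m \<in> carrier (Sec M V)"
    then have V: "opn V" "V \<subseteq> U" and m: "m \<in> carrier (Sec M V)" by auto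
    interpret NV: module "Rg X V" "Sec N V" by (rule N.mods[OF V(1)])
    show "lin (Rg X V) (Sec N V) (Sec N V) (\<lambda>n. co V m \<odot>\<^bsub>Sec N V\<^esub> n)"
      by (rule semilinI) (simp_all add: co[OF V m] NV.smult_r_distr NV.smult_assoc1[symmetric] NV.R.m_comm)
  next
    fix V W m n assume "opn V \<and> opn W \<and> W \<subseteq> V \<and> V \<subseteq> U \<and> m \<in> carrier (Sec M V) \<and> n \<in> carrier (Sec N V)"
    then have V: "opn V" "V \<subseteq> U" and W: "opn W" "W \<subseteq> V" and m: "m \<in> carrier (Sec M V)" and n: "n \<in> carrier (Sec N V)" by auto
    show "Res N V W (co V m \<odot>\<^bsub>Sec N V\<^esub> n) = co W (Res M V W m) \<odot>\<^bsub>Sec N W\<^esub> Res N V W n"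
      using N.res_smult[OF V(1) W co(1)[OF V m] n] co_res[OF V W m] by simp
  qed
  from MN.tensor_lift_on[OF U N this] obtain h where hh: "hom_on X U (tensor X M N) N h \<and>
    (\<forall>V m n. opn V \<and> V \<subseteq> U \<and> m \<in> carrier (Sec M V) \<and> n \<in> carrier (Sec N V)
      \<longrightarrow> h V (tens X M N V m n) = co V m \<odot>\<^bsub>Sec N V\<^esub> n)" ..
  note h = conjunct1[OF hh]
  have ht: "h V (tens X M N V m n) = co V m \<odot>\<^bsub>Sec N V\<^esub> n"
    if "opn V" "V \<subseteq> U" "m \<in> carrier (Sec M V)" "n \<in> carrier (Sec N V)" for V m n
    using conjunct2[OF hh] that by simp
  show ?thesis
  proof (rule bij_betw_byWitness[where f' = "h V"])
    interpret NV: module "Rg X V" "Sec N V" by (rule N.mods[OF V(1)])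
    show "\<forall>n\<in>carrier (Sec N V). h V (tens X M N V (eV V) n) = n"
      using ht[OF V eV[OF V]] co_e[OF V] by simp
    show "tens X M N V (eV V) ` carrier (Sec N V) \<subseteq> carrier (Sec (tensor X M N) V)"
      using MN.tens_closed[OF V(1) eV[OF V]] by blast
    show "h V ` carrier (Sec (tensor X M N) V) \<subseteq> carrier (Sec N V)"
      using hom_on_closed[OF h V] by blast
    show "\<forall>z\<in>carrier (Sec (tensor X M N) V). tens X M N V (eV V) (h V z) = z"
    proof
      fix z assume z: "z \<in> carrier (Sec (tensor X M N) V)"
      have "hom_on X V N (tensor X M N) (\<lambda>W. tens X M N W (eV W))"
        unfolding hom_on_def
      proof (intro conjI allI impI ballI)
        show "lin (Rg X W) (Sec N W) (Sec (tensor X M N) W) (tens X M N W (eV W))" if "opn W \<and> W \<subseteq> V" for W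
          using that V by (intro MN.tens_right eV) auto
        fix W W' n assume "opn W \<and> opn W' \<and> W' \<subseteq> W \<and> W \<subseteq> V" and n: "n \<in> carrier (Sec N W)"
        then have W: "opn W" "opn W'" "W' \<subseteq> W" "W \<subseteq> U" using V by auto
        show "Res (tensor X M N) W W' (tens X M N W (eV W) n) = tens X M N W' (eV W') (Res N W W' n)"
          using MN.tens_res[OF W(1-3) eV[OF W(1,4)] n] res_comp[OF U W(1,2,3,4) e] by simp
      qed
      from hom_on_comp[OF hom_on_subset[OF h V(2)] this]
      have k: "hom_on X V (tensor X M N) (tensor X M N) (\<lambda>W z. tens X M N W (eV W) (h W z))" .
      show "tens X M N V (eV V) (h V z) = z"
      proof (rule MN.tensor_unique[OF V(1) MN.T_mod_sheaf k hom_on_id _ z])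
        fix W m n assume W: "opn W" "W \<subseteq> V" and m: "m \<in> carrier (Sec M W)" and n: "n \<in> carrier (Sec N W)"
        have WU: "W \<subseteq> U" using W V by auto
        have "tens X M N W (eV W) (co W m \<odot>\<^bsub>Sec N W\<^esub> n) = co W m \<odot>\<^bsub>Sec (tensor X M N) W\<^esub> tens X M N W (eV W) n"
          by (rule semilin_smult[OF MN.tens_right[OF W(1) eV[OF W(1) WU]] co(1)[OF W(1) WU m] n])
        also have "\<dots> = tens X M N W (co W m \<odot>\<^bsub>Sec M W\<^esub> eV W) n"
          by (rule semilin_smult[OF MN.tens_left[OF W(1) n] co(1)[OF W(1) WU m] eV[OF W(1) WU], symmetric])
        finally show "tens X M N W (eV W) (h W (tens X M N W m n)) = tens X M N W m n"
          using ht[OF W(1) WU m n] co(2)[OF W(1) WU m] by simp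
      qed
    qed
  qed
qed

end

section \<open>The structure sheaf and duals\<close>

lemma str_mod_simps [simp]:
  "carrier (Sec (str_mod X) U) = carrier (Rg X U)"
  "zero (Sec (str_mod X) U) = zero (Rg X U)"
  "add (Sec (str_mod X) U) = add (Rg X U)"
  "smult (Sec (str_mod X) U) = mult (Rg X U)"
  "Res (str_mod X) = Res (Str X)"
  by (simp_all add: str_mod_def)

context rspace
begin

lemma str_mod_sheaf: "mod_sheaf X (str_mod X)"
  unfolding mod_sheaf_iff
proof
  show "sheaf (Top X) (str_mod X)"
    using str_sheaf unfolding sheaf_def presheaf_def by (simp only: str_mod_simps)
  show "pmod X (str_mod X)"
    unfolding pmod_def
  proof (intro conjI allI impI)
    show "presheaf (Top X) (str_mod X)"
      using str_presheaf unfolding presheaf_def by simp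
    show "module (Rg X U) (Sec (str_mod X) U)" if U: "opn U" for U
    proof (rule module_intro[OF rg_cring[OF U]])
      interpret cring "Rg X U" by (rule rg_cring[OF U])
      show "\<one>\<^bsub>Rg X U\<^esub> \<odot>\<^bsub>Sec (str_mod X) U\<^esub> x = x" if "x \<in> carrier (Sec (str_mod X) U)" for x using that by simp
    qed (simp_all add: cring.cring_simprules[OF rg_cring[OF U]])
    show "semilin (Rg X U) (Sec (str_mod X) U) (Sec (str_mod X) V) (rr U V) (Res (str_mod X) U V)"
      if "opn U \<and> opn V \<and> V \<subseteq> U" for U V
      by (rule semilinI) (use that in \<open>auto simp: rr_closed rr_add rr_mult\<close>)
  qed
qed

end

sublocale rspace \<subseteq> str: msheaf_space X "str_mod X"
  by unfold_locales (rule str_mod_sheaf)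

section \<open>Zero, sums and multiples of morphisms\<close>

context pmod_space
begin

lemma hom_on_cong:
  assumes h: "hom_on X U M N h"
    and eq: "\<And>V m. opn V \<Longrightarrow> V \<subseteq> U \<Longrightarrow> m \<in> carrier (Sec M V) \<Longrightarrow> k V m = h V m"
  shows "hom_on X U M N k"
  unfolding hom_on_def
proof (intro conjI allI impI ballI)
  fix V assume "opn V \<and> V \<subseteq> U"
  then have V: "opn V" "V \<subseteq> U" by auto
  show "lin (Rg X V) (Sec M V) (Sec N V) (k V)"
    by (rule semilinI) (simp_all add: eq[OF V] hom_on_closed[OF h V] hom_on_add[OF h V] hom_on_smult[OF h V]
        add_closed[OF V(1)] smult_closed[OF V(1)])
next
  fix V W m assume "opn V \<and> opn W \<and> W \<subseteq> V \<and> V \<subseteq> U" and m: "m \<in> carrier (Sec M V)"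
  then have o: "opn V" "opn W" "W \<subseteq> V" "V \<subseteq> U" "W \<subseteq> U" by auto
  show "Res N V W (k V m) = k W (Res M V W m)"
    using eq[OF o(1,4) m] eq[OF o(2,5) res_closed[OF o(1-3) m]] hom_on_nat[OF h o(1-4) m] by simp
qed

lemma hom_on_const_zero: "hom_on X U N M (\<lambda>V n. \<zero>\<^bsub>Sec M V\<^esub>)"
  unfolding hom_on_def
proof (intro conjI allI impI ballI)
  fix V assume "opn V \<and> V \<subseteq> U"
  then have V: "opn V" by auto
  interpret module "Rg X V" "Sec M V" by (rule mods[OF V])
  show "lin (Rg X V) (Sec N V) (Sec M V) (\<lambda>n. \<zero>\<^bsub>Sec M V\<^esub>)" by (rule semilinI) auto
qed (simp add: res_zero)

lemma hom_on_plus: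
  assumes h: "hom_on X U N M h" and k: "hom_on X U N M k"
  shows "hom_on X U N M (\<lambda>V n. h V n \<oplus>\<^bsub>Sec M V\<^esub> k V n)"
  unfolding hom_on_def
proof (intro conjI allI impI ballI)
  fix V assume "opn V \<and> V \<subseteq> U"
  then have V: "opn V" "V \<subseteq> U" by auto
  interpret module "Rg X V" "Sec M V" by (rule mods[OF V(1)])
  note c = hom_on_closed[OF h V] hom_on_closed[OF k V]
  show "lin (Rg X V) (Sec N V) (Sec M V) (\<lambda>n. h V n \<oplus>\<^bsub>Sec M V\<^esub> k V n)"
    by (rule semilinI) (simp_all add: hom_on_add[OF h V] hom_on_smult[OF h V] hom_on_add[OF k V] hom_on_smult[OF k V]
        c smult_r_distr M.a_ac)
next
  fix V W n assume "opn V \<and> opn W \<and> W \<subseteq> V \<and> V \<subseteq> U" and n: "n \<in> carrier (Sec N V)"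
  then have o: "opn V" "opn W" "W \<subseteq> V" "V \<subseteq> U" by auto
  show "Res M V W (h V n \<oplus>\<^bsub>Sec M V\<^esub> k V n) = h W (Res N V W n) \<oplus>\<^bsub>Sec M W\<^esub> k W (Res N V W n)"
    using res_add[OF o(1-3) hom_on_closed[OF h o(1,4) n] hom_on_closed[OF k o(1,4) n]]
      hom_on_nat[OF h o n] hom_on_nat[OF k o n] by simp
qed

lemma hom_on_scale:
  assumes U: "opn U" and h: "hom_on X U N M h" and r: "r \<in> carrier (Rg X U)"
  shows "hom_on X U N M (\<lambda>V n. rr U V r \<odot>\<^bsub>Sec M V\<^esub> h V n)"
  unfolding hom_on_def
proof (intro conjI allI impI ballI)
  fix V assume "opn V \<and> V \<subseteq> U"
  then have V: "opn V" "V \<subseteq> U" by auto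
  interpret module "Rg X V" "Sec M V" by (rule mods[OF V(1)])
  show "lin (Rg X V) (Sec N V) (Sec M V) (\<lambda>n. rr U V r \<odot>\<^bsub>Sec M V\<^esub> h V n)"
    by (rule semilinI) (simp_all add: hom_on_add[OF h V] hom_on_smult[OF h V]
        hom_on_closed[OF h V] smult_r_distr rr_closed[OF U V r] smult_assoc1[symmetric] R.m_comm)
next
  fix V W n assume "opn V \<and> opn W \<and> W \<subseteq> V \<and> V \<subseteq> U" and n: "n \<in> carrier (Sec N V)"
  then have o: "opn V" "opn W" "W \<subseteq> V" "V \<subseteq> U" by auto
  show "Res M V W (rr U V r \<odot>\<^bsub>Sec M V\<^esub> h V n) = rr U W r \<odot>\<^bsub>Sec M W\<^esub> h W (Res N V W n)"
    using res_smult[OF o(1-3) rr_closed[OF U o(1,4) r] hom_on_closed[OF h o(1,4) n]]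
      hom_on_nat[OF h o n] rr_comp[OF U o(1-4) r] by simp
qed

end

section \<open>The dual of a module, evaluation and contraction\<close>

locale dual_space = pmod_space X L for X :: "('x, 'r) ringed" and L :: "('x, 'r, 'l) mod_presheaf"
begin

abbreviation "D \<equiv> dual X L"
abbreviation "trim \<equiv> hom_trim X L"

lemma trim_apply: "opn V \<Longrightarrow> V \<subseteq> U \<Longrightarrow> s \<in> carrier (Sec L V) \<Longrightarrow> trim U h V s = h V s"
  by (simp add: hom_trim_def)

lemma trim_cong:
  assumes "\<And>V s. opn V \<Longrightarrow> V \<subseteq> U \<Longrightarrow> s \<in> carrier (Sec L V) \<Longrightarrow> h V s = k V s"
  shows "trim U h = trim U k"
  unfolding hom_trim_def using assms by (auto intro!: ext)

lemma dual_simps [simp]: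
  "\<zero>\<^bsub>Sec D U\<^esub> = trim U (\<lambda>V s. \<zero>\<^bsub>Rg X V\<^esub>)"
  "h \<oplus>\<^bsub>Sec D U\<^esub> k = trim U (\<lambda>V s. h V s \<oplus>\<^bsub>Rg X V\<^esub> k V s)"
  "r \<odot>\<^bsub>Sec D U\<^esub> h = trim U (\<lambda>V s. rr U V r \<otimes>\<^bsub>Rg X V\<^esub> h V s)"
  "Res D U V h = trim V h"
  by (simp_all add: dual_def)

lemma dual_mem: "opn U \<Longrightarrow> h \<in> carrier (Sec D U) \<longleftrightarrow> hom_on X U L (str_mod X) h \<and> trim U h = h"
  by (simp add: dual_def mod_hom_sub_iff)

lemma dual_hom: "opn U \<Longrightarrow> h \<in> carrier (Sec D U) \<Longrightarrow> hom_on X U L (str_mod X) h"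
  by (simp add: dual_mem)

text \<open>Sections of the dual are families of functions in a normal form with
  \<open>undefined\<close> outside the domain; being fixed by \<open>trim\<close>, they are equal as
  soon as their meaningful values are.\<close>

lemma dual_ext:
  assumes U: "opn U" and h: "h \<in> carrier (Sec D U)" and k: "k \<in> carrier (Sec D U)"
    and eq: "\<And>V s. opn V \<Longrightarrow> V \<subseteq> U \<Longrightarrow> s \<in> carrier (Sec L V) \<Longrightarrow> h V s = k V s"
  shows "h = k"
  using trim_cong[of U h k, OF eq] h k by (simp add: dual_mem[OF U])

lemma trim_mem:
  assumes U: "opn U" and h: "hom_on X U L (str_mod X) h"
  shows "trim U h \<in> carrier (Sec D U)"
proof -
  have "hom_on X U L (str_mod X) (trim U h)" by (rule hom_on_cong[OF h]) (simp add: trim_apply)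
  moreover have "trim U (trim U h) = trim U h" by (rule trim_cong) (simp add: trim_apply)
  ultimately show ?thesis by (simp add: dual_mem[OF U])
qed

lemma dual_value: "opn U \<Longrightarrow> h \<in> carrier (Sec D U) \<Longrightarrow> opn V \<Longrightarrow> V \<subseteq> U \<Longrightarrow> s \<in> carrier (Sec L V) \<Longrightarrow> h V s \<in> carrier (Rg X V)"
  using hom_on_closed[OF dual_hom, of U h V s] by simp

lemma dual_closed:
  assumes U: "opn U"
  shows "\<zero>\<^bsub>Sec D U\<^esub> \<in> carrier (Sec D U)"
    and "h \<in> carrier (Sec D U) \<Longrightarrow> k \<in> carrier (Sec D U) \<Longrightarrow> h \<oplus>\<^bsub>Sec D U\<^esub> k \<in> carrier (Sec D U)"
    and "r \<in> carrier (Rg X U) \<Longrightarrow> h \<in> carrier (Sec D U) \<Longrightarrow> r \<odot>\<^bsub>Sec D U\<^esub> h \<in> carrier (Sec D U)"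
    and "opn V \<Longrightarrow> V \<subseteq> U \<Longrightarrow> h \<in> carrier (Sec D U) \<Longrightarrow> Res D U V h \<in> carrier (Sec D V)"
  unfolding dual_simps
  using str.hom_on_const_zero[of U L] str.hom_on_plus[OF dual_hom[OF U] dual_hom[OF U]]
    str.hom_on_scale[OF U dual_hom[OF U]] hom_on_subset[OF dual_hom[OF U]]
  by (auto intro!: trim_mem U)

lemma dual_module:
  assumes U: "opn U"
  shows "module (Rg X U) (Sec D U)"
proof (rule module_intro[OF rg_cring[OF U]])
  note C = dual_closed[OF U]
  interpret R: cring "Rg X U" by (rule rg_cring[OF U])
  show "\<zero>\<^bsub>Sec D U\<^esub> \<in> carrier (Sec D U)" by (rule C)
  fix h assume h: "h \<in> carrier (Sec D U)"
  note S = trim_apply dual_value[OF U]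
  show "\<zero>\<^bsub>Sec D U\<^esub> \<oplus>\<^bsub>Sec D U\<^esub> h = h"
    by (rule dual_ext[OF U C(2)[OF C(1) h] h]) (simp add: S h cring.cring_simprules[OF rg_cring])
  show "\<one>\<^bsub>Rg X U\<^esub> \<odot>\<^bsub>Sec D U\<^esub> h = h"
    by (rule dual_ext[OF U C(3)[OF R.one_closed h] h]) (simp add: S h rr_one[OF U] cring.cring_simprules(12)[OF rg_cring])
  show "\<zero>\<^bsub>Rg X U\<^esub> \<odot>\<^bsub>Sec D U\<^esub> h = \<zero>\<^bsub>Sec D U\<^esub>"
    by (rule dual_ext[OF U C(3)[OF R.zero_closed h] C(1)])
      (simp add: S h str.res_zero[OF U, simplified] cring.cring_simprules(26,27)[OF rg_cring])
  fix k assume k: "k \<in> carrier (Sec D U)"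
  show hk: "h \<oplus>\<^bsub>Sec D U\<^esub> k \<in> carrier (Sec D U)" by (rule C(2)[OF h k])
  show "h \<oplus>\<^bsub>Sec D U\<^esub> k = k \<oplus>\<^bsub>Sec D U\<^esub> h"
    by (rule dual_ext[OF U hk C(2)[OF k h]]) (simp add: S h k cring.cring_simprules[OF rg_cring])
  show "h \<oplus>\<^bsub>Sec D U\<^esub> k \<oplus>\<^bsub>Sec D U\<^esub> l = h \<oplus>\<^bsub>Sec D U\<^esub> (k \<oplus>\<^bsub>Sec D U\<^esub> l)"
    if l: "l \<in> carrier (Sec D U)" for l
    by (rule dual_ext[OF U C(2)[OF hk l] C(2)[OF h C(2)[OF k l]]])
      (simp add: S h k l cring.cring_simprules[OF rg_cring])
  fix r assume r: "r \<in> carrier (Rg X U)"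
  show "r \<odot>\<^bsub>Sec D U\<^esub> h \<in> carrier (Sec D U)" by (rule C(3)[OF r h])
  show "r \<odot>\<^bsub>Sec D U\<^esub> (h \<oplus>\<^bsub>Sec D U\<^esub> k) = r \<odot>\<^bsub>Sec D U\<^esub> h \<oplus>\<^bsub>Sec D U\<^esub> r \<odot>\<^bsub>Sec D U\<^esub> k"
    by (rule dual_ext[OF U C(3)[OF r hk] C(2)[OF C(3)[OF r h] C(3)[OF r k]]])
      (simp add: S h k rr_closed[OF U _ _ r] cring.cring_simprules[OF rg_cring])
  fix q assume q: "q \<in> carrier (Rg X U)"
  show "(r \<oplus>\<^bsub>Rg X U\<^esub> q) \<odot>\<^bsub>Sec D U\<^esub> h = r \<odot>\<^bsub>Sec D U\<^esub> h \<oplus>\<^bsub>Sec D U\<^esub> q \<odot>\<^bsub>Sec D U\<^esub> h"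
    by (rule dual_ext[OF U C(3)[OF R.a_closed[OF r q] h] C(2)[OF C(3)[OF r h] C(3)[OF q h]]])
      (simp add: S h rr_closed[OF U _ _ r] rr_closed[OF U _ _ q] rr_add[OF U _ _ r q] cring.cring_simprules[OF rg_cring])
  show "(r \<otimes>\<^bsub>Rg X U\<^esub> q) \<odot>\<^bsub>Sec D U\<^esub> h = r \<odot>\<^bsub>Sec D U\<^esub> (q \<odot>\<^bsub>Sec D U\<^esub> h)"
    by (rule dual_ext[OF U C(3)[OF R.m_closed[OF r q] h] C(3)[OF r C(3)[OF q h]]])
      (simp add: S h rr_closed[OF U _ _ r] rr_closed[OF U _ _ q] rr_mult[OF U _ _ r q] cring.cring_simprules[OF rg_cring])
qed

lemma dual_pmod: "pmod X D"
  unfolding pmod_def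
proof (intro conjI allI impI dual_module)
  note S = trim_apply dual_value
  show "presheaf (Top X) D"
    unfolding presheaf_def
  proof (intro conjI allI impI)
    fix U V assume "opn U \<and> opn V \<and> V \<subseteq> U"
    then show "Res D U V \<in> carrier (Sec D U) \<rightarrow> carrier (Sec D V)" using dual_closed(4) by blast
  next
    fix U h assume "opn U \<and> h \<in> carrier (Sec D U)"
    then show "Res D U U h = h" using dual_mem by auto
  next
    fix U V W h assume "opn U \<and> opn V \<and> opn W \<and> W \<subseteq> V \<and> V \<subseteq> U \<and> h \<in> carrier (Sec D U)"
    then show "Res D V W (Res D U V h) = Res D U W h"
      unfolding dual_simps by (intro trim_cong trim_apply) auto
  qed
  fix U V assume "opn U \<and> opn V \<and> V \<subseteq> U"
  then have o: "opn U" "opn V" "V \<subseteq> U" by auto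
  note C = dual_closed[OF o(1)] and CV = dual_closed[OF o(2)]
  have VU: "W \<subseteq> U" if "W \<subseteq> V" for W using that o(3) by auto
  show "semilin (Rg X U) (Sec D U) (Sec D V) (rr U V) (Res D U V)"
  proof (rule semilinI)
    fix h assume h: "h \<in> carrier (Sec D U)"
    show h': "Res D U V h \<in> carrier (Sec D V)" by (rule C(4)[OF o(2,3) h])
    show "Res D U V (h \<oplus>\<^bsub>Sec D U\<^esub> k) = Res D U V h \<oplus>\<^bsub>Sec D V\<^esub> Res D U V k" if k: "k \<in> carrier (Sec D U)" for k
      by (rule dual_ext[OF o(2) C(4)[OF o(2,3) C(2)[OF h k]] CV(2)[OF h' C(4)[OF o(2,3) k]]])
        (simp add: S VU)
    show "Res D U V (r \<odot>\<^bsub>Sec D U\<^esub> h) = rr U V r \<odot>\<^bsub>Sec D V\<^esub> Res D U V h" if r: "r \<in> carrier (Rg X U)" for r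
      by (rule dual_ext[OF o(2) C(4)[OF o(2,3) C(3)[OF r h]] CV(3)[OF rr_closed[OF o r] h']])
        (simp add: S VU rr_comp[OF o(1,2) _ _ o(3) r])
  qed
qed

sublocale D: pmod_space X D
  by unfold_locales (rule dual_pmod)

sublocale DL: tensor_space X D L
  by unfold_locales

lemma eval_bilin: "bilin X TX D L (str_mod X) (\<lambda>U u e. u U e)"
  unfolding bilin_def
proof (intro conjI allI impI)
  fix V n assume "opn V \<and> V \<subseteq> TX \<and> n \<in> carrier (Sec L V)"
  then have V: "opn V" and n: "n \<in> carrier (Sec L V)" by auto
  show "lin (Rg X V) (Sec D V) (Sec (str_mod X) V) (\<lambda>u. u V n)"
    by (rule semilinI) (simp_all add: dual_value[OF V _ V subset_refl n] trim_apply[OF V subset_refl n] rr_id[OF V])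
next
  fix V u assume "opn V \<and> V \<subseteq> TX \<and> u \<in> carrier (Sec D V)"
  then show "lin (Rg X V) (Sec L V) (Sec (str_mod X) V) (u V)"
    using hom_on_lin[OF dual_hom, of V u V] by simp
next
  fix V W u e assume "opn V \<and> opn W \<and> W \<subseteq> V \<and> V \<subseteq> TX \<and> u \<in> carrier (Sec D V) \<and> e \<in> carrier (Sec L V)"
  then have o: "opn V" "opn W" "W \<subseteq> V" and u: "u \<in> carrier (Sec D V)" and e: "e \<in> carrier (Sec L V)" by auto
  show "Res (str_mod X) V W (u V e) = Res D V W u W (Res L V W e)"
    using hom_on_nat[OF dual_hom[OF o(1) u] o subset_refl e] trim_apply[OF o(2) subset_refl res_closed[OF o e]] by simp
qed

lemma eval_hom: "hom_on X TX (tensor X D L) (str_mod X) (evaluation X L)"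
  and eval_tens: "opn U \<Longrightarrow> u \<in> carrier (Sec D U) \<Longrightarrow> e \<in> carrier (Sec L U)
    \<Longrightarrow> evaluation X L U (tens X D L U u e) = u U e"
  unfolding evaluation_def by (rule DL.tensor_lift_spec[OF str_mod_sheaf eval_bilin]; assumption)+

text \<open>The required formula is trilinear, while the universal property handles two factors at a
  time. For a section \<open>u\<close> of the dual over \<open>U\<close>, the bilinear map
  \<open>(e, g) \<mapsto> u e \<odot> g\<close> yields a morphism \<open>\<gamma> U u\<close> on
  \<open>L \<otimes> G\<close> over \<open>U\<close>. The assignment
  \<open>(u, w) \<mapsto> \<gamma> U u U w\<close> is then shown to be bilinear and is lifted in
  turn.\<close>

lemma contraction_exists:
  fixes G :: "('x, 'r, 'g) mod_presheaf"
  assumes G: "mod_sheaf X G"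
  shows "\<exists>h. hom_on X TX (tensor X D (tensor X L G)) G h \<and>
     (\<forall>U u e g. opn U \<and> u \<in> carrier (Sec D U) \<and> e \<in> carrier (Sec L U) \<and> g \<in> carrier (Sec G U) \<longrightarrow>
        h U (tens X D (tensor X L G) U u (tens X L G U e g)) = u U e \<odot>\<^bsub>Sec G U\<^esub> g)"
proof -
  interpret G: msheaf_space X G by unfold_locales (rule G)
  interpret LG: tensor_space X L G by unfold_locales
  interpret DLG: tensor_space X D "tensor X L G" by unfold_locales
  have "bilin X U L G G (\<lambda>V e g. u V e \<odot>\<^bsub>Sec G V\<^esub> g)" if U: "opn U" and u: "u \<in> carrier (Sec D U)" for U u
    unfolding bilin_def
  proof (intro conjI allI impI)
    fix V g assume "opn V \<and> V \<subseteq> U \<and> g \<in> carrier (Sec G V)"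
    then have V: "opn V" "V \<subseteq> U" and g: "g \<in> carrier (Sec G V)" by auto
    interpret GV: module "Rg X V" "Sec G V" by (rule G.mods[OF V(1)])
    note H = dual_value[OF U u V] hom_on_add[OF dual_hom[OF U u] V] hom_on_smult[OF dual_hom[OF U u] V]
    show "lin (Rg X V) (Sec L V) (Sec G V) (\<lambda>e. u V e \<odot>\<^bsub>Sec G V\<^esub> g)"
      by (rule semilinI) (simp_all add: H g GV.smult_l_distr GV.smult_assoc1)
  next
    fix V e assume "opn V \<and> V \<subseteq> U \<and> e \<in> carrier (Sec L V)"
    then have V: "opn V" "V \<subseteq> U" and e: "e \<in> carrier (Sec L V)" by auto
    interpret GV: module "Rg X V" "Sec G V" by (rule G.mods[OF V(1)])
    show "lin (Rg X V) (Sec G V) (Sec G V) (\<lambda>g. u V e \<odot>\<^bsub>Sec G V\<^esub> g)"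
      by (rule semilinI) (simp_all add: dual_value[OF U u V e] GV.smult_r_distr GV.smult_assoc1[symmetric] GV.R.m_comm)
  next
    fix V W e g assume "opn V \<and> opn W \<and> W \<subseteq> V \<and> V \<subseteq> U \<and> e \<in> carrier (Sec L V) \<and> g \<in> carrier (Sec G V)"
    then have o: "opn V" "opn W" "W \<subseteq> V" "V \<subseteq> U" and e: "e \<in> carrier (Sec L V)" and g: "g \<in> carrier (Sec G V)" by auto
    show "Res G V W (u V e \<odot>\<^bsub>Sec G V\<^esub> g) = u W (Res L V W e) \<odot>\<^bsub>Sec G W\<^esub> Res G V W g"
      using G.res_smult[OF o(1-3) dual_value[OF U u o(1,4) e] g] hom_on_nat[OF dual_hom[OF U u] o e] by simp
  qed
  note ex = LG.tensor_lift_on[OF _ G this]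
  \<comment> \<open>The morphisms for different \<open>u\<close> are chosen independently. Linearity
    in \<open>u\<close> and compatibility with restriction are regained from uniqueness: both sides
    agree on pure tensors \<open>e \<otimes> g\<close>.\<close>
  define \<gamma> where "\<gamma> U u = (SOME h. hom_on X U (tensor X L G) G h \<and> (\<forall>V e g. opn V \<and> V \<subseteq> U \<and> e \<in> carrier (Sec L V) \<and>
    g \<in> carrier (Sec G V) \<longrightarrow> h V (tens X L G V e g) = u V e \<odot>\<^bsub>Sec G V\<^esub> g))" for U u
  have "hom_on X U (tensor X L G) G (\<gamma> U u) \<and> (\<forall>V e g. opn V \<and> V \<subseteq> U \<and> e \<in> carrier (Sec L V) \<and>
    g \<in> carrier (Sec G V) \<longrightarrow> \<gamma> U u V (tens X L G V e g) = u V e \<odot>\<^bsub>Sec G V\<^esub> g)"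
    if "opn U" "u \<in> carrier (Sec D U)" for U u
    unfolding \<gamma>_def by (rule someI_ex[OF ex[OF that(1) that]])
  then have gh: "\<And>U u. opn U \<Longrightarrow> u \<in> carrier (Sec D U) \<Longrightarrow> hom_on X U (tensor X L G) G (\<gamma> U u)"
    and gt: "\<And>U u V e g. opn U \<Longrightarrow> u \<in> carrier (Sec D U) \<Longrightarrow> opn V \<Longrightarrow> V \<subseteq> U \<Longrightarrow> e \<in> carrier (Sec L V)
      \<Longrightarrow> g \<in> carrier (Sec G V) \<Longrightarrow> \<gamma> U u V (tens X L G V e g) = u V e \<odot>\<^bsub>Sec G V\<^esub> g"
    by simp_all
  have "bilin X TX D (tensor X L G) G (\<lambda>U u. \<gamma> U u U)"
    unfolding bilin_def
  proof (intro conjI allI impI)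
    fix U w assume "opn U \<and> U \<subseteq> TX \<and> w \<in> carrier (Sec (tensor X L G) U)"
    then have U: "opn U" and w: "w \<in> carrier (Sec (tensor X L G) U)" by auto
    note C = dual_closed[OF U]
    show "lin (Rg X U) (Sec D U) (Sec G U) (\<lambda>u. \<gamma> U u U w)"
    proof (rule semilinI)
      fix u assume u: "u \<in> carrier (Sec D U)"
      show "\<gamma> U u U w \<in> carrier (Sec G U)" by (rule hom_on_closed[OF gh[OF U u] U subset_refl w])
      show "\<gamma> U (u \<oplus>\<^bsub>Sec D U\<^esub> v) U w = \<gamma> U u U w \<oplus>\<^bsub>Sec G U\<^esub> \<gamma> U v U w" if v: "v \<in> carrier (Sec D U)" for v
      proof (rule LG.tensor_unique[OF U G gh[OF U C(2)[OF u v]] G.hom_on_plus[OF gh[OF U u] gh[OF U v]] _ w])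
        fix V e g assume V: "opn V" "V \<subseteq> U" and e: "e \<in> carrier (Sec L V)" and g: "g \<in> carrier (Sec G V)"
        interpret GV: module "Rg X V" "Sec G V" by (rule G.mods[OF V(1)])
        show "\<gamma> U (u \<oplus>\<^bsub>Sec D U\<^esub> v) V (tens X L G V e g) = \<gamma> U u V (tens X L G V e g) \<oplus>\<^bsub>Sec G V\<^esub> \<gamma> U v V (tens X L G V e g)"
          unfolding gt[OF U C(2)[OF u v] V e g] gt[OF U u V e g] gt[OF U v V e g]
          by (simp add: trim_apply[OF V e] GV.smult_l_distr dual_value[OF U _ V e] u v g)
      qed
      show "\<gamma> U (r \<odot>\<^bsub>Sec D U\<^esub> u) U w = r \<odot>\<^bsub>Sec G U\<^esub> \<gamma> U u U w" if r: "r \<in> carrier (Rg X U)" for r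
      proof -
        \<comment> \<open>The scalar appears as \<open>rr U U r\<close> because a multiple of a
          morphism acts over each \<open>V\<close> by the restriction of \<open>r\<close> to
          \<open>V\<close>.\<close>
        have "\<gamma> U (r \<odot>\<^bsub>Sec D U\<^esub> u) U w = rr U U r \<odot>\<^bsub>Sec G U\<^esub> \<gamma> U u U w"
        proof (rule LG.tensor_unique[OF U G gh[OF U C(3)[OF r u]] G.hom_on_scale[OF U gh[OF U u] r] _ w])
          fix V e g assume V: "opn V" "V \<subseteq> U" and e: "e \<in> carrier (Sec L V)" and g: "g \<in> carrier (Sec G V)"
          interpret GV: module "Rg X V" "Sec G V" by (rule G.mods[OF V(1)])
          show "\<gamma> U (r \<odot>\<^bsub>Sec D U\<^esub> u) V (tens X L G V e g) = rr U V r \<odot>\<^bsub>Sec G V\<^esub> \<gamma> U u V (tens X L G V e g)"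
            unfolding gt[OF U C(3)[OF r u] V e g] gt[OF U u V e g]
            by (simp add: trim_apply[OF V e] GV.smult_assoc1 dual_value[OF U _ V e] u g rr_closed[OF U V r])
        qed
        then show ?thesis by (simp add: rr_id[OF U r])
      qed
    qed
  next
    fix U u assume "opn U \<and> U \<subseteq> TX \<and> u \<in> carrier (Sec D U)"
    then show "lin (Rg X U) (Sec (tensor X L G) U) (Sec G U) (\<gamma> U u U)"
      using hom_on_lin[OF gh, of U u U] by simp
  next
    fix U V u w assume "opn U \<and> opn V \<and> V \<subseteq> U \<and> U \<subseteq> TX \<and> u \<in> carrier (Sec D U) \<and> w \<in> carrier (Sec (tensor X L G) U)"
    then have o: "opn U" "opn V" "V \<subseteq> U" and u: "u \<in> carrier (Sec D U)" and w: "w \<in> carrier (Sec (tensor X L G) U)" by auto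
    note uV = dual_closed(4)[OF o(1-3) u]
    \<comment> \<open>The morphism chosen for \<open>u\<close> over \<open>U\<close>, used over
      \<open>V\<close>, against the one chosen for the restriction of \<open>u\<close> to
      \<open>V\<close>.\<close>
    have "\<gamma> U u V (Res (tensor X L G) U V w) = \<gamma> V (Res D U V u) V (Res (tensor X L G) U V w)"
    proof (rule LG.tensor_unique[OF o(2) G hom_on_subset[OF gh[OF o(1) u] o(3)] gh[OF o(2) uV] _ LG.T.res_closed[OF o w]])
      fix W e g assume W: "opn W" "W \<subseteq> V" and e: "e \<in> carrier (Sec L W)" and g: "g \<in> carrier (Sec G W)"
      have WU: "W \<subseteq> U" using W o by auto
      show "\<gamma> U u W (tens X L G W e g) = \<gamma> V (Res D U V u) W (tens X L G W e g)"
        unfolding gt[OF o(1) u W(1) WU e g] gt[OF o(2) uV W e g] by (simp add: trim_apply[OF W e])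
    qed
    then show "Res G U V (\<gamma> U u U w) = \<gamma> V (Res D U V u) V (Res (tensor X L G) U V w)"
      using hom_on_nat[OF gh[OF o(1) u] o subset_refl w] by simp
  qed
  note sp = DLG.tensor_lift_spec[OF G this]
  show ?thesis
  proof (intro exI conjI allI impI)
    show "hom_on X TX (tensor X D (tensor X L G)) G (tensor_lift X D (tensor X L G) G (\<lambda>U u. \<gamma> U u U))" by (rule sp(1))
    fix U u e g assume "opn U \<and> u \<in> carrier (Sec D U) \<and> e \<in> carrier (Sec L U) \<and> g \<in> carrier (Sec G U)"
    then show "tensor_lift X D (tensor X L G) G (\<lambda>U u. \<gamma> U u U) U (tens X D (tensor X L G) U u (tens X L G U e g)) = u U e \<odot>\<^bsub>Sec G U\<^esub> g"
      using sp(2)[of U u "tens X L G U e g"] LG.tens_closed[of U e g] gt[of U u U e g] by simp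
  qed
qed

lemma contraction_spec:
  fixes G :: "('x, 'r, 'g) mod_presheaf"
  assumes G: "mod_sheaf X G"
  shows "hom_on X TX (tensor X D (tensor X L G)) G (contraction X L G)"
    and "opn U \<Longrightarrow> u \<in> carrier (Sec D U) \<Longrightarrow> e \<in> carrier (Sec L U) \<Longrightarrow> g \<in> carrier (Sec G U) \<Longrightarrow>
      contraction X L G U (tens X D (tensor X L G) U u (tens X L G U e g)) = u U e \<odot>\<^bsub>Sec G U\<^esub> g"
proof -
  have "mod_hom X (tensor X D (tensor X L G)) G (contraction X L G) \<and>
     (\<forall>U u e g. opn U \<and> u \<in> carrier (Sec D U) \<and> e \<in> carrier (Sec L U) \<and> g \<in> carrier (Sec G U) \<longrightarrow>
        contraction X L G U (tens X D (tensor X L G) U u (tens X L G U e g)) = u U e \<odot>\<^bsub>Sec G U\<^esub> g)"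
    unfolding contraction_def by (rule someI_ex[OF contraction_exists[OF G, folded mod_hom_iff]])
  then show "hom_on X TX (tensor X D (tensor X L G)) G (contraction X L G)"
    "opn U \<Longrightarrow> u \<in> carrier (Sec D U) \<Longrightarrow> e \<in> carrier (Sec L U) \<Longrightarrow> g \<in> carrier (Sec G U) \<Longrightarrow>
      contraction X L G U (tens X D (tensor X L G) U u (tens X L G U e g)) = u U e \<odot>\<^bsub>Sec G U\<^esub> g"
    by (simp_all add: mod_hom_iff)
qed

end

locale dual_gen_space = dual_space X L + free_gen_space X L U e
  for X :: "('x, 'r) ringed" and L :: "('x, 'r, 'l) mod_presheaf" and U e
begin

text \<open>The coordinate function of \<open>e\<close>, put into the normal form of sections of the
  dual: the dual generator.\<close>

definition "du = trim U co"

lemma co_hom: "hom_on X U L (str_mod X) co"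
  unfolding hom_on_def
proof (intro conjI allI impI ballI)
  fix V assume "opn V \<and> V \<subseteq> U"
  then show "lin (Rg X V) (Sec L V) (Sec (str_mod X) V) (co V)"
    by (intro semilinI) (simp_all add: co co_add co_smult)
qed (simp add: co_res)

lemma du: "du \<in> carrier (Sec D U)"
  unfolding du_def by (rule trim_mem[OF U co_hom])

lemma du_apply: "opn V \<Longrightarrow> V \<subseteq> U \<Longrightarrow> s \<in> carrier (Sec L V) \<Longrightarrow> du V s = co V s"
  by (simp add: du_def trim_apply)

lemma du_e: "opn V \<Longrightarrow> V \<subseteq> U \<Longrightarrow> du V (eV V) = \<one>\<^bsub>Rg X V\<^esub>"
  by (simp add: du_apply eV co_e)

text \<open>A functional \<open>v\<close> is determined by its value at the generator,
  \<open>v s = co s \<cdot> v e\<close>, that is \<open>v = v e \<odot> du\<close>. So the inverse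
  of multiplication with \<open>du\<close> is evaluation at \<open>e\<close>.\<close>

lemma du_free_gen: "free_gen X D U du"
  unfolding free_gen_def
proof (intro conjI allI impI U du)
  fix V assume "opn V \<and> V \<subseteq> U"
  then have V: "opn V" "V \<subseteq> U" by auto
  interpret RV: cring "Rg X V" by (rule rg_cring[OF V(1)])
  note duV = dual_closed(4)[OF U V du]
  have val: "(r \<odot>\<^bsub>Sec D V\<^esub> Res D U V du) W s = rr V W r \<otimes>\<^bsub>Rg X W\<^esub> co W s"
    if "opn W" "W \<subseteq> V" "s \<in> carrier (Sec L W)" for r W s
    using that V by (simp add: trim_apply du_apply)
  show "bij_betw (\<lambda>r. r \<odot>\<^bsub>Sec D V\<^esub> Res D U V du) (carrier (Rg X V)) (carrier (Sec D V))"
  proof (rule bij_betw_byWitness[where f' = "\<lambda>v. v V (eV V)"])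
    show "\<forall>r\<in>carrier (Rg X V). (r \<odot>\<^bsub>Sec D V\<^esub> Res D U V du) V (eV V) = r"
      using val[OF V(1) subset_refl eV[OF V]] by (simp add: rr_id[OF V(1)] co_e[OF V] del: dual_simps)
    show "(\<lambda>r. r \<odot>\<^bsub>Sec D V\<^esub> Res D U V du) ` carrier (Rg X V) \<subseteq> carrier (Sec D V)"
      using dual_closed(3)[OF V(1) _ duV] by blast
    show "(\<lambda>v. v V (eV V)) ` carrier (Sec D V) \<subseteq> carrier (Rg X V)"
      using dual_value[OF V(1) _ V(1) subset_refl eV[OF V]] by blast
    show "\<forall>v\<in>carrier (Sec D V). v V (eV V) \<odot>\<^bsub>Sec D V\<^esub> Res D U V du = v"
    proof
      fix v assume v: "v \<in> carrier (Sec D V)"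
      note vr = dual_value[OF V(1) v V(1) subset_refl eV[OF V]]
      show "v V (eV V) \<odot>\<^bsub>Sec D V\<^esub> Res D U V du = v"
      proof (rule dual_ext[OF V(1) dual_closed(3)[OF V(1) vr duV] v])
        fix W s assume W: "opn W" "W \<subseteq> V" and s: "s \<in> carrier (Sec L W)"
        have WU: "W \<subseteq> U" using W V by auto
        interpret RW: cring "Rg X W" by (rule rg_cring[OF W(1)])
        have "v W s = v W (co W s \<odot>\<^bsub>Sec L W\<^esub> eV W)" by (simp add: co(2)[OF W(1) WU s])
        also have "\<dots> = co W s \<otimes>\<^bsub>Rg X W\<^esub> v W (eV W)"
          using hom_on_smult[OF dual_hom[OF V(1) v] W co(1)[OF W(1) WU s] eV[OF W(1) WU]] by simp
        also have "v W (eV W) = rr V W (v V (eV V))"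
          using hom_on_nat[OF dual_hom[OF V(1) v] V(1) W subset_refl eV[OF V]] res_comp[OF U V(1) W V(2) e] by simp
        finally show "(v V (eV V) \<odot>\<^bsub>Sec D V\<^esub> Res D U V du) W s = v W s"
          unfolding val[OF W s] using rr_closed[OF V(1) W vr] co(1)[OF W(1) WU s] by (simp add: RW.m_comm)
      qed
    qed
  qed
qed

sublocale dug: free_gen_space X D U du
  by unfold_locales (rule du_free_gen)

end

text \<open>The composites of the two swaps fix pure tensors, hence are identities. The swap
  mediates between the Atiyah class, whose kernel term is \<open>G \<otimes> L\<close>, and the map
  to H^1, which starts from extensions by \<open>L \<otimes> G\<close>.\<close>

lemma tensor_swap_iso:
  fixes X :: "('x, 'r) ringed" and M :: "('x, 'r, 'm) mod_presheaf" and N :: "('x, 'r, 'n) mod_presheaf"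
  assumes X: "ringed_space X" and M: "pmod X M" and N: "pmod X N"
  shows "mod_iso X (tensor X M N) (tensor X N M) (tensor_swap X M N)"
    and "openin (Top X) U \<Longrightarrow> m \<in> carrier (Sec M U) \<Longrightarrow> n \<in> carrier (Sec N U)
      \<Longrightarrow> tensor_swap X M N U (tens X M N U m n) = tens X N M U n m"
proof -
  interpret M: pmod_space X M by unfold_locales (rule X, rule M)
  interpret N: pmod_space X N by unfold_locales (rule N)
  interpret MN: tensor_space X M N by unfold_locales
  interpret NM: tensor_space X N M by unfold_locales
  have "bilin X M.TX M N (tensor X N M) (\<lambda>U m n. tens X N M U n m)"
    unfolding bilin_def by (simp add: NM.tens_left NM.tens_right NM.tens_res)
  note s1 = MN.tensor_lift_spec[OF NM.T_mod_sheaf this, folded tensor_swap_def]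
  have "bilin X M.TX N M (tensor X M N) (\<lambda>U n m. tens X M N U m n)"
    unfolding bilin_def by (simp add: MN.tens_left MN.tens_right MN.tens_res)
  note s2 = NM.tensor_lift_spec[OF MN.T_mod_sheaf this, folded tensor_swap_def]
  show "mod_iso X (tensor X M N) (tensor X N M) (tensor_swap X M N)"
    unfolding mod_iso_def mod_hom_iff
  proof (intro conjI allI impI s1(1))
    fix U assume U: "M.opn U"
    note h = hom_on_top[OF s1(1) U] hom_on_top[OF s2(1) U]
    show "bij_betw (tensor_swap X M N U) (carrier (Sec (tensor X M N) U)) (carrier (Sec (tensor X N M) U))"
    proof (rule bij_betw_byWitness[where f' = "tensor_swap X N M U"])
      show "\<forall>z\<in>carrier (Sec (tensor X M N) U). tensor_swap X N M U (tensor_swap X M N U z) = z"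
        by (intro ballI MN.tensor_unique[OF U MN.T_mod_sheaf hom_on_comp[OF h(1,2)] hom_on_id])
          (simp_all add: s1(2) s2(2))
      show "\<forall>z\<in>carrier (Sec (tensor X N M) U). tensor_swap X M N U (tensor_swap X N M U z) = z"
        by (intro ballI NM.tensor_unique[OF U NM.T_mod_sheaf hom_on_comp[OF h(2,1)] hom_on_id])
          (simp_all add: s1(2) s2(2))
    qed (use hom_on_closed[OF h(1) U subset_refl] hom_on_closed[OF h(2) U subset_refl] in auto)
  qed
  show "openin (Top X) U \<Longrightarrow> m \<in> carrier (Sec M U) \<Longrightarrow> n \<in> carrier (Sec N U)
      \<Longrightarrow> tensor_swap X M N U (tens X M N U m n) = tens X N M U n m"
    by (rule s1(2))
qed

section \<open>Extensions\<close>

lemma ex1_eq_elem: "\<exists>!x. P x \<Longrightarrow> P a \<Longrightarrow> P b \<Longrightarrow> a = b"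
  by blast

lemma extension_iff: "extension X E G (B, i, p) \<longleftrightarrow>
    mod_sheaf X B \<and> hom_on X (topspace (Top X)) G B i \<and> hom_on X (topspace (Top X)) B E p \<and>
    (\<forall>U. openin (Top X) U \<longrightarrow>
        inj_on (i U) (carrier (Sec G U)) \<and>
        {b \<in> carrier (Sec B U). p U b = \<zero>\<^bsub>Sec E U\<^esub>} = i U ` carrier (Sec G U) \<and>
        (\<forall>e\<in>carrier (Sec E U). \<forall>x\<in>U. \<exists>V b. openin (Top X) V \<and> x \<in> V \<and> V \<subseteq> U \<and>
           b \<in> carrier (Sec B V) \<and> p V b = Res E U V e))"
  by (simp add: extension_def mod_hom_iff)

lemma ext_equiv_iff: "ext_equiv X E G (B, i, p) (B', i', p') \<longleftrightarrow> (\<exists>h. mod_iso X B B' h \<and>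
     (\<forall>U. openin (Top X) U \<longrightarrow>
        (\<forall>g\<in>carrier (Sec G U). h U (i U g) = i' U g) \<and>
        (\<forall>b\<in>carrier (Sec B U). p' U (h U b) = p U b)))"
  by (simp add: ext_equiv_def)

locale ext_space = rspace X + E: pmod_space X E + G: pmod_space X G + B: msheaf_space X B
  for X :: "('x, 'r) ringed" and E :: "('x, 'r, 'e) mod_presheaf" and G :: "('x, 'r, 'g) mod_presheaf"
    and B :: "('x, 'r, 'b) mod_presheaf" +
  fixes i p
  assumes i_hom: "hom_on X TX G B i" and p_hom: "hom_on X TX B E p"
    and i_inj: "opn U \<Longrightarrow> inj_on (i U) (carrier (Sec G U))"
    and p_ker: "opn U \<Longrightarrow> {b \<in> carrier (Sec B U). p U b = \<zero>\<^bsub>Sec E U\<^esub>} = i U ` carrier (Sec G U)"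
    and p_surj: "opn U \<Longrightarrow> e \<in> carrier (Sec E U) \<Longrightarrow> x \<in> U \<Longrightarrow> \<exists>V b. opn V \<and> x \<in> V \<and> V \<subseteq> U \<and>
           b \<in> carrier (Sec B V) \<and> p V b = Res E U V e"
begin

lemma i_closed: "opn U \<Longrightarrow> g \<in> carrier (Sec G U) \<Longrightarrow> i U g \<in> carrier (Sec B U)"
  and i_add: "opn U \<Longrightarrow> g \<in> carrier (Sec G U) \<Longrightarrow> g' \<in> carrier (Sec G U)
    \<Longrightarrow> i U (g \<oplus>\<^bsub>Sec G U\<^esub> g') = i U g \<oplus>\<^bsub>Sec B U\<^esub> i U g'"
  and i_res: "opn U \<Longrightarrow> opn V \<Longrightarrow> V \<subseteq> U \<Longrightarrow> g \<in> carrier (Sec G U) \<Longrightarrow> Res B U V (i U g) = i V (Res G U V g)"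
  by (rule hom_on_closed[OF i_hom] hom_on_add[OF i_hom] hom_on_nat[OF i_hom]; (assumption | erule openin_subset))+

lemma p_closed: "opn U \<Longrightarrow> b \<in> carrier (Sec B U) \<Longrightarrow> p U b \<in> carrier (Sec E U)"
  and p_smult: "opn U \<Longrightarrow> r \<in> carrier (Rg X U) \<Longrightarrow> b \<in> carrier (Sec B U)
    \<Longrightarrow> p U (r \<odot>\<^bsub>Sec B U\<^esub> b) = r \<odot>\<^bsub>Sec E U\<^esub> p U b"
  and p_res: "opn U \<Longrightarrow> opn V \<Longrightarrow> V \<subseteq> U \<Longrightarrow> b \<in> carrier (Sec B U) \<Longrightarrow> Res E U V (p U b) = p V (Res B U V b)"
  by (rule hom_on_closed[OF p_hom] hom_on_smult[OF p_hom] hom_on_nat[OF p_hom]; (assumption | erule openin_subset))+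

lemma p_diff: "opn U \<Longrightarrow> b \<in> carrier (Sec B U) \<Longrightarrow> b' \<in> carrier (Sec B U)
    \<Longrightarrow> p U (b \<ominus>\<^bsub>Sec B U\<^esub> b') = p U b \<ominus>\<^bsub>Sec E U\<^esub> p U b'"
  using hom_on_diff[OF p_hom _ _ B.pmod E.pmod] openin_subset by blast

lemma p_i: "opn U \<Longrightarrow> g \<in> carrier (Sec G U) \<Longrightarrow> p U (i U g) = \<zero>\<^bsub>Sec E U\<^esub>"
  using p_ker[of U] by blast

lemma p_eqD:
  assumes U: "opn U" and b: "b \<in> carrier (Sec B U)" "b' \<in> carrier (Sec B U)" and eq: "p U b = p U b'"
  shows "\<exists>g\<in>carrier (Sec G U). i U g = b \<ominus>\<^bsub>Sec B U\<^esub> b'"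
proof -
  interpret BU: module "Rg X U" "Sec B U" by (rule B.mods[OF U])
  have "p U (b \<ominus>\<^bsub>Sec B U\<^esub> b') = \<zero>\<^bsub>Sec E U\<^esub>"
    using p_diff[OF U b] eq module_zero_diff[OF E.mods[OF U] p_closed[OF U b(2)]] by simp
  moreover have "b \<ominus>\<^bsub>Sec B U\<^esub> b' \<in> carrier (Sec B U)" using b by simp
  ultimately have "b \<ominus>\<^bsub>Sec B U\<^esub> b' \<in> i U ` carrier (Sec G U)" using p_ker[OF U] by blast
  then show ?thesis by force
qed

text \<open>An extension is moved along an isomorphism of its middle term. Applied to a transported
  copy, this yields an equivalent extension whose middle term lives on another type.\<close>

lemma iso_image:
  fixes B' :: "('x, 'r, 'c) mod_presheaf"
  assumes B': "mod_sheaf X B'" and iso: "mod_iso X B B' h"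
  defines "k \<equiv> \<lambda>U. inv_into (carrier (Sec B U)) (h U)"
  shows "extension X E G (B', \<lambda>U g. h U (i U g), \<lambda>U b. p U (k U b))"
    and "ext_equiv X E G (B, i, p) (B', \<lambda>U g. h U (i U g), \<lambda>U b. p U (k U b))"
proof -
  interpret B': msheaf_space X B' by unfold_locales (rule B')
  have hom: "hom_on X TX B B' h" and bij: "\<And>U. opn U \<Longrightarrow> bij_betw (h U) (carrier (Sec B U)) (carrier (Sec B' U))"
    using iso by (auto simp: mod_iso_def mod_hom_iff)
  have k: "hom_on X TX B' B k"
    unfolding k_def by (rule mod_iso_inverse[OF ringed B.pmod B'.pmod iso])
  have kh: "k U (h U b) = b" if "opn U" "b \<in> carrier (Sec B U)" for U b
    using bij[OF that(1)] that(2) by (simp add: k_def bij_betw_def inv_into_f_f)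
  have hk: "h U (k U b) = b" "k U b \<in> carrier (Sec B U)" if "opn U" "b \<in> carrier (Sec B' U)" for U b
    using bij[OF that(1)] that(2) by (auto simp: k_def bij_betw_def f_inv_into_f inv_into_into)
  have hc: "h U b \<in> carrier (Sec B' U)" if "opn U" "b \<in> carrier (Sec B U)" for U b
    using bij[OF that(1)] that(2) by (auto simp: bij_betw_def)
  show "extension X E G (B', \<lambda>U g. h U (i U g), \<lambda>U b. p U (k U b))"
    unfolding extension_iff
  proof (intro conjI allI impI B' hom_on_comp[OF i_hom hom] hom_on_comp[OF k p_hom])
    fix U assume U: "opn U"
    show "inj_on (\<lambda>g. h U (i U g)) (carrier (Sec G U))"
    proof (rule inj_onI)
      fix g g' assume g: "g \<in> carrier (Sec G U)" "g' \<in> carrier (Sec G U)" and "h U (i U g) = h U (i U g')"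
      then have "k U (h U (i U g)) = k U (h U (i U g'))" by simp
      then have "i U g = i U g'" by (simp only: kh[OF U i_closed[OF U g(1)]] kh[OF U i_closed[OF U g(2)]])
      then show "g = g'" by (rule inj_onD[OF i_inj[OF U] _ g])
    qed
    show "{b \<in> carrier (Sec B' U). p U (k U b) = \<zero>\<^bsub>Sec E U\<^esub>} = (\<lambda>g. h U (i U g)) ` carrier (Sec G U)"
    proof (intro equalityI subsetI)
      fix b assume "b \<in> {b \<in> carrier (Sec B' U). p U (k U b) = \<zero>\<^bsub>Sec E U\<^esub>}"
      then have b: "b \<in> carrier (Sec B' U)" "p U (k U b) = \<zero>\<^bsub>Sec E U\<^esub>" by auto
      then have "k U b \<in> i U ` carrier (Sec G U)" using p_ker[OF U] hk(2)[OF U b(1)] by blast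
      then show "b \<in> (\<lambda>g. h U (i U g)) ` carrier (Sec G U)" using hk(1)[OF U b(1)] by force
    next
      fix b assume "b \<in> (\<lambda>g. h U (i U g)) ` carrier (Sec G U)"
      then obtain g where "g \<in> carrier (Sec G U)" "b = h U (i U g)" by auto
      then show "b \<in> {b \<in> carrier (Sec B' U). p U (k U b) = \<zero>\<^bsub>Sec E U\<^esub>}"
        using kh[OF U i_closed[OF U]] hc[OF U i_closed[OF U]] p_i[OF U] by simp
    qed
    show "\<forall>e\<in>carrier (Sec E U). \<forall>x\<in>U. \<exists>V b. opn V \<and> x \<in> V \<and> V \<subseteq> U \<and> b \<in> carrier (Sec B' V) \<and> p V (k V b) = Res E U V e"
    proof (intro ballI)
      fix e x assume "e \<in> carrier (Sec E U)" "x \<in> U"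
      from p_surj[OF U this] obtain V b where V: "opn V" "x \<in> V" "V \<subseteq> U" "b \<in> carrier (Sec B V)" "p V b = Res E U V e" by blast
      then have "p V (k V (h V b)) = Res E U V e" using kh by simp
      then show "\<exists>V b. opn V \<and> x \<in> V \<and> V \<subseteq> U \<and> b \<in> carrier (Sec B' V) \<and> p V (k V b) = Res E U V e"
        using V(1-3) hc[OF V(1,4)] by blast
    qed
  qed
  show "ext_equiv X E G (B, i, p) (B', \<lambda>U g. h U (i U g), \<lambda>U b. p U (k U b))"
    unfolding ext_equiv_iff by (rule exI[of _ h]) (simp add: iso kh)
qed

text \<open>Middle term and projection stay the same. Precomposition of \<open>i\<close> with the
  inverse of \<open>\<alpha>\<close> only renames the kernel, so its image is unchanged.\<close>

lemma push:
  fixes G' :: "('x, 'r, 'h) mod_presheaf"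
  assumes G': "pmod X G'" and iso: "mod_iso X G G' \<alpha>"
  shows "extension X E G' (B, \<lambda>U. i U \<circ> inv_into (carrier (Sec G U)) (\<alpha> U), p)"
  unfolding extension_iff
proof (intro conjI allI impI B.mod_sheaf p_hom)
  let ?k = "\<lambda>U. inv_into (carrier (Sec G U)) (\<alpha> U)"
  have bij: "\<And>U. opn U \<Longrightarrow> bij_betw (\<alpha> U) (carrier (Sec G U)) (carrier (Sec G' U))"
    using iso by (auto simp: mod_iso_def)
  then have bij': "\<And>U. opn U \<Longrightarrow> bij_betw (?k U) (carrier (Sec G' U)) (carrier (Sec G U))"
    by (rule bij_betw_inv_into)
  show "hom_on X TX G' B (\<lambda>U. i U \<circ> ?k U)"
    unfolding comp_def by (rule hom_on_comp[OF mod_iso_inverse[OF ringed G.pmod G' iso] i_hom])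
  fix U assume U: "opn U"
  show "inj_on (i U \<circ> ?k U) (carrier (Sec G' U))"
    using comp_inj_on[of "?k U" "carrier (Sec G' U)" "i U"] bij'[OF U] i_inj[OF U] by (simp add: bij_betw_def)
  show "{b \<in> carrier (Sec B U). p U b = \<zero>\<^bsub>Sec E U\<^esub>} = (i U \<circ> ?k U) ` carrier (Sec G' U)"
    unfolding image_comp[symmetric] p_ker[OF U] using bij'[OF U] by (simp add: bij_betw_def)
  show "\<forall>e\<in>carrier (Sec E U). \<forall>x\<in>U. \<exists>V b. opn V \<and> x \<in> V \<and> V \<subseteq> U \<and> b \<in> carrier (Sec B V) \<and> p V b = Res E U V e"
    using p_surj[OF U] by simp
qed

end

lemma ext_spaceI:
  assumes "ringed_space X" "pmod X E" "pmod X G" "extension X E G (B, i, p)"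
  shows "ext_space X E G B i p"
proof -
  note A = assms(4)[unfolded extension_iff]
  interpret rspace X by unfold_locales fact
  interpret E: pmod_space X E by unfold_locales fact
  interpret G: pmod_space X G by unfold_locales fact
  interpret B: msheaf_space X B by unfold_locales (use A in simp)
  show ?thesis
    by unfold_locales (use A in simp_all)
qed

subsection \<open>Transport of structure\<close>

text \<open>The structure of \<open>B\<close> copied along maps \<open>j U\<close> that are
  injective on sections: arguments are brought back by the inverse of \<open>j U\<close>, and the
  result is sent forward. The maps \<open>j U\<close> may be unrelated for different
  \<open>U\<close> and need not respect any operation, since the restrictions and operations of the
  copy are themselves defined through them.\<close>

definition transport ::
  "('x set \<Rightarrow> 'm \<Rightarrow> 'n) \<Rightarrow> ('x, 'r, 'm) mod_presheaf \<Rightarrow> ('x, 'r, 'n) mod_presheaf" where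
  "transport j B = (let k = (\<lambda>U. inv_into (carrier (Sec B U)) (j U)) in
     \<lparr>Sec = (\<lambda>U. mk_module (j U ` carrier (Sec B U)) (j U \<zero>\<^bsub>Sec B U\<^esub>)
         (\<lambda>x y. j U (k U x \<oplus>\<^bsub>Sec B U\<^esub> k U y)) (\<lambda>r x. j U (r \<odot>\<^bsub>Sec B U\<^esub> k U x))),
      Res = (\<lambda>U V x. j V (Res B U V (k U x)))\<rparr>)"

lemma (in msheaf_space) transport:
  assumes inj: "\<And>U. opn U \<Longrightarrow> inj_on (j U) (carrier (Sec M U))"
  shows "mod_sheaf X (transport j M)" "mod_iso X M (transport j M) j"
proof -
  let ?T = "transport j M"
  define k where "k U = inv_into (carrier (Sec M U)) (j U)" for U
  have T: "carrier (Sec ?T U) = j U ` carrier (Sec M U)" "\<zero>\<^bsub>Sec ?T U\<^esub> = j U \<zero>\<^bsub>Sec M U\<^esub>"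
    "x \<oplus>\<^bsub>Sec ?T U\<^esub> y = j U (k U x \<oplus>\<^bsub>Sec M U\<^esub> k U y)"
    "r \<odot>\<^bsub>Sec ?T U\<^esub> x = j U (r \<odot>\<^bsub>Sec M U\<^esub> k U x)" "Res ?T U V x = j V (Res M U V (k U x))" for U V x y r
    by (simp_all add: transport_def k_def Let_def)
  have kj: "k U (j U m) = m" if "opn U" "m \<in> carrier (Sec M U)" for U m
    using inj[OF that(1)] that(2) by (simp add: k_def)
  note C = add_closed smult_closed zero_closed res_closed
  have pm: "pmod X ?T"
    unfolding pmod_def
  proof (intro conjI allI impI)
    show "presheaf (Top X) ?T"
      unfolding presheaf_def
    proof (intro conjI allI impI)
      fix U V assume "opn U \<and> opn V \<and> V \<subseteq> U"
      then show "Res ?T U V \<in> carrier (Sec ?T U) \<rightarrow> carrier (Sec ?T V)" by (auto simp: T kj C)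
    next
      fix U s assume "opn U \<and> s \<in> carrier (Sec ?T U)"
      then show "Res ?T U U s = s" by (auto simp: T kj res_id)
    next
      fix U V W s assume "opn U \<and> opn V \<and> opn W \<and> W \<subseteq> V \<and> V \<subseteq> U \<and> s \<in> carrier (Sec ?T U)"
      then show "Res ?T V W (Res ?T U V s) = Res ?T U W s" by (auto simp: T kj C res_comp)
    qed
    fix U assume U: "opn U"
    interpret MU: module "Rg X U" "Sec M U" by (rule mods[OF U])
    show "module (Rg X U) (Sec ?T U)"
      by (rule module_intro[OF rg_cring[OF U]])
        (auto simp: T kj[OF U] MU.M.a_ac MU.smult_l_distr MU.smult_r_distr MU.smult_assoc1)
  next
    fix U V assume "opn U \<and> opn V \<and> V \<subseteq> U"
    then show "semilin (Rg X U) (Sec ?T U) (Sec ?T V) (rr U V) (Res ?T U V)"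
      by (intro semilinI) (auto simp: T kj C res_add res_smult rr_closed)
  qed
  have sh: "sheaf (Top X) ?T"
    unfolding sheaf_def
  proof (intro conjI allI impI)
    show "presheaf (Top X) ?T" using pm by (simp add: pmod_def)
    fix \<U> s assume A: "(\<forall>U\<in>\<U>. opn U \<and> s U \<in> carrier (Sec ?T U)) \<and>
        (\<forall>U\<in>\<U>. \<forall>V\<in>\<U>. Res ?T U (U \<inter> V) (s U) = Res ?T V (U \<inter> V) (s V))"
    have o: "opn U" "k U (s U) \<in> carrier (Sec M U)" "j U (k U (s U)) = s U" if "U \<in> \<U>" for U
      using A that by (auto simp: T kj)
    have Un: "opn (\<Union>\<U>)" using o(1) by auto
    have ex1: "\<exists>!t. t \<in> carrier (Sec M (\<Union>\<U>)) \<and> (\<forall>U\<in>\<U>. Res M (\<Union>\<U>) U t = k U (s U))"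
    proof (rule sheafD[OF shf], intro conjI ballI)
      fix U V assume UV: "U \<in> \<U>" "V \<in> \<U>"
      have oUV: "opn (U \<inter> V)" using o UV by auto
      have c: "Res M U (U \<inter> V) (k U (s U)) \<in> carrier (Sec M (U \<inter> V))" "Res M V (U \<inter> V) (k V (s V)) \<in> carrier (Sec M (U \<inter> V))"
        using o[OF UV(1)] o[OF UV(2)] oUV by (auto intro!: C)
      have "j (U \<inter> V) (Res M U (U \<inter> V) (k U (s U))) = j (U \<inter> V) (Res M V (U \<inter> V) (k V (s V)))"
        using bspec[OF bspec[OF conjunct2[OF A] UV(1)] UV(2)] by (simp add: T)
      then show "Res M U (U \<inter> V) (k U (s U)) = Res M V (U \<inter> V) (k V (s V))"
        by (rule inj_onD[OF inj[OF oUV] _ c])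
    qed (use o in auto)
    obtain t where t': "t \<in> carrier (Sec M (\<Union>\<U>)) \<and> (\<forall>U\<in>\<U>. Res M (\<Union>\<U>) U t = k U (s U))"
      using ex1 by (rule ex1E)
    then have t: "t \<in> carrier (Sec M (\<Union>\<U>))" "\<And>U. U \<in> \<U> \<Longrightarrow> Res M (\<Union>\<U>) U t = k U (s U)" by simp_all
    have un: "t'' = t" if "t'' \<in> carrier (Sec M (\<Union>\<U>))" "\<forall>U\<in>\<U>. Res M (\<Union>\<U>) U t'' = k U (s U)" for t''
      by (rule ex1_eq_elem[OF ex1 _ t']) (use that in simp)
    show "\<exists>!t. t \<in> carrier (Sec ?T (\<Union>\<U>)) \<and> (\<forall>U\<in>\<U>. Res ?T (\<Union>\<U>) U t = s U)"
    proof (rule ex1I[of _ "j (\<Union>\<U>) t"])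
      show "j (\<Union>\<U>) t \<in> carrier (Sec ?T (\<Union>\<U>)) \<and> (\<forall>U\<in>\<U>. Res ?T (\<Union>\<U>) U (j (\<Union>\<U>) t) = s U)"
        using t o by (auto simp: T kj[OF Un])
      fix t' assume t': "t' \<in> carrier (Sec ?T (\<Union>\<U>)) \<and> (\<forall>U\<in>\<U>. Res ?T (\<Union>\<U>) U t' = s U)"
      then obtain m where m: "m \<in> carrier (Sec M (\<Union>\<U>))" "t' = j (\<Union>\<U>) m" by (auto simp: T)
      have "m = t"
      proof (rule un[OF m(1)], intro ballI)
        fix U assume U: "U \<in> \<U>"
        have sub: "U \<subseteq> \<Union>\<U>" using U by auto
        have "j U (Res M (\<Union>\<U>) U m) = s U" using t' U m by (simp add: T kj[OF Un])
        then show "Res M (\<Union>\<U>) U m = k U (s U)" using kj[OF o(1)[OF U] res_closed[OF Un o(1)[OF U] sub m(1)]] by simp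
      qed
      then show "t' = j (\<Union>\<U>) t" using m by simp
    qed
  qed
  show "mod_sheaf X ?T" unfolding mod_sheaf_iff using pm sh by simp
  show "mod_iso X M ?T j"
    unfolding mod_iso_def mod_hom_iff
  proof (intro conjI allI impI)
    show "hom_on X TX M ?T j"
      unfolding hom_on_def
    proof (intro conjI allI impI ballI)
      fix V assume "opn V \<and> V \<subseteq> TX"
      then show "lin (Rg X V) (Sec M V) (Sec ?T V) (j V)"
        by (intro semilinI) (auto simp: T kj)
    qed (auto simp: T kj)
    show "bij_betw (j U) (carrier (Sec M U)) (carrier (Sec ?T U))" if "opn U" for U
      using inj[OF that] by (simp add: T bij_betw_def)
  qed
qed

text \<open>The members of a class have their middle terms on the type
  \<open>'g \<times> 'e\<close>, so an equivalent extension on that type has to be produced. A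
  section \<open>b\<close> is recorded as the pair of the element of \<open>G\<close> that maps to
  \<open>b - \<sigma> (p b)\<close> and the image \<open>p b\<close>, with \<open>\<sigma>\<close> a
  choice of lifts without any linearity. The resulting injection \<open>j\<close> need not be
  additive, which is why the structure is transported along it.\<close>

lemma ext_class_nonempty:
  fixes X :: "('x, 'r) ringed" and E :: "('x, 'r, 'e) mod_presheaf" and G :: "('x, 'r, 'g) mod_presheaf"
  assumes X: "ringed_space X" and E: "pmod X E" and G: "pmod X G" and ext: "extension X E G \<xi>"
  shows "ext_class X E G \<xi> \<noteq> {}"
proof -
  obtain B i p where \<xi>: "\<xi> = (B, i, p)" by (cases \<xi>)
  interpret ext_space X E G B i p by (rule ext_spaceI[OF X E G ext[unfolded \<xi>]])
  define \<sigma> where "\<sigma> U e = (SOME b. b \<in> carrier (Sec B U) \<and> p U b = e)" for U e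
  define j where "j U b = (inv_into (carrier (Sec G U)) (i U) (b \<ominus>\<^bsub>Sec B U\<^esub> \<sigma> U (p U b)), p U b)" for U b
  have "inj_on (j U) (carrier (Sec B U))" if U: "opn U" for U
  proof (rule inj_onI)
    fix b c assume b: "b \<in> carrier (Sec B U)" and c: "c \<in> carrier (Sec B U)" and eq: "j U b = j U c"
    interpret BU: module "Rg X U" "Sec B U" by (rule B.mods[OF U])
    have pe: "p U b = p U c" using eq by (simp add: j_def)
    \<comment> \<open>Both sections have the same image, so this one lift enters both pairs, and the
      first components compare \<open>b - s\<close> with \<open>c - s\<close>.\<close>
    define s where "s = \<sigma> U (p U c)"
    have "s \<in> carrier (Sec B U) \<and> p U s = p U c"
      unfolding s_def \<sigma>_def by (rule someI[of _ c]) (simp add: c)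
    then have s: "s \<in> carrier (Sec B U)" "p U b = p U s" "p U c = p U s" using pe by auto
    obtain g where g: "g \<in> carrier (Sec G U)" "i U g = b \<ominus>\<^bsub>Sec B U\<^esub> s" using p_eqD[OF U b s(1,2)] by blast
    obtain g' where g': "g' \<in> carrier (Sec G U)" "i U g' = c \<ominus>\<^bsub>Sec B U\<^esub> s" using p_eqD[OF U c s(1,3)] by blast
    have "inv_into (carrier (Sec G U)) (i U) (i U g) = inv_into (carrier (Sec G U)) (i U) (i U g')"
      using eq unfolding g(2) g'(2) j_def pe s_def by simp
    then have "g = g'" using inv_into_f_f[OF i_inj[OF U] g(1)] inv_into_f_f[OF i_inj[OF U] g'(1)] by simp
    then have "b \<ominus>\<^bsub>Sec B U\<^esub> s = c \<ominus>\<^bsub>Sec B U\<^esub> s" using g g' by simp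
    then show "b = c" using b c s(1) by (simp add: a_minus_def)
  qed
  note tr = B.transport[OF this]
  show ?thesis
    using iso_image[OF tr] unfolding ext_class_def \<xi> by blast
qed

section \<open>Line bundles\<close>

text \<open>By linearity and naturality \<open>h V r\<close> is \<open>r\<close> times the
  restriction of \<open>h U 1\<close>, so multiplication by this section is the bijection
  \<open>h V\<close>.\<close>

lemma free_gen_of_iso:
  fixes X :: "('x, 'r) ringed" and L :: "('x, 'r, 'l) mod_presheaf"
  assumes X: "ringed_space X" and L: "pmod X L" and U: "openin (Top X) U" and iso: "mod_iso (open_sub X U) (str_mod X) L h"
  shows "free_gen X L U (h U \<one>\<^bsub>Rg X U\<^esub>)"
proof -
  interpret L: pmod_space X L by unfold_locales (rule X, rule L)
  interpret RU: cring "Rg X U" by (rule L.rg_cring[OF U])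
  have h: "hom_on X U (str_mod X) L h"
    and bij: "\<And>V. L.opn V \<Longrightarrow> V \<subseteq> U \<Longrightarrow> bij_betw (h V) (carrier (Rg X V)) (carrier (Sec L V))"
    using iso U by (auto simp: mod_iso_def mod_hom_sub_iff)
  show ?thesis
    unfolding free_gen_def
  proof (intro conjI allI impI U)
    show "h U \<one>\<^bsub>Rg X U\<^esub> \<in> carrier (Sec L U)" using hom_on_closed[OF h U subset_refl] by simp
    fix V assume "L.opn V \<and> V \<subseteq> U"
    then have V: "L.opn V" "V \<subseteq> U" by auto
    interpret RV: cring "Rg X V" by (rule L.rg_cring[OF V(1)])
    have "r \<odot>\<^bsub>Sec L V\<^esub> Res L U V (h U \<one>\<^bsub>Rg X U\<^esub>) = h V r" if r: "r \<in> carrier (Rg X V)" for r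
      using hom_on_nat[OF h U V subset_refl, of "\<one>\<^bsub>Rg X U\<^esub>"] hom_on_smult[OF h V r, of "\<one>\<^bsub>Rg X V\<^esub>"] r
      by (simp add: L.rr_one[OF U V])
    then show "bij_betw (\<lambda>r. r \<odot>\<^bsub>Sec L V\<^esub> Res L U V (h U \<one>\<^bsub>Rg X U\<^esub>)) (carrier (Rg X V)) (carrier (Sec L V))"
      using bij[OF V] by (subst bij_betw_cong) auto
  qed
qed

locale lb_space = dual_space X L + L: msheaf_space X L
  for X :: "('x, 'r) ringed" and L :: "('x, 'r, 'l) mod_presheaf" +
  assumes gens: "x \<in> TX \<Longrightarrow> \<exists>U e. x \<in> U \<and> free_gen X L U e"
begin

text \<open>Dual bases in rank one. Such pairs restrict to smaller open sets and exist near every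
  point, so they are the local coordinates in which statements about \<open>L\<close> and its dual
  are checked.\<close>

definition dpair where
  "dpair V e u \<longleftrightarrow> free_gen X L V e \<and> free_gen X D V u \<and> u V e = \<one>\<^bsub>Rg X V\<^esub>"

lemma dpairD:
  assumes "dpair V e u"
  shows "opn V" "e \<in> carrier (Sec L V)" "u \<in> carrier (Sec D V)" "u V e = \<one>\<^bsub>Rg X V\<^esub>"
    "free_gen X L V e" "free_gen X D V u"
  using assms by (auto simp: dpair_def free_gen_def)

lemma dpair_of_free_gen:
  assumes e: "free_gen X L U e"
  shows "\<exists>u. dpair U e u"
proof -
  interpret dual_gen_space X L U e by unfold_locales (rule e)
  have "du U e = \<one>\<^bsub>Rg X U\<^esub>"
    using du_e[OF U subset_refl] res_id[OF U] free_gen_space.e[OF free_gen_space_axioms] by simp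
  then show ?thesis unfolding dpair_def using assms du_free_gen by (intro exI[of _ du] conjI)
qed

lemma dpair_restrict:
  assumes d: "dpair V e u" and W: "opn W" "W \<subseteq> V"
  shows "dpair W (Res L V W e) (Res D V W u)"
proof -
  note D = dpairD[OF d]
  interpret e: free_gen_space X L V e by unfold_locales (rule D)
  interpret u: free_gen_space X D V u by unfold_locales (rule D)
  have "Res D V W u W (Res L V W e) = \<one>\<^bsub>Rg X W\<^esub>"
    using trim_apply[OF W(1) subset_refl res_closed[OF D(1) W D(2)]] hom_on_nat[OF dual_hom[OF D(1,3)] D(1) W subset_refl D(2)]
    by (simp add: D(4) rr_one[OF D(1) W])
  then show ?thesis
    unfolding dpair_def using e.free_gen_restrict[OF W] u.free_gen_restrict[OF W] by blast
qed

lemma dpair_ex: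
  assumes U: "opn U" "x \<in> U"
  obtains V e u where "x \<in> V" "V \<subseteq> U" "dpair V e u"
proof -
  have "x \<in> TX" using openin_subset[OF U(1)] U(2) by auto
  then obtain A e where A: "x \<in> A" "free_gen X L A e" using gens by blast
  obtain u where u: "dpair A e u" using dpair_of_free_gen[OF A(2)] by blast
  have "opn (U \<inter> A)" using dpairD(1)[OF u] U by auto
  from dpair_restrict[OF u this] show thesis using that[of "U \<inter> A"] A U by auto
qed

lemma dpair_bij:
  fixes N :: "('x, 'r, 'n) mod_presheaf"
  assumes d: "dpair V e u" and N: "mod_sheaf X N"
  shows "bij_betw (tens X D N V u) (carrier (Sec N V)) (carrier (Sec (tensor X D N) V))"
    and "bij_betw (tens X L N V e) (carrier (Sec N V)) (carrier (Sec (tensor X L N) V))"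
proof -
  note D = dpairD[OF d]
  interpret e: free_gen_space X L V e by unfold_locales (rule D)
  interpret u: free_gen_space X D V u by unfold_locales (rule D)
  show "bij_betw (tens X D N V u) (carrier (Sec N V)) (carrier (Sec (tensor X D N) V))"
    using u.tensor_free_bij[OF N D(1) subset_refl] D.res_id[OF D(1,3)] by simp
  show "bij_betw (tens X L N V e) (carrier (Sec N V)) (carrier (Sec (tensor X L N) V))"
    using e.tensor_free_bij[OF N D(1) subset_refl] res_id[OF D(1,2)] by simp
qed

text \<open>\<open>u\<close> reads off the coordinate with respect to \<open>e\<close>, as
  \<open>u (r \<odot> e) = r\<close>; a section with coordinate zero is zero.\<close>

lemma dpair_zero:
  assumes d: "dpair V e u" and l: "l \<in> carrier (Sec L V)" and z: "u V l = \<zero>\<^bsub>Rg X V\<^esub>"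
  shows "l = \<zero>\<^bsub>Sec L V\<^esub>"
proof -
  note D = dpairD[OF d]
  interpret e: free_gen_space X L V e by unfold_locales (rule D)
  interpret LV: module "Rg X V" "Sec L V" by (rule mods[OF D(1)])
  have e': "Res L V V e = e" by (rule res_id[OF D(1,2)])
  note c = e.co[OF D(1) subset_refl l, unfolded e']
  have "u V (e.co V l \<odot>\<^bsub>Sec L V\<^esub> e) = e.co V l"
    using hom_on_smult[OF dual_hom[OF D(1,3)] D(1) subset_refl c(1) D(2)] D(4) c(1) by simp
  then have "e.co V l = \<zero>\<^bsub>Rg X V\<^esub>" using c z by simp
  then show ?thesis using c D(2) by simp
qed

text \<open>Over a set with a dual pair the map
  \<open>g \<mapsto> u \<otimes> (e \<otimes> g)\<close> is bijective, since \<open>u\<close> and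
  \<open>e\<close> are free generators, and contraction undoes it because \<open>u e = 1\<close>. So
  contraction is locally bijective, hence an isomorphism.\<close>

lemma contraction_iso:
  fixes G :: "('x, 'r, 'g) mod_presheaf"
  assumes G: "mod_sheaf X G"
  shows "mod_iso X (tensor X D (tensor X L G)) G (contraction X L G)"
proof -
  interpret G: msheaf_space X G by unfold_locales (rule G)
  interpret LG: tensor_space X L G by unfold_locales
  interpret DLG: tensor_space X D "tensor X L G" by unfold_locales
  interpret H: sheaf_hom X "tensor X D (tensor X L G)" G "contraction X L G"
    by unfold_locales (rule contraction_spec(1)[OF G])
  show ?thesis
  proof (rule H.iso_local)
    fix x assume x: "x \<in> TX"
    obtain U e u where U: "x \<in> U" "dpair U e u" by (rule dpair_ex[OF openin_topspace x])
    note oU = dpairD(1)[OF U(2)]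
    have "bij_betw (contraction X L G V) (carrier (Sec (tensor X D (tensor X L G)) V)) (carrier (Sec G V))"
      if V: "opn V" "V \<subseteq> U" for V
    proof -
      note d = dpair_restrict[OF U(2) V]
      note D = dpairD[OF d]
      interpret GV: module "Rg X V" "Sec G V" by (rule G.mods[OF V(1)])
      let ?f = "\<lambda>g. tens X D (tensor X L G) V (Res D U V u) (tens X L G V (Res L U V e) g)"
      have f: "bij_betw ?f (carrier (Sec G V)) (carrier (Sec (tensor X D (tensor X L G)) V))"
        using bij_betw_trans[OF dpair_bij(2)[OF d G] dpair_bij(1)[OF d LG.T_mod_sheaf]] by (simp add: comp_def)
      have "bij_betw (contraction X L G V \<circ> ?f) (carrier (Sec G V)) (carrier (Sec G V))"
      proof (subst bij_betw_cong[where g = "\<lambda>g. g"])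
        show "(contraction X L G V \<circ> ?f) g = g" if "g \<in> carrier (Sec G V)" for g
          using contraction_spec(2)[OF G V(1) D(3,2) that] D(4) that by simp
      qed (simp add: bij_betw_def)
      then show ?thesis using bij_betw_comp_iff[OF f] by blast
    qed
    then show "\<exists>U. opn U \<and> x \<in> U \<and> (\<forall>V. opn V \<and> V \<subseteq> U \<longrightarrow>
        bij_betw (contraction X L G V) (carrier (Sec (tensor X D (tensor X L G)) V)) (carrier (Sec G V)))"
      using U(1) oU by blast
  qed
qed

lemma tensor_map_right_spec:
  fixes N :: "('x, 'r, 'n) mod_presheaf" and P :: "('x, 'r, 'p) mod_presheaf"
  assumes N: "pmod X N" and P: "pmod X P" and h: "hom_on X TX N P h"
  shows "hom_on X TX (tensor X D N) (tensor X D P) (tensor_map_right X D N P h)"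
    and "opn U \<Longrightarrow> u \<in> carrier (Sec D U) \<Longrightarrow> n \<in> carrier (Sec N U)
      \<Longrightarrow> tensor_map_right X D N P h U (tens X D N U u n) = tens X D P U u (h U n)"
proof -
  interpret N: pmod_space X N by unfold_locales (rule N)
  interpret P: pmod_space X P by unfold_locales (rule P)
  interpret DN: tensor_space X D N by unfold_locales
  interpret DP: tensor_space X D P by unfold_locales
  have "bilin X TX D N (tensor X D P) (\<lambda>U m n. tens X D P U m (h U n))"
    unfolding bilin_def
  proof (intro conjI allI impI)
    fix V n assume "opn V \<and> V \<subseteq> TX \<and> n \<in> carrier (Sec N V)"
    then show "lin (Rg X V) (Sec D V) (Sec (tensor X D P) V) (\<lambda>m. tens X D P V m (h V n))"
      by (intro DP.tens_left hom_on_closed[OF h]) auto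
  next
    fix V u assume "opn V \<and> V \<subseteq> TX \<and> u \<in> carrier (Sec D V)"
    then show "lin (Rg X V) (Sec N V) (Sec (tensor X D P) V) (\<lambda>n. tens X D P V u (h V n))"
      by (intro semilin_comp[OF hom_on_lin[OF h] DP.tens_right]) auto
  next
    fix V W u n assume "opn V \<and> opn W \<and> W \<subseteq> V \<and> V \<subseteq> TX \<and> u \<in> carrier (Sec D V) \<and> n \<in> carrier (Sec N V)"
    then show "Res (tensor X D P) V W (tens X D P V u (h V n)) = tens X D P W (Res D V W u) (h W (Res N V W n))"
      using hom_on_nat[OF h, of V W n] DP.tens_res[of V W u "h V n"] hom_on_closed[OF h, of V n] by (simp del: dual_simps)
  qed
  note s = DN.tensor_lift_spec[OF DP.T_mod_sheaf this, folded tensor_map_right_def]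
  show "hom_on X TX (tensor X D N) (tensor X D P) (tensor_map_right X D N P h)" by (rule s(1))
  show "opn U \<Longrightarrow> u \<in> carrier (Sec D U) \<Longrightarrow> n \<in> carrier (Sec N U)
      \<Longrightarrow> tensor_map_right X D N P h U (tens X D N U u n) = tens X D P U u (h U n)" by (rule s(2))
qed

text \<open>In the local coordinate \<open>b \<mapsto> u \<otimes> b\<close> the new inclusion is
  \<open>i\<close> and the new projection is \<open>b \<mapsto> u (p b)\<close>, that is
  \<open>p\<close> followed by the coordinate of \<open>L\<close>. Exactness is read off there.
  Passing to arbitrary open sets needs the gluing of preimages for the kernel; surjectivity is a
  local condition anyway.\<close>

lemma twist_extension:
  fixes H :: "('x, 'r, 'h) mod_presheaf" and B :: "('x, 'r, 'b) mod_presheaf"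
  assumes H: "mod_sheaf X H" and ext: "extension X L H (B, i, p)"
  shows "extension X (str_mod X) (tensor X D H) (tensor X D B, tensor_map_right X D H B i,
         \<lambda>U. evaluation X L U \<circ> tensor_map_right X D B L p U)"
proof -
  interpret H: msheaf_space X H by unfold_locales (rule H)
  interpret ext_space X L H B i p by (rule ext_spaceI[OF ringed pmod H.pmod ext])
  interpret DH: tensor_space X D H by unfold_locales
  interpret DB: tensor_space X D B by unfold_locales
  let ?i = "tensor_map_right X D H B i" and ?p = "tensor_map_right X D B L p" and ?ev = "evaluation X L"
  note i = tensor_map_right_spec[OF H.pmod B.pmod i_hom]
  note p = tensor_map_right_spec[OF B.pmod pmod p_hom]
  have q_hom: "hom_on X TX (tensor X D B) (str_mod X) (\<lambda>U b. ?ev U (?p U b))"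
    by (rule hom_on_comp[OF p(1) eval_hom])
  have q: "?ev U (?p U (tens X D B U u b)) = u U (p U b)"
    if "opn U" "u \<in> carrier (Sec D U)" "b \<in> carrier (Sec B U)" for U u b
    using p(2)[OF that] eval_tens[OF that(1,2) p_closed[OF that(1,3)]] by simp
  interpret I: sheaf_hom X "tensor X D H" "tensor X D B" ?i
    by unfold_locales (rule i(1))
  have inj: "inj_on (?i U) (carrier (Sec (tensor X D H) U))" if U: "opn U" for U
  proof (rule I.inj_local[OF _ U])
    fix x assume x: "x \<in> TX"
    obtain U e u where U: "x \<in> U" "dpair U e u" by (rule dpair_ex[OF openin_topspace x])
    have "inj_on (?i V) (carrier (Sec (tensor X D H) V))" if V: "opn V" "V \<subseteq> U" for V
    proof -
      note d = dpair_restrict[OF U(2) V]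
      note uV = dpairD(3)[OF d]
      let ?f = "tens X D H V (Res D U V u)" and ?g = "tens X D B V (Res D U V u)"
      have f: "?f ` carrier (Sec H V) = carrier (Sec (tensor X D H) V)"
        using dpair_bij(1)[OF d H] by (simp add: bij_betw_def)
      have "inj_on (?g \<circ> i V) (carrier (Sec H V))"
      proof (rule comp_inj_on[OF i_inj[OF V(1)]])
        have "i V ` carrier (Sec H V) \<subseteq> carrier (Sec B V)" using i_closed[OF V(1)] by auto
        then show "inj_on ?g (i V ` carrier (Sec H V))"
          using dpair_bij(1)[OF d B.mod_sheaf] by (auto simp: bij_betw_def intro: inj_on_subset)
      qed
      moreover have "(?g \<circ> i V) w = (?i V \<circ> ?f) w" if "w \<in> carrier (Sec H V)" for w
        using i(2)[OF V(1) uV that] by simp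
      ultimately have "inj_on (?i V \<circ> ?f) (carrier (Sec H V))"
        by (simp add: inj_on_def)
      from inj_on_imageI[OF this] show ?thesis unfolding f .
    qed
    then show "\<exists>U. opn U \<and> x \<in> U \<and> (\<forall>V. opn V \<and> V \<subseteq> U \<longrightarrow> inj_on (?i V) (carrier (Sec (tensor X D H) V)))"
      using U(1) dpairD(1)[OF U(2)] by blast
  qed
  \<comment> \<open>The composite agrees with the zero morphism on pure tensors, where it is
    \<open>u (p (i w)) = u 0\<close>.\<close>
  have qi: "?ev U (?p U (?i U z)) = \<zero>\<^bsub>Rg X U\<^esub>" if U: "opn U" and z: "z \<in> carrier (Sec (tensor X D H) U)" for U z
  proof -
    have "hom_on X U (tensor X D H) (str_mod X) (\<lambda>U z. ?ev U (?p U (?i U z)))"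
      by (rule hom_on_top[OF hom_on_comp[OF i(1) q_hom] U])
    then have "?ev U (?p U (?i U z)) = \<zero>\<^bsub>Sec (str_mod X) U\<^esub>"
    proof (rule DH.tensor_unique[OF U str_mod_sheaf _ str.hom_on_const_zero _ z])
      fix V u w assume V: "opn V" and u: "u \<in> carrier (Sec D V)" and w: "w \<in> carrier (Sec H V)"
      show "?ev V (?p V (?i V (tens X D H V u w))) = \<zero>\<^bsub>Sec (str_mod X) V\<^esub>"
        unfolding i(2)[OF V u w] q[OF V u i_closed[OF V w]] p_i[OF V w]
        by (rule hom_on_zero[OF dual_hom[OF V u] V subset_refl pmod str.pmod])
    qed
    then show ?thesis by simp
  qed
  show ?thesis
    unfolding extension_iff comp_def
  proof (intro conjI allI impI DB.T_mod_sheaf i(1) q_hom inj)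
    fix U assume U: "opn U"
    show "{b \<in> carrier (Sec (tensor X D B) U). ?ev U (?p U b) = \<zero>\<^bsub>Sec (str_mod X) U\<^esub>} = ?i U ` carrier (Sec (tensor X D H) U)"
    proof (intro equalityI subsetI)
      fix b assume "b \<in> ?i U ` carrier (Sec (tensor X D H) U)"
      then show "b \<in> {b \<in> carrier (Sec (tensor X D B) U). ?ev U (?p U b) = \<zero>\<^bsub>Sec (str_mod X) U\<^esub>}"
        using qi[OF U] I.h_closed[OF U] by auto
    next
      fix b assume "b \<in> {b \<in> carrier (Sec (tensor X D B) U). ?ev U (?p U b) = \<zero>\<^bsub>Sec (str_mod X) U\<^esub>}"
      then have b: "b \<in> carrier (Sec (tensor X D B) U)" and b0: "?ev U (?p U b) = \<zero>\<^bsub>Rg X U\<^esub>" by auto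
      have "\<exists>z\<in>carrier (Sec (tensor X D H) U). ?i U z = b"
      proof (rule I.preimage_local[OF inj U b])
        fix x assume x: "x \<in> U"
        obtain V e u where V: "x \<in> V" "V \<subseteq> U" "dpair V e u" by (rule dpair_ex[OF U x])
        note DV = dpairD[OF V(3)]
        have "Res (tensor X D B) U V b \<in> tens X D B V u ` carrier (Sec B V)"
          using dpair_bij(1)[OF V(3) B.mod_sheaf] DB.T.res_closed[OF U DV(1) V(2) b] by (simp add: bij_betw_def)
        then obtain b' where b': "b' \<in> carrier (Sec B V)" "Res (tensor X D B) U V b = tens X D B V u b'" by auto
        \<comment> \<open>The section is locally \<open>u \<otimes> b'\<close>. Its image being zero
          means that \<open>p b'\<close> has coordinate zero, so \<open>b'\<close> comes from
          \<open>H\<close>.\<close>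
        have "u V (p V b') = ?ev V (?p V (Res (tensor X D B) U V b))" unfolding b'(2) q[OF DV(1,3) b'(1)] ..
        also have "\<dots> = rr U V (?ev U (?p U b))"
          using hom_on_nat[OF q_hom U DV(1) V(2) openin_subset[OF U] b] by simp
        also have "\<dots> = \<zero>\<^bsub>Rg X V\<^esub>" unfolding b0 using str.res_zero[OF U DV(1) V(2)] by simp
        finally have "p V b' = \<zero>\<^bsub>Sec L V\<^esub>" by (rule dpair_zero[OF V(3) p_closed[OF DV(1) b'(1)]])
        then obtain w where w: "w \<in> carrier (Sec H V)" "b' = i V w" using p_ker[OF DV(1)] b'(1) by blast
        have "?i V (tens X D H V u w) = Res (tensor X D B) U V b" unfolding i(2)[OF DV(1,3) w(1)] b'(2) w(2) ..
        then show "\<exists>V s. opn V \<and> x \<in> V \<and> V \<subseteq> U \<and> s \<in> carrier (Sec (tensor X D H) V) \<and> ?i V s = Res (tensor X D B) U V b"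
          using V DV(1) DH.tens_closed[OF DV(1,3) w(1)] by blast
      qed
      then show "b \<in> ?i U ` carrier (Sec (tensor X D H) U)" by blast
    qed
    show "\<forall>a\<in>carrier (Sec (str_mod X) U). \<forall>x\<in>U. \<exists>V b. opn V \<and> x \<in> V \<and> V \<subseteq> U \<and> b \<in> carrier (Sec (tensor X D B) V) \<and>
        ?ev V (?p V b) = Res (str_mod X) U V a"
    proof (intro ballI)
      fix a x assume "a \<in> carrier (Sec (str_mod X) U)" and x: "x \<in> U"
      then have a: "a \<in> carrier (Rg X U)" by simp
      obtain V e u where V: "x \<in> V" "V \<subseteq> U" "dpair V e u" by (rule dpair_ex[OF U x])
      note DV = dpairD[OF V(3)]
      interpret RV: cring "Rg X V" by (rule rg_cring[OF DV(1)])
      note aV = rr_closed[OF U DV(1) V(2) a]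
      \<comment> \<open>The section of \<open>L\<close> with coordinate \<open>a\<close>: if
        \<open>b\<close> lifts it, then \<open>u \<otimes> b\<close> lifts \<open>a\<close>.\<close>
      let ?l = "rr U V a \<odot>\<^bsub>Sec L V\<^esub> e"
      note l = smult_closed[OF DV(1) aV DV(2)]
      have ul: "u V ?l = rr U V a"
        using hom_on_smult[OF dual_hom[OF DV(1,3)] DV(1) subset_refl aV DV(2)] DV(4) aV by simp
      obtain W b where W: "opn W" "x \<in> W" "W \<subseteq> V" "b \<in> carrier (Sec B W)" "p W b = Res L V W ?l"
        using p_surj[OF DV(1) l V(1)] by blast
      note uW = dual_closed(4)[OF DV(1) W(1,3) DV(3)]
      have "?ev W (?p W (tens X D B W (Res D V W u) b)) = Res D V W u W (Res L V W ?l)"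
        unfolding q[OF W(1) uW W(4)] W(5) ..
      also have "\<dots> = u W (Res L V W ?l)"
        using trim_apply[OF W(1) subset_refl res_closed[OF DV(1) W(1,3) l]] by simp
      also have "\<dots> = rr V W (u V ?l)"
        using hom_on_nat[OF dual_hom[OF DV(1,3)] DV(1) W(1,3) subset_refl l] by simp
      also have "\<dots> = rr U W a" unfolding ul by (rule rr_comp[OF U DV(1) W(1,3) V(2) a])
      finally have "?ev W (?p W (tens X D B W (Res D V W u) b)) = Res (str_mod X) U W a" by simp
      moreover have "W \<subseteq> U" using W V by auto
      ultimately show "\<exists>V b. opn V \<and> x \<in> V \<and> V \<subseteq> U \<and> b \<in> carrier (Sec (tensor X D B) V) \<and> ?ev V (?p V b) = Res (str_mod X) U V a"
        using W(1,2) DB.tens_closed[OF W(1) uW W(4)] by blast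
    qed
  qed
qed

end

section \<open>Jets\<close>

locale derivation_space = rspace X + G: msheaf_space X G for X :: "('x, 'r) ringed" and G :: "('x, 'r, 'g) mod_presheaf" +
  fixes d :: "('x, 'r, 'g) sheaf_map"
  assumes d_closed: "opn U \<Longrightarrow> a \<in> carrier (Rg X U) \<Longrightarrow> d U a \<in> carrier (Sec G U)"
    and d_add: "opn U \<Longrightarrow> a \<in> carrier (Rg X U) \<Longrightarrow> b \<in> carrier (Rg X U)
      \<Longrightarrow> d U (a \<oplus>\<^bsub>Rg X U\<^esub> b) = d U a \<oplus>\<^bsub>Sec G U\<^esub> d U b"
    and d_mult: "opn U \<Longrightarrow> a \<in> carrier (Rg X U) \<Longrightarrow> b \<in> carrier (Rg X U)
      \<Longrightarrow> d U (a \<otimes>\<^bsub>Rg X U\<^esub> b) = a \<odot>\<^bsub>Sec G U\<^esub> d U b \<oplus>\<^bsub>Sec G U\<^esub> b \<odot>\<^bsub>Sec G U\<^esub> d U a"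
    and d_res: "opn U \<Longrightarrow> opn V \<Longrightarrow> V \<subseteq> U \<Longrightarrow> a \<in> carrier (Rg X U) \<Longrightarrow> Res G U V (d U a) = d V (rr U V a)"
begin

lemma d_one:
  assumes U: "opn U"
  shows "d U \<one>\<^bsub>Rg X U\<^esub> = \<zero>\<^bsub>Sec G U\<^esub>"
proof -
  interpret GU: module "Rg X U" "Sec G U" by (rule G.mods[OF U])
  note c = d_closed[OF U GU.R.one_closed]
  have "d U \<one>\<^bsub>Rg X U\<^esub> = d U \<one>\<^bsub>Rg X U\<^esub> \<oplus>\<^bsub>Sec G U\<^esub> d U \<one>\<^bsub>Rg X U\<^esub>"
    using d_mult[OF U GU.R.one_closed GU.R.one_closed] c by simp
  then show ?thesis using c by (metis GU.M.add.r_cancel_one')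
qed

lemma d_zero:
  assumes U: "opn U"
  shows "d U \<zero>\<^bsub>Rg X U\<^esub> = \<zero>\<^bsub>Sec G U\<^esub>"
proof -
  interpret GU: module "Rg X U" "Sec G U" by (rule G.mods[OF U])
  note c = d_closed[OF U GU.R.zero_closed]
  have "d U \<zero>\<^bsub>Rg X U\<^esub> = d U \<zero>\<^bsub>Rg X U\<^esub> \<oplus>\<^bsub>Sec G U\<^esub> d U \<zero>\<^bsub>Rg X U\<^esub>"
    using d_add[OF U GU.R.zero_closed GU.R.zero_closed] by simp
  then show ?thesis using c by (metis GU.M.add.r_cancel_one')
qed

text \<open>The Leibniz rule for the product of \<open>a\<close> with its inverse, together with
  \<open>d 1 = 0\<close>. This identity absorbs the sign that the jets produce.\<close>

lemma d_inverse:
  assumes U: "opn U" and a: "a \<in> Units (Rg X U)"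
  shows "inv\<^bsub>Rg X U\<^esub> a \<odot>\<^bsub>Sec G U\<^esub> d U a = \<ominus>\<^bsub>Sec G U\<^esub> (a \<odot>\<^bsub>Sec G U\<^esub> d U (inv\<^bsub>Rg X U\<^esub> a))"
proof -
  interpret GU: module "Rg X U" "Sec G U" by (rule G.mods[OF U])
  have ac: "a \<in> carrier (Rg X U)" "inv\<^bsub>Rg X U\<^esub> a \<in> carrier (Rg X U)" using a by auto
  have "a \<odot>\<^bsub>Sec G U\<^esub> d U (inv\<^bsub>Rg X U\<^esub> a) \<oplus>\<^bsub>Sec G U\<^esub> inv\<^bsub>Rg X U\<^esub> a \<odot>\<^bsub>Sec G U\<^esub> d U a = d U \<one>\<^bsub>Rg X U\<^esub>"
    using d_mult[OF U ac] a by simp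
  then have "inv\<^bsub>Rg X U\<^esub> a \<odot>\<^bsub>Sec G U\<^esub> d U a \<oplus>\<^bsub>Sec G U\<^esub> a \<odot>\<^bsub>Sec G U\<^esub> d U (inv\<^bsub>Rg X U\<^esub> a) = \<zero>\<^bsub>Sec G U\<^esub>"
    using d_one[OF U] ac by (simp add: GU.M.a_comm d_closed[OF U])
  from GU.M.minus_equality[OF this] show ?thesis using ac by (simp add: d_closed[OF U])
qed

end

locale jet_space = derivation_space X G d + L: msheaf_space X L
  for X :: "('x, 'r) ringed" and G :: "('x, 'r, 'g) mod_presheaf" and d and L :: "('x, 'r, 'e) mod_presheaf"
begin

sublocale GL: tensor_space X G L by unfold_locales

abbreviation "J \<equiv> jets X G d L"
abbreviation "TGL \<equiv> tensor X G L"

lemma jets_simps [simp]: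
  "carrier (Sec J U) = carrier (Sec TGL U) \<times> carrier (Sec L U)"
  "\<zero>\<^bsub>Sec J U\<^esub> = (\<zero>\<^bsub>Sec TGL U\<^esub>, \<zero>\<^bsub>Sec L U\<^esub>)"
  "(w, e) \<oplus>\<^bsub>Sec J U\<^esub> (w', e') = (w \<oplus>\<^bsub>Sec TGL U\<^esub> w', e \<oplus>\<^bsub>Sec L U\<^esub> e')"
  "s \<odot>\<^bsub>Sec J U\<^esub> (w, e) = (s \<odot>\<^bsub>Sec TGL U\<^esub> w \<oplus>\<^bsub>Sec TGL U\<^esub> tens X G L U (d U s) e, s \<odot>\<^bsub>Sec L U\<^esub> e)"
  "Res J U V (w, e) = (Res TGL U V w, Res L U V e)"
  by (simp_all add: jets_def)

lemma tens_zero_left: "opn U \<Longrightarrow> e \<in> carrier (Sec L U) \<Longrightarrow> tens X G L U \<zero>\<^bsub>Sec G U\<^esub> e = \<zero>\<^bsub>Sec TGL U\<^esub>"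
  by (rule semilin_zero[OF GL.tens_left G.mods GL.T.mods])

lemma tens_zero_right: "opn U \<Longrightarrow> g \<in> carrier (Sec G U) \<Longrightarrow> tens X G L U g \<zero>\<^bsub>Sec L U\<^esub> = \<zero>\<^bsub>Sec TGL U\<^esub>"
  by (rule semilin_zero[OF GL.tens_right L.mods GL.T.mods])

text \<open>The twisted action is associative by the Leibniz rule: \<open>d (r s) \<otimes> e = r (d
  s \<otimes> e) + d r \<otimes> s e\<close>, where the first term is \<open>r\<close> acting on the
  correction made by \<open>s\<close>, and the second is the correction made by \<open>r\<close>.
  Distributivity in the scalar uses additivity of \<open>d\<close>; 1 and 0 act correctly since
  \<open>d\<close> vanishes on them.\<close>

lemma jets_pmod: "pmod X J"
  unfolding pmod_def
proof (intro conjI allI impI)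
  show "presheaf (Top X) J"
    unfolding presheaf_def
    by (auto simp: L.res_closed GL.T.res_closed L.res_id GL.T.res_id L.res_comp GL.T.res_comp)
  show "module (Rg X U) (Sec J U)" if U: "opn U" for U
  proof -
    interpret LU: module "Rg X U" "Sec L U" by (rule L.mods[OF U])
    interpret GU: module "Rg X U" "Sec G U" by (rule G.mods[OF U])
    interpret TU: module "Rg X U" "Sec TGL U" by (rule GL.T.mods[OF U])
    note t = semilin_add[OF GL.tens_left[OF U]] semilin_smult[OF GL.tens_left[OF U]]
      semilin_add[OF GL.tens_right[OF U]] semilin_smult[OF GL.tens_right[OF U]] GL.tens_closed[OF U]
      tens_zero_left[OF U] d_closed[OF U] d_add[OF U] d_mult[OF U] d_one[OF U] d_zero[OF U]
    show ?thesis
      by (rule module_intro[OF rg_cring[OF U]])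
        (auto simp: t TU.M.a_ac LU.M.a_ac TU.smult_l_distr TU.smult_r_distr TU.smult_assoc1
          LU.smult_l_distr LU.smult_r_distr LU.smult_assoc1)
  qed
  fix U V assume "opn U \<and> opn V \<and> V \<subseteq> U"
  then have o: "opn U" "opn V" "V \<subseteq> U" by auto
  show "semilin (Rg X U) (Sec J U) (Sec J V) (rr U V) (Res J U V)"
    by (rule semilinI)
      (auto simp: L.res_closed[OF o] GL.T.res_closed[OF o] L.res_add[OF o] GL.T.res_add[OF o] L.res_smult[OF o]
        GL.T.res_smult[OF o] GL.T.smult_closed[OF o(1)] GL.tens_closed[OF o(1)] d_closed[OF o(1)] GL.tens_res[OF o] d_res[OF o])
qed

text \<open>Restriction of jets is componentwise, with no correction term, so gluing reduces to the
  two factors.\<close>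

lemma jets_mod_sheaf: "mod_sheaf X J"
  unfolding mod_sheaf_iff
proof
  show "pmod X J" by (rule jets_pmod)
  show "sheaf (Top X) J"
    unfolding sheaf_def
  proof (intro conjI allI impI)
    show "presheaf (Top X) J" using jets_pmod by (simp add: pmod_def)
    fix \<U> s assume A: "(\<forall>U\<in>\<U>. opn U \<and> s U \<in> carrier (Sec J U)) \<and>
        (\<forall>U\<in>\<U>. \<forall>V\<in>\<U>. Res J U (U \<inter> V) (s U) = Res J V (U \<inter> V) (s V))"
    define s1 s2 where "s1 U = fst (s U)" and "s2 U = snd (s U)" for U
    have s: "s U = (s1 U, s2 U)" for U by (simp add: s1_def s2_def)
    have 1: "\<exists>!t. t \<in> carrier (Sec TGL (\<Union>\<U>)) \<and> (\<forall>U\<in>\<U>. Res TGL (\<Union>\<U>) U t = s1 U)"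
      by (rule sheafD[OF GL.T.shf]) (use A in \<open>auto simp: s\<close>)
    have 2: "\<exists>!t. t \<in> carrier (Sec L (\<Union>\<U>)) \<and> (\<forall>U\<in>\<U>. Res L (\<Union>\<U>) U t = s2 U)"
      by (rule sheafD[OF L.shf]) (use A in \<open>auto simp: s\<close>)
    obtain t1 where t1: "t1 \<in> carrier (Sec TGL (\<Union>\<U>)) \<and> (\<forall>U\<in>\<U>. Res TGL (\<Union>\<U>) U t1 = s1 U)"
      using 1 by (rule ex1E)
    obtain t2 where t2: "t2 \<in> carrier (Sec L (\<Union>\<U>)) \<and> (\<forall>U\<in>\<U>. Res L (\<Union>\<U>) U t2 = s2 U)"
      using 2 by (rule ex1E)
    show "\<exists>!t. t \<in> carrier (Sec J (\<Union>\<U>)) \<and> (\<forall>U\<in>\<U>. Res J (\<Union>\<U>) U t = s U)"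
    proof (rule ex1I[of _ "(t1, t2)"])
      show "(t1, t2) \<in> carrier (Sec J (\<Union>\<U>)) \<and> (\<forall>U\<in>\<U>. Res J (\<Union>\<U>) U (t1, t2) = s U)"
        using t1 t2 by (simp add: s)
      fix t assume t: "t \<in> carrier (Sec J (\<Union>\<U>)) \<and> (\<forall>U\<in>\<U>. Res J (\<Union>\<U>) U t = s U)"
      obtain a b where ab: "t = (a, b)" by (cases t)
      have a: "a \<in> carrier (Sec TGL (\<Union>\<U>)) \<and> (\<forall>U\<in>\<U>. Res TGL (\<Union>\<U>) U a = s1 U)"
        and b: "b \<in> carrier (Sec L (\<Union>\<U>)) \<and> (\<forall>U\<in>\<U>. Res L (\<Union>\<U>) U b = s2 U)"
        using t by (simp_all add: ab s)
      have "a = t1" using 1 a t1 by blast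
      moreover have "b = t2" using 2 b t2 by blast
      ultimately show "t = (t1, t2)" by (simp add: ab)
    qed
  qed
qed

text \<open>The inclusion is linear because the correction term \<open>d s \<otimes> 0\<close>
  vanishes. Every section \<open>e\<close> has the lift \<open>(0, e)\<close> over its whole domain;
  the class can still be nontrivial, as this lift is not linear in \<open>e\<close> in
  general.\<close>

lemma jets_extension: "extension X L TGL (J, \<lambda>U w. (w, \<zero>\<^bsub>Sec L U\<^esub>), \<lambda>U. snd)"
  unfolding extension_iff
proof (intro conjI allI impI jets_mod_sheaf)
  show "hom_on X TX TGL J (\<lambda>U w. (w, \<zero>\<^bsub>Sec L U\<^esub>))"
    unfolding hom_on_def
  proof (intro conjI allI impI ballI)
    fix U assume "opn U \<and> U \<subseteq> TX"
    then have U: "opn U" by simp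
    interpret LU: module "Rg X U" "Sec L U" by (rule L.mods[OF U])
    interpret TU: module "Rg X U" "Sec TGL U" by (rule GL.T.mods[OF U])
    show "lin (Rg X U) (Sec TGL U) (Sec J U) (\<lambda>w. (w, \<zero>\<^bsub>Sec L U\<^esub>))"
      by (rule semilinI) (auto simp: tens_zero_right[OF U] d_closed[OF U])
  qed (auto simp: L.res_zero)
  show "hom_on X TX J L (\<lambda>U. snd)"
    unfolding hom_on_def by (auto intro!: semilinI)
  fix U assume U: "opn U"
  show "inj_on (\<lambda>w. (w, \<zero>\<^bsub>Sec L U\<^esub>)) (carrier (Sec TGL U))" by (rule inj_onI) simp
  show "{b \<in> carrier (Sec J U). snd b = \<zero>\<^bsub>Sec L U\<^esub>} = (\<lambda>w. (w, \<zero>\<^bsub>Sec L U\<^esub>)) ` carrier (Sec TGL U)"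
    using L.zero_closed[OF U] by auto
  show "\<forall>e\<in>carrier (Sec L U). \<forall>x\<in>U. \<exists>V b. opn V \<and> x \<in> V \<and> V \<subseteq> U \<and> b \<in> carrier (Sec J V) \<and> snd b = Res L U V e"
  proof (intro ballI)
    fix e x assume e: "e \<in> carrier (Sec L U)" and x: "x \<in> U"
    show "\<exists>V b. opn V \<and> x \<in> V \<and> V \<subseteq> U \<and> b \<in> carrier (Sec J V) \<and> snd b = Res L U V e"
      using U x e L.res_id[OF U e] GL.T.zero_closed[OF U]
      by (intro exI[of _ U] exI[of _ "(\<zero>\<^bsub>Sec TGL U\<^esub>, e)"]) simp
  qed
qed

end

section \<open>First cohomology\<close>

text \<open>Abelian groups in multiplicative notation, so that the units and, through
  \<open>add_presheaf\<close>, the additive groups of modules are both instances and dlog is a map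
  between instances.\<close>

locale gpre_space =
  fixes T :: "'x topology" and G :: "('x, 'a) group_presheaf"
  assumes gpre: "presheaf T G"
    and grp: "openin T U \<Longrightarrow> comm_group (Sec G U)"
    and gres_mult: "openin T U \<Longrightarrow> openin T V \<Longrightarrow> V \<subseteq> U \<Longrightarrow> a \<in> carrier (Sec G U) \<Longrightarrow> b \<in> carrier (Sec G U)
      \<Longrightarrow> Res G U V (a \<otimes>\<^bsub>Sec G U\<^esub> b) = Res G U V a \<otimes>\<^bsub>Sec G V\<^esub> Res G U V b"
begin

lemmas gres_closed = presheaf_closed[OF gpre] and gres_comp = presheaf_comp[OF gpre]

lemma gres_hom:
  assumes "openin T U" "openin T V" "V \<subseteq> U"
  shows "group_hom (Sec G U) (Sec G V) (Res G U V)"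
  using assms gres_closed gres_mult
  by (auto simp: group_hom_def group_hom_axioms_def hom_def comm_group.axioms(2)[OF grp])

lemma gres_inv: "openin T U \<Longrightarrow> openin T V \<Longrightarrow> V \<subseteq> U \<Longrightarrow> a \<in> carrier (Sec G U)
    \<Longrightarrow> Res G U V (inv\<^bsub>Sec G U\<^esub> a) = inv\<^bsub>Sec G V\<^esub> Res G U V a"
  by (rule group_hom.hom_inv[OF gres_hom])

text \<open>To be cohomologous is an equivalence relation already among cochains. The differences of
  lifts that occur in \<open>ext_to_H1\<close> are compared at this level.\<close>

definition cochain :: "('x, 'a) cochain \<Rightarrow> bool" where
  "cochain = (\<lambda>(U, c). pointed_cover T U \<and>
     (\<forall>x\<in>topspace T. \<forall>y\<in>topspace T. c x y \<in> carrier (Sec G (U x \<inter> U y))))"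

lemma cocycle_cochain: "cocycle T G C \<Longrightarrow> cochain C"
  unfolding cochain_def cocycle_def by (cases C) auto

lemma cochainD:
  assumes "cochain (U, c)" "x \<in> topspace T"
  shows "openin T (U x)" "x \<in> U x" and "y \<in> topspace T \<Longrightarrow> openin T (U x \<inter> U y)"
    and "y \<in> topspace T \<Longrightarrow> c x y \<in> carrier (Sec G (U x \<inter> U y))"
  using assms by (auto simp: cochain_def pointed_cover_def)

lemma cohomologousI:
  assumes "pointed_cover T W"
    and "\<And>x. x \<in> topspace T \<Longrightarrow> W x \<subseteq> U x" "\<And>x. x \<in> topspace T \<Longrightarrow> W x \<subseteq> V x"
    and "\<And>x. x \<in> topspace T \<Longrightarrow> b x \<in> carrier (Sec G (W x))"
    and "\<And>x y. x \<in> topspace T \<Longrightarrow> y \<in> topspace T \<Longrightarrow>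
      Res G (V x \<inter> V y) (W x \<inter> W y) (c' x y) = Res G (U x \<inter> U y) (W x \<inter> W y) (c x y) \<otimes>\<^bsub>Sec G (W x \<inter> W y)\<^esub>
        (Res G (W y) (W x \<inter> W y) (b y) \<otimes>\<^bsub>Sec G (W x \<inter> W y)\<^esub> inv\<^bsub>Sec G (W x \<inter> W y)\<^esub> Res G (W x) (W x \<inter> W y) (b x))"
  shows "cohomologous T G (U, c) (V, c')"
  unfolding cohomologous_def Let_def using assms by (auto intro!: exI[of _ W] exI[of _ b])

lemma cohomologousE:
  assumes "cohomologous T G (U, c) (V, c')"
  obtains W b where "pointed_cover T W" "\<And>x. x \<in> topspace T \<Longrightarrow> W x \<subseteq> U x"
    "\<And>x. x \<in> topspace T \<Longrightarrow> W x \<subseteq> V x" "\<And>x. x \<in> topspace T \<Longrightarrow> b x \<in> carrier (Sec G (W x))"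
    "\<And>x y. x \<in> topspace T \<Longrightarrow> y \<in> topspace T \<Longrightarrow>
      Res G (V x \<inter> V y) (W x \<inter> W y) (c' x y) = Res G (U x \<inter> U y) (W x \<inter> W y) (c x y) \<otimes>\<^bsub>Sec G (W x \<inter> W y)\<^esub>
        (Res G (W y) (W x \<inter> W y) (b y) \<otimes>\<^bsub>Sec G (W x \<inter> W y)\<^esub> inv\<^bsub>Sec G (W x \<inter> W y)\<^esub> Res G (W x) (W x \<inter> W y) (b x))"
proof -
  from assms obtain W b where W: "pointed_cover T W"
    and b: "\<forall>x\<in>topspace T. W x \<subseteq> U x \<inter> V x \<and> b x \<in> carrier (Sec G (W x))"
    and eq: "\<forall>x\<in>topspace T. \<forall>y\<in>topspace T.
      Res G (V x \<inter> V y) (W x \<inter> W y) (c' x y) = Res G (U x \<inter> U y) (W x \<inter> W y) (c x y) \<otimes>\<^bsub>Sec G (W x \<inter> W y)\<^esub>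
        (Res G (W y) (W x \<inter> W y) (b y) \<otimes>\<^bsub>Sec G (W x \<inter> W y)\<^esub> inv\<^bsub>Sec G (W x \<inter> W y)\<^esub> Res G (W x) (W x \<inter> W y) (b x))"
    unfolding cohomologous_def Let_def case_prod_conv by (elim exE conjE)
  show thesis
  proof (rule that[OF W])
    fix x assume x: "x \<in> topspace T"
    show "W x \<subseteq> U x" "W x \<subseteq> V x" "b x \<in> carrier (Sec G (W x))" using bspec[OF b x] by auto
    fix y assume y: "y \<in> topspace T"
    show "Res G (V x \<inter> V y) (W x \<inter> W y) (c' x y) = Res G (U x \<inter> U y) (W x \<inter> W y) (c x y) \<otimes>\<^bsub>Sec G (W x \<inter> W y)\<^esub>
        (Res G (W y) (W x \<inter> W y) (b y) \<otimes>\<^bsub>Sec G (W x \<inter> W y)\<^esub> inv\<^bsub>Sec G (W x \<inter> W y)\<^esub> Res G (W x) (W x \<inter> W y) (b x))"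
      by (rule bspec[OF bspec[OF eq x] y])
  qed
qed

lemma cohomologous_refl:
  assumes "cochain (U, c)"
  shows "cohomologous T G (U, c) (U, c)"
proof (rule cohomologousI[where W = U and b = "\<lambda>x. \<one>\<^bsub>Sec G (U x)\<^esub>"])
  fix x assume x: "x \<in> topspace T"
  note X = cochainD[OF assms x]
  interpret Gx: comm_group "Sec G (U x)" by (rule grp[OF X(1)])
  show "\<one>\<^bsub>Sec G (U x)\<^esub> \<in> carrier (Sec G (U x))" by simp
  fix y assume y: "y \<in> topspace T"
  note Y = cochainD[OF assms y]
  interpret Gxy: comm_group "Sec G (U x \<inter> U y)" by (rule grp[OF X(3)[OF y]])
  show "Res G (U x \<inter> U y) (U x \<inter> U y) (c x y) = Res G (U x \<inter> U y) (U x \<inter> U y) (c x y) \<otimes>\<^bsub>Sec G (U x \<inter> U y)\<^esub>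
      (Res G (U y) (U x \<inter> U y) \<one>\<^bsub>Sec G (U y)\<^esub> \<otimes>\<^bsub>Sec G (U x \<inter> U y)\<^esub> inv\<^bsub>Sec G (U x \<inter> U y)\<^esub> Res G (U x) (U x \<inter> U y) \<one>\<^bsub>Sec G (U x)\<^esub>)"
    using group_hom.hom_one[OF gres_hom[OF X(1) X(3)[OF y]]] group_hom.hom_one[OF gres_hom[OF Y(1) X(3)[OF y]]]
      gres_closed[OF X(3)[OF y] X(3)[OF y] subset_refl X(4)[OF y]] by simp
qed (use assms in \<open>auto simp: cochain_def\<close>)

text \<open>The inverse sections of the connecting data \<open>b\<close> serve for the opposite
  direction, on the same refinement.\<close>

lemma cohomologous_sym:
  assumes C: "cochain (U, c)" and C': "cochain (V, c')" and coh: "cohomologous T G (U, c) (V, c')"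
  shows "cohomologous T G (V, c') (U, c)"
proof -
  obtain W b where W: "pointed_cover T W" "\<And>x. x \<in> topspace T \<Longrightarrow> W x \<subseteq> U x"
    "\<And>x. x \<in> topspace T \<Longrightarrow> W x \<subseteq> V x" "\<And>x. x \<in> topspace T \<Longrightarrow> b x \<in> carrier (Sec G (W x))"
    and eq: "\<And>x y. x \<in> topspace T \<Longrightarrow> y \<in> topspace T \<Longrightarrow>
      Res G (V x \<inter> V y) (W x \<inter> W y) (c' x y) = Res G (U x \<inter> U y) (W x \<inter> W y) (c x y) \<otimes>\<^bsub>Sec G (W x \<inter> W y)\<^esub>
        (Res G (W y) (W x \<inter> W y) (b y) \<otimes>\<^bsub>Sec G (W x \<inter> W y)\<^esub> inv\<^bsub>Sec G (W x \<inter> W y)\<^esub> Res G (W x) (W x \<inter> W y) (b x))"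
    by (rule cohomologousE[OF coh]) blast
  have oW: "openin T (W x)" if "x \<in> topspace T" for x using W(1) that by (simp add: pointed_cover_def)
  show ?thesis
  proof (rule cohomologousI[where W = W and b = "\<lambda>x. inv\<^bsub>Sec G (W x)\<^esub> b x", OF W(1) W(3) W(2)])
    fix x assume x: "x \<in> topspace T"
    interpret Gx: comm_group "Sec G (W x)" by (rule grp[OF oW[OF x]])
    show "inv\<^bsub>Sec G (W x)\<^esub> b x \<in> carrier (Sec G (W x))" using W(4)[OF x] by simp
    fix y assume y: "y \<in> topspace T"
    let ?N = "W x \<inter> W y"
    have N: "openin T ?N" "?N \<subseteq> W x" "?N \<subseteq> W y" "?N \<subseteq> U x \<inter> U y"
      using oW[OF x] oW[OF y] W(2)[OF x] W(2)[OF y] by auto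
    interpret GN: comm_group "Sec G ?N" by (rule grp[OF N(1)])
    note bx = gres_closed[OF oW[OF x] N(1,2) W(4)[OF x]] and bY = gres_closed[OF oW[OF y] N(1,3) W(4)[OF y]]
    note cx = gres_closed[OF cochainD(3)[OF C x y] N(1,4) cochainD(4)[OF C x y]]
    show "Res G (U x \<inter> U y) ?N (c x y) = Res G (V x \<inter> V y) ?N (c' x y) \<otimes>\<^bsub>Sec G ?N\<^esub>
        (Res G (W y) ?N (inv\<^bsub>Sec G (W y)\<^esub> b y) \<otimes>\<^bsub>Sec G ?N\<^esub> inv\<^bsub>Sec G ?N\<^esub> Res G (W x) ?N (inv\<^bsub>Sec G (W x)\<^esub> b x))"
      unfolding eq[OF x y] gres_inv[OF oW[OF x] N(1,2) W(4)[OF x]] gres_inv[OF oW[OF y] N(1,3) W(4)[OF y]]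
    proof -
      let ?c = "Res G (U x \<inter> U y) ?N (c x y)" and ?bx = "Res G (W x) ?N (b x)" and ?by = "Res G (W y) ?N (b y)"
      have "?c \<otimes>\<^bsub>Sec G ?N\<^esub> (?by \<otimes>\<^bsub>Sec G ?N\<^esub> inv\<^bsub>Sec G ?N\<^esub> ?bx) \<otimes>\<^bsub>Sec G ?N\<^esub> (inv\<^bsub>Sec G ?N\<^esub> ?by \<otimes>\<^bsub>Sec G ?N\<^esub> ?bx)
        = ?c \<otimes>\<^bsub>Sec G ?N\<^esub> ((?by \<otimes>\<^bsub>Sec G ?N\<^esub> inv\<^bsub>Sec G ?N\<^esub> ?by) \<otimes>\<^bsub>Sec G ?N\<^esub> (inv\<^bsub>Sec G ?N\<^esub> ?bx \<otimes>\<^bsub>Sec G ?N\<^esub> ?bx))"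
        using bx bY cx by (simp only: GN.m_ac GN.m_closed GN.inv_closed)
      then show "?c = ?c \<otimes>\<^bsub>Sec G ?N\<^esub> (?by \<otimes>\<^bsub>Sec G ?N\<^esub> inv\<^bsub>Sec G ?N\<^esub> ?bx) \<otimes>\<^bsub>Sec G ?N\<^esub>
          (inv\<^bsub>Sec G ?N\<^esub> ?by \<otimes>\<^bsub>Sec G ?N\<^esub> inv\<^bsub>Sec G ?N\<^esub> (inv\<^bsub>Sec G ?N\<^esub> ?bx))"
        using bx bY cx by simp
    qed
  qed
qed

text \<open>On the common refinement \<open>A\<close> of \<open>W\<close> and \<open>W'\<close> the
  two 0-cochains \<open>b\<close> and \<open>b'\<close> are multiplied; commutativity regroups their
  coboundaries into one.\<close>

lemma cohomologous_trans:
  assumes C: "cochain (U, c)" and C': "cochain (V, c')" and C'': "cochain (V', c'')"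
    and coh: "cohomologous T G (U, c) (V, c')" and coh': "cohomologous T G (V, c') (V', c'')"
  shows "cohomologous T G (U, c) (V', c'')"
proof -
  obtain W b where W: "pointed_cover T W" "\<And>x. x \<in> topspace T \<Longrightarrow> W x \<subseteq> U x"
    "\<And>x. x \<in> topspace T \<Longrightarrow> W x \<subseteq> V x" "\<And>x. x \<in> topspace T \<Longrightarrow> b x \<in> carrier (Sec G (W x))"
    and eq: "\<And>x y. x \<in> topspace T \<Longrightarrow> y \<in> topspace T \<Longrightarrow>
      Res G (V x \<inter> V y) (W x \<inter> W y) (c' x y) = Res G (U x \<inter> U y) (W x \<inter> W y) (c x y) \<otimes>\<^bsub>Sec G (W x \<inter> W y)\<^esub>
        (Res G (W y) (W x \<inter> W y) (b y) \<otimes>\<^bsub>Sec G (W x \<inter> W y)\<^esub> inv\<^bsub>Sec G (W x \<inter> W y)\<^esub> Res G (W x) (W x \<inter> W y) (b x))"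
    by (rule cohomologousE[OF coh]) blast
  obtain W' b' where W': "pointed_cover T W'" "\<And>x. x \<in> topspace T \<Longrightarrow> W' x \<subseteq> V x"
    "\<And>x. x \<in> topspace T \<Longrightarrow> W' x \<subseteq> V' x" "\<And>x. x \<in> topspace T \<Longrightarrow> b' x \<in> carrier (Sec G (W' x))"
    and eq': "\<And>x y. x \<in> topspace T \<Longrightarrow> y \<in> topspace T \<Longrightarrow>
      Res G (V' x \<inter> V' y) (W' x \<inter> W' y) (c'' x y) = Res G (V x \<inter> V y) (W' x \<inter> W' y) (c' x y) \<otimes>\<^bsub>Sec G (W' x \<inter> W' y)\<^esub>
        (Res G (W' y) (W' x \<inter> W' y) (b' y) \<otimes>\<^bsub>Sec G (W' x \<inter> W' y)\<^esub> inv\<^bsub>Sec G (W' x \<inter> W' y)\<^esub> Res G (W' x) (W' x \<inter> W' y) (b' x))"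
    by (rule cohomologousE[OF coh']) blast
  have oW: "openin T (W x)" "x \<in> W x" "openin T (W' x)" "x \<in> W' x" if "x \<in> topspace T" for x
    using W(1) W'(1) that by (simp_all add: pointed_cover_def)
  define A where "A x = W x \<inter> W' x" for x
  have A: "openin T (A x)" "x \<in> A x" "A x \<subseteq> W x" "A x \<subseteq> W' x" if "x \<in> topspace T" for x
    using oW[OF that] by (auto simp: A_def)
  let ?b = "\<lambda>x. Res G (W x) (A x) (b x) \<otimes>\<^bsub>Sec G (A x)\<^esub> Res G (W' x) (A x) (b' x)"
  show ?thesis
  proof (rule cohomologousI[where W = A and b = ?b])
    show "pointed_cover T A" using A by (simp add: pointed_cover_def)
    fix x assume x: "x \<in> topspace T"
    show "A x \<subseteq> U x" "A x \<subseteq> V' x" using A[OF x] W(2)[OF x] W'(3)[OF x] by auto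
    interpret Gx: comm_group "Sec G (A x)" by (rule grp[OF A(1)[OF x]])
    note bA = gres_closed[OF oW(1) A(1,3) W(4)] gres_closed[OF oW(3) A(1,4) W'(4)]
    show "?b x \<in> carrier (Sec G (A x))" using bA[OF x x x x] by simp
    fix y assume y: "y \<in> topspace T"
    let ?N = "A x \<inter> A y" and ?M = "W x \<inter> W y" and ?M' = "W' x \<inter> W' y"
    have N: "openin T ?N" "?N \<subseteq> A x" "?N \<subseteq> A y" "?N \<subseteq> W x" "?N \<subseteq> W y" "?N \<subseteq> W' x" "?N \<subseteq> W' y" "?N \<subseteq> ?M" "?N \<subseteq> ?M'"
      using A[OF x] A[OF y] by auto
    have M: "openin T ?M" "?M \<subseteq> W x" "?M \<subseteq> W y" "?M \<subseteq> U x \<inter> U y" "?M \<subseteq> V x \<inter> V y"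
      "openin T ?M'" "?M' \<subseteq> W' x" "?M' \<subseteq> W' y" "?M' \<subseteq> V x \<inter> V y" "?M' \<subseteq> V' x \<inter> V' y"
      using oW[OF x] oW[OF y] W(2,3)[OF x] W(2,3)[OF y] W'(2,3)[OF x] W'(2,3)[OF y] by auto
    interpret GN: comm_group "Sec G ?N" by (rule grp[OF N(1)])
    interpret GM: comm_group "Sec G ?M" by (rule grp[OF M(1)])
    interpret GM': comm_group "Sec G ?M'" by (rule grp[OF M(6)])
    note K = cochainD(3)[OF C x y] cochainD(3)[OF C' x y] cochainD(3)[OF C'' x y]
    note KC = cochainD(4)[OF C x y] cochainD(4)[OF C' x y] cochainD(4)[OF C'' x y]
    note b = W(4)[OF x] W(4)[OF y] W'(4)[OF x] W'(4)[OF y]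
    note o = oW(1)[OF x] oW(1)[OF y] oW(3)[OF x] oW(3)[OF y]
    have cl: "Res G (W x) ?M (b x) \<in> carrier (Sec G ?M)" "Res G (W y) ?M (b y) \<in> carrier (Sec G ?M)"
      "Res G (W' x) ?M' (b' x) \<in> carrier (Sec G ?M')" "Res G (W' y) ?M' (b' y) \<in> carrier (Sec G ?M')"
      "Res G (U x \<inter> U y) ?M (c x y) \<in> carrier (Sec G ?M)" "Res G (V x \<inter> V y) ?M' (c' x y) \<in> carrier (Sec G ?M')"
      by (rule gres_closed[OF o(1) M(1,2) b(1)], rule gres_closed[OF o(2) M(1,3) b(2)],
          rule gres_closed[OF o(3) M(6,7) b(3)], rule gres_closed[OF o(4) M(6,8) b(4)],
          rule gres_closed[OF K(1) M(1,4) KC(1)], rule gres_closed[OF K(2) M(6,9) KC(2)])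
    let ?c = "Res G (U x \<inter> U y) ?N (c x y)" and ?bx = "Res G (W x) ?N (b x)" and ?by = "Res G (W y) ?N (b y)"
      and ?bx' = "Res G (W' x) ?N (b' x)" and ?by' = "Res G (W' y) ?N (b' y)"
    have cN: "?bx \<in> carrier (Sec G ?N)" "?by \<in> carrier (Sec G ?N)" "?bx' \<in> carrier (Sec G ?N)" "?by' \<in> carrier (Sec G ?N)"
      "?c \<in> carrier (Sec G ?N)"
      by (rule gres_closed[OF o(1) N(1,4) b(1)], rule gres_closed[OF o(2) N(1,5) b(2)],
          rule gres_closed[OF o(3) N(1,6) b(3)], rule gres_closed[OF o(4) N(1,7) b(4)],
          rule gres_closed[OF K(1) N(1) subset_trans[OF N(8) M(4)] KC(1)])
    have 1: "Res G (V x \<inter> V y) ?N (c' x y) = ?c \<otimes>\<^bsub>Sec G ?N\<^esub> (?by \<otimes>\<^bsub>Sec G ?N\<^esub> inv\<^bsub>Sec G ?N\<^esub> ?bx)"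
      using arg_cong[OF eq[OF x y], of "Res G ?M ?N"] cl
      by (simp add: gres_mult[OF M(1) N(1,8)] gres_inv[OF M(1) N(1,8)] gres_comp[OF K(2) M(1) N(1,8) M(5) KC(2)]
        gres_comp[OF K(1) M(1) N(1,8) M(4) KC(1)] gres_comp[OF o(1) M(1) N(1,8) M(2) b(1)]
        gres_comp[OF o(2) M(1) N(1,8) M(3) b(2)])
    have 2: "Res G (V' x \<inter> V' y) ?N (c'' x y) = Res G (V x \<inter> V y) ?N (c' x y) \<otimes>\<^bsub>Sec G ?N\<^esub> (?by' \<otimes>\<^bsub>Sec G ?N\<^esub> inv\<^bsub>Sec G ?N\<^esub> ?bx')"
      using arg_cong[OF eq'[OF x y], of "Res G ?M' ?N"] cl
      by (simp add: gres_mult[OF M(6) N(1,9)] gres_inv[OF M(6) N(1,9)] gres_comp[OF K(3) M(6) N(1,9) M(10) KC(3)]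
        gres_comp[OF K(2) M(6) N(1,9) M(9) KC(2)] gres_comp[OF o(3) M(6) N(1,9) M(7) b(3)]
        gres_comp[OF o(4) M(6) N(1,9) M(8) b(4)])
    have 3: "Res G (A x) ?N (?b x) = ?bx \<otimes>\<^bsub>Sec G ?N\<^esub> ?bx'"
      using gres_mult[OF A(1)[OF x] N(1,2) bA(1)[OF x x x x] bA(2)[OF x x x x]]
        gres_comp[OF o(1) A(1)[OF x] N(1,2) A(3)[OF x] b(1)] gres_comp[OF o(3) A(1)[OF x] N(1,2) A(4)[OF x] b(3)] by simp
    have 4: "Res G (A y) ?N (?b y) = ?by \<otimes>\<^bsub>Sec G ?N\<^esub> ?by'"
      using gres_mult[OF A(1)[OF y] N(1,3) bA(1)[OF y y y y] bA(2)[OF y y y y]]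
        gres_comp[OF o(2) A(1)[OF y] N(1,3) A(3)[OF y] b(2)] gres_comp[OF o(4) A(1)[OF y] N(1,3) A(4)[OF y] b(4)] by simp
    show "Res G (V' x \<inter> V' y) ?N (c'' x y) = ?c \<otimes>\<^bsub>Sec G ?N\<^esub>
        (Res G (A y) ?N (?b y) \<otimes>\<^bsub>Sec G ?N\<^esub> inv\<^bsub>Sec G ?N\<^esub> Res G (A x) ?N (?b x))"
      unfolding 1 2 3 4 using cN by (simp add: GN.inv_mult GN.m_ac)
  qed
qed

lemma H1_class_eqI:
  assumes C: "cochain C" and C': "cochain C'" and coh: "cohomologous T G C C'"
  shows "H1_class T G C = H1_class T G C'"
proof -
  obtain U c V c' where e: "C = (U, c)" "C' = (V, c')" by (cases C, cases C') auto
  note coh2 = cohomologous_sym[OF C[unfolded e] C'[unfolded e] coh[unfolded e]]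
  show ?thesis
    unfolding H1_class_def e
    using cohomologous_trans[OF C'[unfolded e] C[unfolded e] _ coh2]
      cohomologous_trans[OF C[unfolded e] C'[unfolded e] _ coh[unfolded e]] cocycle_cochain
    by (intro Collect_cong conj_cong refl iffI) (force, force)
qed

lemma H1_class_self: "cocycle T G C \<Longrightarrow> C \<in> H1_class T G C"
  using cohomologous_refl cocycle_cochain by (cases C) (simp add: H1_class_def)

end

locale gpre_hom = A: gpre_space T A + B: gpre_space T B
  for T :: "'x topology" and A :: "('x, 'a) group_presheaf" and B :: "('x, 'b) group_presheaf" +
  fixes h :: "('x, 'a, 'b) sheaf_map"
  assumes hc: "openin T U \<Longrightarrow> a \<in> carrier (Sec A U) \<Longrightarrow> h U a \<in> carrier (Sec B U)"
    and hm: "openin T U \<Longrightarrow> a \<in> carrier (Sec A U) \<Longrightarrow> b \<in> carrier (Sec A U)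
      \<Longrightarrow> h U (a \<otimes>\<^bsub>Sec A U\<^esub> b) = h U a \<otimes>\<^bsub>Sec B U\<^esub> h U b"
    and hr: "openin T U \<Longrightarrow> openin T V \<Longrightarrow> V \<subseteq> U \<Longrightarrow> a \<in> carrier (Sec A U) \<Longrightarrow> Res B U V (h U a) = h V (Res A U V a)"
begin

lemma h_inv:
  assumes U: "openin T U" and a: "a \<in> carrier (Sec A U)"
  shows "h U (inv\<^bsub>Sec A U\<^esub> a) = inv\<^bsub>Sec B U\<^esub> h U a"
proof -
  have "group_hom (Sec A U) (Sec B U) (h U)"
    using hc[OF U] hm[OF U]
    by (auto simp: group_hom_def group_hom_axioms_def hom_def comm_group.axioms(2)[OF A.grp[OF U]] comm_group.axioms(2)[OF B.grp[OF U]])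
  then show ?thesis using a by (rule group_hom.hom_inv)
qed

abbreviation "hC U c \<equiv> (\<lambda>x y. h (U x \<inter> U y) (c x y))"

lemma h_cochain:
  assumes c: "A.cochain (U, c)"
  shows "B.cochain (U, hC U c)"
proof -
  have "h (U x \<inter> U y) (c x y) \<in> carrier (Sec B (U x \<inter> U y))" if "x \<in> topspace T" "y \<in> topspace T" for x y
    by (rule hc[OF A.cochainD(3)[OF c that] A.cochainD(4)[OF c that]])
  then show ?thesis using c by (simp add: A.cochain_def B.cochain_def)
qed

lemma h_cocycle:
  assumes c: "cocycle T A (U, c)"
  shows "cocycle T B (U, hC U c)"
proof -
  note C = A.cochainD[OF A.cocycle_cochain[OF c]]
  have "Res B (U x \<inter> U y) (U x \<inter> U y \<inter> U z) (h (U x \<inter> U y) (c x y)) \<otimes>\<^bsub>Sec B (U x \<inter> U y \<inter> U z)\<^esub>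
      Res B (U y \<inter> U z) (U x \<inter> U y \<inter> U z) (h (U y \<inter> U z) (c y z)) = Res B (U x \<inter> U z) (U x \<inter> U y \<inter> U z) (h (U x \<inter> U z) (c x z))"
    if x: "x \<in> topspace T" and y: "y \<in> topspace T" and z: "z \<in> topspace T" for x y z
  proof -
    let ?W = "U x \<inter> U y \<inter> U z"
    have W: "openin T ?W" "?W \<subseteq> U x \<inter> U y" "?W \<subseteq> U y \<inter> U z" "?W \<subseteq> U x \<inter> U z" using C(1)[OF x] C(1)[OF y] C(1)[OF z] by auto
    have "Res A (U x \<inter> U y) ?W (c x y) \<otimes>\<^bsub>Sec A ?W\<^esub> Res A (U y \<inter> U z) ?W (c y z) = Res A (U x \<inter> U z) ?W (c x z)"
      using c x y z by (simp add: cocycle_def Let_def)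
    from arg_cong[OF this, of "h ?W"] show ?thesis
      using hm[OF W(1) A.gres_closed[OF C(3)[OF x y] W(1,2) C(4)[OF x y]] A.gres_closed[OF C(3)[OF y z] W(1,3) C(4)[OF y z]]]
        hr[OF C(3)[OF x y] W(1,2) C(4)[OF x y]] hr[OF C(3)[OF y z] W(1,3) C(4)[OF y z]] hr[OF C(3)[OF x z] W(1,4) C(4)[OF x z]]
      by simp
  qed
  then show ?thesis
    using h_cochain[OF A.cocycle_cochain[OF c]] unfolding cocycle_def B.cochain_def by (simp add: Let_def)
qed

lemma h_cohomologous:
  assumes C: "A.cochain (U, c)" and C': "A.cochain (V, c')" and coh: "cohomologous T A (U, c) (V, c')"
  shows "cohomologous T B (U, hC U c) (V, hC V c')"
proof -
  obtain W b where W: "pointed_cover T W" "\<And>x. x \<in> topspace T \<Longrightarrow> W x \<subseteq> U x"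
    "\<And>x. x \<in> topspace T \<Longrightarrow> W x \<subseteq> V x" "\<And>x. x \<in> topspace T \<Longrightarrow> b x \<in> carrier (Sec A (W x))"
    and eq: "\<And>x y. x \<in> topspace T \<Longrightarrow> y \<in> topspace T \<Longrightarrow>
      Res A (V x \<inter> V y) (W x \<inter> W y) (c' x y) = Res A (U x \<inter> U y) (W x \<inter> W y) (c x y) \<otimes>\<^bsub>Sec A (W x \<inter> W y)\<^esub>
        (Res A (W y) (W x \<inter> W y) (b y) \<otimes>\<^bsub>Sec A (W x \<inter> W y)\<^esub> inv\<^bsub>Sec A (W x \<inter> W y)\<^esub> Res A (W x) (W x \<inter> W y) (b x))"
    by (rule A.cohomologousE[OF coh]) blast
  have oW: "openin T (W x)" if "x \<in> topspace T" for x using W(1) that by (simp add: pointed_cover_def)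
  show ?thesis
  proof (rule B.cohomologousI[where W = W and b = "\<lambda>x. h (W x) (b x)", OF W(1-3)])
    fix x assume x: "x \<in> topspace T"
    show "h (W x) (b x) \<in> carrier (Sec B (W x))" by (rule hc[OF oW[OF x] W(4)[OF x]])
    fix y assume y: "y \<in> topspace T"
    let ?N = "W x \<inter> W y"
    have N: "openin T ?N" "?N \<subseteq> W x" "?N \<subseteq> W y" "?N \<subseteq> U x \<inter> U y" "?N \<subseteq> V x \<inter> V y"
      using oW[OF x] oW[OF y] W(2)[OF x] W(2)[OF y] W(3)[OF x] W(3)[OF y] by auto
    interpret AN: comm_group "Sec A ?N" by (rule A.grp[OF N(1)])
    note bx = A.gres_closed[OF oW[OF x] N(1,2) W(4)[OF x]] and bY = A.gres_closed[OF oW[OF y] N(1,3) W(4)[OF y]]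
    note cx = A.gres_closed[OF A.cochainD(3)[OF C x y] N(1,4) A.cochainD(4)[OF C x y]]
    show "Res B (V x \<inter> V y) ?N (h (V x \<inter> V y) (c' x y)) = Res B (U x \<inter> U y) ?N (h (U x \<inter> U y) (c x y)) \<otimes>\<^bsub>Sec B ?N\<^esub>
        (Res B (W y) ?N (h (W y) (b y)) \<otimes>\<^bsub>Sec B ?N\<^esub> inv\<^bsub>Sec B ?N\<^esub> Res B (W x) ?N (h (W x) (b x)))"
      unfolding hr[OF A.cochainD(3)[OF C' x y] N(1,5) A.cochainD(4)[OF C' x y]] eq[OF x y]
        hr[OF A.cochainD(3)[OF C x y] N(1,4) A.cochainD(4)[OF C x y]] hr[OF oW[OF x] N(1,2) W(4)[OF x]]
        hr[OF oW[OF y] N(1,3) W(4)[OF y]] h_inv[OF N(1) bx, symmetric]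
        hm[OF N(1) bY AN.inv_closed[OF bx], symmetric] hm[OF N(1) cx AN.m_closed[OF bY AN.inv_closed[OF bx]], symmetric] ..
  qed
qed

text \<open>\<open>H1_map\<close> is a union over all representatives. Those on the same class have
  cohomologous images, so they contribute one and the same class, and a cocycle belongs to its own
  class, so the union is not empty.\<close>

lemma H1_map_class:
  assumes c: "cocycle T A (U, c)"
  shows "H1_map T B h (H1_class T A (U, c)) = H1_class T B (U, hC U c)"
proof -
  have "H1_class T B (V, hC V c') = H1_class T B (U, hC U c)" if m: "(V, c') \<in> H1_class T A (U, c)" for V c'
  proof -
    have c': "cocycle T A (V, c')" "cohomologous T A (U, c) (V, c')" using m by (simp_all add: H1_class_def)
    note C = A.cocycle_cochain[OF c] A.cocycle_cochain[OF c'(1)]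
    show ?thesis
      by (rule B.H1_class_eqI[OF h_cochain[OF C(1)] h_cochain[OF C(2)] h_cohomologous[OF C c'(2)], symmetric])
  qed
  then have "(\<lambda>(V, c'). H1_class T B (V, hC V c')) C = H1_class T B (U, hC U c)" if "C \<in> H1_class T A (U, c)" for C
    using that by (cases C) simp
  then show ?thesis
    unfolding H1_map_def using A.H1_class_self[OF c] by blast
qed

end

section \<open>Cocycles of extensions\<close>

lemma add_presheaf_simps [simp]:
  "carrier (Sec (add_presheaf M) U) = carrier (Sec M U)"
  "x \<otimes>\<^bsub>Sec (add_presheaf M) U\<^esub> y = x \<oplus>\<^bsub>Sec M U\<^esub> y"
  "\<one>\<^bsub>Sec (add_presheaf M) U\<^esub> = \<zero>\<^bsub>Sec M U\<^esub>"
  "inv\<^bsub>Sec (add_presheaf M) U\<^esub> x = \<ominus>\<^bsub>Sec M U\<^esub> x"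
  "Res (add_presheaf M) = Res M"
  by (simp_all add: add_presheaf_def a_inv_def m_inv_def)

lemma (in pmod_space) add_gpre: "gpre_space (Top X) (add_presheaf M)"
proof (rule gpre_space.intro)
  show "presheaf (Top X) (add_presheaf M)" using pre unfolding presheaf_def by (simp only: add_presheaf_simps)
  show "comm_group (Sec (add_presheaf M) U)" if U: "opn U" for U
  proof -
    interpret module "Rg X U" "Sec M U" by (rule mods[OF U])
    show ?thesis
    proof (rule comm_groupI)
      fix x assume "x \<in> carrier (Sec (add_presheaf M) U)"
      then show "\<exists>y\<in>carrier (Sec (add_presheaf M) U). y \<otimes>\<^bsub>Sec (add_presheaf M) U\<^esub> x = \<one>\<^bsub>Sec (add_presheaf M) U\<^esub>"
        by (intro bexI[of _ "\<ominus>\<^bsub>Sec M U\<^esub> x"]) (simp_all add: M.l_neg)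
    qed (simp_all add: M.a_ac)
  qed
qed (simp add: res_add)

text \<open>
  Lifts \<open>b x\<close> of the sections \<open>e x\<close>, and the sections \<open>w x y\<close> that measure how far the lifts are
  from satisfying the relation \<open>e y = r x y \<cdot> e x\<close>. For \<open>e = 1\<close> and \<open>r = 1\<close> this is the cocycle of the
  connecting homomorphism.
\<close>

definition lift_data ::
  "('x, 'r) ringed \<Rightarrow> ('x, 'r, 'g) mod_presheaf \<Rightarrow> ('x \<Rightarrow> 'x set) \<Rightarrow> ('x \<Rightarrow> 'e) \<Rightarrow> ('x \<Rightarrow> 'x \<Rightarrow> 'r)
     \<Rightarrow> ('x \<Rightarrow> 'x \<Rightarrow> 'g) \<Rightarrow> ('x, 'r, 'g, 'b, 'e) ext \<Rightarrow> bool" where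
  "lift_data X G U e r w = (\<lambda>(B, i, p). \<exists>b.
     (\<forall>x\<in>topspace (Top X). b x \<in> carrier (Sec B (U x)) \<and> p (U x) (b x) = e x) \<and>
     (\<forall>x\<in>topspace (Top X). \<forall>y\<in>topspace (Top X). w x y \<in> carrier (Sec G (U x \<inter> U y)) \<and>
        i (U x \<inter> U y) (w x y) = Res B (U y) (U x \<inter> U y) (b y) \<ominus>\<^bsub>Sec B (U x \<inter> U y)\<^esub>
          (r x y \<odot>\<^bsub>Sec B (U x \<inter> U y)\<^esub> Res B (U x) (U x \<inter> U y) (b x))))"

lemma lift_data_cong:
  assumes w: "\<And>x y. x \<in> topspace (Top X) \<Longrightarrow> y \<in> topspace (Top X) \<Longrightarrow> w x y = w' x y"
    and \<eta>: "lift_data X G U e r w \<eta>"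
  shows "lift_data X G U e r w' \<eta>"
proof -
  obtain B i p where "\<eta> = (B, i, p)" by (cases \<eta>)
  then show ?thesis using \<eta> w by (simp add: lift_data_def cong: ball_cong)
qed

section \<open>Lifts over a fixed cover and maps between classes of extensions\<close>

locale cover_space = rspace X for X :: "('x, 'r) ringed" +
  fixes U :: "'x \<Rightarrow> 'x set"
  assumes cover: "pointed_cover (Top X) U"
begin

lemma U: "x \<in> TX \<Longrightarrow> opn (U x)" "x \<in> TX \<Longrightarrow> x \<in> U x" "x \<in> TX \<Longrightarrow> y \<in> TX \<Longrightarrow> opn (U x \<inter> U y)"
  using cover by (auto simp: pointed_cover_def)

text \<open>An equivalence \<open>h\<close> turns the lifts \<open>b x\<close> into lifts
  \<open>h (b x)\<close> of the same sections. It is linear, commutes with restriction and is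
  compatible with the inclusions of \<open>G\<close>, so the defect is the same
  \<open>w\<close>.\<close>

lemma lift_data_equiv:
  fixes E :: "('x, 'r, 'e) mod_presheaf" and G :: "('x, 'r, 'g) mod_presheaf"
    and \<xi> :: "('x, 'r, 'g, 'b, 'e) ext" and \<eta> :: "('x, 'r, 'g, 'c, 'e) ext"
  assumes E: "pmod X E" and G: "pmod X G" and \<xi>: "extension X E G \<xi>" and \<eta>: "extension X E G \<eta>"
    and eq: "ext_equiv X E G \<xi> \<eta>" and r: "\<And>x y. x \<in> TX \<Longrightarrow> y \<in> TX \<Longrightarrow> r x y \<in> carrier (Rg X (U x \<inter> U y))"
    and d: "lift_data X G U e r w \<xi>"
  shows "lift_data X G U e r w \<eta>"
proof -
  obtain B i p where x: "\<xi> = (B, i, p)" by (cases \<xi>)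
  obtain B' i' p' where x': "\<eta> = (B', i', p')" by (cases \<eta>)
  interpret A: ext_space X E G B i p by (rule ext_spaceI[OF ringed E G \<xi>[unfolded x]])
  interpret A': ext_space X E G B' i' p' by (rule ext_spaceI[OF ringed E G \<eta>[unfolded x']])
  obtain h where iso: "mod_iso X B B' h"
    and hh: "\<forall>U. opn U \<longrightarrow> (\<forall>g\<in>carrier (Sec G U). h U (i U g) = i' U g) \<and> (\<forall>b\<in>carrier (Sec B U). p' U (h U b) = p U b)"
    using eq unfolding x x' ext_equiv_iff by (elim exE conjE)
  have hi: "h V (i V g) = i' V g" if "opn V" "g \<in> carrier (Sec G V)" for V g using hh that by simp
  have hp: "p' V (h V b) = p V b" if "opn V" "b \<in> carrier (Sec B V)" for V b using hh that by simp
  have h: "hom_on X V B B' h" if "opn V" for V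
    using iso by (intro hom_on_top[OF _ that]) (simp add: mod_iso_def mod_hom_iff)
  obtain b where b: "\<And>x. x \<in> TX \<Longrightarrow> b x \<in> carrier (Sec B (U x))" "\<And>x. x \<in> TX \<Longrightarrow> p (U x) (b x) = e x"
    and w: "\<And>x y. x \<in> TX \<Longrightarrow> y \<in> TX \<Longrightarrow> w x y \<in> carrier (Sec G (U x \<inter> U y))"
    and iw: "\<And>x y. x \<in> TX \<Longrightarrow> y \<in> TX \<Longrightarrow> i (U x \<inter> U y) (w x y) = Res B (U y) (U x \<inter> U y) (b y) \<ominus>\<^bsub>Sec B (U x \<inter> U y)\<^esub>
          (r x y \<odot>\<^bsub>Sec B (U x \<inter> U y)\<^esub> Res B (U x) (U x \<inter> U y) (b x))"
    using d unfolding x lift_data_def by auto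
  have "i' (U x \<inter> U y) (w x y) = Res B' (U y) (U x \<inter> U y) (h (U y) (b y)) \<ominus>\<^bsub>Sec B' (U x \<inter> U y)\<^esub>
          (r x y \<odot>\<^bsub>Sec B' (U x \<inter> U y)\<^esub> Res B' (U x) (U x \<inter> U y) (h (U x) (b x)))"
    if xy: "x \<in> TX" "y \<in> TX" for x y
  proof -
    let ?N = "U x \<inter> U y"
    have N: "opn ?N" "?N \<subseteq> U x" "?N \<subseteq> U y" using U xy by auto
    note bx = A.B.res_closed[OF U(1)[OF xy(1)] N(1,2) b(1)[OF xy(1)]] and bY = A.B.res_closed[OF U(1)[OF xy(2)] N(1,3) b(1)[OF xy(2)]]
    have "i' ?N (w x y) = h ?N (i ?N (w x y))" by (rule hi[OF N(1) w[OF xy], symmetric])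
    then show ?thesis
      unfolding iw[OF xy] using hom_on_diff[OF h[OF N(1)] N(1) subset_refl A.B.pmod A'.B.pmod bY A.B.smult_closed[OF N(1) r[OF xy] bx]]
        hom_on_smult[OF h[OF N(1)] N(1) subset_refl r[OF xy] bx]
        hom_on_nat[OF h[OF U(1)[OF xy(1)]] U(1)[OF xy(1)] N(1,2) subset_refl b(1)[OF xy(1)]]
        hom_on_nat[OF h[OF U(1)[OF xy(2)]] U(1)[OF xy(2)] N(1,3) subset_refl b(1)[OF xy(2)]] by simp
  qed
  moreover have "h (U x) (b x) \<in> carrier (Sec B' (U x))" "p' (U x) (h (U x) (b x)) = e x" if "x \<in> TX" for x
    using hom_on_closed[OF h[OF U(1)[OF that]] U(1)[OF that] subset_refl b(1)[OF that]] hp[OF U(1)[OF that] b(1)[OF that]] b(2)[OF that]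
    by simp_all
  ultimately show ?thesis
    unfolding x' lift_data_def using w by (auto intro!: exI[of _ "\<lambda>x. h (U x) (b x)"])
qed

lemma ext_class_lift_data:
  fixes E :: "('x, 'r, 'e) mod_presheaf" and G :: "('x, 'r, 'g) mod_presheaf" and \<xi> :: "('x, 'r, 'g, 'b, 'e) ext"
  assumes E: "pmod X E" and G: "pmod X G" and \<xi>: "extension X E G \<xi>"
    and r: "\<And>x y. x \<in> TX \<Longrightarrow> y \<in> TX \<Longrightarrow> r x y \<in> carrier (Rg X (U x \<inter> U y))"
    and d: "lift_data X G U e r w \<xi>" and \<eta>: "\<eta> \<in> ext_class X E G \<xi>"
  shows "extension X E G \<eta>" "lift_data X G U e r w \<eta>"
  using \<eta> lift_data_equiv[OF E G \<xi> _ _ r d, of \<eta>] by (auto simp: ext_class_def)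

text \<open>The conclusions have the same three-part form as the assumptions on \<open>C\<close>:
  nonempty, consisting of extensions, and all members with lift data. This shape is kept by every
  map between classes, so that the maps can be chained.\<close>

lemma ext_push_lift_data:
  fixes E :: "('x, 'r, 'e) mod_presheaf" and G :: "('x, 'r, 'g) mod_presheaf" and G' :: "('x, 'r, 'h) mod_presheaf"
  assumes E: "pmod X E" and G: "pmod X G" and G': "pmod X G'" and iso: "mod_iso X G G' \<alpha>"
    and r: "\<And>x y. x \<in> TX \<Longrightarrow> y \<in> TX \<Longrightarrow> r x y \<in> carrier (Rg X (U x \<inter> U y))"
    and C: "C \<noteq> {}" "\<And>\<eta>. \<eta> \<in> C \<Longrightarrow> extension X E G \<eta>" "\<And>\<eta>. \<eta> \<in> C \<Longrightarrow> lift_data X G U e r w \<eta>"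
  defines "w' \<equiv> \<lambda>x y. \<alpha> (U x \<inter> U y) (w x y)"
  shows "ext_push X E G G' \<alpha> C \<noteq> {}"
    and "\<eta> \<in> ext_push X E G G' \<alpha> C \<Longrightarrow> extension X E G' \<eta>"
    and "\<eta> \<in> ext_push X E G G' \<alpha> C \<Longrightarrow> lift_data X G' U e r w' \<eta>"
proof -
  have bij: "\<And>V. opn V \<Longrightarrow> bij_betw (\<alpha> V) (carrier (Sec G V)) (carrier (Sec G' V))"
    using iso by (simp add: mod_iso_def)
  let ?push = "\<lambda>i V. i V \<circ> inv_into (carrier (Sec G V)) (\<alpha> V)"
  have ext: "extension X E G' (B, ?push i, p)" if "(B, i, p) \<in> C" for B i p
  proof -
    interpret ext_space X E G B i p by (rule ext_spaceI[OF ringed E G C(2)[OF that]])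
    show ?thesis by (rule push[OF G' iso])
  qed
  have ld: "lift_data X G' U e r w' (B, ?push i, p)" if "(B, i, p) \<in> C" for B i p
  proof -
    have "\<alpha> (U x \<inter> U y) (w x y) \<in> carrier (Sec G' (U x \<inter> U y))"
      "inv_into (carrier (Sec G (U x \<inter> U y))) (\<alpha> (U x \<inter> U y)) (\<alpha> (U x \<inter> U y) (w x y)) = w x y"
      if "x \<in> TX" "y \<in> TX" "w x y \<in> carrier (Sec G (U x \<inter> U y))" for x y
      using bij[OF U(3)[OF that(1,2)]] that(3) by (auto simp: bij_betw_def)
    then show ?thesis
      using C(3)[OF that] unfolding lift_data_def w'_def by auto
  qed
  show "ext_push X E G G' \<alpha> C \<noteq> {}"
  proof -
    obtain B i p where m: "(B, i, p) \<in> C" using C(1) by auto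
    show ?thesis using m ext_class_nonempty[OF ringed E G' ext[OF m]] unfolding ext_push_def by blast
  qed
  assume "\<eta> \<in> ext_push X E G G' \<alpha> C"
  then obtain B i p where m: "(B, i, p) \<in> C" "\<eta> \<in> ext_class X E G' (B, ?push i, p)" unfolding ext_push_def by blast
  show "extension X E G' \<eta>" "lift_data X G' U e r w' \<eta>"
    using ext_class_lift_data[OF E G' ext[OF m(1)] r ld[OF m(1)] m(2)] by auto
qed

text \<open>Independence of the connecting homomorphism from the lifts. Two systems of lifts
  \<open>t\<close>, \<open>s\<close> of 1 differ on a common refinement by sections
  \<open>b x\<close> of \<open>G\<close>, and the cocycles of differences then differ by the
  coboundary of \<open>b\<close>. Independence from the member of \<open>C\<close> is built into the
  assumption: each member has some system of lifts with the same \<open>w\<close>.\<close>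

lemma ext_to_H1_eq:
  fixes G :: "('x, 'r, 'g) mod_presheaf"
  assumes G: "pmod X G"
    and C: "C \<noteq> {}" "\<And>\<eta>. \<eta> \<in> C \<Longrightarrow> extension X (str_mod X) G \<eta>"
    "\<And>\<eta>. \<eta> \<in> C \<Longrightarrow> lift_data X G U (\<lambda>x. \<one>\<^bsub>Rg X (U x)\<^esub>) (\<lambda>x y. \<one>\<^bsub>Rg X (U x \<inter> U y)\<^esub>) w \<eta>"
  shows "ext_to_H1 X G C = H1_class (Top X) (add_presheaf G) (U, w)"
proof -
  interpret G: pmod_space X G by unfold_locales (rule G)
  interpret H: gpre_space "Top X" "add_presheaf G" by (rule G.add_gpre)
  \<comment> \<open>The condition inside \<open>ext_to_H1\<close>, with the lifts \<open>t\<close>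
    made explicit; it is the lift data for sections 1 with the trivial factors 1 removed.\<close>
  define Q where "Q B i p V c t \<longleftrightarrow> (\<forall>x\<in>TX. t x \<in> carrier (Sec B (V x)) \<and> p (V x) (t x) = \<one>\<^bsub>Rg X (V x)\<^esub>) \<and>
          (\<forall>x\<in>TX. \<forall>y\<in>TX. c x y \<in> carrier (Sec G (V x \<inter> V y)) \<and>
             i (V x \<inter> V y) (c x y) = Res B (V y) (V x \<inter> V y) (t y) \<ominus>\<^bsub>Sec B (V x \<inter> V y)\<^esub> Res B (V x) (V x \<inter> V y) (t x))"
    for B :: "('x, 'r, 'g \<times> 'r) mod_presheaf" and i p V c t
  have Qw: "\<exists>t. Q B i p U w t" if m: "(B, i, p) \<in> C" for B i p
  proof -
    interpret ext_space X "str_mod X" G B i p by (rule ext_spaceI[OF ringed str.pmod G C(2)[OF m]])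
    obtain t where t: "\<And>x. x \<in> TX \<Longrightarrow> t x \<in> carrier (Sec B (U x))" "\<And>x. x \<in> TX \<Longrightarrow> p (U x) (t x) = \<one>\<^bsub>Rg X (U x)\<^esub>"
      and w: "\<And>x y. x \<in> TX \<Longrightarrow> y \<in> TX \<Longrightarrow> w x y \<in> carrier (Sec G (U x \<inter> U y))"
      and iw: "\<And>x y. x \<in> TX \<Longrightarrow> y \<in> TX \<Longrightarrow> i (U x \<inter> U y) (w x y) = Res B (U y) (U x \<inter> U y) (t y) \<ominus>\<^bsub>Sec B (U x \<inter> U y)\<^esub>
          (\<one>\<^bsub>Rg X (U x \<inter> U y)\<^esub> \<odot>\<^bsub>Sec B (U x \<inter> U y)\<^esub> Res B (U x) (U x \<inter> U y) (t x))"
      using C(3)[OF m] unfolding lift_data_def by auto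
    have "\<one>\<^bsub>Rg X (U x \<inter> U y)\<^esub> \<odot>\<^bsub>Sec B (U x \<inter> U y)\<^esub> Res B (U x) (U x \<inter> U y) (t x) = Res B (U x) (U x \<inter> U y) (t x)"
      if "x \<in> TX" "y \<in> TX" for x y
      by (rule module.smult_one[OF B.mods[OF U(3)[OF that]] B.res_closed[OF U(1)[OF that(1)] U(3)[OF that] _ t(1)[OF that(1)]]]) simp
    then show ?thesis unfolding Q_def using t w iw by (intro exI[of _ t]) simp
  qed
  have coh: "H1_class (Top X) (add_presheaf G) (V, c) = H1_class (Top X) (add_presheaf G) (U, w)"
    if m: "(B, i, p) \<in> C" and V: "pointed_cover (Top X) V" and q: "Q B i p V c t" for B i p V c t
  proof -
    interpret ext_space X "str_mod X" G B i p by (rule ext_spaceI[OF ringed str.pmod G C(2)[OF m]])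
    obtain s where s: "Q B i p U w s" using Qw[OF m] by blast
    have oV: "opn (V x)" "x \<in> V x" if "x \<in> TX" for x using V that by (auto simp: pointed_cover_def)
    have cc: "H.cochain (V, c)" "H.cochain (U, w)"
      using q s V cover unfolding Q_def H.cochain_def by auto
    define W where "W x = V x \<inter> U x" for x
    have W: "opn (W x)" "x \<in> W x" "W x \<subseteq> V x" "W x \<subseteq> U x" if "x \<in> TX" for x
      using oV[OF that] U[OF that] by (auto simp: W_def)
    have t1: "t x \<in> carrier (Sec B (V x))" "p (V x) (t x) = \<one>\<^bsub>Rg X (V x)\<^esub>"
      and s1: "s x \<in> carrier (Sec B (U x))" "p (U x) (s x) = \<one>\<^bsub>Rg X (U x)\<^esub>" if "x \<in> TX" for x
      using q s that unfolding Q_def by auto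
    have c2: "c x y \<in> carrier (Sec G (V x \<inter> V y))"
        "i (V x \<inter> V y) (c x y) = Res B (V y) (V x \<inter> V y) (t y) \<ominus>\<^bsub>Sec B (V x \<inter> V y)\<^esub> Res B (V x) (V x \<inter> V y) (t x)"
      and w2: "w x y \<in> carrier (Sec G (U x \<inter> U y))"
        "i (U x \<inter> U y) (w x y) = Res B (U y) (U x \<inter> U y) (s y) \<ominus>\<^bsub>Sec B (U x \<inter> U y)\<^esub> Res B (U x) (U x \<inter> U y) (s x)"
      if "x \<in> TX" "y \<in> TX" for x y
      using q s that unfolding Q_def by auto
    have "\<exists>b\<in>carrier (Sec G (W x)). i (W x) b = Res B (U x) (W x) (s x) \<ominus>\<^bsub>Sec B (W x)\<^esub> Res B (V x) (W x) (t x)" if x: "x \<in> TX" for x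
    proof (rule p_eqD[OF W(1)[OF x] B.res_closed[OF U(1)[OF x] W(1,4)[OF x] s1(1)[OF x]] B.res_closed[OF oV(1)[OF x] W(1,3)[OF x] t1(1)[OF x]]])
      show "p (W x) (Res B (U x) (W x) (s x)) = p (W x) (Res B (V x) (W x) (t x))"
        using p_res[OF U(1)[OF x] W(1,4)[OF x] s1(1)[OF x]] p_res[OF oV(1)[OF x] W(1,3)[OF x] t1(1)[OF x]]
        by (simp add: s1(2)[OF x] t1(2)[OF x] rr_one[OF U(1)[OF x] W(1,4)[OF x]] rr_one[OF oV(1)[OF x] W(1,3)[OF x]])
    qed
    then obtain b where b: "\<And>x. x \<in> TX \<Longrightarrow> b x \<in> carrier (Sec G (W x))"
      "\<And>x. x \<in> TX \<Longrightarrow> i (W x) (b x) = Res B (U x) (W x) (s x) \<ominus>\<^bsub>Sec B (W x)\<^esub> Res B (V x) (W x) (t x)"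
      by metis
    have "cohomologous (Top X) (add_presheaf G) (V, c) (U, w)"
    proof (rule H.cohomologousI[where W = W and b = b])
      show "pointed_cover (Top X) W" using W by (simp add: pointed_cover_def)
      fix x assume x: "x \<in> TX"
      show "W x \<subseteq> V x" "W x \<subseteq> U x" "b x \<in> carrier (Sec (add_presheaf G) (W x))" using W[OF x] b[OF x] by auto
      fix y assume y: "y \<in> TX"
      let ?N = "W x \<inter> W y"
      have N: "opn ?N" "?N \<subseteq> W x" "?N \<subseteq> W y" "?N \<subseteq> V x \<inter> V y" "?N \<subseteq> U x \<inter> U y" using W[OF x] W[OF y] by auto
      have o: "opn (V x \<inter> V y)" "opn (U x \<inter> U y)" using oV x y U by auto
      interpret GN: module "Rg X ?N" "Sec G ?N" by (rule G.mods[OF N(1)])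
      interpret BN: module "Rg X ?N" "Sec B ?N" by (rule B.mods[OF N(1)])
      note bG = G.res_closed[OF W(1)[OF x] N(1,2) b(1)[OF x]] G.res_closed[OF W(1)[OF y] N(1,3) b(1)[OF y]]
      note cG = G.res_closed[OF o(1) N(1,4) c2(1)[OF x y]] G.res_closed[OF o(2) N(1,5) w2(1)[OF x y]]
      let ?sx = "Res B (U x) ?N (s x)" and ?sy = "Res B (U y) ?N (s y)" and ?tx = "Res B (V x) ?N (t x)" and ?ty = "Res B (V y) ?N (t y)"
      have sub: "?N \<subseteq> U x" "?N \<subseteq> U y" "?N \<subseteq> V x" "?N \<subseteq> V y" using N by auto
      have cl: "?sx \<in> carrier (Sec B ?N)" "?sy \<in> carrier (Sec B ?N)" "?tx \<in> carrier (Sec B ?N)" "?ty \<in> carrier (Sec B ?N)"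
        using B.res_closed[OF U(1)[OF x] N(1) sub(1) s1(1)[OF x]] B.res_closed[OF U(1)[OF y] N(1) sub(2) s1(1)[OF y]]
          B.res_closed[OF oV(1)[OF x] N(1) sub(3) t1(1)[OF x]] B.res_closed[OF oV(1)[OF y] N(1) sub(4) t1(1)[OF y]] by auto
      have ib: "i ?N (Res G (W z) ?N (b z)) = Res B (U z) ?N (s z) \<ominus>\<^bsub>Sec B ?N\<^esub> Res B (V z) ?N (t z)"
        if z: "z \<in> TX" and Nz: "?N \<subseteq> W z" for z
      proof -
        have "i ?N (Res G (W z) ?N (b z)) = Res B (W z) ?N (i (W z) (b z))" by (rule i_res[OF W(1)[OF z] N(1) Nz b(1)[OF z], symmetric])
        then show ?thesis
          unfolding b(2)[OF z] using B.res_diff[OF W(1)[OF z] N(1) Nz B.res_closed[OF U(1)[OF z] W(1,4)[OF z] s1(1)[OF z]]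
              B.res_closed[OF oV(1)[OF z] W(1,3)[OF z] t1(1)[OF z]]]
            B.res_comp[OF U(1)[OF z] W(1)[OF z] N(1) Nz W(4)[OF z] s1(1)[OF z]]
            B.res_comp[OF oV(1)[OF z] W(1)[OF z] N(1) Nz W(3)[OF z] t1(1)[OF z]] by simp
      qed
      have ic: "i ?N (Res G (V x \<inter> V y) ?N (c x y)) = ?ty \<ominus>\<^bsub>Sec B ?N\<^esub> ?tx"
      proof -
        have "i ?N (Res G (V x \<inter> V y) ?N (c x y)) = Res B (V x \<inter> V y) ?N (i (V x \<inter> V y) (c x y))"
          by (rule i_res[OF o(1) N(1,4) c2(1)[OF x y], symmetric])
        then show ?thesis
          unfolding c2(2)[OF x y] using B.res_diff[OF o(1) N(1,4) B.res_closed[OF oV(1)[OF y] o(1) _ t1(1)[OF y]]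
              B.res_closed[OF oV(1)[OF x] o(1) _ t1(1)[OF x]]]
            B.res_comp[OF oV(1)[OF y] o(1) N(1,4) _ t1(1)[OF y]] B.res_comp[OF oV(1)[OF x] o(1) N(1,4) _ t1(1)[OF x]] by simp
      qed
      have iw: "i ?N (Res G (U x \<inter> U y) ?N (w x y)) = ?sy \<ominus>\<^bsub>Sec B ?N\<^esub> ?sx"
      proof -
        have "i ?N (Res G (U x \<inter> U y) ?N (w x y)) = Res B (U x \<inter> U y) ?N (i (U x \<inter> U y) (w x y))"
          by (rule i_res[OF o(2) N(1,5) w2(1)[OF x y], symmetric])
        then show ?thesis
          unfolding w2(2)[OF x y] using B.res_diff[OF o(2) N(1,5) B.res_closed[OF U(1)[OF y] o(2) _ s1(1)[OF y]]
              B.res_closed[OF U(1)[OF x] o(2) _ s1(1)[OF x]]]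
            B.res_comp[OF U(1)[OF y] o(2) N(1,5) _ s1(1)[OF y]] B.res_comp[OF U(1)[OF x] o(2) N(1,5) _ s1(1)[OF x]] by simp
      qed
      \<comment> \<open>As \<open>i\<close> is injective, the coboundary relation may be verified in
        \<open>B\<close>, where it reads
        \<open>sy - sx = (ty - tx) + ((sy - ty) - (sx - tx))\<close>.\<close>
      have "i ?N (Res G (U x \<inter> U y) ?N (w x y)) = i ?N (Res G (V x \<inter> V y) ?N (c x y) \<oplus>\<^bsub>Sec G ?N\<^esub>
          (Res G (W y) ?N (b y) \<ominus>\<^bsub>Sec G ?N\<^esub> Res G (W x) ?N (b x)))"
      proof -
        have "i ?N (Res G (V x \<inter> V y) ?N (c x y) \<oplus>\<^bsub>Sec G ?N\<^esub> (Res G (W y) ?N (b y) \<ominus>\<^bsub>Sec G ?N\<^esub> Res G (W x) ?N (b x)))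
          = (?ty \<ominus>\<^bsub>Sec B ?N\<^esub> ?tx) \<oplus>\<^bsub>Sec B ?N\<^esub> ((?sy \<ominus>\<^bsub>Sec B ?N\<^esub> ?ty) \<ominus>\<^bsub>Sec B ?N\<^esub> (?sx \<ominus>\<^bsub>Sec B ?N\<^esub> ?tx))"
          using i_add[OF N(1) cG(1) GN.M.minus_closed[OF bG(2,1)]]
            hom_on_diff[OF hom_on_top[OF i_hom N(1)] N(1) subset_refl G.pmod B.pmod bG(2,1)] ib[OF x N(2)] ib[OF y N(3)] ic by simp
        also have "\<dots> = (?sy \<ominus>\<^bsub>Sec B ?N\<^esub> ?sx) \<oplus>\<^bsub>Sec B ?N\<^esub> ((?ty \<ominus>\<^bsub>Sec B ?N\<^esub> ?ty) \<oplus>\<^bsub>Sec B ?N\<^esub> (?tx \<ominus>\<^bsub>Sec B ?N\<^esub> ?tx))"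
          using cl by (simp add: a_minus_def BN.M.minus_add BN.M.a_ac del: BN.M.r_neg)
        also have "\<dots> = ?sy \<ominus>\<^bsub>Sec B ?N\<^esub> ?sx"
          using cl by (simp add: a_minus_def BN.M.r_neg)
        finally show ?thesis using iw by simp
      qed
      then have "Res G (U x \<inter> U y) ?N (w x y) = Res G (V x \<inter> V y) ?N (c x y) \<oplus>\<^bsub>Sec G ?N\<^esub>
          (Res G (W y) ?N (b y) \<ominus>\<^bsub>Sec G ?N\<^esub> Res G (W x) ?N (b x))"
        by (rule inj_onD[OF i_inj[OF N(1)]]) (use cG bG in auto)
      then show "Res (add_presheaf G) (U x \<inter> U y) ?N (w x y) = Res (add_presheaf G) (V x \<inter> V y) ?N (c x y) \<otimes>\<^bsub>Sec (add_presheaf G) ?N\<^esub>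
          (Res (add_presheaf G) (W y) ?N (b y) \<otimes>\<^bsub>Sec (add_presheaf G) ?N\<^esub> inv\<^bsub>Sec (add_presheaf G) ?N\<^esub> Res (add_presheaf G) (W x) ?N (b x))"
        by (simp add: a_minus_def)
    qed
    then show ?thesis by (rule H.H1_class_eqI[OF cc])
  qed
  have eq: "\<Union>{H1_class (Top X) (add_presheaf G) (V, c) | V c. pointed_cover (Top X) V \<and> (\<exists>t. Q B i p V c t)}
      = H1_class (Top X) (add_presheaf G) (U, w)" if m: "(B, i, p) \<in> C" for B i p
  proof -
    have "{H1_class (Top X) (add_presheaf G) (V, c) | V c. pointed_cover (Top X) V \<and> (\<exists>t. Q B i p V c t)}
      = {H1_class (Top X) (add_presheaf G) (U, w)}"
      using coh[OF m] Qw[OF m] cover by auto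
    then show ?thesis by simp
  qed
  have "ext_to_H1 X G C = (\<Union>(B, i, p)\<in>C. \<Union>{H1_class (Top X) (add_presheaf G) (V, c) | V c. pointed_cover (Top X) V \<and> (\<exists>t. Q B i p V c t)})"
    unfolding ext_to_H1_def Q_def ..
  also have "\<dots> = (\<Union>\<eta>\<in>C. H1_class (Top X) (add_presheaf G) (U, w))"
  proof (rule SUP_cong[OF refl])
    fix \<eta> assume m: "\<eta> \<in> C"
    obtain B i p where \<eta>: "\<eta> = (B, i, p)" by (cases \<eta>)
    show "(case \<eta> of (B, i, p) \<Rightarrow> \<Union>{H1_class (Top X) (add_presheaf G) (V, c) | V c. pointed_cover (Top X) V \<and> (\<exists>t. Q B i p V c t)})
      = H1_class (Top X) (add_presheaf G) (U, w)"
      unfolding \<eta> case_prod_conv by (rule eq[OF m[unfolded \<eta>]])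
  qed
  also have "\<dots> = H1_class (Top X) (add_presheaf G) (U, w)" using C(1) by simp
  finally show ?thesis .
qed

end

locale lb_cover = lb_space X L + cover_space X U
  for X :: "('x, 'r) ringed" and L :: "('x, 'r, 'l) mod_presheaf" and U +
  fixes e u r
  assumes dp: "x \<in> TX \<Longrightarrow> dpair (U x) (e x) (u x)"
    and r: "x \<in> TX \<Longrightarrow> y \<in> TX \<Longrightarrow> r x y \<in> carrier (Rg X (U x \<inter> U y))"
    and e_r: "x \<in> TX \<Longrightarrow> y \<in> TX \<Longrightarrow> Res L (U y) (U x \<inter> U y) (e y) = r x y \<odot>\<^bsub>Sec L (U x \<inter> U y)\<^esub> Res L (U x) (U x \<inter> U y) (e x)"
begin

text \<open>Dual generators transform inversely to generators. Write
  \<open>u x = k \<cdot> u y\<close>; evaluation at \<open>e y\<close> gives \<open>k\<close> on the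
  right, and on the left \<open>u x (r x y \<cdot> e x) = r x y\<close>.\<close>

lemma u_r:
  assumes x: "x \<in> TX" and y: "y \<in> TX"
  shows "r x y \<odot>\<^bsub>Sec D (U x \<inter> U y)\<^esub> Res D (U y) (U x \<inter> U y) (u y) = Res D (U x) (U x \<inter> U y) (u x)"
proof -
  let ?N = "U x \<inter> U y"
  have N: "opn ?N" "?N \<subseteq> U x" "?N \<subseteq> U y" using U x y by auto
  note dx = dpair_restrict[OF dp[OF x] N(1,2)] and dy = dpair_restrict[OF dp[OF y] N(1,3)]
  note Dx = dpairD[OF dx] and Dy = dpairD[OF dy]
  let ?ux = "Res D (U x) ?N (u x)" and ?uy = "Res D (U y) ?N (u y)"
  let ?ex = "Res L (U x) ?N (e x)" and ?ey = "Res L (U y) ?N (e y)"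
  interpret R: cring "Rg X ?N" by (rule rg_cring[OF N(1)])
  interpret uy: free_gen_space X D ?N ?uy by unfold_locales (rule Dy)
  note k = uy.co[OF N(1) subset_refl Dx(3), unfolded D.res_id[OF N(1) Dy(3)]]
  have "?ux ?N ?ey = r x y"
    using e_r[OF x y] hom_on_smult[OF dual_hom[OF N(1) Dx(3)] N(1) subset_refl r[OF x y] Dx(2)] Dx(4) r[OF x y] by simp
  moreover have "(uy.co ?N ?ux \<odot>\<^bsub>Sec D ?N\<^esub> ?uy) ?N ?ey = uy.co ?N ?ux"
    using trim_apply[OF N(1) subset_refl Dy(2)] Dy(4) k(1) by (simp add: rr_id[OF N(1)] del: dual_simps(4))
  ultimately have "uy.co ?N ?ux = r x y" using k(2) by simp
  then show ?thesis using k(2) by simp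
qed

text \<open>The new lifts are \<open>u x \<otimes> b x\<close>. The coefficient moves across the
  tensor sign, \<open>u y \<otimes> (r \<cdot> b x) = (r \<cdot> u y) \<otimes> b x = u x \<otimes>
  b x\<close>, so that tensoring the defect relation with \<open>u y\<close> leaves a plain
  difference of lifts.\<close>

lemma twist_lift_data:
  fixes H :: "('x, 'r, 'h) mod_presheaf" and B :: "('x, 'r, 'b) mod_presheaf"
  assumes H: "mod_sheaf X H" and ext: "extension X L H (B, i, p)" and d: "lift_data X H U e r w (B, i, p)"
  shows "lift_data X (tensor X D H) U (\<lambda>x. \<one>\<^bsub>Rg X (U x)\<^esub>) (\<lambda>x y. \<one>\<^bsub>Rg X (U x \<inter> U y)\<^esub>)
     (\<lambda>x y. tens X D H (U x \<inter> U y) (Res D (U y) (U x \<inter> U y) (u y)) (w x y))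
     (tensor X D B, tensor_map_right X D H B i, \<lambda>U. evaluation X L U \<circ> tensor_map_right X D B L p U)"
proof -
  interpret H: msheaf_space X H by unfold_locales (rule H)
  interpret ext_space X L H B i p by (rule ext_spaceI[OF ringed pmod H.pmod ext])
  interpret DH: tensor_space X D H by unfold_locales
  interpret DB: tensor_space X D B by unfold_locales
  note im = tensor_map_right_spec[OF H.pmod B.pmod i_hom]
  note pm = tensor_map_right_spec[OF B.pmod pmod p_hom]
  obtain b where b: "\<And>x. x \<in> TX \<Longrightarrow> b x \<in> carrier (Sec B (U x))" "\<And>x. x \<in> TX \<Longrightarrow> p (U x) (b x) = e x"
    and w: "\<And>x y. x \<in> TX \<Longrightarrow> y \<in> TX \<Longrightarrow> w x y \<in> carrier (Sec H (U x \<inter> U y))"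
    and iw: "\<And>x y. x \<in> TX \<Longrightarrow> y \<in> TX \<Longrightarrow> i (U x \<inter> U y) (w x y) = Res B (U y) (U x \<inter> U y) (b y) \<ominus>\<^bsub>Sec B (U x \<inter> U y)\<^esub>
          (r x y \<odot>\<^bsub>Sec B (U x \<inter> U y)\<^esub> Res B (U x) (U x \<inter> U y) (b x))"
    using d unfolding lift_data_def by auto
  let ?t = "\<lambda>x. tens X D B (U x) (u x) (b x)"
  show ?thesis
    unfolding lift_data_def case_prod_conv
  proof (intro exI[of _ ?t] conjI ballI)
    fix x assume x: "x \<in> TX"
    note Dx = dpairD[OF dp[OF x]]
    show "?t x \<in> carrier (Sec (tensor X D B) (U x))" by (rule DB.tens_closed[OF U(1)[OF x] Dx(3) b(1)[OF x]])
    show "(evaluation X L (U x) \<circ> tensor_map_right X D B L p (U x)) (?t x) = \<one>\<^bsub>Rg X (U x)\<^esub>"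
      using pm(2)[OF U(1)[OF x] Dx(3) b(1)[OF x]] b(2)[OF x] eval_tens[OF U(1)[OF x] Dx(3,2)] Dx(4) by simp
    fix y assume y: "y \<in> TX"
    let ?N = "U x \<inter> U y"
    have N: "opn ?N" "?N \<subseteq> U x" "?N \<subseteq> U y" using U x y by auto
    note Dy = dpairD[OF dp[OF y]]
    note dx = dpairD[OF dpair_restrict[OF dp[OF x] N(1,2)]] and dy = dpairD[OF dpair_restrict[OF dp[OF y] N(1,3)]]
    let ?ux = "Res D (U x) ?N (u x)" and ?uy = "Res D (U y) ?N (u y)"
    let ?bx = "Res B (U x) ?N (b x)" and ?by = "Res B (U y) ?N (b y)"
    note bx = B.res_closed[OF U(1)[OF x] N(1,2) b(1)[OF x]] and bY = B.res_closed[OF U(1)[OF y] N(1,3) b(1)[OF y]]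
    interpret T: module "Rg X ?N" "Sec (tensor X D B) ?N" by (rule DB.T.mods[OF N(1)])
    show "tens X D H ?N ?uy (w x y) \<in> carrier (Sec (tensor X D H) ?N)" by (rule DH.tens_closed[OF N(1) dy(3) w[OF x y]])
    have "tensor_map_right X D H B i ?N (tens X D H ?N ?uy (w x y)) = tens X D B ?N ?uy (?by \<ominus>\<^bsub>Sec B ?N\<^esub> (r x y \<odot>\<^bsub>Sec B ?N\<^esub> ?bx))"
      unfolding im(2)[OF N(1) dy(3) w[OF x y]] iw[OF x y] ..
    also have "\<dots> = tens X D B ?N ?uy ?by \<ominus>\<^bsub>Sec (tensor X D B) ?N\<^esub> tens X D B ?N ?uy (r x y \<odot>\<^bsub>Sec B ?N\<^esub> ?bx)"
      by (rule semilin_diff[OF DB.tens_right[OF N(1) dy(3)] B.mods[OF N(1)] DB.T.mods[OF N(1)] bY B.smult_closed[OF N(1) r[OF x y] bx]])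
    also have "tens X D B ?N ?uy (r x y \<odot>\<^bsub>Sec B ?N\<^esub> ?bx) = tens X D B ?N (r x y \<odot>\<^bsub>Sec D ?N\<^esub> ?uy) ?bx"
      using semilin_smult[OF DB.tens_right[OF N(1) dy(3)] r[OF x y] bx] semilin_smult[OF DB.tens_left[OF N(1) bx] r[OF x y] dy(3)] by simp
    also have "\<dots> = tens X D B ?N ?ux ?bx" unfolding u_r[OF x y] ..
    also have "tens X D B ?N ?ux ?bx = \<one>\<^bsub>Rg X ?N\<^esub> \<odot>\<^bsub>Sec (tensor X D B) ?N\<^esub> Res (tensor X D B) (U x) ?N (?t x)"
      unfolding DB.tens_res[OF U(1)[OF x] N(1,2) Dx(3) b(1)[OF x]] using DB.tens_closed[OF N(1) dx(3) bx] by simp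
    also have "tens X D B ?N ?uy ?by = Res (tensor X D B) (U y) ?N (?t y)"
      by (rule DB.tens_res[OF U(1)[OF y] N(1,3) Dy(3) b(1)[OF y], symmetric])
    finally show "tensor_map_right X D H B i ?N (tens X D H ?N ?uy (w x y)) = Res (tensor X D B) (U y) ?N (?t y)
        \<ominus>\<^bsub>Sec (tensor X D B) ?N\<^esub> (\<one>\<^bsub>Rg X ?N\<^esub> \<odot>\<^bsub>Sec (tensor X D B) ?N\<^esub> Res (tensor X D B) (U x) ?N (?t x))" .
  qed
qed

lemma ext_twist_lift_data:
  fixes H :: "('x, 'r, 'h) mod_presheaf"
  assumes H: "mod_sheaf X H"
    and C: "C \<noteq> {}" "\<And>\<eta>. \<eta> \<in> C \<Longrightarrow> extension X L H \<eta>" "\<And>\<eta>. \<eta> \<in> C \<Longrightarrow> lift_data X H U e r w \<eta>"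
  defines "w' \<equiv> \<lambda>x y. tens X D H (U x \<inter> U y) (Res D (U y) (U x \<inter> U y) (u y)) (w x y)"
  shows "ext_twist X L H C \<noteq> {}"
    and "\<eta> \<in> ext_twist X L H C \<Longrightarrow> extension X (str_mod X) (tensor X D H) \<eta>"
    and "\<eta> \<in> ext_twist X L H C \<Longrightarrow> lift_data X (tensor X D H) U (\<lambda>x. \<one>\<^bsub>Rg X (U x)\<^esub>) (\<lambda>x y. \<one>\<^bsub>Rg X (U x \<inter> U y)\<^esub>) w' \<eta>"
proof -
  interpret H: msheaf_space X H by unfold_locales (rule H)
  interpret DH: tensor_space X D H by unfold_locales
  let ?tw = "\<lambda>(B, i, p). (tensor X D B, tensor_map_right X D H B i, \<lambda>U. evaluation X L U \<circ> tensor_map_right X D B L p U)"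
  have 1: "\<one>\<^bsub>Rg X (U x \<inter> U y)\<^esub> \<in> carrier (Rg X (U x \<inter> U y))" if "x \<in> TX" "y \<in> TX" for x y
    using rg_cring[OF U(3)[OF that]] by (simp add: cring.cring_simprules)
  have ext: "extension X (str_mod X) (tensor X D H) (?tw (B, i, p))" if "(B, i, p) \<in> C" for B i p
    using twist_extension[OF H C(2)[OF that]] by simp
  have ld: "lift_data X (tensor X D H) U (\<lambda>x. \<one>\<^bsub>Rg X (U x)\<^esub>) (\<lambda>x y. \<one>\<^bsub>Rg X (U x \<inter> U y)\<^esub>) w' (?tw (B, i, p))" if "(B, i, p) \<in> C" for B i p
    using twist_lift_data[OF H C(2)[OF that] C(3)[OF that]] by (simp add: w'_def del: dual_simps)
  have tw: "ext_twist X L H C = (\<Union>\<eta>\<in>C. ext_class X (str_mod X) (tensor X D H) (?tw \<eta>))"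
    unfolding ext_twist_def by (rule SUP_cong) auto
  show "ext_twist X L H C \<noteq> {}"
  proof -
    obtain B i p where m: "(B, i, p) \<in> C" using C(1) by auto
    show ?thesis using m ext_class_nonempty[OF ringed str.pmod DH.T.pmod ext[OF m]] unfolding tw by blast
  qed
  assume "\<eta> \<in> ext_twist X L H C"
  then obtain B i p where m: "(B, i, p) \<in> C" "\<eta> \<in> ext_class X (str_mod X) (tensor X D H) (?tw (B, i, p))"
    unfolding tw by auto
  show "extension X (str_mod X) (tensor X D H) \<eta>"
    "lift_data X (tensor X D H) U (\<lambda>x. \<one>\<^bsub>Rg X (U x)\<^esub>) (\<lambda>x y. \<one>\<^bsub>Rg X (U x \<inter> U y)\<^esub>) w' \<eta>"
    using ext_class_lift_data[OF str.pmod DH.T.pmod ext[OF m(1)] 1 ld[OF m(1)] m(2)] by auto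
qed

end

section \<open>Differentials\<close>

lemma kaehler_gens_closed:
  fixes A :: "'r ring"
  assumes A: "cring A" and K: "K \<subseteq> carrier A"
  defines "M \<equiv> free_module A (carrier A)"
  shows "{gen A (a \<oplus>\<^bsub>A\<^esub> b) \<ominus>\<^bsub>M\<^esub> (gen A a \<oplus>\<^bsub>M\<^esub> gen A b) | a b. a \<in> carrier A \<and> b \<in> carrier A} \<union>
       {gen A (a \<otimes>\<^bsub>A\<^esub> b) \<ominus>\<^bsub>M\<^esub> (a \<odot>\<^bsub>M\<^esub> gen A b \<oplus>\<^bsub>M\<^esub> b \<odot>\<^bsub>M\<^esub> gen A a) | a b. a \<in> carrier A \<and> b \<in> carrier A} \<union>
       {gen A c | c. c \<in> K} \<subseteq> carrier M"
proof -
  interpret A: cring A by (rule A)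
  interpret M: module A M unfolding M_def by (rule free_module_module[OF A])
  have "a \<in> carrier A \<Longrightarrow> gen A a \<in> carrier M" for a
    unfolding M_def by (rule gen_carrier[OF A])
  then show ?thesis using K by auto
qed

lemma kaehler_rel_incl:
  fixes A K
  defines "M \<equiv> free_module A (carrier A)"
  shows "a \<in> carrier A \<Longrightarrow> b \<in> carrier A \<Longrightarrow> gen A (a \<oplus>\<^bsub>A\<^esub> b) \<ominus>\<^bsub>M\<^esub> (gen A a \<oplus>\<^bsub>M\<^esub> gen A b) \<in> kaehler_rel A K"
    and "a \<in> carrier A \<Longrightarrow> b \<in> carrier A
      \<Longrightarrow> gen A (a \<otimes>\<^bsub>A\<^esub> b) \<ominus>\<^bsub>M\<^esub> (a \<odot>\<^bsub>M\<^esub> gen A b \<oplus>\<^bsub>M\<^esub> b \<odot>\<^bsub>M\<^esub> gen A a) \<in> kaehler_rel A K"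
    and "c \<in> K \<Longrightarrow> gen A c \<in> kaehler_rel A K"
  unfolding kaehler_rel_def Let_def M_def by (rule subsetD[OF span_of_incl], blast)+

text \<open>The constant is the fraction with denominator 1 on the whole space at once, and 1 lies
  in no prime ideal.\<close>

lemma spec_const_closed:
  assumes F: "ring F" and a: "a \<in> carrier F"
  shows "spec_const F (topspace (zariski F)) a \<in> carrier (spec_sections F (topspace (zariski F)))"
proof -
  interpret F: ring F by (rule F)
  let ?T = "topspace (zariski F)"
  have "\<one>\<^bsub>F\<^esub> \<notin> Q" if "Q \<in> ?T" for Q
  proof
    assume 1: "\<one>\<^bsub>F\<^esub> \<in> Q"
    have "primeideal Q F" using that unfolding zariski_def by auto
    then interpret Q: primeideal Q F .
    show False using Q.one_imp_carrier[OF 1] Q.I_notcarr by simp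
  qed
  then have "\<exists>V b f. openin (zariski F) V \<and> P \<in> V \<and> V \<subseteq> ?T \<and> b \<in> carrier F \<and> f \<in> carrier F \<and>
      (\<forall>Q\<in>V. f \<notin> Q \<and> spec_const F ?T a Q = frac F Q b f)" if "P \<in> ?T" for P
    using that a by (intro exI[of _ ?T] exI[of _ a] exI[of _ "\<one>\<^bsub>F\<^esub>"]) (auto simp: spec_const_def)
  then show ?thesis by (auto simp: spec_sections_def spec_const_def)
qed

locale kaehler_space = rspace X for X :: "('x, 'r) ringed" +
  fixes F :: "'k ring" and \<phi> :: "('x, 'r, 'k) structure_map"
  assumes F: "ring F" and mor: "lrs_morphism X (Spec F) \<phi>"
begin

abbreviation "sc \<equiv> scalars F X \<phi>"

text \<open>The preimage of the whole spectrum is the whole space, so the pullback of a constant is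
  a global function.\<close>

lemma global_scalar:
  assumes a: "a \<in> carrier F"
  shows "pull \<phi> (topspace (zariski F)) (spec_const F (topspace (zariski F)) a) \<in> carrier (Rg X TX)"
proof -
  let ?T = "topspace (zariski F)"
  have S: "Top (Spec F) = zariski F" "Rg (Spec F) ?T = spec_sections F ?T" by (simp_all add: Spec_def)
  have "continuous_map (Top X) (zariski F) (pts \<phi>)" using mor unfolding lrs_morphism_def S by (rule conjunct1)
  then have "preimg X \<phi> ?T = TX" by (auto simp: preimg_def continuous_map_def)
  moreover have "pull \<phi> ?T \<in> ring_hom (Rg (Spec F) ?T) (Rg X (preimg X \<phi> ?T))"
    using conjunct1[OF conjunct2[OF mor[unfolded lrs_morphism_def]], rule_format, of ?T] by (simp add: S)
  ultimately have "pull \<phi> ?T \<in> ring_hom (spec_sections F ?T) (Rg X TX)" by (simp add: S)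
  then show ?thesis using spec_const_closed[OF F a] by (rule ring_hom_closed)
qed

lemma scalars_closed: "opn U \<Longrightarrow> sc U \<subseteq> carrier (Rg X U)"
  using rr_closed[OF openin_topspace _ openin_subset global_scalar] by (auto simp: scalars_def)

lemma scalars_res:
  assumes o: "opn U" "opn V" "V \<subseteq> U" and c: "c \<in> sc U"
  shows "rr U V c \<in> sc V"
proof -
  obtain a where a: "a \<in> carrier F"
    "c = rr TX U (pull \<phi> (topspace (zariski F)) (spec_const F (topspace (zariski F)) a))"
    using c by (auto simp: scalars_def)
  show ?thesis
    unfolding a(2) using rr_comp[OF openin_topspace o(1,2,3) openin_subset[OF o(1)] global_scalar[OF a(1)]] a(1)
    by (auto simp: scalars_def)
qed

abbreviation "krel U \<equiv> kaehler_rel (Rg X U) (sc U)"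
abbreviation "rgs U \<equiv> carrier (Rg X U)"

sublocale free_space X rgs rr
  by unfold_locales (simp_all add: rr_closed rr_id rr_comp)

lemma krel_submodule:
  assumes U: "opn U"
  shows "submodule (krel U) (Rg X U) (Sec FP U)"
  unfolding kaehler_rel_def Let_def free_presheaf_simps
  by (rule span_of_submodule[OF free_module_module[OF rg_cring[OF U]]
        kaehler_gens_closed[OF rg_cring[OF U] scalars_closed[OF U]]])

text \<open>Each of the three kinds of relation restricts to one of the same kind: sums and products
  because restriction is a ring map, and constants because all scalars are restrictions of global
  ones.\<close>

sublocale quot_space X FP krel
proof (intro quot_space.intro quot_space_axioms.intro FP.pmod_space_axioms krel_submodule)
  fix U V x assume o: "opn U" "opn V" "V \<subseteq> U" and x: "x \<in> krel U"
  interpret RU: cring "Rg X U" by (rule rg_cring[OF o(1)])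
  interpret FU: module "Rg X U" "Sec FP U" by (rule FP_module[OF o(1)])
  let ?M = "free_module (Rg X U) (carrier (Rg X U))"
  let ?gens = "{gen (Rg X U) (a \<oplus>\<^bsub>Rg X U\<^esub> b) \<ominus>\<^bsub>?M\<^esub> (gen (Rg X U) a \<oplus>\<^bsub>?M\<^esub> gen (Rg X U) b) | a b. a \<in> rgs U \<and> b \<in> rgs U} \<union>
       {gen (Rg X U) (a \<otimes>\<^bsub>Rg X U\<^esub> b) \<ominus>\<^bsub>?M\<^esub> (a \<odot>\<^bsub>?M\<^esub> gen (Rg X U) b \<oplus>\<^bsub>?M\<^esub> b \<odot>\<^bsub>?M\<^esub> gen (Rg X U) a) | a b. a \<in> rgs U \<and> b \<in> rgs U} \<union>
       {gen (Rg X U) c | c. c \<in> sc U}"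
  show "Res FP U V x \<in> krel V"
  proof (rule span_of_image[OF FP_module[OF o(1)] FP_module[OF o(2)] FP_semilin[OF o] _ krel_submodule[OF o(2)]])
    show "rr U V \<in> rgs U \<rightarrow> rgs V" using rr_closed[OF o] by blast
    show "?gens \<subseteq> carrier (Sec FP U)"
      using kaehler_gens_closed[OF rg_cring[OF o(1)] scalars_closed[OF o(1)]] by simp
    show "x \<in> span_of (Rg X U) (Sec FP U) ?gens"
      using x unfolding kaehler_rel_def Let_def free_presheaf_simps .
    fix y assume "y \<in> ?gens"
    moreover note G = FP_gen[OF o(1)] and R = FP_res_gen[OF o] and
      S = semilin_diff[OF FP_semilin[OF o] FP_module[OF o(1)] FP_module[OF o(2)]] semilin_add[OF FP_semilin[OF o]]
        semilin_smult[OF FP_semilin[OF o]] and c = rr_closed[OF o]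
    have "Res FP U V (gen (Rg X U) (a \<oplus>\<^bsub>Rg X U\<^esub> b) \<ominus>\<^bsub>Sec FP U\<^esub> (gen (Rg X U) a \<oplus>\<^bsub>Sec FP U\<^esub> gen (Rg X U) b)) \<in> krel V"
      if ab: "a \<in> rgs U" "b \<in> rgs U" for a b
    proof -
      have "Res FP U V (gen (Rg X U) (a \<oplus>\<^bsub>Rg X U\<^esub> b) \<ominus>\<^bsub>Sec FP U\<^esub> (gen (Rg X U) a \<oplus>\<^bsub>Sec FP U\<^esub> gen (Rg X U) b)) =
        gen (Rg X V) (rr U V a \<oplus>\<^bsub>Rg X V\<^esub> rr U V b) \<ominus>\<^bsub>Sec FP V\<^esub> (gen (Rg X V) (rr U V a) \<oplus>\<^bsub>Sec FP V\<^esub> gen (Rg X V) (rr U V b))"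
        using ab by (simp add: S G R rr_add[OF o] del: free_presheaf_simps free_module_simps)
      then show ?thesis using kaehler_rel_incl(1)[OF c[OF ab(1)] c[OF ab(2)], of "sc V"] by simp
    qed
    moreover have "Res FP U V (gen (Rg X U) (a \<otimes>\<^bsub>Rg X U\<^esub> b) \<ominus>\<^bsub>Sec FP U\<^esub>
        (a \<odot>\<^bsub>Sec FP U\<^esub> gen (Rg X U) b \<oplus>\<^bsub>Sec FP U\<^esub> b \<odot>\<^bsub>Sec FP U\<^esub> gen (Rg X U) a)) \<in> krel V"
      if ab: "a \<in> rgs U" "b \<in> rgs U" for a b
    proof -
      have "Res FP U V (gen (Rg X U) (a \<otimes>\<^bsub>Rg X U\<^esub> b) \<ominus>\<^bsub>Sec FP U\<^esub>
          (a \<odot>\<^bsub>Sec FP U\<^esub> gen (Rg X U) b \<oplus>\<^bsub>Sec FP U\<^esub> b \<odot>\<^bsub>Sec FP U\<^esub> gen (Rg X U) a)) =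
        gen (Rg X V) (rr U V a \<otimes>\<^bsub>Rg X V\<^esub> rr U V b) \<ominus>\<^bsub>Sec FP V\<^esub>
          (rr U V a \<odot>\<^bsub>Sec FP V\<^esub> gen (Rg X V) (rr U V b) \<oplus>\<^bsub>Sec FP V\<^esub> rr U V b \<odot>\<^bsub>Sec FP V\<^esub> gen (Rg X V) (rr U V a))"
        using ab by (simp add: S G R rr_mult[OF o] del: free_presheaf_simps free_module_simps)
      then show ?thesis using kaehler_rel_incl(2)[OF c[OF ab(1)] c[OF ab(2)], of "sc V"] by simp
    qed
    moreover have "Res FP U V (gen (Rg X U) a) \<in> krel V" if "a \<in> sc U" for a
      using R[of a] that scalars_closed[OF o(1)] kaehler_rel_incl(3)[OF scalars_res[OF o that], of "Rg X V"]
      by (simp add: subset_iff del: free_presheaf_simps)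
    ultimately show "Res FP U V y \<in> krel V"
      unfolding free_presheaf_simps(1) by (elim UnE CollectE exE conjE) (simp_all only:)
  qed
qed

lemma kaehler_eq: "kaehler F X \<phi> = QS"
  by (simp add: kaehler_def kaehler_presheaf_def quot_sheaf_def quot_presheaf_def)

lemma kaehler_presheaf_eq: "kaehler_presheaf F X \<phi> = QP"
  by (simp add: kaehler_presheaf_def quot_presheaf_def)

lemma univ_der_eq: "univ_der F X \<phi> U a = qmap U (gen (Rg X U) a)"
  unfolding univ_der_def quot_map_def kaehler_presheaf_eq by simp

text \<open>Additivity and the Leibniz rule are relations imposed among the generators, so they hold
  for their classes before sheafification and are inherited by the images under
  \<open>qmap\<close>.\<close>

lemma kaehler_derivation: "derivation_space X (kaehler F X \<phi>) (univ_der F X \<phi>)"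
proof -
  interpret Q: msheaf_space X QS by (rule qs_space)
  show ?thesis
    unfolding kaehler_eq univ_der_eq[abs_def]
  proof unfold_locales
    fix U a assume U: "opn U" and a: "a \<in> rgs U"
    interpret RU: cring "Rg X U" by (rule rg_cring[OF U])
    note g = FP_gen[OF U]
    show "qmap U (gen (Rg X U) a) \<in> carrier (Sec QS U)" by (rule qmap_closed[OF U g[OF a]])
    show "Res QS U V (qmap U (gen (Rg X U) a)) = qmap V (gen (Rg X V) (rr U V a))" if "opn V" "V \<subseteq> U" for V
      unfolding qmap_res[OF U that g[OF a]] FP_res_gen[OF U that a] ..
    fix b assume b: "b \<in> rgs U"
    show "qmap U (gen (Rg X U) (a \<oplus>\<^bsub>Rg X U\<^esub> b)) = qmap U (gen (Rg X U) a) \<oplus>\<^bsub>Sec QS U\<^esub> qmap U (gen (Rg X U) b)"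
      unfolding qmap_add[OF U g[OF a] g[OF b], symmetric]
    proof (rule qmap_eqI[OF U g[OF RU.a_closed[OF a b]] FP.add_closed[OF U g[OF a] g[OF b]]])
      show "gen (Rg X U) (a \<oplus>\<^bsub>Rg X U\<^esub> b) \<ominus>\<^bsub>Sec FP U\<^esub> (gen (Rg X U) a \<oplus>\<^bsub>Sec FP U\<^esub> gen (Rg X U) b) \<in> krel U"
        using kaehler_rel_incl(1)[OF a b] by (simp only: free_presheaf_simps(1))
    qed
    show "qmap U (gen (Rg X U) (a \<otimes>\<^bsub>Rg X U\<^esub> b)) = a \<odot>\<^bsub>Sec QS U\<^esub> qmap U (gen (Rg X U) b) \<oplus>\<^bsub>Sec QS U\<^esub>
        b \<odot>\<^bsub>Sec QS U\<^esub> qmap U (gen (Rg X U) a)"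
      unfolding qmap_smult[OF U a g[OF b], symmetric] qmap_smult[OF U b g[OF a], symmetric]
        qmap_add[OF U FP.smult_closed[OF U a g[OF b]] FP.smult_closed[OF U b g[OF a]], symmetric]
    proof (rule qmap_eqI[OF U g[OF RU.m_closed[OF a b]] FP.add_closed[OF U FP.smult_closed[OF U a g[OF b]] FP.smult_closed[OF U b g[OF a]]]])
      show "gen (Rg X U) (a \<otimes>\<^bsub>Rg X U\<^esub> b) \<ominus>\<^bsub>Sec FP U\<^esub> (a \<odot>\<^bsub>Sec FP U\<^esub> gen (Rg X U) b \<oplus>\<^bsub>Sec FP U\<^esub> b \<odot>\<^bsub>Sec FP U\<^esub> gen (Rg X U) a) \<in> krel U"
        using kaehler_rel_incl(2)[OF a b] by (simp only: free_presheaf_simps(1))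
    qed
  qed
qed

end

lemma (in derivation_space) derivation_comp:
  fixes P :: "('x, 'r, 'p) mod_presheaf"
  assumes P: "mod_sheaf X P" and h: "hom_on X TX G P h"
  shows "derivation_space X P (\<lambda>U a. h U (d U a))"
proof -
  interpret P: msheaf_space X P by unfold_locales (rule P)
  show ?thesis
  proof unfold_locales
    fix U a assume U: "opn U" and a: "a \<in> carrier (Rg X U)"
    interpret RU: cring "Rg X U" by (rule rg_cring[OF U])
    note h' = hom_on_top[OF h U]
    note H = hom_on_closed[OF h' U subset_refl] hom_on_add[OF h' U subset_refl] hom_on_smult[OF h' U subset_refl]
    note S = d_closed[OF U] G.smult_closed[OF U] H d_add[OF U] d_mult[OF U]
    show "h U (d U a) \<in> carrier (Sec P U)" using a by (simp add: S)
    show "Res P U V (h U (d U a)) = h V (d V (rr U V a))" if "opn V" "V \<subseteq> U" for V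
      using hom_on_nat[OF h' U that subset_refl d_closed[OF U a]] d_res[OF U that a] by simp
    fix b assume b: "b \<in> carrier (Rg X U)"
    show "h U (d U (a \<oplus>\<^bsub>Rg X U\<^esub> b)) = h U (d U a) \<oplus>\<^bsub>Sec P U\<^esub> h U (d U b)" using a b by (simp add: S)
    show "h U (d U (a \<otimes>\<^bsub>Rg X U\<^esub> b)) = a \<odot>\<^bsub>Sec P U\<^esub> h U (d U b) \<oplus>\<^bsub>Sec P U\<^esub> b \<odot>\<^bsub>Sec P U\<^esub> h U (d U a)"
      using a b by (simp add: S)
  qed
qed

section \<open>Units and the Picard class\<close>

lemma unit_presheaf_simps [simp]:
  "Sec (unit_presheaf X) U = units_of (Rg X U)" "Res (unit_presheaf X) = Res (Str X)"
  by (simp_all add: unit_presheaf_def)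

context rspace
begin

lemma rr_unit:
  assumes o: "opn U" "opn V" "V \<subseteq> U" and a: "a \<in> Units (Rg X U)"
  shows "rr U V a \<in> Units (Rg X V)" "rr U V (inv\<^bsub>Rg X U\<^esub> a) = inv\<^bsub>Rg X V\<^esub> rr U V a"
proof -
  interpret RU: cring "Rg X U" by (rule rg_cring[OF o(1)])
  interpret RV: cring "Rg X V" by (rule rg_cring[OF o(2)])
  have c: "a \<in> carrier (Rg X U)" "inv\<^bsub>Rg X U\<^esub> a \<in> carrier (Rg X U)" using a by auto
  have m: "rr U V (inv\<^bsub>Rg X U\<^esub> a) \<otimes>\<^bsub>Rg X V\<^esub> rr U V a = \<one>\<^bsub>Rg X V\<^esub>"
    using rr_mult[OF o c(2,1)] a rr_one[OF o] by simp
  have cV: "rr U V a \<in> carrier (Rg X V)" "rr U V (inv\<^bsub>Rg X U\<^esub> a) \<in> carrier (Rg X V)" using c rr_closed[OF o] by auto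
  show "rr U V a \<in> Units (Rg X V)" using m cV RV.m_comm[OF cV] unfolding Units_def
    by (auto intro!: bexI[of _ "rr U V (inv\<^bsub>Rg X U\<^esub> a)"])
  show "rr U V (inv\<^bsub>Rg X U\<^esub> a) = inv\<^bsub>Rg X V\<^esub> rr U V a"
    by (rule RV.comm_inv_char[OF cV(1,2), symmetric]) (simp add: m RV.m_comm[OF cV])
qed

lemma unit_gpre: "gpre_space (Top X) (unit_presheaf X)"
proof (rule gpre_space.intro)
  show "presheaf (Top X) (unit_presheaf X)"
    unfolding presheaf_def
  proof (intro conjI allI impI)
    fix U V assume "opn U \<and> opn V \<and> V \<subseteq> U"
    then show "Res (unit_presheaf X) U V \<in> carrier (Sec (unit_presheaf X) U) \<rightarrow> carrier (Sec (unit_presheaf X) V)"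
      using rr_unit(1) by (auto simp: units_of_carrier)
  next
    fix U s assume "opn U \<and> s \<in> carrier (Sec (unit_presheaf X) U)"
    then show "Res (unit_presheaf X) U U s = s" by (simp add: units_of_carrier rr_id Units_def)
  next
    fix U V W s assume "opn U \<and> opn V \<and> opn W \<and> W \<subseteq> V \<and> V \<subseteq> U \<and> s \<in> carrier (Sec (unit_presheaf X) U)"
    then show "Res (unit_presheaf X) V W (Res (unit_presheaf X) U V s) = Res (unit_presheaf X) U W s"
      by (simp add: units_of_carrier rr_comp Units_def)
  qed
  show "comm_group (Sec (unit_presheaf X) U)" if U: "opn U" for U
  proof -
    interpret RU: cring "Rg X U" by (rule rg_cring[OF U])
    show ?thesis using RU.units_comm_group by simp
  qed
qed (simp add: units_of_carrier units_of_mult rr_mult Units_def)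

lemma unit_inv: "opn U \<Longrightarrow> a \<in> Units (Rg X U) \<Longrightarrow> inv\<^bsub>units_of (Rg X U)\<^esub> a = inv\<^bsub>Rg X U\<^esub> a"
proof -
  assume U: "opn U" and a: "a \<in> Units (Rg X U)"
  interpret RU: cring "Rg X U" by (rule rg_cring[OF U])
  show ?thesis by (rule RU.units_of_inv[OF a])
qed

end

section \<open>Logarithmic derivatives\<close>

context derivation_space
begin

text \<open>Dividing the Leibniz rule for \<open>a b\<close> by \<open>a b\<close> cancels one
  factor in each term and leaves the sum of the two logarithmic derivatives.\<close>

lemma dlog_hom: "gpre_hom (Top X) (unit_presheaf X) (add_presheaf G) (\<lambda>U a. inv\<^bsub>Rg X U\<^esub> a \<odot>\<^bsub>Sec G U\<^esub> d U a)"
proof -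
  interpret A: gpre_space "Top X" "unit_presheaf X" by (rule unit_gpre)
  interpret B: gpre_space "Top X" "add_presheaf G" by (rule G.add_gpre)
  show ?thesis
  proof
    fix U a assume U: "opn U" and "a \<in> carrier (Sec (unit_presheaf X) U)"
    then have a: "a \<in> Units (Rg X U)" by (simp add: units_of_carrier)
    interpret GU: module "Rg X U" "Sec G U" by (rule G.mods[OF U])
    have ac: "a \<in> carrier (Rg X U)" "inv\<^bsub>Rg X U\<^esub> a \<in> carrier (Rg X U)" using a by auto
    show "inv\<^bsub>Rg X U\<^esub> a \<odot>\<^bsub>Sec G U\<^esub> d U a \<in> carrier (Sec (add_presheaf G) U)" using ac d_closed[OF U] by simp
    show "Res (add_presheaf G) U V (inv\<^bsub>Rg X U\<^esub> a \<odot>\<^bsub>Sec G U\<^esub> d U a) =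
        inv\<^bsub>Rg X V\<^esub> Res (unit_presheaf X) U V a \<odot>\<^bsub>Sec G V\<^esub> d V (Res (unit_presheaf X) U V a)" if V: "opn V" "V \<subseteq> U" for V
      using G.res_smult[OF U V ac(2) d_closed[OF U ac(1)]] d_res[OF U V ac(1)] rr_unit(2)[OF U V a] by simp
    fix b assume "b \<in> carrier (Sec (unit_presheaf X) U)"
    then have b: "b \<in> Units (Rg X U)" by (simp add: units_of_carrier)
    have bc: "b \<in> carrier (Rg X U)" "inv\<^bsub>Rg X U\<^esub> b \<in> carrier (Rg X U)" using b by auto
    note dc = d_closed[OF U ac(1)] d_closed[OF U bc(1)]
    let ?R = "Rg X U"
    have ab: "inv\<^bsub>?R\<^esub> (a \<otimes>\<^bsub>?R\<^esub> b) = inv\<^bsub>?R\<^esub> a \<otimes>\<^bsub>?R\<^esub> inv\<^bsub>?R\<^esub> b"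
      using ac bc a b by (intro GU.R.comm_inv_char) (simp_all add: GU.R.m_ac GU.R.m_lcomm[of a "inv\<^bsub>?R\<^esub> a"])
    have 1: "(inv\<^bsub>?R\<^esub> a \<otimes>\<^bsub>?R\<^esub> inv\<^bsub>?R\<^esub> b) \<otimes>\<^bsub>?R\<^esub> a = inv\<^bsub>?R\<^esub> b"
      "(inv\<^bsub>?R\<^esub> a \<otimes>\<^bsub>?R\<^esub> inv\<^bsub>?R\<^esub> b) \<otimes>\<^bsub>?R\<^esub> b = inv\<^bsub>?R\<^esub> a"
    proof -
      have "(inv\<^bsub>?R\<^esub> a \<otimes>\<^bsub>?R\<^esub> inv\<^bsub>?R\<^esub> b) \<otimes>\<^bsub>?R\<^esub> a = inv\<^bsub>?R\<^esub> b \<otimes>\<^bsub>?R\<^esub> (inv\<^bsub>?R\<^esub> a \<otimes>\<^bsub>?R\<^esub> a)"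
        using ac bc by (simp only: GU.R.m_ac GU.R.m_closed)
      then show "(inv\<^bsub>?R\<^esub> a \<otimes>\<^bsub>?R\<^esub> inv\<^bsub>?R\<^esub> b) \<otimes>\<^bsub>?R\<^esub> a = inv\<^bsub>?R\<^esub> b" using a bc by simp
      show "(inv\<^bsub>?R\<^esub> a \<otimes>\<^bsub>?R\<^esub> inv\<^bsub>?R\<^esub> b) \<otimes>\<^bsub>?R\<^esub> b = inv\<^bsub>?R\<^esub> a"
        using ac bc b by (simp add: GU.R.m_assoc)
    qed
    have "inv\<^bsub>?R\<^esub> (a \<otimes>\<^bsub>?R\<^esub> b) \<odot>\<^bsub>Sec G U\<^esub> d U (a \<otimes>\<^bsub>?R\<^esub> b) =
      ((inv\<^bsub>?R\<^esub> a \<otimes>\<^bsub>?R\<^esub> inv\<^bsub>?R\<^esub> b) \<otimes>\<^bsub>?R\<^esub> a) \<odot>\<^bsub>Sec G U\<^esub> d U b \<oplus>\<^bsub>Sec G U\<^esub>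
      ((inv\<^bsub>?R\<^esub> a \<otimes>\<^bsub>?R\<^esub> inv\<^bsub>?R\<^esub> b) \<otimes>\<^bsub>?R\<^esub> b) \<odot>\<^bsub>Sec G U\<^esub> d U a"
      unfolding ab d_mult[OF U ac(1) bc(1)] using ac bc dc by (simp only: GU.smult_r_distr GU.smult_assoc1 GU.R.m_closed GU.smult_closed)
    then show "inv\<^bsub>?R\<^esub> (a \<otimes>\<^bsub>Sec (unit_presheaf X) U\<^esub> b) \<odot>\<^bsub>Sec G U\<^esub> d U (a \<otimes>\<^bsub>Sec (unit_presheaf X) U\<^esub> b) =
       (inv\<^bsub>?R\<^esub> a \<odot>\<^bsub>Sec G U\<^esub> d U a) \<otimes>\<^bsub>Sec (add_presheaf G) U\<^esub> (inv\<^bsub>?R\<^esub> b \<odot>\<^bsub>Sec G U\<^esub> d U b)"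
      unfolding 1 using ac bc dc by (simp add: units_of_mult GU.M.a_comm)
  qed
qed

end

lemma (in pmod_space) add_presheaf_hom:
  fixes N :: "('x, 'r, 'n) mod_presheaf"
  assumes N: "pmod X N" and h: "hom_on X TX M N h"
  shows "gpre_hom (Top X) (add_presheaf M) (add_presheaf N) h"
proof -
  interpret N: pmod_space X N by unfold_locales (rule N)
  interpret A: gpre_space "Top X" "add_presheaf M" by (rule add_gpre)
  interpret B: gpre_space "Top X" "add_presheaf N" by (rule N.add_gpre)
  show ?thesis
    by unfold_locales
      (simp_all add: hom_on_closed[OF hom_on_top[OF h]] hom_on_add[OF hom_on_top[OF h]] hom_on_nat[OF h] openin_subset)
qed

section \<open>Local frames and their transition cocycles\<close>

context pmod_space
begin

text \<open>The coordinate of each generator with respect to the other is the inverse of the reverse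
  one: going back and forth multiplies \<open>e\<close> by their product, and the coordinate of
  \<open>e\<close> with respect to itself is 1.\<close>

lemma free_gens_unit:
  assumes e: "free_gen X M V e" and e': "free_gen X M V e'"
  shows "\<exists>g\<in>Units (Rg X V). e = g \<odot>\<^bsub>Sec M V\<^esub> e'"
proof -
  interpret e: free_gen_space X M V e by unfold_locales (rule e)
  interpret e': free_gen_space X M V e' by unfold_locales (rule e')
  note V = e.U and ee = e.e e'.e
  interpret MV: module "Rg X V" "Sec M V" by (rule mods[OF V])
  note c = e'.co[OF V subset_refl ee(1), unfolded res_id[OF V ee(2)]]
    and c' = e.co[OF V subset_refl ee(2), unfolded res_id[OF V ee(1)]]
  have "e'.co V e \<otimes>\<^bsub>Rg X V\<^esub> e.co V e' = \<one>\<^bsub>Rg X V\<^esub>"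
  proof -
    have "(e'.co V e \<otimes>\<^bsub>Rg X V\<^esub> e.co V e') \<odot>\<^bsub>Sec M V\<^esub> e = e"
      using c c' ee by (simp add: MV.smult_assoc1)
    then have "e.co V e = e'.co V e \<otimes>\<^bsub>Rg X V\<^esub> e.co V e'"
      using c(1) c'(1) by (intro e.coI[OF V subset_refl]) (simp_all add: res_id[OF V ee(1)])
    moreover have "e.co V e = \<one>\<^bsub>Rg X V\<^esub>" using e.co_e[OF V subset_refl] by (simp add: res_id[OF V ee(1)])
    ultimately show ?thesis by simp
  qed
  then have "e'.co V e \<in> Units (Rg X V)"
    using c(1) c'(1) MV.R.m_comm[OF c(1) c'(1)] unfolding Units_def by auto
  then show ?thesis using c(2) by (intro bexI[of _ "e'.co V e"]) simp
qed

lemma free_gen_cancel: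
  assumes e: "free_gen X M V e" and "r \<in> carrier (Rg X V)" "s \<in> carrier (Rg X V)"
    and "r \<odot>\<^bsub>Sec M V\<^esub> e = s \<odot>\<^bsub>Sec M V\<^esub> e"
  shows "r = s"
proof -
  interpret e: free_gen_space X M V e by unfold_locales (rule e)
  show ?thesis
    using inj_onD[OF bij_betw_imp_inj_on[OF e.e_bij[OF e.U subset_refl]], of r s] assms res_id[OF e.U e.e] by simp
qed

text \<open>Trivialisations reduced to their generators, with transition units in the convention of
  \<open>pic_class\<close>, in which \<open>e x\<close> is expressed through
  \<open>e y\<close>.\<close>

definition frame where
  "frame U e g \<longleftrightarrow> pointed_cover (Top X) U \<and> (\<forall>x\<in>TX. free_gen X M (U x) (e x)) \<and>
     (\<forall>x\<in>TX. \<forall>y\<in>TX. g x y \<in> Units (Rg X (U x \<inter> U y)) \<and>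
        Res M (U x) (U x \<inter> U y) (e x) = g x y \<odot>\<^bsub>Sec M (U x \<inter> U y)\<^esub> Res M (U y) (U x \<inter> U y) (e y))"

lemma frameD:
  assumes "frame U e g" "x \<in> TX"
  shows "opn (U x)" "x \<in> U x" "free_gen X M (U x) (e x)" "e x \<in> carrier (Sec M (U x))"
    and "y \<in> TX \<Longrightarrow> g x y \<in> Units (Rg X (U x \<inter> U y))"
    and "y \<in> TX \<Longrightarrow> Res M (U x) (U x \<inter> U y) (e x) = g x y \<odot>\<^bsub>Sec M (U x \<inter> U y)\<^esub> Res M (U y) (U x \<inter> U y) (e y)"
  using assms by (auto simp: frame_def pointed_cover_def free_gen_def)

lemma free_gen_res: "free_gen X M U e \<Longrightarrow> opn V \<Longrightarrow> V \<subseteq> U \<Longrightarrow> free_gen X M V (Res M U V e)"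
  by (rule free_gen_space.free_gen_restrict) (unfold_locales)

lemma frame_eq:
  assumes f: "frame U e g" and x: "x \<in> TX" and y: "y \<in> TX" and W: "opn W" "W \<subseteq> U x" "W \<subseteq> U y"
  shows "Res M (U x) W (e x) = rr (U x \<inter> U y) W (g x y) \<odot>\<^bsub>Sec M W\<^esub> Res M (U y) W (e y)"
proof -
  note X = frameD[OF f x] and Y = frameD[OF f y]
  have N: "opn (U x \<inter> U y)" "W \<subseteq> U x \<inter> U y" using X Y W by auto
  have gc: "g x y \<in> carrier (Rg X (U x \<inter> U y))" using X(5)[OF y] by (simp add: Units_def)
  have "Res M (U x) W (e x) = Res M (U x \<inter> U y) W (Res M (U x) (U x \<inter> U y) (e x))"
    by (rule res_comp[OF X(1) N(1) W(1) N(2) _ X(4), symmetric]) auto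
  also have "\<dots> = rr (U x \<inter> U y) W (g x y) \<odot>\<^bsub>Sec M W\<^esub> Res M (U x \<inter> U y) W (Res M (U y) (U x \<inter> U y) (e y))"
    unfolding X(6)[OF y] by (rule res_smult[OF N(1) W(1) N(2) gc res_closed[OF Y(1) N(1) _ Y(4)]]) auto
  also have "Res M (U x \<inter> U y) W (Res M (U y) (U x \<inter> U y) (e y)) = Res M (U y) W (e y)"
    by (rule res_comp[OF Y(1) N(1) W(1) N(2) _ Y(4)]) auto
  finally show ?thesis .
qed

text \<open>On a triple overlap \<open>g x y \<cdot> g y z\<close> and \<open>g x z\<close> both
  express \<open>e x\<close> through \<open>e z\<close>, and a free generator can be
  cancelled.\<close>

lemma frame_cocycle:
  assumes f: "frame U e g"
  shows "cocycle (Top X) (unit_presheaf X) (U, g)"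
  unfolding cocycle_def case_prod_conv Let_def
proof (intro conjI ballI)
  show "pointed_cover (Top X) U" using f by (simp add: frame_def)
  fix x y assume x: "x \<in> TX" and y: "y \<in> TX"
  show "g x y \<in> carrier (Sec (unit_presheaf X) (U x \<inter> U y))" using frameD(5)[OF f x y] by (simp add: units_of_carrier)
  fix z assume z: "z \<in> TX"
  let ?W = "U x \<inter> U y \<inter> U z"
  have o: "opn (U x)" "opn (U y)" "opn (U z)" using frameD(1)[OF f] x y z by auto
  have W: "opn ?W" "?W \<subseteq> U x" "?W \<subseteq> U y" "?W \<subseteq> U z" using o by auto
  interpret MW: module "Rg X ?W" "Sec M ?W" by (rule mods[OF W(1)])
  note ez = free_gen_res[OF frameD(3)[OF f z] W(1,4)]
  have ezc: "Res M (U z) ?W (e z) \<in> carrier (Sec M ?W)" using ez by (simp add: free_gen_def)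
  let ?a = "rr (U x \<inter> U y) ?W (g x y)" and ?b = "rr (U y \<inter> U z) ?W (g y z)" and ?c = "rr (U x \<inter> U z) ?W (g x z)"
  have u: "?a \<in> Units (Rg X ?W)" "?b \<in> Units (Rg X ?W)" "?c \<in> Units (Rg X ?W)"
    using o W by (auto intro!: rr_unit(1) frameD(5)[OF f] x y z)
  have cc: "?a \<in> carrier (Rg X ?W)" "?b \<in> carrier (Rg X ?W)" "?c \<in> carrier (Rg X ?W)" using u by (auto simp: Units_def)
  have "(?a \<otimes>\<^bsub>Rg X ?W\<^esub> ?b) \<odot>\<^bsub>Sec M ?W\<^esub> Res M (U z) ?W (e z) = ?c \<odot>\<^bsub>Sec M ?W\<^esub> Res M (U z) ?W (e z)"
    using frame_eq[OF f x y W(1-3)] frame_eq[OF f y z W(1,3,4)] frame_eq[OF f x z W(1,2,4)] cc ezc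
    by (simp add: MW.smult_assoc1)
  then have "?a \<otimes>\<^bsub>Rg X ?W\<^esub> ?b = ?c" by (rule free_gen_cancel[OF ez MW.R.m_closed[OF cc(1,2)] cc(3)])
  then show "Res (unit_presheaf X) (U x \<inter> U y) ?W (g x y) \<otimes>\<^bsub>Sec (unit_presheaf X) ?W\<^esub> Res (unit_presheaf X) (U y \<inter> U z) ?W (g y z)
     = Res (unit_presheaf X) (U x \<inter> U z) ?W (g x z)" by (simp add: units_of_mult)
qed

text \<open>If \<open>e' x = a x \<cdot> e x\<close>, comparing the transition relations gives
  \<open>a x \<cdot> g = g' \<cdot> a y\<close>. A coboundary has the form \<open>b y\<close> times
  the inverse of \<open>b x\<close>, so the connecting sections are the inverses of the
  \<open>a x\<close>.\<close>

lemma frames_H1_class: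
  assumes f: "frame U e g" and f': "frame V e' g'"
  shows "H1_class (Top X) (unit_presheaf X) (U, g) = H1_class (Top X) (unit_presheaf X) (V, g')"
proof -
  interpret H: gpre_space "Top X" "unit_presheaf X" by (rule unit_gpre)
  define W where "W x = U x \<inter> V x" for x
  have W: "opn (W x)" "x \<in> W x" "W x \<subseteq> U x" "W x \<subseteq> V x" if "x \<in> TX" for x
    using frameD(1,2)[OF f that] frameD(1,2)[OF f' that] by (auto simp: W_def)
  have "\<exists>a\<in>Units (Rg X (W x)). Res M (V x) (W x) (e' x) = a \<odot>\<^bsub>Sec M (W x)\<^esub> Res M (U x) (W x) (e x)" if x: "x \<in> TX" for x
    by (rule free_gens_unit[OF free_gen_res[OF frameD(3)[OF f' x] W(1,4)[OF x]] free_gen_res[OF frameD(3)[OF f x] W(1,3)[OF x]]])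
  then obtain a where a: "\<And>x. x \<in> TX \<Longrightarrow> a x \<in> Units (Rg X (W x))"
    "\<And>x. x \<in> TX \<Longrightarrow> Res M (V x) (W x) (e' x) = a x \<odot>\<^bsub>Sec M (W x)\<^esub> Res M (U x) (W x) (e x)"
    by metis
  have "cohomologous (Top X) (unit_presheaf X) (U, g) (V, g')"
  proof (rule H.cohomologousI[where W = W and b = "\<lambda>x. inv\<^bsub>Rg X (W x)\<^esub> a x"])
    show "pointed_cover (Top X) W" using W by (simp add: pointed_cover_def)
    fix x assume x: "x \<in> TX"
    show "W x \<subseteq> U x" "W x \<subseteq> V x" using W[OF x] by auto
    interpret Rx: cring "Rg X (W x)" by (rule rg_cring[OF W(1)[OF x]])
    show "inv\<^bsub>Rg X (W x)\<^esub> a x \<in> carrier (Sec (unit_presheaf X) (W x))"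
      using a(1)[OF x] by (simp add: units_of_carrier)
    fix y assume y: "y \<in> TX"
    let ?N = "W x \<inter> W y"
    have N: "opn ?N" "?N \<subseteq> W x" "?N \<subseteq> W y" "?N \<subseteq> U x" "?N \<subseteq> U y" "?N \<subseteq> V x" "?N \<subseteq> V y" using W[OF x] W[OF y] by auto
    have o: "opn (U x \<inter> U y)" "opn (V x \<inter> V y)" "?N \<subseteq> U x \<inter> U y" "?N \<subseteq> V x \<inter> V y"
      using frameD(1)[OF f x] frameD(1)[OF f y] frameD(1)[OF f' x] frameD(1)[OF f' y] N by auto
    interpret MN: module "Rg X ?N" "Sec M ?N" by (rule mods[OF N(1)])
    let ?g = "rr (U x \<inter> U y) ?N (g x y)" and ?g' = "rr (V x \<inter> V y) ?N (g' x y)"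
      and ?ax = "rr (W x) ?N (a x)" and ?ay = "rr (W y) ?N (a y)"
    have u: "?g \<in> Units (Rg X ?N)" "?g' \<in> Units (Rg X ?N)" "?ax \<in> Units (Rg X ?N)" "?ay \<in> Units (Rg X ?N)"
      by (rule rr_unit(1)[OF o(1) N(1) o(3) frameD(5)[OF f x y]], rule rr_unit(1)[OF o(2) N(1) o(4) frameD(5)[OF f' x y]],
          rule rr_unit(1)[OF W(1)[OF x] N(1,2) a(1)[OF x]], rule rr_unit(1)[OF W(1)[OF y] N(1,3) a(1)[OF y]])
    have c: "?g \<in> carrier (Rg X ?N)" "?g' \<in> carrier (Rg X ?N)" "?ax \<in> carrier (Rg X ?N)" "?ay \<in> carrier (Rg X ?N)"
      using u by (auto simp: Units_def)
    have ae: "Res M (V z) ?N (e' z) = rr (W z) ?N (a z) \<odot>\<^bsub>Sec M ?N\<^esub> Res M (U z) ?N (e z)" if z: "z \<in> TX" and Nz: "?N \<subseteq> W z" for z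
    proof -
      have az: "a z \<in> carrier (Rg X (W z))" using a(1)[OF z] by (simp add: Units_def)
      have "Res M (V z) ?N (e' z) = Res M (W z) ?N (Res M (V z) (W z) (e' z))"
        by (rule res_comp[OF frameD(1)[OF f' z] W(1)[OF z] N(1) Nz W(4)[OF z] frameD(4)[OF f' z], symmetric])
      then show ?thesis
        unfolding a(2)[OF z] using res_smult[OF W(1)[OF z] N(1) Nz az res_closed[OF frameD(1)[OF f z] W(1,3)[OF z] frameD(4)[OF f z]]]
          res_comp[OF frameD(1)[OF f z] W(1)[OF z] N(1) Nz W(3)[OF z] frameD(4)[OF f z]] by simp
    qed
    note ey = free_gen_res[OF frameD(3)[OF f y] N(1,5)]
    have eyc: "Res M (U y) ?N (e y) \<in> carrier (Sec M ?N)" using ey by (simp add: free_gen_def)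
    have "(?ax \<otimes>\<^bsub>Rg X ?N\<^esub> ?g) \<odot>\<^bsub>Sec M ?N\<^esub> Res M (U y) ?N (e y) = (?g' \<otimes>\<^bsub>Rg X ?N\<^esub> ?ay) \<odot>\<^bsub>Sec M ?N\<^esub> Res M (U y) ?N (e y)"
      using frame_eq[OF f x y N(1,4,5)] frame_eq[OF f' x y N(1,6,7)] ae[OF x N(2)] ae[OF y N(3)] c eyc
      by (simp add: MN.smult_assoc1)
    then have ag: "?ax \<otimes>\<^bsub>Rg X ?N\<^esub> ?g = ?g' \<otimes>\<^bsub>Rg X ?N\<^esub> ?ay"
      by (rule free_gen_cancel[OF ey MN.R.m_closed[OF c(3,1)] MN.R.m_closed[OF c(2,4)]])
    have ic: "inv\<^bsub>Rg X ?N\<^esub> ?ax \<in> Units (Rg X ?N)" "inv\<^bsub>Rg X ?N\<^esub> ?ay \<in> Units (Rg X ?N)" using u by auto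
    have "?g \<otimes>\<^bsub>Rg X ?N\<^esub> (inv\<^bsub>Rg X ?N\<^esub> ?ay \<otimes>\<^bsub>Rg X ?N\<^esub> ?ax) = (?ax \<otimes>\<^bsub>Rg X ?N\<^esub> ?g) \<otimes>\<^bsub>Rg X ?N\<^esub> inv\<^bsub>Rg X ?N\<^esub> ?ay"
      using c u by (simp add: MN.R.m_ac)
    also have "\<dots> = ?g'" unfolding ag using c u by (simp add: MN.R.m_assoc)
    finally have "?g' = ?g \<otimes>\<^bsub>Rg X ?N\<^esub> (inv\<^bsub>Rg X ?N\<^esub> ?ay \<otimes>\<^bsub>Rg X ?N\<^esub> ?ax)" ..
    then show "Res (unit_presheaf X) (V x \<inter> V y) ?N (g' x y) = Res (unit_presheaf X) (U x \<inter> U y) ?N (g x y) \<otimes>\<^bsub>Sec (unit_presheaf X) ?N\<^esub>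
        (Res (unit_presheaf X) (W y) ?N (inv\<^bsub>Rg X (W y)\<^esub> a y) \<otimes>\<^bsub>Sec (unit_presheaf X) ?N\<^esub>
          inv\<^bsub>Sec (unit_presheaf X) ?N\<^esub> Res (unit_presheaf X) (W x) ?N (inv\<^bsub>Rg X (W x)\<^esub> a x))"
      using rr_unit(2)[OF W(1)[OF x] N(1,2) a(1)[OF x]] rr_unit(2)[OF W(1)[OF y] N(1,3) a(1)[OF y]] u
      by (simp add: units_of_mult unit_inv[OF N(1) ic(1)])
  qed
  then show ?thesis
    using H.H1_class_eqI H.cocycle_cochain frame_cocycle[OF f] frame_cocycle[OF f'] by blast
qed

end

section \<open>The Atiyah class of a line bundle\<close>

locale chern_space = jet_space X G d L + lb_space X L
  for X :: "('x, 'r) ringed" and G :: "('x, 'r, 'g) mod_presheaf" and d and L :: "('x, 'r, 'l) mod_presheaf"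
begin

text \<open>The four classes \<open>C0\<close> to \<open>C3\<close> are the successive images of the
  Atiyah class. All are treated over the same cover, and only the defect changes: from
  \<open>- d r \<otimes> e x\<close> to \<open>e x \<otimes> (- d r)\<close> by the swap, then with
  \<open>u y\<close> in front, and finally to an element of \<open>G\<close>.\<close>

lemma atiyah_H1:
  assumes f: "L.frame U e g"
    and c: "\<And>x y. x \<in> TX \<Longrightarrow> y \<in> TX
      \<Longrightarrow> c x y = inv\<^bsub>Rg X (U x \<inter> U y)\<^esub> g x y \<odot>\<^bsub>Sec G (U x \<inter> U y)\<^esub> d (U x \<inter> U y) (g x y)"
  shows "ext_line_to_H1 X L G (ext_push X L (tensor X G L) (tensor X L G) (tensor_swap X G L) (atiyah_class X G d L))
    = H1_class (Top X) (add_presheaf G) (U, c)"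
proof -
  note fD = L.frameD[OF f]
  have oN: "opn (U x \<inter> U y)" "U x \<inter> U y \<subseteq> U x" "U x \<inter> U y \<subseteq> U y" if "x \<in> TX" "y \<in> TX" for x y
    using fD(1) that by auto
  have "\<forall>x\<in>TX. \<exists>u. dpair (U x) (e x) u" using dpair_of_free_gen[OF fD(3)] by blast
  from bchoice[OF this] obtain u where u: "\<And>x. x \<in> TX \<Longrightarrow> dpair (U x) (e x) (u x)" by auto
  \<comment> \<open>The frame expresses \<open>e x\<close> through \<open>e y\<close>, whereas
    differences of lifts need \<open>e y\<close> in terms of \<open>e x\<close>.\<close>
  define r where "r x y = inv\<^bsub>Rg X (U x \<inter> U y)\<^esub> g x y" for x y
  interpret LG: tensor_space X L G by unfold_locales
  interpret DLG: tensor_space X D "tensor X L G" by unfold_locales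
  have r_unit: "r x y \<in> Units (Rg X (U x \<inter> U y))" "r x y \<in> carrier (Rg X (U x \<inter> U y))"
    and g_car: "g x y \<in> carrier (Rg X (U x \<inter> U y))"
    and e_r: "Res L (U y) (U x \<inter> U y) (e y) = r x y \<odot>\<^bsub>Sec L (U x \<inter> U y)\<^esub> Res L (U x) (U x \<inter> U y) (e x)"
    if x: "x \<in> TX" and y: "y \<in> TX" for x y
  proof -
    let ?N = "U x \<inter> U y"
    note N = oN[OF x y]
    interpret LN: module "Rg X ?N" "Sec L ?N" by (rule L.mods[OF N(1)])
    note gu = fD(5)[OF x y]
    show "r x y \<in> Units (Rg X ?N)" "r x y \<in> carrier (Rg X ?N)" using gu by (simp_all add: r_def)
    show gc: "g x y \<in> carrier (Rg X ?N)" using gu by auto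
    note ey = L.res_closed[OF fD(1)[OF y] N(1,3) fD(4)[OF y]]
    show "Res L (U y) ?N (e y) = r x y \<odot>\<^bsub>Sec L ?N\<^esub> Res L (U x) ?N (e x)"
      unfolding fD(6)[OF x y] using gu gc ey by (simp add: r_def LN.smult_assoc1[symmetric])
  qed
  interpret cover_space X U by unfold_locales (use f in \<open>simp add: L.frame_def\<close>)
  interpret C: lb_cover X L U e u r by unfold_locales (use u r_unit e_r in auto)
  \<comment> \<open>In the jets \<open>r \<odot> (0, e x) = (d r \<otimes> e x, r e x)\<close>, and
    this is subtracted from \<open>(0, e y)\<close>; hence the sign. It is kept inside the first
    factor so that \<open>w\<close> is a pure tensor, on which swap and contraction can be
    evaluated.\<close>
  define w where "w x y = tens X G L (U x \<inter> U y) (\<ominus>\<^bsub>Sec G (U x \<inter> U y)\<^esub> d (U x \<inter> U y) (r x y)) (Res L (U x) (U x \<inter> U y) (e x))" for x y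
  have dr: "\<ominus>\<^bsub>Sec G (U x \<inter> U y)\<^esub> d (U x \<inter> U y) (r x y) \<in> carrier (Sec G (U x \<inter> U y))" if "x \<in> TX" "y \<in> TX" for x y
  proof -
    interpret GN: module "Rg X (U x \<inter> U y)" "Sec G (U x \<inter> U y)" by (rule G.mods[OF oN(1)[OF that]])
    show ?thesis using d_closed[OF oN(1)[OF that] r_unit(2)[OF that]] by simp
  qed
  have ex: "Res L (U x) (U x \<inter> U y) (e x) \<in> carrier (Sec L (U x \<inter> U y))" if "x \<in> TX" "y \<in> TX" for x y
    by (rule L.res_closed[OF fD(1)[OF that(1)] oN(1,2)[OF that] fD(4)[OF that(1)]])
  let ?\<xi> = "(jets X G d L, \<lambda>U w. (w, \<zero>\<^bsub>Sec L U\<^esub>), \<lambda>U. snd)"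
  have jets_data: "lift_data X TGL U e r w ?\<xi>"
    unfolding lift_data_def case_prod_conv
  proof (intro exI[of _ "\<lambda>x. (\<zero>\<^bsub>Sec TGL (U x)\<^esub>, e x)"] conjI ballI)
    fix x assume x: "x \<in> TX"
    show "(\<zero>\<^bsub>Sec TGL (U x)\<^esub>, e x) \<in> carrier (Sec J (U x))" using GL.T.zero_closed[OF fD(1)[OF x]] fD(4)[OF x] by simp
    show "snd (\<zero>\<^bsub>Sec TGL (U x)\<^esub>, e x) = e x" by simp
    fix y assume y: "y \<in> TX"
    let ?N = "U x \<inter> U y"
    note N = oN[OF x y]
    show wc: "w x y \<in> carrier (Sec TGL ?N)" unfolding w_def by (rule GL.tens_closed[OF N(1) dr[OF x y] ex[OF x y]])
    interpret LN: module "Rg X ?N" "Sec L ?N" by (rule L.mods[OF N(1)])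
    interpret TN: module "Rg X ?N" "Sec TGL ?N" by (rule GL.T.mods[OF N(1)])
    interpret JN: module "Rg X ?N" "Sec J ?N" using jets_pmod N(1) by (simp add: pmod_def)
    let ?z = "\<zero>\<^bsub>Sec TGL ?N\<^esub>" and ?ex = "Res L (U x) ?N (e x)"
    let ?dr = "tens X G L ?N (d ?N (r x y)) ?ex"
    note drc = GL.tens_closed[OF N(1) d_closed[OF N(1) r_unit(2)[OF x y]] ex[OF x y]]
    have w: "w x y = \<ominus>\<^bsub>Sec TGL ?N\<^esub> ?dr"
      unfolding w_def by (rule semilin_minus[OF GL.tens_left[OF N(1) ex[OF x y]] G.mods[OF N(1)] GL.T.mods[OF N(1)] d_closed[OF N(1) r_unit(2)[OF x y]]])
    have Rx: "Res J (U x) ?N (\<zero>\<^bsub>Sec TGL (U x)\<^esub>, e x) = (?z, ?ex)" "Res J (U y) ?N (\<zero>\<^bsub>Sec TGL (U y)\<^esub>, e y) = (?z, Res L (U y) ?N (e y))"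
      using GL.T.res_zero[OF fD(1)[OF x] N(1,2)] GL.T.res_zero[OF fD(1)[OF y] N(1,3)] by simp_all
    have s: "r x y \<odot>\<^bsub>Sec J ?N\<^esub> (?z, ?ex) = (?dr, Res L (U y) ?N (e y))"
      using r_unit(2)[OF x y] drc e_r[OF x y] by simp
    \<comment> \<open>Addition of jets is componentwise by definition, while subtraction goes
      through negation in the module; the difference is therefore verified as a sum.\<close>
    have "(w x y, \<zero>\<^bsub>Sec L ?N\<^esub>) \<oplus>\<^bsub>Sec J ?N\<^esub> (?dr, Res L (U y) ?N (e y)) = (?z, Res L (U y) ?N (e y))"
      using drc ex[OF y x] L.res_closed[OF fD(1)[OF y] N(1,3) fD(4)[OF y]] by (simp add: w TN.M.l_neg)
    then have "(w x y, \<zero>\<^bsub>Sec L ?N\<^esub>) = (?z, Res L (U y) ?N (e y)) \<ominus>\<^bsub>Sec J ?N\<^esub> (?dr, Res L (U y) ?N (e y))"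
      by (rule module_eq_diffI[OF JN.module_axioms _ _, rotated 2])
        (use wc drc L.zero_closed[OF N(1)] L.res_closed[OF fD(1)[OF y] N(1,3) fD(4)[OF y]] in simp_all)
    then show "(w x y, \<zero>\<^bsub>Sec L ?N\<^esub>) = Res J (U y) ?N (\<zero>\<^bsub>Sec TGL (U y)\<^esub>, e y) \<ominus>\<^bsub>Sec J ?N\<^esub>
        (r x y \<odot>\<^bsub>Sec J ?N\<^esub> Res J (U x) ?N (\<zero>\<^bsub>Sec TGL (U x)\<^esub>, e x))"
      unfolding Rx s .
  qed
  define C0 where "C0 = atiyah_class X G d L"
  have C0: "C0 \<noteq> {}" "\<And>\<eta>. \<eta> \<in> C0 \<Longrightarrow> extension X L TGL \<eta>" "\<And>\<eta>. \<eta> \<in> C0 \<Longrightarrow> lift_data X TGL U e r w \<eta>"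
    using ext_class_nonempty[OF ringed L.pmod GL.T.pmod jets_extension]
      ext_class_lift_data[OF L.pmod GL.T.pmod jets_extension r_unit(2) jets_data]
    unfolding C0_def atiyah_class_def by simp_all
  define C1 where "C1 = ext_push X L TGL (tensor X L G) (tensor_swap X G L) C0"
  note swap = tensor_swap_iso[OF ringed G.pmod L.pmod]
  have C1: "C1 \<noteq> {}" "\<And>\<eta>. \<eta> \<in> C1 \<Longrightarrow> extension X L (tensor X L G) \<eta>"
    "\<And>\<eta>. \<eta> \<in> C1 \<Longrightarrow> lift_data X (tensor X L G) U e r (\<lambda>x y. tensor_swap X G L (U x \<inter> U y) (w x y)) \<eta>"
    unfolding C1_def
    by (rule ext_push_lift_data[OF L.pmod GL.T.pmod LG.T.pmod swap(1)]; (rule r_unit(2) C0)?; assumption?)+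
  define C2 where "C2 = ext_twist X L (tensor X L G) C1"
  have C2: "C2 \<noteq> {}" "\<And>\<eta>. \<eta> \<in> C2 \<Longrightarrow> extension X (str_mod X) (tensor X D (tensor X L G)) \<eta>"
    "\<And>\<eta>. \<eta> \<in> C2 \<Longrightarrow> lift_data X (tensor X D (tensor X L G)) U (\<lambda>x. \<one>\<^bsub>Rg X (U x)\<^esub>) (\<lambda>x y. \<one>\<^bsub>Rg X (U x \<inter> U y)\<^esub>)
      (\<lambda>x y. tens X D (tensor X L G) (U x \<inter> U y) (Res D (U y) (U x \<inter> U y) (u y)) (tensor_swap X G L (U x \<inter> U y) (w x y))) \<eta>"
    unfolding C2_def
    by (rule C.ext_twist_lift_data[OF LG.T_mod_sheaf]; (rule C1)?; assumption?)+
  have one: "\<one>\<^bsub>Rg X (U x \<inter> U y)\<^esub> \<in> carrier (Rg X (U x \<inter> U y))" if "x \<in> TX" "y \<in> TX" for x y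
    using rg_cring[OF oN(1)[OF that]] by (simp add: cring.cring_simprules)
  define C3 where "C3 = ext_push X (str_mod X) (tensor X D (tensor X L G)) G (contraction X L G) C2"
  let ?k = "\<lambda>x y. contraction X L G (U x \<inter> U y) (tens X D (tensor X L G) (U x \<inter> U y) (Res D (U y) (U x \<inter> U y) (u y))
     (tensor_swap X G L (U x \<inter> U y) (w x y)))"
  have k: "?k x y = c x y" if x: "x \<in> TX" and y: "y \<in> TX" for x y
  proof -
    let ?N = "U x \<inter> U y"
    note N = oN[OF x y]
    interpret GN: module "Rg X ?N" "Sec G ?N" by (rule G.mods[OF N(1)])
    note dy = dpairD[OF dpair_restrict[OF u[OF y] N(1,3)]]
    \<comment> \<open>The twist contributed \<open>u y\<close> and the defect contains
      \<open>e x\<close>; since \<open>e x = g x y \<cdot> e y\<close>, their pairing supplies the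
      factor \<open>g x y\<close> of the logarithmic derivative.\<close>
    have uy: "Res D (U y) ?N (u y) ?N (Res L (U x) ?N (e x)) = g x y"
      unfolding fD(6)[OF x y] using hom_on_smult[OF dual_hom[OF N(1) dy(3)] N(1) subset_refl g_car[OF x y] dy(2)] dy(4) g_car[OF x y] by simp
    have "?k x y = g x y \<odot>\<^bsub>Sec G ?N\<^esub> (\<ominus>\<^bsub>Sec G ?N\<^esub> d ?N (r x y))"
      unfolding w_def swap(2)[OF N(1) dr[OF x y] ex[OF x y]]
        contraction_spec(2)[OF G.mod_sheaf N(1) dy(3) ex[OF x y] dr[OF x y]] uy ..
    also have "\<dots> = \<ominus>\<^bsub>Sec G ?N\<^esub> (g x y \<odot>\<^bsub>Sec G ?N\<^esub> d ?N (r x y))"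
      by (rule GN.smult_r_minus[OF g_car[OF x y] d_closed[OF N(1) r_unit(2)[OF x y]]])
    also have "\<dots> = c x y" unfolding r_def c[OF x y] by (rule d_inverse[OF N(1) fD(5)[OF x y], symmetric])
    finally show ?thesis .
  qed
  have C3: "C3 \<noteq> {}" "\<And>\<eta>. \<eta> \<in> C3 \<Longrightarrow> extension X (str_mod X) G \<eta>"
    "\<And>\<eta>. \<eta> \<in> C3 \<Longrightarrow> lift_data X G U (\<lambda>x. \<one>\<^bsub>Rg X (U x)\<^esub>) (\<lambda>x y. \<one>\<^bsub>Rg X (U x \<inter> U y)\<^esub>) ?k \<eta>"
    unfolding C3_def
    by (rule ext_push_lift_data[OF str.pmod DLG.T.pmod G.pmod contraction_iso[OF G.mod_sheaf]]; (rule one C2)?; assumption?)+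
  have C3': "lift_data X G U (\<lambda>x. \<one>\<^bsub>Rg X (U x)\<^esub>) (\<lambda>x y. \<one>\<^bsub>Rg X (U x \<inter> U y)\<^esub>) c \<eta>" if "\<eta> \<in> C3" for \<eta>
    by (rule lift_data_cong[OF k C3(3)[OF that]])
  have "ext_line_to_H1 X L G (ext_push X L TGL (tensor X L G) (tensor_swap X G L) (atiyah_class X G d L)) = ext_to_H1 X G C3"
    unfolding ext_line_to_H1_def C3_def C2_def C1_def C0_def ..
  also have "\<dots> = H1_class (Top X) (add_presheaf G) (U, c)"
    by (rule ext_to_H1_eq[OF G.pmod C3(1,2) C3'])
  finally show ?thesis .
qed

end

text \<open>Both sides are evaluated on one frame of \<open>L\<close>, where they are classes of the
  same explicit cochain: the image in \<open>G\<close> of the logarithmic derivatives of the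
  transition units. For the Chern class this uses that \<open>pic_class\<close> is the class of any
  frame.\<close>

theorem proposition3p6:
  fixes F :: "'k ring"
    and X :: "('x, 'r) ringed"
    and \<phi> :: "('x, 'r, 'k) structure_map"
    and I :: "'x set \<Rightarrow> ('x, 'r) omega set"
    and L :: "('x, 'r, 'l) mod_presheaf"
    and G :: "('x, 'r, ('x, 'r) qomega) mod_presheaf"
  assumes "field F"
    and "scheme_over F X \<phi>"
    and "mod_subsheaf X (kaehler F X \<phi>) I"
    and "G = quot_sheaf X (kaehler F X \<phi>) I"
    and "line_bundle X L"
  shows "ext_line_to_H1 X L G
           (ext_push X L (tensor X G L) (tensor X L G) (tensor_swap X G L)
             (atiyah_class X G (quot_der F X \<phi> I) L))
         = gen_chern_class F X \<phi> I L"
proof -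
  have ringed: "ringed_space X" and mor: "lrs_morphism X (Spec F) \<phi>"
    using assms(2) by (auto simp: scheme_over_def scheme_def locally_ringed_space_def)
  have "ring F" using assms(1) by (simp add: field_def domain_def cring_def)
  then have "kaehler_space X F \<phi>"
    unfolding kaehler_space_def kaehler_space_axioms_def rspace_def using ringed mor by (intro conjI)
  then interpret K: kaehler_space X F \<phi> .
  let ?\<Omega> = "kaehler F X \<phi>"
  interpret \<Omega>: derivation_space X ?\<Omega> "univ_der F X \<phi>" by (rule K.kaehler_derivation)
  interpret Q: quot_space X ?\<Omega> I
  proof (intro quot_space.intro quot_space_axioms.intro \<Omega>.G.pmod_space_axioms)
    fix V assume V: "K.opn V"
    show "submodule (I V) (Rg X V) (Sec ?\<Omega> V)"
      by (use assms(3) V in \<open>simp only: mod_subsheaf_def\<close>)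
    fix W z assume "K.opn W" "W \<subseteq> V" "z \<in> I V"
    then show "Res ?\<Omega> V W z \<in> I W"
      using assms(3) V by (simp only: mod_subsheaf_def) blast
  qed
  have G: "mod_sheaf X G" and G_eq: "G = Q.QS" using Q.qs_mod_sheaf assms(4) by simp_all
  have q_hom: "hom_on X K.TX ?\<Omega> G Q.qmap" using Q.qmap_hom assms(4) by simp
  have qd: "quot_der F X \<phi> I = (\<lambda>U a. Q.qmap U (univ_der F X \<phi> U a))" by (simp add: quot_der_def fun_eq_iff)
  interpret d: derivation_space X G "quot_der F X \<phi> I"
    unfolding qd by (rule \<Omega>.derivation_comp[OF G q_hom])
  have L: "mod_sheaf X L" and triv: "\<forall>x\<in>K.TX. \<exists>U h. K.opn U \<and> x \<in> U \<and> mod_iso (open_sub X U) (str_mod X) L h"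
    using assms(5) by (auto simp: line_bundle_def)
  interpret L: msheaf_space X L by unfold_locales (rule L)
  interpret chern_space X G "quot_der F X \<phi> I" L
  proof unfold_locales
    fix x assume "x \<in> K.TX"
    then obtain U h where "K.opn U" "x \<in> U" "mod_iso (open_sub X U) (str_mod X) L h" using triv by blast
    then show "\<exists>U e. x \<in> U \<and> free_gen X L U e" using free_gen_of_iso[OF ringed L.pmod] by blast
  qed
  have "\<exists>U h. \<forall>x\<in>K.TX. K.opn (U x) \<and> x \<in> U x \<and> mod_iso (open_sub X (U x)) (str_mod X) L (h x)"
    using triv by metis
  then obtain U h where U: "\<And>x. x \<in> K.TX \<Longrightarrow> K.opn (U x)" "\<And>x. x \<in> K.TX \<Longrightarrow> x \<in> U x"
    "\<And>x. x \<in> K.TX \<Longrightarrow> mod_iso (open_sub X (U x)) (str_mod X) L (h x)"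
    by blast
  define e where "e x = h x (U x) \<one>\<^bsub>Rg X (U x)\<^esub>" for x
  have fg: "free_gen X L (U x) (e x)" if "x \<in> K.TX" for x
    unfolding e_def by (rule free_gen_of_iso[OF ringed L.pmod U(1)[OF that] U(3)[OF that]])
  have "\<exists>g. g \<in> Units (Rg X (U x \<inter> U y)) \<and>
      Res L (U x) (U x \<inter> U y) (e x) = g \<odot>\<^bsub>Sec L (U x \<inter> U y)\<^esub> Res L (U y) (U x \<inter> U y) (e y)"
    if x: "x \<in> K.TX" and y: "y \<in> K.TX" for x y
  proof -
    have o: "K.opn (U x \<inter> U y)" "U x \<inter> U y \<subseteq> U x" "U x \<inter> U y \<subseteq> U y" using U x y by auto
    show ?thesis
      using L.free_gens_unit[OF L.free_gen_res[OF fg[OF x] o(1,2)] L.free_gen_res[OF fg[OF y] o(1,3)]] by blast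
  qed
  then have "\<exists>g. \<forall>x\<in>K.TX. \<forall>y\<in>K.TX. g x y \<in> Units (Rg X (U x \<inter> U y)) \<and>
      Res L (U x) (U x \<inter> U y) (e x) = g x y \<odot>\<^bsub>Sec L (U x \<inter> U y)\<^esub> Res L (U y) (U x \<inter> U y) (e y)"
    by metis
  then obtain g where g: "\<forall>x\<in>K.TX. \<forall>y\<in>K.TX. g x y \<in> Units (Rg X (U x \<inter> U y)) \<and>
      Res L (U x) (U x \<inter> U y) (e x) = g x y \<odot>\<^bsub>Sec L (U x \<inter> U y)\<^esub> Res L (U y) (U x \<inter> U y) (e y)" ..
  have f: "L.frame U e g"
    unfolding L.frame_def using U fg g by (simp add: pointed_cover_def)
  \<comment> \<open>\<open>pic_class\<close> is a union over all trivialisations. Each of them gives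
    a frame, all frames have the same class, and the one constructed above occurs among them; so the
    union is taken over a single set.\<close>
  define triv_cocycle where "triv_cocycle V g' h' \<longleftrightarrow> (\<forall>x\<in>K.TX. mod_iso (open_sub X (V x)) (str_mod X) L (h' x)) \<and>
      (let e = (\<lambda>x. h' x (V x) \<one>\<^bsub>Rg X (V x)\<^esub>) in
           \<forall>x\<in>K.TX. \<forall>y\<in>K.TX. g' x y \<in> Units (Rg X (V x \<inter> V y)) \<and>
             Res L (V x) (V x \<inter> V y) (e x) = g' x y \<odot>\<^bsub>Sec L (V x \<inter> V y)\<^esub> Res L (V y) (V x \<inter> V y) (e y))" for V g' h'
  have fr: "L.frame V (\<lambda>x. h' x (V x) \<one>\<^bsub>Rg X (V x)\<^esub>) g'" if V: "pointed_cover (Top X) V" and t: "triv_cocycle V g' h'" for V g' h'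
    unfolding L.frame_def using V t free_gen_of_iso[OF ringed L.pmod]
    by (auto simp: triv_cocycle_def Let_def pointed_cover_def)
  have "pic_class X L = \<Union>{H1_class (Top X) (unit_presheaf X) (V, g') | V g'. pointed_cover (Top X) V \<and> (\<exists>h'. triv_cocycle V g' h')}"
    unfolding pic_class_def triv_cocycle_def ..
  also have "{H1_class (Top X) (unit_presheaf X) (V, g') | V g'. pointed_cover (Top X) V \<and> (\<exists>h'. triv_cocycle V g' h')}
      = {H1_class (Top X) (unit_presheaf X) (U, g)}"
  proof (intro equalityI subsetI)
    fix Z assume "Z \<in> {H1_class (Top X) (unit_presheaf X) (V, g') | V g'. pointed_cover (Top X) V \<and> (\<exists>h'. triv_cocycle V g' h')}"
    then obtain V g' h' where "Z = H1_class (Top X) (unit_presheaf X) (V, g')" "pointed_cover (Top X) V" "triv_cocycle V g' h'" by blast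
    then show "Z \<in> {H1_class (Top X) (unit_presheaf X) (U, g)}" using L.frames_H1_class[OF fr f] by blast
  next
    fix Z assume "Z \<in> {H1_class (Top X) (unit_presheaf X) (U, g)}"
    moreover have "pointed_cover (Top X) U" using f by (simp add: L.frame_def)
    moreover have "triv_cocycle U g h" using U(3) g by (simp add: triv_cocycle_def e_def Let_def)
    ultimately show "Z \<in> {H1_class (Top X) (unit_presheaf X) (V, g') | V g'. pointed_cover (Top X) V \<and> (\<exists>h'. triv_cocycle V g' h')}"
      by blast
  qed
  finally have pic: "pic_class X L = H1_class (Top X) (unit_presheaf X) (U, g)" by simp
  have dl: "dlog F X \<phi> = (\<lambda>U a. inv\<^bsub>Rg X U\<^esub> a \<odot>\<^bsub>Sec ?\<Omega> U\<^esub> univ_der F X \<phi> U a)"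
    by (simp add: dlog_def fun_eq_iff)
  interpret dlog: gpre_hom "Top X" "unit_presheaf X" "add_presheaf ?\<Omega>" "dlog F X \<phi>"
    unfolding dl by (rule \<Omega>.dlog_hom)
  interpret q: gpre_hom "Top X" "add_presheaf ?\<Omega>" "add_presheaf G" "Q.qmap"
    by (rule \<Omega>.G.add_presheaf_hom[OF d.G.pmod q_hom])
  note cocycle = L.frame_cocycle[OF f]
  have "gen_chern_class F X \<phi> I L = H1_class (Top X) (add_presheaf G)
      (U, \<lambda>x y. Q.qmap (U x \<inter> U y) (dlog F X \<phi> (U x \<inter> U y) (g x y)))"
    unfolding gen_chern_class_def chern_class_def pic dlog.H1_map_class[OF cocycle] assms(4)[symmetric]
    by (rule q.H1_map_class[OF dlog.h_cocycle[OF cocycle]])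
  also have "\<dots> = ext_line_to_H1 X L G
           (ext_push X L (tensor X G L) (tensor X L G) (tensor_swap X G L) (atiyah_class X G (quot_der F X \<phi> I) L))"
  proof (rule atiyah_H1[OF f, symmetric])
    fix x y assume x: "x \<in> K.TX" and y: "y \<in> K.TX"
    have N: "K.opn (U x \<inter> U y)" using U(1) x y by blast
    interpret R: cring "Rg X (U x \<inter> U y)" by (rule K.rg_cring[OF N])
    have u: "g x y \<in> Units (Rg X (U x \<inter> U y))" using g x y by blast
    then have "inv\<^bsub>Rg X (U x \<inter> U y)\<^esub> g x y \<in> carrier (Rg X (U x \<inter> U y))" "g x y \<in> carrier (Rg X (U x \<inter> U y))" by auto
    \<comment> \<open>The quotient map is linear, so dividing by \<open>g x y\<close> commutes with
      it, and the derivation into \<open>G\<close> is the composite of the universal one with this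
      map.\<close>
    then show "Q.qmap (U x \<inter> U y) (dlog F X \<phi> (U x \<inter> U y) (g x y)) =
        inv\<^bsub>Rg X (U x \<inter> U y)\<^esub> g x y \<odot>\<^bsub>Sec G (U x \<inter> U y)\<^esub> quot_der F X \<phi> I (U x \<inter> U y) (g x y)"
      unfolding qd dlog_def G_eq by (intro Q.qmap_smult[OF N] \<Omega>.d_closed[OF N])
  qed
  finally show ?thesis ..
qed

end
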